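(* Let $Q\ne0$ be real, $a>0$, and let $\Theta$ be a minimal L-system (with one-dimensional input-output space $\mathbb C$ and $J=1$) whose impedance function is $$V_\Theta(z)=Q+a\int_{\mathbb R}\left(\frac{1}{\lambda-z}-\frac{\lambda}{1+\lambda^2}\right)d\mu(\lambda),\qquad \int_{\mathbb R}\frac{d\mu(\lambda)}{1+\lambda^2}=1,$$ with $\mu$ an infinite Borel measure. Then $\Theta$ is bi-unitarily equivalent to the universal model L-system $\Theta^Q$ constructed from $Q$, $a$ and $\mu$ (see context). Moreover, the resolvent of the main operator $T=T(Q)$ of $\Theta^Q$, acting on $L^2(\mathbb R;d\mu)$, is given by $$(T-zI)^{-1}=(\mathcal B-zI)^{-1}-p(z)(\cdot,g_{\bar z})g_z,\qquad p(z)=\left(M(\dot{\mathcal B},\mathcal B)(z)+i\,\frac{\mathds{k}+1}{\mathds{k}-1}\right)^{-1},\quad z\in\rho(T)\cap\rho(\mathcal B),$$ where $M(\dot{\mathcal B},\mathcal B)$ is the Weyl–Titchmarsh function of the pair $(\dot{\mathcal B},\mathcal B)$ and $$\mathds{k}=\frac{(a-1-Qi)(Q-2ai)}{(a-1)Q-(Q^2+2a^2+2a)i}.$$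
   Context: Rigged space: for a closed densely defined symmetric operator $\dot A$ with deficiency indices $(1,1)$ in a complex Hilbert space $\mathcal H$, let $\mathcal H_+=\mathrm{Dom}(\dot A^* )$ with $(f,g)_+=(f,g)+(\dot A^*f,\dot A^*g)$, and let $\mathcal H_+\subset\mathcal H\subset\mathcal H_-$ be the associated rigged Hilbert space. The Riesz–Berezansky operator $\mathcal R:\mathcal H_-\to\mathcal H_+$ is the isometry with $(f,g)=(f,\mathcal Rg)_+$ for $f\in\mathcal H_+$, $g\in\mathcal H_-$. If $\mathbb A\in[\mathcal H_+,\mathcal H_-]$ (bounded operators) then $\mathbb A^*\in[\mathcal H_+,\mathcal H_-]$; $\mathrm{Re}\,\mathbb A=(\mathbb A+\mathbb A^* )/2$, $\mathrm{Im}\,\mathbb A=(\mathbb A-\mathbb A^* )/2i$. The quasi-kernel $\hat A$ of $\mathrm{Re}\,\mathbb A$ is its restriction to $\{f\in\mathcal H_+:\mathrm{Re}\,\mathbb A f\in\mathcal H\}$. L-system: let $T$ be a non-symmetric operator with $\dot A\subset T\subset\dot A^*$, $\rho(T)\ne\emptyset$, $\mathrm{Dom}(\dot A)=\mathrm{Dom}(T)\cap\mathrm{Dom}(T^* )$. A $( * )$-extension of $T$ is $\mathbb A\in[\mathcal H_+,\mathcal H_-]$ with $\dot A\subset T\subset\mathbb A$, $\dot A\subset T^*\subset\mathbb A^*$ such that the quasi-kernel $\hat A$ of $\mathrm{Re}\,\mathbb A$ is self-adjoint in $\mathcal H$. An L-system is $\Theta=\begin{pmatrix}\mathbb A&K&1\\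 \mathcal H_+\subset\mathcal H\subset\mathcal H_-&&\mathbb C\end{pmatrix}$ where $\mathbb A$ is a $( * )$-extension of such a $T$ (main operator), $K\in[\mathbb C,\mathcal H_-]$, $\mathrm{Im}\,\mathbb A=KK^*$, $\mathrm{Ran}(K)=\mathrm{Ran}(\mathrm{Im}\,\mathbb A)$. It is minimal if $\dot A$ is prime (no nontrivial reducing subspace on which $\dot A$ induces a self-adjoint operator). Impedance function: $V_\Theta(z)=K^*(\mathrm{Re}\,\mathbb A-zI)^{-1}K$. Two minimal L-systems $\Theta_1,\Theta_2$ are bi-unitarily equivalent if there is a unitary $U:\mathcal H_1\to\mathcal H_2$ whose restriction $U_+$ to $\mathcal H_{+1}$ is an isometry onto $\mathcal H_{+2}$ and, with $U_-=(U_+^* )^{-1}$ (an isometry of $\mathcal H_{-1}$ onto $\mathcal H_{-2}$), $UT_1=T_2U$, $U_-\mathbb A_1=\mathbb A_2U_+$, $U_-K_1=K_2$. Model operators: in $L^2(\mathbb R;d\mu)$ let $\mathcal B$ be multiplication by the independent variable with its maximal domain, $\dot{\mathcal B}$ its restriction to $\{f\in\mathrm{Dom}(\mathcal B):\int f\,d\mu=0\}$ (symmetric, prime, deficiency indices $(1,1)$), $g_z(\lambda)=1/(\lambda-z)\in\mathrm{Ker}(\dot{\mathcal B}^*-zI)$, $g_\pm=g_{\pm i}$; then $g_+-g_-\in\mathrm{Dom}(\mathcal B)$. For a self-adjoint extension $A$ of a symmetric $\dot A$ with deficiency indices $(1,1)$ and unit $g_+\in\mathrm{Ker}(\dot A^*-iI)$,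 the Weyl–Titchmarsh function is $M(\dot A,A)(z)=((Az+I)(A-zI)^{-1}g_+,g_+)$. Universal model $\Theta^Q$: put $$\tilde\kappa=\frac{|Q|}{\sqrt{Q^2+4a^2}},\quad \tilde U=\frac{Q}{|Q|}\cdot\frac{-Q+2ai}{\sqrt{Q^2+4a^2}},\quad g_+^\alpha=g_+,\quad g_-^\alpha=\frac{Q-2ai}{\sqrt{Q^2+4a^2}}\,g_-,$$ $$\chi=\frac{\sqrt a}{2}\left(\frac{\tilde\kappa^2+1+2\tilde\kappa\tilde U}{|1+\tilde\kappa\tilde U|\sqrt{1-\tilde\kappa^2}}\,\mathcal R^{-1}g_+^\alpha+\frac{\tilde\kappa^2\tilde U+2\tilde\kappa+\tilde U}{|1+\tilde\kappa\tilde U|\sqrt{1-\tilde\kappa^2}}\,\mathcal R^{-1}g_-^\alpha\right),$$ $$\mathrm{Re}\,\tilde{\mathbb B}=\dot{\mathcal B}^*-\frac{i\sqrt{1-\tilde\kappa^2}}{2\sqrt a\,|1+\tilde\kappa\tilde U|}\left(\cdot,\mathcal R^{-1}g_+^\alpha-\tilde U\mathcal R^{-1}g_-^\alpha\right)\chi,\qquad \mathbb B=\mathrm{Re}\,\tilde{\mathbb B}+i(\cdot,\chi)\chi .$$ Then $\Theta^Q=\begin{pmatrix}\mathbb B&K&1\\ \mathcal H_+\subset L^2(\mathbb R;d\mu)\subset\mathcal H_-&&\mathbb C\end{pmatrix}$ with $Kc=c\chi$, where $\mathcal H_+=\mathrm{Dom}(\dot{\mathcal B}^* )$; its main operator $T$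 is the extension of $\dot{\mathcal B}$ whose von Neumann parameter $\kappa$ with respect to $g^\alpha_\pm$ (i.e. $g_+^\alpha-\kappa g_-^\alpha\in\mathrm{Dom}(T)$) is $\kappa=\frac{(a-1-Qi)\sqrt{Q^2+4a^2}}{(a-1)Q-(Q^2+2a^2+2a)i}$, equivalently $g_+-\mathds{k}\,g_-\in\mathrm{Dom}(T)$.
   Formalization: Two printed constants are corrected, as the claim fails with them (e.g. Q=2, a=1): g_-^α = (Q/|Q|)(Q+2ai)/√(Q²+4a²) g_- replaces (Q-2ai)/√(Q²+4a²) g_-, and the factor Q-2ai in 𝕜 becomes Q+2ai, so 𝕜=(1-a+Qi)/(1+a+Qi). *)

theory Defs
  imports "HOL-Analysis.Analysis" "HOL-Algebra.Module"
begin

section \<open>Complex Hilbert spaces with explicit carriers\<close>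

definition complex_ring :: "complex ring"
  where "complex_ring = \<lparr>carrier = UNIV, mult = (*), one = 1, zero = 0, add = (+)\<rparr>"

text \<open>
  The fields \<open>mult\<close> and \<open>one\<close> that a \<open>module\<close> record inherits from \<open>ring\<close> play no role.
  The inner product is linear in its first and conjugate-linear in its second argument.
\<close>

record 'a hilbert = "(complex, 'a) module" +
  cinner :: "'a \<Rightarrow> 'a \<Rightarrow> complex"

definition hnorm :: "'a hilbert \<Rightarrow> 'a \<Rightarrow> real"
  where "hnorm H x = sqrt (Re (cinner H x x))"

text \<open>Being \<open>0\<close> off the carrier makes \<open>hdist H\<close> symmetric and nonnegative everywhere, as the
  locale \<^locale>\<open>Metric_space\<close> demands.\<close>

definition hdist :: "'a hilbert \<Rightarrow> 'a \<Rightarrow> 'a \<Rightarrow> real"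
  where "hdist H x y =
    (if x \<in> carrier H \<and> y \<in> carrier H then hnorm H (x \<ominus>\<^bsub>H\<^esub> y) else 0)"

definition htop :: "'a hilbert \<Rightarrow> 'a topology"
  where "htop H = Metric_space.mtopology (carrier H) (hdist H)"

definition hilbert_space :: "'a hilbert \<Rightarrow> bool"
  where "hilbert_space H \<longleftrightarrow>
    module complex_ring H \<and>
    (\<forall>x\<in>carrier H. \<forall>y\<in>carrier H. \<forall>z\<in>carrier H.
      cinner H (x \<oplus>\<^bsub>H\<^esub> y) z = cinner H x z + cinner H y z) \<and>
    (\<forall>c. \<forall>x\<in>carrier H. \<forall>y\<in>carrier H. cinner H (c \<odot>\<^bsub>H\<^esub> x) y = c * cinner H x y) \<and>
    (\<forall>x\<in>carrier H. \<forall>y\<in>carrier H. cinner H y x = cnj (cinner H x y)) \<and>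
    (\<forall>x\<in>carrier H. x \<noteq> \<zero>\<^bsub>H\<^esub> \<longrightarrow> 0 < Re (cinner H x x)) \<and>
    Metric_space.mcomplete (carrier H) (hdist H)"

definition complex_space :: "complex hilbert"
  where "complex_space = \<lparr>carrier = UNIV, mult = (*), one = 1, zero = 0, add = (+),
    smult = (*), cinner = (\<lambda>x y. x * cnj y)\<rparr>"

text \<open>Everywhere defined bounded operators; only their values on \<open>carrier H\<close> matter.\<close>

definition bounded_op :: "'a hilbert \<Rightarrow> 'b hilbert \<Rightarrow> ('a \<Rightarrow> 'b) \<Rightarrow> bool"
  where "bounded_op H H' A \<longleftrightarrow>
    A \<in> carrier H \<rightarrow> carrier H' \<and>
    (\<forall>x\<in>carrier H. \<forall>y\<in>carrier H. A (x \<oplus>\<^bsub>H\<^esub> y) = A x \<oplus>\<^bsub>H'\<^esub> A y) \<and>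
    (\<forall>c. \<forall>x\<in>carrier H. A (c \<odot>\<^bsub>H\<^esub> x) = c \<odot>\<^bsub>H'\<^esub> A x) \<and>
    (\<exists>C. \<forall>x\<in>carrier H. hnorm H' (A x) \<le> C * hnorm H x)"

definition unitary_op :: "'a hilbert \<Rightarrow> 'b hilbert \<Rightarrow> ('a \<Rightarrow> 'b) \<Rightarrow> bool"
  where "unitary_op H H' U \<longleftrightarrow>
    bij_betw U (carrier H) (carrier H') \<and>
    (\<forall>x\<in>carrier H. \<forall>y\<in>carrier H. U (x \<oplus>\<^bsub>H\<^esub> y) = U x \<oplus>\<^bsub>H'\<^esub> U y) \<and>
    (\<forall>c. \<forall>x\<in>carrier H. U (c \<odot>\<^bsub>H\<^esub> x) = c \<odot>\<^bsub>H'\<^esub> U x) \<and>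
    (\<forall>x\<in>carrier H. \<forall>y\<in>carrier H. cinner H' (U x) (U y) = cinner H x y)"

definition closed_subspace :: "'a hilbert \<Rightarrow> 'a set \<Rightarrow> bool"
  where "closed_subspace H M \<longleftrightarrow> submodule M complex_ring H \<and> closedin (htop H) M"

definition orth_compl :: "'a hilbert \<Rightarrow> 'a set \<Rightarrow> 'a set"
  where "orth_compl H M = {x \<in> carrier H. \<forall>y\<in>M. cinner H x y = 0}"


section \<open>Unbounded operators, represented by their graphs\<close>

definition linear_op :: "'a hilbert \<Rightarrow> 'a rel \<Rightarrow> bool"
  where "linear_op H S \<longleftrightarrow>
    S \<subseteq> carrier H \<times> carrier H \<and> single_valued S \<and> (\<zero>\<^bsub>H\<^esub>, \<zero>\<^bsub>H\<^esub>) \<in> S \<and>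
    (\<forall>(f, g)\<in>S. \<forall>(f', g')\<in>S. (f \<oplus>\<^bsub>H\<^esub> f', g \<oplus>\<^bsub>H\<^esub> g') \<in> S) \<and>
    (\<forall>c. \<forall>(f, g)\<in>S. (c \<odot>\<^bsub>H\<^esub> f, c \<odot>\<^bsub>H\<^esub> g) \<in> S)"

definition op_app :: "'a rel \<Rightarrow> 'a \<Rightarrow> 'a"
  where "op_app S f = (THE g. (f, g) \<in> S)"

definition closed_op :: "'a hilbert \<Rightarrow> 'a rel \<Rightarrow> bool"
  where "closed_op H S \<longleftrightarrow> closedin (prod_topology (htop H) (htop H)) S"

definition densely_defined :: "'a hilbert \<Rightarrow> 'a rel \<Rightarrow> bool"
  where "densely_defined H S \<longleftrightarrow> htop H closure_of Domain S = carrier H"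

definition adjoint_op :: "'a hilbert \<Rightarrow> 'a rel \<Rightarrow> 'a rel"
  where "adjoint_op H S = {(g, h). g \<in> carrier H \<and> h \<in> carrier H \<and>
    (\<forall>(f, k)\<in>S. cinner H k g = cinner H f h)}"

definition symmetric_op :: "'a hilbert \<Rightarrow> 'a rel \<Rightarrow> bool"
  where "symmetric_op H S \<longleftrightarrow> S \<subseteq> adjoint_op H S"

text \<open>For a linear operator \<open>S\<close>, equality \<open>S = S\<^sup>*\<close> with the (a priori multivalued) adjoint
  relation already forces \<open>S\<close> to be densely defined.\<close>

definition self_adjoint_op :: "'a hilbert \<Rightarrow> 'a rel \<Rightarrow> bool"
  where "self_adjoint_op H S \<longleftrightarrow> linear_op H S \<and> adjoint_op H S = S"

definition eigenspace :: "'a hilbert \<Rightarrow> 'a rel \<Rightarrow> complex \<Rightarrow> 'a set"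
  where "eigenspace H S z = {f \<in> carrier H. (f, z \<odot>\<^bsub>H\<^esub> f) \<in> S}"

definition one_dimensional :: "'a hilbert \<Rightarrow> 'a set \<Rightarrow> bool"
  where "one_dimensional H M \<longleftrightarrow>
    (\<exists>g\<in>carrier H. g \<noteq> \<zero>\<^bsub>H\<^esub> \<and> M = range (\<lambda>c. c \<odot>\<^bsub>H\<^esub> g))"

definition deficiency_indices_1_1 :: "'a hilbert \<Rightarrow> 'a rel \<Rightarrow> bool"
  where "deficiency_indices_1_1 H S \<longleftrightarrow>
    one_dimensional H (eigenspace H (adjoint_op H S) \<i>) \<and>
    one_dimensional H (eigenspace H (adjoint_op H S) (- \<i>))"

definition resolvent :: "'a hilbert \<Rightarrow> 'a rel \<Rightarrow> complex \<Rightarrow> 'a rel"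
  where "resolvent H S z = {(f, g \<ominus>\<^bsub>H\<^esub> z \<odot>\<^bsub>H\<^esub> f) | f g. (f, g) \<in> S}\<inverse>"

definition resolvent_set :: "'a hilbert \<Rightarrow> 'a rel \<Rightarrow> complex set"
  where "resolvent_set H S = {z. single_valued (resolvent H S z) \<and>
    Domain (resolvent H S z) = carrier H \<and>
    (\<exists>C. \<forall>(h, f)\<in>resolvent H S z. hnorm H f \<le> C * hnorm H h)}"

definition reducing_subspace :: "'a hilbert \<Rightarrow> 'a rel \<Rightarrow> 'a set \<Rightarrow> bool"
  where "reducing_subspace H S M \<longleftrightarrow> closed_subspace H M \<and>
    (\<forall>(f, g)\<in>S. \<exists>(f\<^sub>1, g\<^sub>1) \<in> S \<inter> M \<times> M.
      \<exists>(f\<^sub>2, g\<^sub>2) \<in> S \<inter> orth_compl H M \<times> orth_compl H M. f = f\<^sub>1 \<oplus>\<^bsub>H\<^esub> f\<^sub>2)"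

definition prime_op :: "'a hilbert \<Rightarrow> 'a rel \<Rightarrow> bool"
  where "prime_op H S \<longleftrightarrow>
    \<not> (\<exists>M. reducing_subspace H S M \<and> M \<noteq> {\<zero>\<^bsub>H\<^esub>} \<and>
          self_adjoint_op (H\<lparr>carrier := M\<rparr>) (S \<inter> M \<times> M))"

text \<open>\<open>((Az + I)(A - zI)\<^sup>-\<^sup>1 g, g)\<close>, where \<open>A\<close> is a self-adjoint extension of a symmetric
  operator \<open>S\<close> and \<open>g\<close> a unit vector of \<open>Ker (S\<^sup>* - iI)\<close>; \<open>S\<close> enters only through \<open>g\<close>.\<close>

definition weyl_titchmarsh :: "'a hilbert \<Rightarrow> 'a rel \<Rightarrow> 'a \<Rightarrow> complex \<Rightarrow> complex"
  where "weyl_titchmarsh H A g z =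
    (let f = op_app (resolvent H A z) g
     in cinner H (z \<odot>\<^bsub>H\<^esub> op_app A f \<oplus>\<^bsub>H\<^esub> f) g)"


section \<open>Rigged spaces\<close>

text \<open>
  Throughout, \<open>S\<close> is the underlying symmetric operator. \<open>\<H>\<^sub>-\<close> is realized as the space of bounded conjugate-linear functionals \<open>\<phi>\<close> on \<open>\<H>\<^sub>+\<close>,
  normalized to vanish off \<open>\<H>\<^sub>+\<close>; the duality is \<open>(\<phi>, f) = \<phi> f\<close>, and \<open>g \<in> \<H>\<close> is the functional
  \<open>f \<mapsto> (g, f)\<close>. The inner product makes the Riesz--Berezansky operator isometric.
\<close>

definition H_plus :: "'a hilbert \<Rightarrow> 'a rel \<Rightarrow> 'a hilbert"
  where "H_plus H S = H\<lparr>carrier := Domain (adjoint_op H S),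
    cinner := (\<lambda>f g. cinner H f g +
      cinner H (op_app (adjoint_op H S) f) (op_app (adjoint_op H S) g))\<rparr>"

definition dual_pair :: "'a \<Rightarrow> ('a \<Rightarrow> complex) \<Rightarrow> complex"
  where "dual_pair f \<phi> = cnj (\<phi> f)"

definition riesz_berezansky :: "'a hilbert \<Rightarrow> ('a \<Rightarrow> complex) \<Rightarrow> 'a"
  where "riesz_berezansky P \<phi> =
    (THE h. h \<in> carrier P \<and> (\<forall>f\<in>carrier P. dual_pair f \<phi> = cinner P f h))"

definition antidual :: "'a hilbert \<Rightarrow> ('a \<Rightarrow> complex) hilbert"
  where "antidual P = \<lparr>
    carrier = {\<phi>. (\<forall>x\<in>carrier P. \<forall>y\<in>carrier P. \<phi> (x \<oplus>\<^bsub>P\<^esub> y) = \<phi> x + \<phi> y) \<and>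
      (\<forall>c. \<forall>x\<in>carrier P. \<phi> (c \<odot>\<^bsub>P\<^esub> x) = cnj c * \<phi> x) \<and>
      (\<exists>C. \<forall>x\<in>carrier P. cmod (\<phi> x) \<le> C * hnorm P x) \<and>
      (\<forall>x. x \<notin> carrier P \<longrightarrow> \<phi> x = 0)},
    mult = undefined, one = undefined,
    zero = (\<lambda>_. 0), add = (\<lambda>\<phi> \<psi> x. \<phi> x + \<psi> x),
    smult = (\<lambda>c \<phi> x. c * \<phi> x),
    cinner = (\<lambda>\<phi> \<psi>. cinner P (riesz_berezansky P \<phi>) (riesz_berezansky P \<psi>))\<rparr>"

definition H_minus :: "'a hilbert \<Rightarrow> 'a rel \<Rightarrow> ('a \<Rightarrow> complex) hilbert"
  where "H_minus H S = antidual (H_plus H S)"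

definition embed_minus :: "'a hilbert \<Rightarrow> 'a rel \<Rightarrow> 'a \<Rightarrow> 'a \<Rightarrow> complex"
  where "embed_minus H S g = (\<lambda>f. if f \<in> carrier (H_plus H S) then cinner H g f else 0)"

definition riesz_inv :: "'a hilbert \<Rightarrow> 'a \<Rightarrow> 'a \<Rightarrow> complex"
  where "riesz_inv P = inv_into (carrier (antidual P)) (riesz_berezansky P)"

text \<open>For \<open>\<A> \<in> [\<H>\<^sub>+, \<H>\<^sub>-]\<close>, the adjoint is given by \<open>(\<A> h, f) = (h, \<A>\<^sup>* f)\<close> for \<open>f, h \<in> \<H>\<^sub>+\<close>.\<close>

definition pm_adjoint ::
    "'a hilbert \<Rightarrow> ('a \<Rightarrow> 'a \<Rightarrow> complex) \<Rightarrow> 'a \<Rightarrow> 'a \<Rightarrow> complex"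
  where "pm_adjoint P A f = (\<lambda>h. if h \<in> carrier P then cnj (A h f) else 0)"

definition pm_Re :: "'a hilbert \<Rightarrow> ('a \<Rightarrow> 'a \<Rightarrow> complex) \<Rightarrow> 'a \<Rightarrow> 'a \<Rightarrow> complex"
  where "pm_Re P A f = (\<lambda>h. (A f h + pm_adjoint P A f h) / 2)"

definition pm_Im :: "'a hilbert \<Rightarrow> ('a \<Rightarrow> 'a \<Rightarrow> complex) \<Rightarrow> 'a \<Rightarrow> 'a \<Rightarrow> complex"
  where "pm_Im P A f = (\<lambda>h. (A f h - pm_adjoint P A f h) / (2 * \<i>))"

definition quasi_kernel :: "'a hilbert \<Rightarrow> 'a rel \<Rightarrow> ('a \<Rightarrow> 'a \<Rightarrow> complex) \<Rightarrow> 'a rel"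
  where "quasi_kernel H S B = {(f, g). f \<in> carrier (H_plus H S) \<and> g \<in> carrier H \<and>
    B f = embed_minus H S g}"

text \<open>\<open>K\<^sup>* \<in> [\<H>\<^sub>+, \<complex>]\<close> is determined by \<open>(K c, f) = c * cnj (K\<^sup>* f)\<close>; take \<open>c = 1\<close>.\<close>

definition channel_adjoint :: "(complex \<Rightarrow> 'a \<Rightarrow> complex) \<Rightarrow> 'a \<Rightarrow> complex"
  where "channel_adjoint K f = dual_pair f (K 1)"


section \<open>L-systems with input-output space \<open>\<complex>\<close> and \<open>J = 1\<close>\<close>

record 'a lsystem =
  state_space :: "'a hilbert"
  symm_op :: "'a rel"
  main_op :: "'a rel"
  state_op :: "'a \<Rightarrow> 'a \<Rightarrow> complex"
  channel_op :: "complex \<Rightarrow> 'a \<Rightarrow> complex"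

definition main_operator :: "'a hilbert \<Rightarrow> 'a rel \<Rightarrow> 'a rel \<Rightarrow> bool"
  where "main_operator H S T \<longleftrightarrow>
    linear_op H T \<and> \<not> symmetric_op H T \<and> S \<subseteq> T \<and> T \<subseteq> adjoint_op H S \<and>
    resolvent_set H T \<noteq> {} \<and> Domain S = Domain T \<inter> Domain (adjoint_op H T)"

definition star_extension ::
    "'a hilbert \<Rightarrow> 'a rel \<Rightarrow> 'a rel \<Rightarrow> ('a \<Rightarrow> 'a \<Rightarrow> complex) \<Rightarrow> bool"
  where "star_extension H S T A \<longleftrightarrow>
    bounded_op (H_plus H S) (H_minus H S) A \<and>
    S \<subseteq> T \<and> (\<forall>(f, g)\<in>T. A f = embed_minus H S g) \<and>
    S \<subseteq> adjoint_op H T \<and>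
    (\<forall>(f, g)\<in>adjoint_op H T. pm_adjoint (H_plus H S) A f = embed_minus H S g) \<and>
    self_adjoint_op H (quasi_kernel H S (pm_Re (H_plus H S) A))"

definition L_system :: "'a lsystem \<Rightarrow> bool"
  where "L_system \<Theta> \<longleftrightarrow>
    (let H = state_space \<Theta>; S = symm_op \<Theta>; T = main_op \<Theta>;
         A = state_op \<Theta>; K = channel_op \<Theta>; P = H_plus H S
     in hilbert_space H \<and>
        linear_op H S \<and> closed_op H S \<and> densely_defined H S \<and> symmetric_op H S \<and>
        deficiency_indices_1_1 H S \<and>
        main_operator H S T \<and> star_extension H S T A \<and>
        bounded_op complex_space (H_minus H S) K \<and>
        (\<forall>f\<in>carrier P. pm_Im P A f = K (channel_adjoint K f)) \<and>
        range K = pm_Im P A ` carrier P)"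

definition minimal_L_system :: "'a lsystem \<Rightarrow> bool"
  where "minimal_L_system \<Theta> \<longleftrightarrow> L_system \<Theta> \<and> prime_op (state_space \<Theta>) (symm_op \<Theta>)"

text \<open>An operator on \<open>\<complex>\<close> is identified with its value at \<open>1\<close>.\<close>

definition impedance :: "'a lsystem \<Rightarrow> complex \<Rightarrow> complex"
  where "impedance \<Theta> z =
    (let H = state_space \<Theta>; S = symm_op \<Theta>; K = channel_op \<Theta>; P = H_plus H S
     in channel_adjoint K
          (THE f. f \<in> carrier P \<and>
            pm_Re P (state_op \<Theta>) f \<ominus>\<^bsub>H_minus H S\<^esub> z \<odot>\<^bsub>H_minus H S\<^esub> embed_minus H S f = K 1))"

text \<open>\<open>U\<^sub>+\<^sup>* : \<H>\<^sub>-\<^sub>2 \<rightarrow> \<H>\<^sub>-\<^sub>1\<close> is given by \<open>(U\<^sub>+ f, \<phi>) = (f, U\<^sub>+\<^sup>* \<phi>)\<close>, and \<open>U\<^sub>-\<close> is its inverse.\<close>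

definition U_plus_adjoint ::
    "'a hilbert \<Rightarrow> ('a \<Rightarrow> 'b) \<Rightarrow> ('b \<Rightarrow> complex) \<Rightarrow> 'a \<Rightarrow> complex"
  where "U_plus_adjoint P\<^sub>1 U \<phi> = (\<lambda>f. if f \<in> carrier P\<^sub>1 then \<phi> (U f) else 0)"

definition U_minus ::
    "'a hilbert \<Rightarrow> 'b hilbert \<Rightarrow> ('a \<Rightarrow> 'b) \<Rightarrow> ('a \<Rightarrow> complex) \<Rightarrow> 'b \<Rightarrow> complex"
  where "U_minus P\<^sub>1 P\<^sub>2 U = inv_into (carrier (antidual P\<^sub>2)) (U_plus_adjoint P\<^sub>1 U)"

definition bi_unitarily_equivalent :: "'a lsystem \<Rightarrow> 'b lsystem \<Rightarrow> bool"
  where "bi_unitarily_equivalent \<Theta>\<^sub>1 \<Theta>\<^sub>2 \<longleftrightarrow>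
    minimal_L_system \<Theta>\<^sub>1 \<and> minimal_L_system \<Theta>\<^sub>2 \<and>
    (\<exists>U. let H\<^sub>1 = state_space \<Theta>\<^sub>1; H\<^sub>2 = state_space \<Theta>\<^sub>2;
             P\<^sub>1 = H_plus H\<^sub>1 (symm_op \<Theta>\<^sub>1); P\<^sub>2 = H_plus H\<^sub>2 (symm_op \<Theta>\<^sub>2);
             U' = U_minus P\<^sub>1 P\<^sub>2 U; G = {(f, U f) | f. f \<in> carrier H\<^sub>1}
         in unitary_op H\<^sub>1 H\<^sub>2 U \<and> unitary_op P\<^sub>1 P\<^sub>2 U \<and>
            main_op \<Theta>\<^sub>1 O G = G O main_op \<Theta>\<^sub>2 \<and>
            (\<forall>f\<in>carrier P\<^sub>1. U' (state_op \<Theta>\<^sub>1 f) = state_op \<Theta>\<^sub>2 (U f)) \<and>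
            (\<forall>c. U' (channel_op \<Theta>\<^sub>1 c) = channel_op \<Theta>\<^sub>2 c))"


section \<open>The space \<open>L\<^sup>2(\<real>; d\<mu>)\<close> and the model operators\<close>

definition l2_fun :: "real measure \<Rightarrow> (real \<Rightarrow> complex) set"
  where "l2_fun \<mu> = {f \<in> borel_measurable \<mu>. integrable \<mu> (\<lambda>x. (cmod (f x))\<^sup>2)}"

definition l2_rel :: "real measure \<Rightarrow> (real \<Rightarrow> complex) rel"
  where "l2_rel \<mu> = {(f, g). f \<in> l2_fun \<mu> \<and> g \<in> l2_fun \<mu> \<and> (AE x in \<mu>. f x = g x)}"

definition l2_class :: "real measure \<Rightarrow> (real \<Rightarrow> complex) \<Rightarrow> (real \<Rightarrow> complex) set"
  where "l2_class \<mu> f = l2_rel \<mu> `` {f}"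

definition l2_rep :: "(real \<Rightarrow> complex) set \<Rightarrow> real \<Rightarrow> complex"
  where "l2_rep F = (SOME f. f \<in> F)"

definition L2 :: "real measure \<Rightarrow> (real \<Rightarrow> complex) set hilbert"
  where "L2 \<mu> = \<lparr>carrier = l2_fun \<mu> // l2_rel \<mu>,
    mult = undefined, one = undefined,
    zero = l2_class \<mu> (\<lambda>_. 0),
    add = (\<lambda>F G. l2_class \<mu> (\<lambda>x. l2_rep F x + l2_rep G x)),
    smult = (\<lambda>c F. l2_class \<mu> (\<lambda>x. c * l2_rep F x)),
    cinner = (\<lambda>F G. \<integral>x. l2_rep F x * cnj (l2_rep G x) \<partial>\<mu>)\<rparr>"

definition mult_op :: "real measure \<Rightarrow> (real \<Rightarrow> complex) set rel"
  where "mult_op \<mu> = {(l2_class \<mu> f, l2_class \<mu> (\<lambda>x. of_real x * f x)) | f.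
    f \<in> l2_fun \<mu> \<and> (\<lambda>x. of_real x * f x) \<in> l2_fun \<mu>}"

definition mult_op_dot :: "real measure \<Rightarrow> (real \<Rightarrow> complex) set rel"
  where "mult_op_dot \<mu> = {(F, G) \<in> mult_op \<mu>. (\<integral>x. l2_rep F x \<partial>\<mu>) = 0}"

definition g_vec :: "real measure \<Rightarrow> complex \<Rightarrow> (real \<Rightarrow> complex) set"
  where "g_vec \<mu> z = l2_class \<mu> (\<lambda>x. 1 / (of_real x - z))"


section \<open>The universal model\<close>

definition model_kappa :: "real \<Rightarrow> real \<Rightarrow> real"
  where "model_kappa Q a = \<bar>Q\<bar> / sqrt (Q\<^sup>2 + 4 * a\<^sup>2)"

definition model_U :: "real \<Rightarrow> real \<Rightarrow> complex"
  where "model_U Q a = of_real (Q / \<bar>Q\<bar>) *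
    ((- of_real Q + 2 * of_real a * \<i>) / of_real (sqrt (Q\<^sup>2 + 4 * a\<^sup>2)))"

text \<open>
  Write \<open>S\<close> for the operator \<^const>\<open>mult_op_dot\<close>. The quasi-kernel of \<open>Re \<B>\<close> below has
  domain \<open>Dom S\<close> plus the span of \<open>g\<^sub>+\<^sup>\<alpha> + U g\<^sub>-\<^sup>\<alpha>\<close>. For it to be \<^const>\<open>mult_op\<close>, whose
  domain is \<open>Dom S\<close> plus the span of \<open>g\<^sub>+ - g\<^sub>-\<close>, one needs \<open>g\<^sub>-\<^sup>\<alpha> = - (1 / U) g\<^sub>-\<close> with
  \<open>- 1 / U = (Q / \<bar>Q\<bar>) (Q + 2ai) / sqrt (Q\<^sup>2 + 4a\<^sup>2)\<close>. The published phase
  \<open>(Q - 2ai) / sqrt (Q\<^sup>2 + 4a\<^sup>2)\<close> is a misprint: it gives a different quasi-kernel and, in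
  general, a different impedance function.
\<close>

definition model_g_minus :: "real measure \<Rightarrow> real \<Rightarrow> real \<Rightarrow> (real \<Rightarrow> complex) set"
  where "model_g_minus \<mu> Q a =
    (of_real (Q / \<bar>Q\<bar>) *
      ((of_real Q + 2 * of_real a * \<i>) / of_real (sqrt (Q\<^sup>2 + 4 * a\<^sup>2)))) \<odot>\<^bsub>L2 \<mu>\<^esub> g_vec \<mu> (- \<i>)"

definition model_chi :: "real measure \<Rightarrow> real \<Rightarrow> real \<Rightarrow> (real \<Rightarrow> complex) set \<Rightarrow> complex"
  where "model_chi \<mu> Q a =
    (let \<kappa> = complex_of_real (model_kappa Q a); U = model_U Q a;
         N = H_minus (L2 \<mu>) (mult_op_dot \<mu>);
         Rinv = riesz_inv (H_plus (L2 \<mu>) (mult_op_dot \<mu>));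
         d = complex_of_real (cmod (1 + \<kappa> * U) * sqrt (1 - (model_kappa Q a)\<^sup>2))
     in of_real (sqrt a / 2) \<odot>\<^bsub>N\<^esub>
          (((\<kappa>\<^sup>2 + 1 + 2 * \<kappa> * U) / d) \<odot>\<^bsub>N\<^esub> Rinv (g_vec \<mu> \<i>) \<oplus>\<^bsub>N\<^esub>
           ((\<kappa>\<^sup>2 * U + 2 * \<kappa> + U) / d) \<odot>\<^bsub>N\<^esub> Rinv (model_g_minus \<mu> Q a)))"

definition model_Re_B ::
    "real measure \<Rightarrow> real \<Rightarrow> real \<Rightarrow>
     (real \<Rightarrow> complex) set \<Rightarrow> (real \<Rightarrow> complex) set \<Rightarrow> complex"
  where "model_Re_B \<mu> Q a f =
    (let \<kappa> = complex_of_real (model_kappa Q a); U = model_U Q a;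
         H = L2 \<mu>; S = mult_op_dot \<mu>; N = H_minus H S; Rinv = riesz_inv (H_plus H S);
         s = \<i> * of_real (sqrt (1 - (model_kappa Q a)\<^sup>2) / (2 * sqrt a * cmod (1 + \<kappa> * U)))
     in embed_minus H S (op_app (adjoint_op H S) f) \<ominus>\<^bsub>N\<^esub>
        (s * dual_pair f (Rinv (g_vec \<mu> \<i>) \<ominus>\<^bsub>N\<^esub> U \<odot>\<^bsub>N\<^esub> Rinv (model_g_minus \<mu> Q a)))
          \<odot>\<^bsub>N\<^esub> model_chi \<mu> Q a)"

definition model_B ::
    "real measure \<Rightarrow> real \<Rightarrow> real \<Rightarrow>
     (real \<Rightarrow> complex) set \<Rightarrow> (real \<Rightarrow> complex) set \<Rightarrow> complex"
  where "model_B \<mu> Q a f =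
    (let N = H_minus (L2 \<mu>) (mult_op_dot \<mu>)
     in model_Re_B \<mu> Q a f \<oplus>\<^bsub>N\<^esub>
        (\<i> * dual_pair f (model_chi \<mu> Q a)) \<odot>\<^bsub>N\<^esub> model_chi \<mu> Q a)"

text \<open>
  \<open>k = (1 - a + Qi) / (1 + a + Qi)\<close> after cancellation. The published factor \<open>Q - 2ai\<close> in place
  of \<open>Q + 2ai\<close> comes from the misprinted phase of \<open>g\<^sub>-\<^sup>\<alpha>\<close>; with it, the operator with vector
  \<open>g\<^sub>+ - k g\<^sub>-\<close> in its domain would not be the main operator.
\<close>

definition model_k :: "real \<Rightarrow> real \<Rightarrow> complex"
  where "model_k Q a =
    (of_real a - 1 - of_real Q * \<i>) * (of_real Q + 2 * of_real a * \<i>) /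
    (of_real ((a - 1) * Q) - of_real (Q\<^sup>2 + 2 * a\<^sup>2 + 2 * a) * \<i>)"

definition model_T :: "real measure \<Rightarrow> real \<Rightarrow> real \<Rightarrow> (real \<Rightarrow> complex) set rel"
  where "model_T \<mu> Q a =
    (let H = L2 \<mu>
     in {(f, h) \<in> adjoint_op H (mult_op_dot \<mu>).
          \<exists>\<phi>\<in>Domain (mult_op_dot \<mu>). \<exists>c.
            f = \<phi> \<oplus>\<^bsub>H\<^esub> c \<odot>\<^bsub>H\<^esub> (g_vec \<mu> \<i> \<ominus>\<^bsub>H\<^esub> model_k Q a \<odot>\<^bsub>H\<^esub> g_vec \<mu> (- \<i>))})"

definition universal_model :: "real measure \<Rightarrow> real \<Rightarrow> real \<Rightarrow> (real \<Rightarrow> complex) set lsystem"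
  where "universal_model \<mu> Q a = \<lparr>
    state_space = L2 \<mu>,
    symm_op = mult_op_dot \<mu>,
    main_op = model_T \<mu> Q a,
    state_op = model_B \<mu> Q a,
    channel_op = (\<lambda>c. c \<odot>\<^bsub>H_minus (L2 \<mu>) (mult_op_dot \<mu>)\<^esub> model_chi \<mu> Q a)\<rparr>"

end

theory Submission
  imports Defs "HOL-Real_Asymp.Real_Asymp"
begin

text \<open>
  Let \<open>\<gamma> z\<close> solve \<open>(Re \<A> - z) \<gamma> z = K 1\<close> and let \<open>B\<close> be the quasi-kernel of \<open>Re \<A>\<close>. Then
  \<open>\<gamma> z - \<gamma> w\<close> lies in \<open>Dom B\<close> and \<open>(z - w\<^sup>*) (\<gamma> z, \<gamma> w) = V(z) - V(w)\<^sup>*\<close>, so the impedance function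
  determines all inner products of the vectors \<open>\<gamma> z\<close>, which are total because the symmetric
  operator is prime. In the model the vectors \<open>i \<surd>a g\<^sub>z\<close> satisfy the same identity, and they are
  total by injectivity of the Poisson transform. Hence \<open>\<gamma> z \<mapsto> i \<surd>a g\<^sub>z\<close> extends to a unitary
  operator that carries \<open>B\<close> to the multiplication operator.

  On both sides \<open>K\<close>, \<open>\<A>\<close> and \<open>T\<close> are explicit in terms of \<open>B\<close>, \<open>\<gamma> i\<close> and \<open>V(i) = Q + a i\<close>, where
  \<open>Dom \<A> = Dom B + span (\<gamma> i)\<close>, so they correspond as well. In particular the model inherits the
  axioms of an L-system from the given one. The resolvent formula follows from the description
  of \<open>Dom T\<close> by one linear condition on the pair \<open>(\<integral>F d\<mu>, c)\<close> for \<open>F + c i \<surd>a g\<^sub>i\<close>.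
\<close>

section \<open>Geometry of Hilbert spaces with explicit carriers\<close>

text \<open>The identity that ties \<open>V\<close> to the inner products carries the factor
  \<open>z - cnj w\<close>, so it says nothing at \<open>w = cnj z\<close>. This is the recurring
  obstacle: the arguments that meet this point exclude it first and then recover it, because the
  defect vectors are continuous off the real axis. No formula for the unitary operator is available
  on the abstract side, so it is built as a relation between limits of the same finite combinations
  in the two spaces.

  What ties \<open>T\<close> to \<open>A\<close> is maximality: a point in the resolvent set of
  \<open>T\<close> forces every \<open>f\<close> with \<open>A f\<close> in H to lie in Dom T
  already. This yields both that S is \<open>B\<close> restricted to the kernel of the channel
  functional \<open>chi\<close> and that Dom T is given by the vanishing of the coefficient of
  \<open>chi\<close> in \<open>A f\<close>.

  The resolvent formula is Krein's formula. It also covers real points of the resolvent set of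
  multiplication; there the condition \<open>Im z \<noteq> 0\<close> has to be replaced by almost
  everywhere statements about the Cauchy kernel, derived from \<open>z\<close> being a resolvent
  point.\<close>

locale inner_space =
  fixes H :: "'a hilbert" (structure)
  assumes module: "module complex_ring H"
    and cinner_add_left [simp]: "\<lbrakk>x \<in> carrier H; y \<in> carrier H; z \<in> carrier H\<rbrakk> \<Longrightarrow>
      cinner H (x \<oplus> y) z = cinner H x z + cinner H y z"
    and cinner_smult_left [simp]: "\<lbrakk>x \<in> carrier H; y \<in> carrier H\<rbrakk> \<Longrightarrow>
      cinner H (c \<odot> x) y = c * cinner H x y"
    and cinner_commute: "\<lbrakk>x \<in> carrier H; y \<in> carrier H\<rbrakk> \<Longrightarrow> cinner H y x = cnj (cinner H x y)"
    and cinner_pos: "\<lbrakk>x \<in> carrier H; x \<noteq> \<zero>\<rbrakk> \<Longrightarrow> 0 < Re (cinner H x x)"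
begin

sublocale abelian_group H
  using module by (rule module.axioms)

lemma smult_in [simp, intro]: "x \<in> carrier H \<Longrightarrow> c \<odot> x \<in> carrier H"
  using module.smult_closed[OF module, of c x] by (simp add: complex_ring_def)

lemma cinner_zero_left [simp]: "x \<in> carrier H \<Longrightarrow> cinner H \<zero> x = 0"
  using cinner_add_left[of \<zero> \<zero> x] by simp

lemma cinner_neg_left [simp]: "\<lbrakk>x \<in> carrier H; y \<in> carrier H\<rbrakk> \<Longrightarrow> cinner H (\<ominus> x) y = - cinner H x y"
  using cinner_add_left[of x "\<ominus> x" y] by (simp add: r_neg add_eq_0_iff)

lemma cinner_diff_left [simp]: "\<lbrakk>x \<in> carrier H; y \<in> carrier H; z \<in> carrier H\<rbrakk> \<Longrightarrow>
    cinner H (x \<ominus> y) z = cinner H x z - cinner H y z"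
  by (simp add: minus_eq)

lemma cinner_add_right [simp]: "\<lbrakk>x \<in> carrier H; y \<in> carrier H; z \<in> carrier H\<rbrakk> \<Longrightarrow>
    cinner H z (x \<oplus> y) = cinner H z x + cinner H z y"
  by (subst (1 2 3) cinner_commute) auto

lemma cinner_smult_right [simp]: "\<lbrakk>x \<in> carrier H; y \<in> carrier H\<rbrakk> \<Longrightarrow>
    cinner H y (c \<odot> x) = cnj c * cinner H y x"
  by (subst (1 2) cinner_commute) auto

lemma cinner_zero_right [simp]: "x \<in> carrier H \<Longrightarrow> cinner H x \<zero> = 0"
  by (subst cinner_commute) auto

lemma cinner_neg_right [simp]: "\<lbrakk>x \<in> carrier H; y \<in> carrier H\<rbrakk> \<Longrightarrow> cinner H y (\<ominus> x) = - cinner H y x"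
  by (subst (1 2) cinner_commute) auto

lemma cinner_diff_right [simp]: "\<lbrakk>x \<in> carrier H; y \<in> carrier H; z \<in> carrier H\<rbrakk> \<Longrightarrow>
    cinner H z (x \<ominus> y) = cinner H z x - cinner H z y"
  by (simp add: minus_eq)

lemma cinner_self_eq_zero: "x \<in> carrier H \<Longrightarrow> cinner H x x = 0 \<Longrightarrow> x = \<zero>"
  using cinner_pos[of x] by fastforce

lemma minus_eq_zero_iff: "\<lbrakk>x \<in> carrier H; y \<in> carrier H\<rbrakk> \<Longrightarrow> x \<ominus> y = \<zero> \<longleftrightarrow> x = y"
  unfolding minus_eq by (metis a_inv_closed minus_equality minus_minus r_neg)

lemma minus_self [simp]: "x \<in> carrier H \<Longrightarrow> x \<ominus> x = \<zero>"
  by (simp add: minus_eq_zero_iff)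

text \<open>Vector identities are reduced to identities between complex numbers.\<close>

lemma vec_eqI:
  assumes "x \<in> carrier H" "y \<in> carrier H" "\<And>w. w \<in> carrier H \<Longrightarrow> cinner H x w = cinner H y w"
  shows "x = y"
proof -
  have "x \<ominus> y = \<zero>"
    using assms(1,2) assms(3)[of "x \<ominus> y"]
    by (intro cinner_self_eq_zero) (simp_all del: cinner_diff_right)
  then show ?thesis
    using assms by (simp add: minus_eq_zero_iff)
qed

lemma hnorm_nonneg [simp]: "x \<in> carrier H \<Longrightarrow> 0 \<le> hnorm H x"
  using cinner_pos[of x] by (cases "x = \<zero>") (auto simp: hnorm_def)

lemma cinner_self: "x \<in> carrier H \<Longrightarrow> cinner H x x = of_real ((hnorm H x)\<^sup>2)"
proof -
  assume x: "x \<in> carrier H"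
  have "Im (cinner H x x) = 0"
    using arg_cong[OF cinner_commute[OF x x], of Im] by simp
  moreover have "0 \<le> Re (cinner H x x)"
    using cinner_pos[of x] x by (cases "x = \<zero>") auto
  ultimately show ?thesis
    by (simp add: hnorm_def complex_eq_iff)
qed

lemma hnorm_sq: "x \<in> carrier H \<Longrightarrow> (hnorm H x)\<^sup>2 = Re (cinner H x x)"
  by (simp add: cinner_self)

lemma hnorm_zero [simp]: "hnorm H \<zero> = 0"
  by (simp add: hnorm_def)

lemma hnorm_eq_zero: "x \<in> carrier H \<Longrightarrow> hnorm H x = 0 \<longleftrightarrow> x = \<zero>"
  using cinner_self_eq_zero[of x] cinner_self[of x] by auto

lemma hnorm_smult [simp]: "x \<in> carrier H \<Longrightarrow> hnorm H (c \<odot> x) = cmod c * hnorm H x"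
proof -
  assume x: "x \<in> carrier H"
  have "cinner H (c \<odot> x) (c \<odot> x) = of_real ((cmod c * hnorm H x)\<^sup>2)"
    using x cinner_self[OF x] complex_norm_square[of c] by (simp add: power_mult_distrib algebra_simps)
  then have "(hnorm H (c \<odot> x))\<^sup>2 = (cmod c * hnorm H x)\<^sup>2"
    using cinner_self[of "c \<odot> x"] x by (metis smult_in of_real_eq_iff)
  then show ?thesis
    using x by (simp add: power2_eq_iff_nonneg)
qed

lemma Cauchy_Schwarz:
  assumes x: "x \<in> carrier H" and y: "y \<in> carrier H"
  shows "cmod (cinner H x y) \<le> hnorm H x * hnorm H y"
proof (cases "y = \<zero>")
  case True
  then show ?thesis using x by simp
next
  case False
  define n where "n = (hnorm H y)\<^sup>2"
  have n: "n > 0"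
    using False y hnorm_eq_zero[of y] by (simp add: n_def)
  define t where "t = cinner H x y"
  define u where "u = x \<ominus> (t / n) \<odot> y"
  have u: "u \<in> carrier H"
    using x y by (simp add: u_def)
  have "cinner H u u = cinner H x x - t * cnj t / n"
    using x y n unfolding u_def
    by (simp add: cinner_commute[OF x y] t_def[symmetric] cinner_self[OF y] n_def[symmetric] field_simps
        del: of_real_power)
  then have "(hnorm H u)\<^sup>2 = (hnorm H x)\<^sup>2 - (cmod t)\<^sup>2 / n"
    using x u by (simp add: hnorm_sq complex_mult_cnj cmod_def)
  then have "(cmod t)\<^sup>2 / n \<le> (hnorm H x)\<^sup>2"
    by (metis diff_ge_0_iff_ge zero_le_power2)
  then have "(cmod t)\<^sup>2 \<le> (hnorm H x * hnorm H y)\<^sup>2"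
    using n by (simp add: n_def[symmetric] power_mult_distrib divide_le_eq)
  then show ?thesis
    unfolding t_def by (rule power2_le_imp_le) (use x y in simp)
qed

lemma hnorm_add_sq:
  assumes x: "x \<in> carrier H" and y: "y \<in> carrier H"
  shows "(hnorm H (x \<oplus> y))\<^sup>2 = (hnorm H x)\<^sup>2 + 2 * Re (cinner H x y) + (hnorm H y)\<^sup>2"
  using x y by (simp add: hnorm_sq cinner_commute[OF x y])

lemma hnorm_diff_sq:
  assumes x: "x \<in> carrier H" and y: "y \<in> carrier H"
  shows "(hnorm H (x \<ominus> y))\<^sup>2 = (hnorm H x)\<^sup>2 - 2 * Re (cinner H x y) + (hnorm H y)\<^sup>2"
  using x y by (simp add: hnorm_sq cinner_commute[OF x y])

lemma hnorm_triangle: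
  assumes x: "x \<in> carrier H" and y: "y \<in> carrier H"
  shows "hnorm H (x \<oplus> y) \<le> hnorm H x + hnorm H y"
proof (rule power2_le_imp_le)
  have "Re (cinner H x y) \<le> hnorm H x * hnorm H y"
    using Cauchy_Schwarz[OF x y] complex_Re_le_cmod order_trans by blast
  then show "(hnorm H (x \<oplus> y))\<^sup>2 \<le> (hnorm H x + hnorm H y)\<^sup>2"
    using hnorm_add_sq[OF x y] by (simp add: power2_sum)
qed (use x y in simp)

lemma hnorm_diff_commute:
  assumes x: "x \<in> carrier H" and y: "y \<in> carrier H"
  shows "hnorm H (x \<ominus> y) = hnorm H (y \<ominus> x)"
proof -
  have "(hnorm H (x \<ominus> y))\<^sup>2 = (hnorm H (y \<ominus> x))\<^sup>2"
    using x y hnorm_diff_sq[OF x y] hnorm_diff_sq[OF y x] cinner_commute[OF x y] by simp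
  then show ?thesis
    using x y by (simp add: power2_eq_iff_nonneg)
qed

lemma hnorm_diff_triangle:
  assumes "x \<in> carrier H" "y \<in> carrier H" "z \<in> carrier H"
  shows "hnorm H (x \<ominus> z) \<le> hnorm H (x \<ominus> y) + hnorm H (y \<ominus> z)"
proof -
  have "x \<ominus> z = (x \<ominus> y) \<oplus> (y \<ominus> z)"
    using assms by (intro vec_eqI) auto
  then show ?thesis
    using hnorm_triangle[of "x \<ominus> y" "y \<ominus> z"] assms by simp
qed

lemma metric: "Metric_space (carrier H) (hdist H)"
proof
  fix x y z
  show "0 \<le> hdist H x y" "hdist H x y = hdist H y x"
    using hnorm_diff_commute by (auto simp: hdist_def)
  show "x \<in> carrier H \<Longrightarrow> y \<in> carrier H \<Longrightarrow> (hdist H x y = 0) = (x = y)"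
    by (auto simp: hdist_def hnorm_eq_zero minus_eq_zero_iff)
  show "x \<in> carrier H \<Longrightarrow> y \<in> carrier H \<Longrightarrow> z \<in> carrier H \<Longrightarrow> hdist H x z \<le> hdist H x y + hdist H y z"
    using hnorm_diff_triangle by (auto simp: hdist_def)
qed

end

section \<open>Sequential limits, Cauchy sequences and completeness\<close>

definition hlim :: "'a hilbert \<Rightarrow> (nat \<Rightarrow> 'a) \<Rightarrow> 'a \<Rightarrow> bool"
  where "hlim H x l \<longleftrightarrow> (\<forall>n. x n \<in> carrier H) \<and> l \<in> carrier H \<and>
    (\<lambda>n. hnorm H (x n \<ominus>\<^bsub>H\<^esub> l)) \<longlonglongrightarrow> 0"

definition hCauchy :: "'a hilbert \<Rightarrow> (nat \<Rightarrow> 'a) \<Rightarrow> bool"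
  where "hCauchy H x \<longleftrightarrow> (\<forall>n. x n \<in> carrier H) \<and>
    (\<forall>e>0. \<exists>N. \<forall>m n. N \<le> m \<longrightarrow> N \<le> n \<longrightarrow> hnorm H (x m \<ominus>\<^bsub>H\<^esub> x n) < e)"

lemma hlim_in: "hlim H x l \<Longrightarrow> x n \<in> carrier H" "hlim H x l \<Longrightarrow> l \<in> carrier H"
  by (auto simp: hlim_def)

context inner_space
begin

text \<open>A topological limit constrains only the tail of a sequence, while \<open>hlim\<close>
  asks for all terms in the carrier; the premise removes this difference.\<close>

lemma hlim_iff_limitin:
  "(\<forall>n. x n \<in> carrier H) \<Longrightarrow> hlim H x l \<longleftrightarrow> limitin (htop H) x l sequentially"
  unfolding htop_def Metric_space.limitin_metric_dist_null[OF metric] hlim_def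
  by (cases "l \<in> carrier H") (simp_all add: hdist_def)

lemma hCauchy_iff_MCauchy: "hCauchy H x \<longleftrightarrow> Metric_space.MCauchy (carrier H) (hdist H) x"
  unfolding Metric_space.MCauchy_def[OF metric] hCauchy_def
proof (cases "\<forall>n. x n \<in> carrier H")
  case True
  then show "(\<forall>n. x n \<in> carrier H) \<and>
      (\<forall>e>0. \<exists>N. \<forall>m n. N \<le> m \<longrightarrow> N \<le> n \<longrightarrow> hnorm H (x m \<ominus> x n) < e) \<longleftrightarrow>
    range x \<subseteq> carrier H \<and>
      (\<forall>e>0. \<exists>N. \<forall>m n. N \<le> m \<longrightarrow> N \<le> n \<longrightarrow> hdist H (x m) (x n) < e)"
    by (simp add: hdist_def image_subset_iff)
next
  case False
  then have "\<not> range x \<subseteq> carrier H"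
    by (simp add: image_subset_iff)
  with False show "(\<forall>n. x n \<in> carrier H) \<and>
      (\<forall>e>0. \<exists>N. \<forall>m n. N \<le> m \<longrightarrow> N \<le> n \<longrightarrow> hnorm H (x m \<ominus> x n) < e) \<longleftrightarrow>
    range x \<subseteq> carrier H \<and>
      (\<forall>e>0. \<exists>N. \<forall>m n. N \<le> m \<longrightarrow> N \<le> n \<longrightarrow> hdist H (x m) (x n) < e)"
    by (simp only: simp_thms)
qed

lemma mcomplete_iff:
  "Metric_space.mcomplete (carrier H) (hdist H) \<longleftrightarrow> (\<forall>x. hCauchy H x \<longrightarrow> (\<exists>l. hlim H x l))"
proof -
  have "limitin (htop H) x l sequentially \<longleftrightarrow> hlim H x l" if "hCauchy H x" for x l
    using hlim_iff_limitin[of x l] that by (simp add: hCauchy_def)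
  then have eq: "(hCauchy H x \<longrightarrow> (\<exists>l. limitin (htop H) x l sequentially)) \<longleftrightarrow>
      (hCauchy H x \<longrightarrow> (\<exists>l. hlim H x l))" for x
    by simp
  show ?thesis
    unfolding Metric_space.mcomplete_def[OF metric] hCauchy_iff_MCauchy[symmetric] htop_def[symmetric]
    by (rule all_cong1, rule eq)
qed

lemma closedin_iff_hlim:
  "closedin (htop H) M \<longleftrightarrow>
    M \<subseteq> carrier H \<and> (\<forall>x l. (\<forall>n. x n \<in> M) \<longrightarrow> hlim H x l \<longrightarrow> l \<in> M)"
proof -
  have eq: "range x \<subseteq> M \<and> limitin (htop H) x l sequentially \<longleftrightarrow> (\<forall>n. x n \<in> M) \<and> hlim H x l"
    if "M \<subseteq> carrier H" for x l
  proof (cases "\<forall>n. x n \<in> M")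
    case True
    then have "\<forall>n. x n \<in> carrier H"
      using that by blast
    then show ?thesis
      using hlim_iff_limitin[of x l] True by (simp add: image_subset_iff)
  next
    case False
    then have "\<not> range x \<subseteq> M"
      by (simp add: image_subset_iff)
    with False show ?thesis
      by (simp only: simp_thms)
  qed
  have m: "closedin (htop H) M \<longleftrightarrow>
      M \<subseteq> carrier H \<and> (\<forall>x l. range x \<subseteq> M \<and> limitin (htop H) x l sequentially \<longrightarrow> l \<in> M)"
    unfolding htop_def by (rule Metric_space.metric_closedin_iff_sequentially_closed[OF metric])
  show ?thesis
  proof (cases "M \<subseteq> carrier H")
    case True
    show ?thesis
      unfolding m eq[OF True] imp_conjL ..
  next
    case False
    then show ?thesis
      unfolding m by (simp only: simp_thms)
  qed
qed

lemma hlim_const [simp]: "x \<in> carrier H \<Longrightarrow> hlim H (\<lambda>_. x) x"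
  by (simp add: hlim_def)

lemma hlim_squeeze:
  assumes "\<And>n. x n \<in> carrier H" "l \<in> carrier H" "\<And>n. hnorm H (x n \<ominus> l) \<le> e n" "e \<longlonglongrightarrow> 0"
  shows "hlim H x l"
  unfolding hlim_def
proof (intro conjI allI assms)
  show "(\<lambda>n. hnorm H (x n \<ominus> l)) \<longlonglongrightarrow> 0"
    using assms by (intro Lim_null_comparison[OF always_eventually assms(4)] allI) simp
qed

lemma hlim_add:
  assumes "hlim H x l" "hlim H y m"
  shows "hlim H (\<lambda>n. x n \<oplus> y n) (l \<oplus> m)"
proof (rule hlim_squeeze)
  note c = hlim_in[OF assms(1)] hlim_in[OF assms(2)]
  show "x n \<oplus> y n \<in> carrier H" "l \<oplus> m \<in> carrier H" for n
    using c by auto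
  show "hnorm H ((x n \<oplus> y n) \<ominus> (l \<oplus> m)) \<le> hnorm H (x n \<ominus> l) + hnorm H (y n \<ominus> m)" for n
  proof -
    have "(x n \<oplus> y n) \<ominus> (l \<oplus> m) = (x n \<ominus> l) \<oplus> (y n \<ominus> m)"
      using c by (intro vec_eqI) auto
    then show ?thesis
      using hnorm_triangle[of "x n \<ominus> l" "y n \<ominus> m"] c by simp
  qed
  show "(\<lambda>n. hnorm H (x n \<ominus> l) + hnorm H (y n \<ominus> m)) \<longlonglongrightarrow> 0"
    using tendsto_add[of "\<lambda>n. hnorm H (x n \<ominus> l)" 0 _ "\<lambda>n. hnorm H (y n \<ominus> m)" 0] assms
    by (simp add: hlim_def)
qed

lemma hlim_smult:
  assumes "hlim H x l"
  shows "hlim H (\<lambda>n. c \<odot> x n) (c \<odot> l)"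
proof (rule hlim_squeeze)
  note c = hlim_in[OF assms(1)]
  show "c \<odot> x n \<in> carrier H" "c \<odot> l \<in> carrier H" for n
    using c by auto
  show "hnorm H ((c \<odot> x n) \<ominus> (c \<odot> l)) \<le> cmod c * hnorm H (x n \<ominus> l)" for n
  proof -
    have "(c \<odot> x n) \<ominus> (c \<odot> l) = c \<odot> (x n \<ominus> l)"
      using c by (intro vec_eqI) (auto simp: algebra_simps)
    then show ?thesis
      using c by simp
  qed
  show "(\<lambda>n. cmod c * hnorm H (x n \<ominus> l)) \<longlonglongrightarrow> 0"
    using tendsto_mult_right_zero assms by (auto simp: hlim_def)
qed

lemma diff_as_add: "\<lbrakk>x \<in> carrier H; y \<in> carrier H\<rbrakk> \<Longrightarrow> x \<ominus> y = x \<oplus> (-1) \<odot> y"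
  by (intro vec_eqI) auto

lemma hlim_diff:
  assumes "hlim H x l" "hlim H y m"
  shows "hlim H (\<lambda>n. x n \<ominus> y n) (l \<ominus> m)"
  using hlim_add[OF assms(1) hlim_smult[OF assms(2), of "-1"]] hlim_in[OF assms(1)] hlim_in[OF assms(2)]
  by (simp add: diff_as_add)

lemma hlim_cinner_left:
  assumes "hlim H x l" "y \<in> carrier H"
  shows "(\<lambda>n. cinner H (x n) y) \<longlonglongrightarrow> cinner H l y"
proof (rule LIM_zero_cancel, rule Lim_null_comparison)
  show "\<forall>\<^sub>F n in sequentially. norm (cinner H (x n) y - cinner H l y) \<le> hnorm H (x n \<ominus> l) * hnorm H y"
    using Cauchy_Schwarz[of "x _ \<ominus> l" y] assms hlim_in[OF assms(1)] by (auto intro!: always_eventually)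
  show "(\<lambda>n. hnorm H (x n \<ominus> l) * hnorm H y) \<longlonglongrightarrow> 0"
    using assms tendsto_mult_left_zero by (auto simp: hlim_def)
qed

lemma hlim_cinner_right:
  assumes "hlim H x l" "y \<in> carrier H"
  shows "(\<lambda>n. cinner H y (x n)) \<longlonglongrightarrow> cinner H y l"
  using tendsto_cnj[OF hlim_cinner_left[OF assms]] assms hlim_in[OF assms(1)]
  by (simp add: cinner_commute[symmetric])

lemma hlim_hnorm:
  assumes "hlim H x l"
  shows "(\<lambda>n. hnorm H (x n)) \<longlonglongrightarrow> hnorm H l"
proof (rule LIM_zero_cancel, rule Lim_null_comparison)
  note c = hlim_in[OF assms(1)]
  have "\<bar>hnorm H (x n) - hnorm H l\<bar> \<le> hnorm H (x n \<ominus> l)" for n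
  proof -
    have "x n = (x n \<ominus> l) \<oplus> l" "l = (l \<ominus> x n) \<oplus> x n"
      using c by (auto intro!: vec_eqI)
    then show ?thesis
      using hnorm_triangle[of "x n \<ominus> l" l] hnorm_triangle[of "l \<ominus> x n" "x n"] c
        hnorm_diff_commute[of "x n" l] by (simp add: abs_le_iff)
  qed
  then show "\<forall>\<^sub>F n in sequentially. norm (hnorm H (x n) - hnorm H l) \<le> hnorm H (x n \<ominus> l)"
    by (auto intro!: always_eventually)
  show "(\<lambda>n. hnorm H (x n \<ominus> l)) \<longlonglongrightarrow> 0"
    using assms by (auto simp: hlim_def)
qed

lemma hlim_cinner:
  assumes x: "hlim H x l" and y: "hlim H y m"
  shows "(\<lambda>n. cinner H (x n) (y n)) \<longlonglongrightarrow> cinner H l m"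
proof (rule LIM_zero_cancel, rule Lim_null_comparison)
  note c = hlim_in[OF x] hlim_in[OF y]
  have "cmod (cinner H (x n) (y n) - cinner H l m)
      \<le> hnorm H (x n \<ominus> l) * hnorm H (y n) + hnorm H l * hnorm H (y n \<ominus> m)" for n
  proof -
    have "cinner H (x n) (y n) - cinner H l m = cinner H (x n \<ominus> l) (y n) + cinner H l (y n \<ominus> m)"
      using c by simp
    then show ?thesis
      using Cauchy_Schwarz[of "x n \<ominus> l" "y n"] Cauchy_Schwarz[of l "y n \<ominus> m"] c
        norm_triangle_ineq[of "cinner H (x n \<ominus> l) (y n)" "cinner H l (y n \<ominus> m)"] by simp
  qed
  then show "\<forall>\<^sub>F n in sequentially. norm (cinner H (x n) (y n) - cinner H l m)
      \<le> hnorm H (x n \<ominus> l) * hnorm H (y n) + hnorm H l * hnorm H (y n \<ominus> m)"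
    by (auto intro!: always_eventually)
  have "(\<lambda>n. hnorm H (x n \<ominus> l) * hnorm H (y n) + hnorm H l * hnorm H (y n \<ominus> m))
      \<longlonglongrightarrow> 0 * hnorm H m + hnorm H l * 0"
    using x y hlim_hnorm[OF y] by (intro tendsto_intros) (auto simp: hlim_def)
  then show "(\<lambda>n. hnorm H (x n \<ominus> l) * hnorm H (y n) + hnorm H l * hnorm H (y n \<ominus> m)) \<longlonglongrightarrow> 0"
    by simp
qed

lemma hlim_hCauchy:
  assumes "hlim H x l"
  shows "hCauchy H x"
  unfolding hCauchy_def
proof (intro conjI allI impI)
  note c = hlim_in[OF assms(1)]
  show "x n \<in> carrier H" for n
    using c by simp
  fix e :: real assume "e > 0"
  then obtain N where N: "hnorm H (x n \<ominus> l) < e / 2" if "n \<ge> N" for n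
    using assms c unfolding hlim_def LIMSEQ_iff
    by (metis abs_of_nonneg diff_zero half_gt_zero hnorm_nonneg minus_closed real_norm_def)
  have "hnorm H (x m \<ominus> x n) < e" if "m \<ge> N" "n \<ge> N" for m n
    using hnorm_diff_triangle[of "x m" l "x n"] c hnorm_diff_commute[of l "x n"] N[OF that(1)] N[OF that(2)]
    by simp
  then show "\<exists>N. \<forall>m n. N \<le> m \<longrightarrow> N \<le> n \<longrightarrow> hnorm H (x m \<ominus> x n) < e"
    by blast
qed

end

locale hilb = inner_space +
  assumes hCauchy_hlim: "hCauchy H x \<Longrightarrow> \<exists>l. hlim H x l"

text \<open>Exchanges the predicate of the definitions for the locale with its derived facts: in one
  direction for the given state space, in the other for the transported one.\<close>

lemma hilbert_space_iff_hilb: "hilbert_space H \<longleftrightarrow> hilb H"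
proof
  assume h: "hilbert_space H"
  note h' = h[unfolded hilbert_space_def]
  note h1 = h'[THEN conjunct2] note h2 = h1[THEN conjunct2] note h3 = h2[THEN conjunct2]
  note h4 = h3[THEN conjunct2]
  interpret inner_space H
    by (rule inner_space.intro; rule h'[THEN conjunct1] h1[THEN conjunct1, rule_format]
      h2[THEN conjunct1, rule_format] h3[THEN conjunct1, rule_format] h4[THEN conjunct1, rule_format])
  show "hilb H"
    using h4[THEN conjunct2] unfolding mcomplete_iff by unfold_locales blast
next
  assume "hilb H"
  then interpret hilb H .
  have "Metric_space.mcomplete (carrier H) (hdist H)"
    unfolding mcomplete_iff using hCauchy_hlim by blast
  then show "hilbert_space H"
    unfolding hilbert_space_def
    by (intro conjI ballI allI impI module cinner_commute cinner_pos cinner_add_left cinner_smult_left)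
qed

section \<open>Closed subspaces, orthogonal projection and Riesz representation\<close>

definition hsub :: "'a hilbert \<Rightarrow> 'a set \<Rightarrow> bool"
  where "hsub H M \<longleftrightarrow> M \<subseteq> carrier H \<and> \<zero>\<^bsub>H\<^esub> \<in> M \<and>
    (\<forall>x\<in>M. \<forall>y\<in>M. x \<oplus>\<^bsub>H\<^esub> y \<in> M) \<and> (\<forall>c. \<forall>x\<in>M. c \<odot>\<^bsub>H\<^esub> x \<in> M)"

definition seq_closed :: "'a hilbert \<Rightarrow> 'a set \<Rightarrow> bool"
  where "seq_closed H M \<longleftrightarrow> (\<forall>x l. (\<forall>n. x n \<in> M) \<longrightarrow> hlim H x l \<longrightarrow> l \<in> M)"

context inner_space
begin

lemma hsub_in: "\<lbrakk>hsub H M; x \<in> M\<rbrakk> \<Longrightarrow> x \<in> carrier H"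
  unfolding hsub_def by auto

lemma closed_subspace_iff: "closed_subspace H M \<longleftrightarrow> hsub H M \<and> seq_closed H M"
proof -
  have neg: "(-1) \<odot> x = \<ominus> x" if "x \<in> carrier H" for x
    using that by (intro vec_eqI) auto
  have "submodule M complex_ring H \<longleftrightarrow> hsub H M"
  proof
    assume s: "submodule M complex_ring H"
    show "hsub H M"
      using module.submoduleE[OF module s] subgroup.one_closed[OF submodule.axioms(1)[OF s]]
      unfolding hsub_def by (auto simp: complex_ring_def)
  next
    assume h: "hsub H M"
    show "submodule M complex_ring H"
    proof (rule module.submoduleI[OF module])
      fix x assume "x \<in> M"
      then show "\<ominus> x \<in> M"
        using h neg[of x] unfolding hsub_def by (metis subsetD)
    qed (use h in \<open>auto simp: hsub_def\<close>)
  qed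
  moreover have "closedin (htop H) M \<longleftrightarrow> M \<subseteq> carrier H \<and> seq_closed H M"
    unfolding closedin_iff_hlim seq_closed_def ..
  ultimately show ?thesis
    unfolding closed_subspace_def hsub_def by blast
qed

lemma parallelogram:
  assumes "u \<in> carrier H" "v \<in> carrier H"
  shows "(hnorm H (u \<ominus> v))\<^sup>2 = 2 * (hnorm H u)\<^sup>2 + 2 * (hnorm H v)\<^sup>2 - (hnorm H (u \<oplus> v))\<^sup>2"
  using hnorm_add_sq[OF assms] hnorm_diff_sq[OF assms] by simp

end

context hilb
begin

lemma projection:
  assumes M: "hsub H M" "seq_closed H M" and x: "x \<in> carrier H"
  obtains m where "m \<in> M" "\<And>w. w \<in> M \<Longrightarrow> cinner H (x \<ominus> m) w = 0"
proof -
  define D where "D = (\<lambda>m. (hnorm H (x \<ominus> m))\<^sup>2) ` M"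
  define d where "d = Inf D"
  have ne: "D \<noteq> {}" and bdd: "bdd_below D"
    using M by (auto simp: D_def hsub_def intro!: bdd_belowI[of _ 0])
  have lower: "d \<le> (hnorm H (x \<ominus> m))\<^sup>2" if "m \<in> M" for m
    unfolding d_def using bdd that by (intro cInf_lower) (auto simp: D_def)
  have "\<exists>m\<in>M. (hnorm H (x \<ominus> m))\<^sup>2 < d + 1 / Suc n" for n
    using cInf_lessD[OF ne, of "d + 1 / Suc n"] unfolding d_def[symmetric] by (auto simp: D_def)
  then obtain m where m: "\<And>n. m n \<in> M" and ub: "\<And>n. (hnorm H (x \<ominus> m n))\<^sup>2 < d + 1 / Suc n"
    by metis
  have mc: "m n \<in> carrier H" for n
    using m M hsub_in by blast
  \<comment> \<open>Parallelogram law for \<open>x - m q\<close> and \<open>x - m p\<close>: their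
    sum is twice the vector from a midpoint in \<open>M\<close> to \<open>x\<close>, so its squared
    norm is at least \<open>4 * d\<close>. Hence a minimizing sequence is Cauchy.\<close>
  have close: "(hnorm H (m p \<ominus> m q))\<^sup>2 \<le> 2 / Suc p + 2 / Suc q" for p q
  proof -
    have c: "(1/2) \<odot> (m p \<oplus> m q) \<in> M"
      using m M unfolding hsub_def by blast
    have "(x \<ominus> m q) \<oplus> (x \<ominus> m p) = 2 \<odot> (x \<ominus> (1/2) \<odot> (m p \<oplus> m q))"
      using x mc by (intro vec_eqI) (auto simp: algebra_simps)
    then have "hnorm H ((x \<ominus> m q) \<oplus> (x \<ominus> m p)) = 2 * hnorm H (x \<ominus> (1/2) \<odot> (m p \<oplus> m q))"
      using x mc by simp
    then have a: "(hnorm H ((x \<ominus> m q) \<oplus> (x \<ominus> m p)))\<^sup>2 \<ge> 4 * d"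
      using lower[OF c] by (simp add: power_mult_distrib)
    have "m p \<ominus> m q = (x \<ominus> m q) \<ominus> (x \<ominus> m p)"
      using x mc by (intro vec_eqI) auto
    then show ?thesis
      using parallelogram[of "x \<ominus> m q" "x \<ominus> m p"] a ub[of p] ub[of q] x mc by simp
  qed
  have "hCauchy H m"
    unfolding hCauchy_def
  proof (intro conjI allI impI mc)
    fix e :: real assume e: "e > 0"
    obtain N where N: "4 / Suc N < e\<^sup>2"
    proof -
      obtain N where "4 / e\<^sup>2 < real N"
        using reals_Archimedean2 by blast
      then have "4 / Suc N < e\<^sup>2"
        using e by (simp add: field_simps) (smt (verit) zero_less_power)
      then show thesis using that by blast
    qed
    have "hnorm H (m p \<ominus> m q) < e" if "N \<le> p" "N \<le> q" for p q
    proof -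
      have "2 / real (Suc p) \<le> 2 / Suc N" "2 / real (Suc q) \<le> 2 / Suc N"
        using that by (auto intro!: divide_left_mono)
      then have "(hnorm H (m p \<ominus> m q))\<^sup>2 < e\<^sup>2"
        using close[of p q] N by simp
      then show ?thesis
        using e power2_less_imp_less by fastforce
    qed
    then show "\<exists>N. \<forall>p q. N \<le> p \<longrightarrow> N \<le> q \<longrightarrow> hnorm H (m p \<ominus> m q) < e"
      by blast
  qed
  then obtain l where l: "hlim H m l"
    using hCauchy_hlim by blast
  have lM: "l \<in> M"
    using M l m unfolding seq_closed_def by blast
  have lc: "l \<in> carrier H"
    using lM M hsub_in by blast
  have "(\<lambda>n. (hnorm H (x \<ominus> m n))\<^sup>2) \<longlonglongrightarrow> (hnorm H (x \<ominus> l))\<^sup>2"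
    using x by (intro tendsto_power hlim_hnorm hlim_diff l hlim_const)
  moreover have "(\<lambda>n. d + 1 / Suc n) \<longlonglongrightarrow> d + 0"
    by (intro tendsto_intros LIMSEQ_Suc[OF lim_1_over_n])
  ultimately have opt: "(hnorm H (x \<ominus> l))\<^sup>2 \<le> d"
    using ub by (simp add: LIMSEQ_le less_imp_le)
  have "cinner H (x \<ominus> l) w = 0" if w: "w \<in> M" for w
  proof (rule ccontr)
    define u t where "u = x \<ominus> l" and "t = cinner H u w"
    assume "cinner H (x \<ominus> l) w \<noteq> 0"
    then have t: "t \<noteq> 0" by (simp add: t_def u_def)
    have wc: "w \<in> carrier H" and uc: "u \<in> carrier H"
      using w M hsub_in x lc by (auto simp: u_def)
    \<comment> \<open>Moving \<open>l\<close> by \<open>c w\<close> with \<open>c = s t\<close>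
      changes the squared distance by \<open>- 2 s |t|^2 + s^2 |t|^2 |w|^2\<close>. With this
      \<open>s\<close> one has \<open>s |w|^2 <= 1\<close>, so the linear term wins and contradicts
      minimality.\<close>
    define s where "s = 1 / (1 + (hnorm H w)\<^sup>2)"
    have s: "s > 0"
      by (simp add: s_def add_pos_nonneg)
    define c where "c = complex_of_real s * t"
    have "l \<oplus> c \<odot> w \<in> M"
      using lM w M unfolding hsub_def by blast
    moreover have "x \<ominus> (l \<oplus> c \<odot> w) = u \<ominus> c \<odot> w"
      unfolding u_def using x lc wc by (intro vec_eqI) auto
    ultimately have "d \<le> (hnorm H (u \<ominus> c \<odot> w))\<^sup>2"
      using lower by metis
    then have "2 * Re (cinner H u (c \<odot> w)) \<le> (hnorm H (c \<odot> w))\<^sup>2"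
      using hnorm_diff_sq[of u "c \<odot> w"] uc wc opt by (simp add: u_def[symmetric])
    moreover have "Re (cinner H u (c \<odot> w)) = s * (cmod t)\<^sup>2"
      unfolding cmod_power2 using uc wc by (simp add: c_def t_def[symmetric] algebra_simps power2_eq_square)
    moreover have "(hnorm H (c \<odot> w))\<^sup>2 = s * (cmod t)\<^sup>2 * (s * (hnorm H w)\<^sup>2)"
      using wc s by (simp add: c_def norm_mult power_mult_distrib power2_eq_square)
    ultimately have "2 * (s * (cmod t)\<^sup>2) \<le> s * (cmod t)\<^sup>2 * (s * (hnorm H w)\<^sup>2)"
      by simp
    moreover have "s * (cmod t)\<^sup>2 > 0"
      using s t by simp
    ultimately have "2 \<le> s * (hnorm H w)\<^sup>2"
      by (metis mult.commute mult_le_cancel_left_pos)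
    moreover have "s * (hnorm H w)\<^sup>2 \<le> 1"
      by (simp add: s_def add_pos_nonneg)
    ultimately show False by simp
  qed
  then show thesis
    using that lM by blast
qed

text \<open>The bound makes the kernel closed. A vector \<open>u\<close> orthogonal to the kernel
  and not in it determines the functional, because \<open>f - (\<phi> f / \<phi> u) u\<close> always
  lies in the kernel.\<close>

lemma riesz:
  assumes add: "\<And>x y. \<lbrakk>x \<in> carrier H; y \<in> carrier H\<rbrakk> \<Longrightarrow> \<phi> (x \<oplus> y) = \<phi> x + \<phi> y"
    and smult: "\<And>c x. x \<in> carrier H \<Longrightarrow> \<phi> (c \<odot> x) = c * \<phi> x"
    and bound: "\<And>x. x \<in> carrier H \<Longrightarrow> cmod (\<phi> x) \<le> C * hnorm H x"
  obtains h where "h \<in> carrier H" "\<And>f. f \<in> carrier H \<Longrightarrow> \<phi> f = cinner H f h"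
proof -
  define M where "M = {f \<in> carrier H. \<phi> f = 0}"
  have diff: "\<phi> (x \<ominus> y) = \<phi> x - \<phi> y" if "x \<in> carrier H" "y \<in> carrier H" for x y
    using that by (simp add: diff_as_add add smult)
  have "\<phi> \<zero> = 0"
    using add[of \<zero> \<zero>] by simp
  then have sub: "hsub H M"
    by (auto simp: hsub_def M_def add smult)
  have closed: "seq_closed H M"
    unfolding seq_closed_def
  proof (intro allI impI)
    fix x l assume x: "\<forall>n. x n \<in> M" and l: "hlim H x l"
    note c = hlim_in[OF l]
    have "cmod (\<phi> l) \<le> C * hnorm H (x n \<ominus> l)" for n
      using bound[of "x n \<ominus> l"] x c diff by (simp add: M_def)
    moreover have "(\<lambda>n. C * hnorm H (x n \<ominus> l)) \<longlonglongrightarrow> 0"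
      using l tendsto_mult_right_zero by (auto simp: hlim_def)
    ultimately have "cmod (\<phi> l) \<le> 0"
      by (meson LIMSEQ_le_const)
    then show "l \<in> M"
      using c by (simp add: M_def)
  qed
  show thesis
  proof (cases "M = carrier H")
    case True
    then show thesis
      using that[of \<zero>] by (auto simp: M_def)
  next
    case False
    then obtain x where x: "x \<in> carrier H" "\<phi> x \<noteq> 0"
      by (auto simp: M_def)
    obtain m where m: "m \<in> M" "\<And>w. w \<in> M \<Longrightarrow> cinner H (x \<ominus> m) w = 0"
      using projection[OF sub closed x(1)] by blast
    define u where "u = x \<ominus> m"
    have mc: "m \<in> carrier H" and u: "u \<in> carrier H" "\<phi> u \<noteq> 0"
      using m x diff by (auto simp: u_def M_def)
    then have uu: "cinner H u u \<noteq> 0"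
      using cinner_self_eq_zero[OF u(1)] \<open>\<phi> \<zero> = 0\<close> by auto
    show thesis
    proof (rule that)
      show "(cnj (\<phi> u) / cnj (cinner H u u)) \<odot> u \<in> carrier H"
        using u by simp
      fix f assume f: "f \<in> carrier H"
      have "f \<ominus> (\<phi> f / \<phi> u) \<odot> u \<in> M"
        using f u by (simp add: M_def diff smult)
      then have "cinner H u (f \<ominus> (\<phi> f / \<phi> u) \<odot> u) = 0"
        using m(2) by (simp add: u_def)
      then have "cinner H (f \<ominus> (\<phi> f / \<phi> u) \<odot> u) u = 0"
        using cinner_commute[of u "f \<ominus> (\<phi> f / \<phi> u) \<odot> u"] f u
        by (simp del: cinner_diff_left cinner_diff_right)
      then have "cinner H f u = \<phi> f / \<phi> u * cinner H u u"
        using f u by simp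
      then show "\<phi> f = cinner H f ((cnj (\<phi> u) / cnj (cinner H u u)) \<odot> u)"
        using f u uu by simp
    qed
  qed
qed

end

section \<open>Operators given by their graphs\<close>

context inner_space
begin

lemma linear_op_in: "linear_op H S \<Longrightarrow> (f, g) \<in> S \<Longrightarrow> f \<in> carrier H"
  "linear_op H S \<Longrightarrow> (f, g) \<in> S \<Longrightarrow> g \<in> carrier H"
  by (auto simp: linear_op_def)

lemma linear_op_add: "\<lbrakk>linear_op H S; (f, g) \<in> S; (f', g') \<in> S\<rbrakk> \<Longrightarrow> (f \<oplus> f', g \<oplus> g') \<in> S"
  unfolding linear_op_def by fast

lemma linear_op_smult: "\<lbrakk>linear_op H S; (f, g) \<in> S\<rbrakk> \<Longrightarrow> (c \<odot> f, c \<odot> g) \<in> S"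
  unfolding linear_op_def by fast

lemma linear_op_diff: "\<lbrakk>linear_op H S; (f, g) \<in> S; (f', g') \<in> S\<rbrakk> \<Longrightarrow> (f \<ominus> f', g \<ominus> g') \<in> S"
  using linear_op_add[of S f g "(-1) \<odot> f'" "(-1) \<odot> g'"] linear_op_smult[of S f' g' "-1"]
    linear_op_in[of S] by (simp add: diff_as_add)

lemma linear_op_zero: "linear_op H S \<Longrightarrow> (\<zero>, \<zero>) \<in> S"
  by (simp add: linear_op_def)

lemma linear_op_unique: "\<lbrakk>linear_op H S; (f, g) \<in> S; (f, g') \<in> S\<rbrakk> \<Longrightarrow> g = g'"
  unfolding linear_op_def single_valued_def by blast

lemma op_app_eq: "\<lbrakk>single_valued S; (f, g) \<in> S\<rbrakk> \<Longrightarrow> op_app S f = g"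
  unfolding op_app_def single_valued_def by blast

lemma adjoint_opD:
  assumes "(g, h) \<in> adjoint_op H S"
  shows "g \<in> carrier H" "h \<in> carrier H" "(f, k) \<in> S \<Longrightarrow> cinner H k g = cinner H f h"
  using assms by (auto simp: adjoint_op_def)

lemma adjoint_opI:
  assumes "g \<in> carrier H" "h \<in> carrier H" "\<And>f k. (f, k) \<in> S \<Longrightarrow> cinner H k g = cinner H f h"
  shows "(g, h) \<in> adjoint_op H S"
  using assms by (auto simp: adjoint_op_def)

lemma adjoint_op_antimono: "S \<subseteq> S' \<Longrightarrow> adjoint_op H S' \<subseteq> adjoint_op H S"
  by (auto simp: adjoint_op_def)

lemma adjoint_op_add:
  assumes S: "S \<subseteq> carrier H \<times> carrier H" and a: "(f, g) \<in> adjoint_op H S" and b: "(f', g') \<in> adjoint_op H S"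
  shows "(f \<oplus> f', g \<oplus> g') \<in> adjoint_op H S"
proof (rule adjoint_opI)
  note c = adjoint_opD(1,2)[OF a] adjoint_opD(1,2)[OF b]
  show "f \<oplus> f' \<in> carrier H" "g \<oplus> g' \<in> carrier H"
    using c by auto
  fix x y assume xy: "(x, y) \<in> S"
  then have "x \<in> carrier H" "y \<in> carrier H"
    using S by auto
  then show "cinner H y (f \<oplus> f') = cinner H x (g \<oplus> g')"
    using c adjoint_opD(3)[OF a xy] adjoint_opD(3)[OF b xy] by simp
qed

lemma adjoint_op_smult:
  assumes S: "S \<subseteq> carrier H \<times> carrier H" and a: "(f, g) \<in> adjoint_op H S"
  shows "(c \<odot> f, c \<odot> g) \<in> adjoint_op H S"
proof (rule adjoint_opI)
  note c = adjoint_opD(1,2)[OF a]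
  show "c \<odot> f \<in> carrier H" "c \<odot> g \<in> carrier H"
    using c by auto
  fix x y assume xy: "(x, y) \<in> S"
  then have "x \<in> carrier H" "y \<in> carrier H"
    using S by auto
  then show "cinner H y (c \<odot> f) = cinner H x (c \<odot> g)"
    using c adjoint_opD(3)[OF a xy] by simp
qed

lemma adjoint_op_diff:
  assumes S: "S \<subseteq> carrier H \<times> carrier H" and a: "(f, g) \<in> adjoint_op H S" and b: "(f', g') \<in> adjoint_op H S"
  shows "(f \<ominus> f', g \<ominus> g') \<in> adjoint_op H S"
proof (rule adjoint_opI)
  note c = adjoint_opD(1,2)[OF a] adjoint_opD(1,2)[OF b]
  show "f \<ominus> f' \<in> carrier H" "g \<ominus> g' \<in> carrier H"
    using c by auto
  fix x y assume xy: "(x, y) \<in> S"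
  then have "x \<in> carrier H" "y \<in> carrier H"
    using S by auto
  then show "cinner H y (f \<ominus> f') = cinner H x (g \<ominus> g')"
    using c adjoint_opD(3)[OF a xy] adjoint_opD(3)[OF b xy] by simp
qed

lemma adjoint_op_hlim:
  assumes S: "S \<subseteq> carrier H \<times> carrier H" and fg: "\<And>n. (f n, g n) \<in> adjoint_op H S"
    and lim: "hlim H f f'" "hlim H g g'"
  shows "(f', g') \<in> adjoint_op H S"
proof (rule adjoint_opI)
  show "f' \<in> carrier H" "g' \<in> carrier H"
    using hlim_in(2)[OF lim(1)] hlim_in(2)[OF lim(2)] by auto
  fix x y assume xy: "(x, y) \<in> S"
  then have c: "x \<in> carrier H" "y \<in> carrier H"
    using S by auto
  have "cinner H y (f n) = cinner H x (g n)" for n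
    using adjoint_opD(3)[OF fg xy] .
  then show "cinner H y f' = cinner H x g'"
    using hlim_cinner_right[OF lim(1) c(2)] hlim_cinner_right[OF lim(2) c(1)] LIMSEQ_unique by simp
qed

lemma symmetric_opD:
  "\<lbrakk>symmetric_op H S; (f, g) \<in> S; (f', g') \<in> S\<rbrakk> \<Longrightarrow> cinner H g f' = cinner H f g'"
  unfolding symmetric_op_def adjoint_op_def by blast

text \<open>Symmetry makes \<open>(g, f)\<close> real, so the imaginary part of
  \<open>(g - z f, f)\<close> is \<open>- Im z |f|^2\<close>, and Cauchy-Schwarz applies. This one
  estimate yields injectivity of \<open>S - z\<close>, closedness of ranges and, later, continuity
  of the defect vectors.\<close>

lemma symmetric_resolvent_bound:
  assumes S: "linear_op H S" "symmetric_op H S" and fg: "(f, g) \<in> S"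
  shows "\<bar>Im z\<bar> * hnorm H f \<le> hnorm H (g \<ominus> z \<odot> f)"
proof (cases "f = \<zero>")
  case True
  then show ?thesis
    using linear_op_in[OF S(1) fg] by simp
next
  case False
  have c: "f \<in> carrier H" "g \<in> carrier H"
    using linear_op_in[OF S(1) fg] by auto
  have "cinner H g f = cnj (cinner H g f)"
    using symmetric_opD[OF S(2) fg fg] cinner_commute[OF c(2,1)] by simp
  then have "Im (cinner H g f) = 0"
    by (metis cnj.simps(2) equal_neg_zero)
  then have "Im (cinner H (g \<ominus> z \<odot> f) f) = - Im z * (hnorm H f)\<^sup>2"
    using c by (simp add: cinner_self power2_eq_square)
  then have "\<bar>Im z\<bar> * (hnorm H f)\<^sup>2 \<le> cmod (cinner H (g \<ominus> z \<odot> f) f)"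
    using abs_Im_le_cmod[of "cinner H (g \<ominus> z \<odot> f) f"] by (simp add: abs_mult)
  also have "\<dots> \<le> hnorm H (g \<ominus> z \<odot> f) * hnorm H f"
    using c by (intro Cauchy_Schwarz) auto
  finally have "(\<bar>Im z\<bar> * hnorm H f) * hnorm H f \<le> hnorm H (g \<ominus> z \<odot> f) * hnorm H f"
    by (simp add: power2_eq_square mult.assoc)
  moreover have "hnorm H f > 0"
    using False c hnorm_eq_zero hnorm_nonneg by (metis less_eq_real_def)
  ultimately show ?thesis
    by (metis mult_le_cancel_right_pos)
qed

lemma symmetric_eigen_zero:
  assumes "linear_op H S" "symmetric_op H S" "(f, z \<odot> f) \<in> S" "Im z \<noteq> 0"
  shows "f = \<zero>"
proof -
  have c: "f \<in> carrier H"
    using linear_op_in assms by blast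
  then have "\<bar>Im z\<bar> * hnorm H f \<le> 0"
    using symmetric_resolvent_bound[OF assms(1-3), of z] by simp
  then have "hnorm H f \<le> 0"
    using assms(4) by (simp add: mult_le_0_iff)
  then show ?thesis
    using c hnorm_nonneg[OF c] hnorm_eq_zero[OF c] by simp
qed

text \<open>The set of vectors orthogonal to \<open>y\<close> is closed and contains Dom S, so it
  contains the closure, which is the whole space and in particular \<open>y\<close> itself.\<close>

lemma densely_defined_orth_zero:
  assumes "densely_defined H S" "y \<in> carrier H" "\<And>f. f \<in> Domain S \<Longrightarrow> cinner H f y = 0"
    "Domain S \<subseteq> carrier H"
  shows "y = \<zero>"
proof -
  define M where "M = {x \<in> carrier H. cinner H x y = 0}"
  have "closedin (htop H) M"
    unfolding closedin_iff_hlim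
  proof (intro conjI allI impI)
    fix x l assume x: "\<forall>n. x n \<in> M" and l: "hlim H x l"
    then have "cinner H l y = 0"
      using hlim_cinner_left[OF l assms(2)] by (simp add: M_def LIMSEQ_const_iff)
    then show "l \<in> M"
      using hlim_in[OF l] by (simp add: M_def)
  qed (auto simp: M_def)
  moreover have "Domain S \<subseteq> M"
    using assms by (auto simp: M_def)
  ultimately have "htop H closure_of Domain S \<subseteq> M"
    by (rule closure_of_minimal[rotated])
  then show ?thesis
    using assms unfolding densely_defined_def M_def by (auto intro: cinner_self_eq_zero)
qed

lemma adjoint_single_valued:
  assumes "densely_defined H S" "S \<subseteq> carrier H \<times> carrier H"
  shows "single_valued (adjoint_op H S)"
proof (rule single_valuedI)
  fix f g g' assume a: "(f, g) \<in> adjoint_op H S" "(f, g') \<in> adjoint_op H S"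
  have c: "g \<in> carrier H" "g' \<in> carrier H"
    using adjoint_opD(2) a by blast+
  have "g \<ominus> g' = \<zero>"
  proof (rule densely_defined_orth_zero[OF assms(1)])
    fix x assume "x \<in> Domain S"
    then obtain k where k: "(x, k) \<in> S" by auto
    then show "cinner H x (g \<ominus> g') = 0"
      using adjoint_opD(3)[OF a(1) k] adjoint_opD(3)[OF a(2) k] c assms(2) by auto
  qed (use c assms(2) in auto)
  then show "g = g'"
    using c by (simp add: minus_eq_zero_iff)
qed

end

text \<open>\<open>B - z\<close> is onto. Its range is closed, since
  \<open>symmetric_resolvent_bound\<close> turns Cauchy images into Cauchy preimages and
  \<open>B\<close> equals its closed adjoint. A vector orthogonal to the range is an eigenvector of
  \<open>B\<close> at \<open>cnj z\<close>, hence zero.\<close>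

lemma (in hilb) self_adjoint_range:
  assumes B: "self_adjoint_op H B" and z: "Im z \<noteq> 0" and h: "h \<in> carrier H"
  obtains f where "(f, h \<oplus> z \<odot> f) \<in> B"
proof -
  have lin: "linear_op H B" and adj: "adjoint_op H B = B" and sym: "symmetric_op H B"
    using B by (auto simp: self_adjoint_op_def symmetric_op_def)
  have sub: "B \<subseteq> carrier H \<times> carrier H"
    using lin by (simp add: linear_op_def)
  define M where "M = {g \<ominus> z \<odot> f | f g. (f, g) \<in> B}"
  have "hsub H M"
    unfolding hsub_def
  proof (intro conjI ballI allI)
    show "M \<subseteq> carrier H"
      using sub by (auto simp: M_def)
    have "\<zero> = \<zero> \<ominus> z \<odot> \<zero>"
      by (intro vec_eqI) auto
    then show "\<zero> \<in> M"
      using linear_op_zero[OF lin] unfolding M_def by blast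
  next
    fix x y assume "x \<in> M" "y \<in> M"
    then obtain f g f' g' where a: "(f, g) \<in> B" "(f', g') \<in> B" "x = g \<ominus> z \<odot> f" "y = g' \<ominus> z \<odot> f'"
      by (auto simp: M_def)
    then have "x \<oplus> y = (g \<oplus> g') \<ominus> z \<odot> (f \<oplus> f')"
      using linear_op_in[OF lin] by (intro vec_eqI) (auto simp: algebra_simps)
    then show "x \<oplus> y \<in> M"
      using linear_op_add[OF lin a(1,2)] unfolding M_def by blast
  next
    fix c x assume "x \<in> M"
    then obtain f g where a: "(f, g) \<in> B" "x = g \<ominus> z \<odot> f"
      by (auto simp: M_def)
    then have "c \<odot> x = (c \<odot> g) \<ominus> z \<odot> (c \<odot> f)"
      using linear_op_in[OF lin a(1)] by (intro vec_eqI) (auto simp: algebra_simps)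
    then show "c \<odot> x \<in> M"
      using linear_op_smult[OF lin a(1)] unfolding M_def by blast
  qed
  moreover have "seq_closed H M"
    unfolding seq_closed_def
  proof (intro allI impI)
    fix x l assume "\<forall>n. x n \<in> M" and l: "hlim H x l"
    then have "\<forall>n. \<exists>f g. (f, g) \<in> B \<and> x n = g \<ominus> z \<odot> f"
      by (simp add: M_def) metis
    then obtain f g where fg: "\<And>n. (f n, g n) \<in> B" and x: "\<And>n. x n = g n \<ominus> z \<odot> f n"
      by metis
    have c: "f n \<in> carrier H" "g n \<in> carrier H" for n
      using linear_op_in[OF lin fg] by auto
    have bd: "hnorm H (f m \<ominus> f n) \<le> hnorm H (x m \<ominus> x n) / \<bar>Im z\<bar>" for m n
    proof -
      have "(g m \<ominus> g n) \<ominus> z \<odot> (f m \<ominus> f n) = x m \<ominus> x n"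
        unfolding x using c by (intro vec_eqI) (auto simp: algebra_simps)
      then have "\<bar>Im z\<bar> * hnorm H (f m \<ominus> f n) \<le> hnorm H (x m \<ominus> x n)"
        using symmetric_resolvent_bound[OF lin sym linear_op_diff[OF lin fg fg], of z m n] by simp
      then show ?thesis
        using z by (simp add: field_simps)
    qed
    have "hCauchy H f"
      unfolding hCauchy_def
    proof (intro conjI allI impI c)
      fix e :: real assume "e > 0"
      then have "e * \<bar>Im z\<bar> > 0"
        using z by simp
      then obtain N where N: "\<forall>m n. N \<le> m \<longrightarrow> N \<le> n \<longrightarrow> hnorm H (x m \<ominus> x n) < e * \<bar>Im z\<bar>"
        using hlim_hCauchy[OF l] unfolding hCauchy_def by blast
      have "hnorm H (f m \<ominus> f n) < e" if "N \<le> m" "N \<le> n" for m n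
        using bd[of m n] N that z by (smt (verit) divide_less_eq zero_less_abs_iff)
      then show "\<exists>N. \<forall>m n. N \<le> m \<longrightarrow> N \<le> n \<longrightarrow> hnorm H (f m \<ominus> f n) < e"
        by blast
    qed
    then obtain f' where f': "hlim H f f'"
      using hCauchy_hlim by blast
    have "g = (\<lambda>n. x n \<oplus> z \<odot> f n)"
      unfolding x using c by (intro ext vec_eqI) auto
    then have g': "hlim H g (l \<oplus> z \<odot> f')"
      using hlim_add[OF l hlim_smult[OF f']] by simp
    have "(f', l \<oplus> z \<odot> f') \<in> B"
      using adjoint_op_hlim[OF sub _ f' g'] fg adj by simp
    moreover have "l = (l \<oplus> z \<odot> f') \<ominus> z \<odot> f'"
      using hlim_in[OF l] hlim_in[OF f'] by (intro vec_eqI) auto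
    ultimately show "l \<in> M"
      unfolding M_def by blast
  qed
  ultimately obtain m where m: "m \<in> M" "\<And>w. w \<in> M \<Longrightarrow> cinner H (h \<ominus> m) w = 0"
    using projection[OF _ _ h] by blast
  obtain f g where fg: "(f, g) \<in> B" "m = g \<ominus> z \<odot> f"
    using m by (auto simp: M_def)
  define y where "y = h \<ominus> m"
  have c: "f \<in> carrier H" "g \<in> carrier H" "y \<in> carrier H"
    using linear_op_in[OF lin fg(1)] fg(2) h by (auto simp: y_def)
  have "(y, cnj z \<odot> y) \<in> adjoint_op H B"
  proof (rule adjoint_opI)
    fix u v assume uv: "(u, v) \<in> B"
    then have uvc: "u \<in> carrier H" "v \<in> carrier H"
      using linear_op_in[OF lin] by auto
    have "cinner H y (v \<ominus> z \<odot> u) = 0"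
      unfolding y_def using m(2) uv by (auto simp: M_def)
    then have "cinner H (v \<ominus> z \<odot> u) y = 0"
      using cinner_commute[of y "v \<ominus> z \<odot> u"] uvc c by (simp del: cinner_diff_left cinner_diff_right)
    then show "cinner H v y = cinner H u (cnj z \<odot> y)"
      using uvc c by simp
  qed (use c in auto)
  then have "y = \<zero>"
    using symmetric_eigen_zero[OF lin sym, of y "cnj z"] adj z by simp
  then have "h = g \<ominus> z \<odot> f"
    using y_def fg(2) h c by (simp add: minus_eq_zero_iff)
  then have "g = h \<oplus> z \<odot> f"
    using c by (auto intro!: vec_eqI)
  then show thesis
    using that fg by blast
qed

section \<open>Rigged spaces\<close>

lemma cring_complex_ring: "cring complex_ring"
proof (rule cringI)
  show "abelian_group complex_ring"
    by (rule abelian_groupI) (auto simp: complex_ring_def intro: exI[of _ "- _"])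
  show "comm_monoid complex_ring"
    by (rule comm_monoidI) (auto simp: complex_ring_def)
qed (auto simp: complex_ring_def distrib_right)

text \<open>No additive inverse is asked for: it comes from multiplication by -1, so spaces of
  functionals and of classes need not exhibit one.\<close>

lemma module_complexI:
  fixes M (structure)
  assumes add: "\<And>x y. \<lbrakk>x \<in> carrier M; y \<in> carrier M\<rbrakk> \<Longrightarrow> x \<oplus> y \<in> carrier M"
    and zero: "\<zero> \<in> carrier M"
    and smult: "\<And>c x. x \<in> carrier M \<Longrightarrow> c \<odot> x \<in> carrier M"
    and assoc: "\<And>x y z. \<lbrakk>x \<in> carrier M; y \<in> carrier M; z \<in> carrier M\<rbrakk> \<Longrightarrow> (x \<oplus> y) \<oplus> z = x \<oplus> (y \<oplus> z)"
    and comm: "\<And>x y. \<lbrakk>x \<in> carrier M; y \<in> carrier M\<rbrakk> \<Longrightarrow> x \<oplus> y = y \<oplus> x"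
    and l_zero: "\<And>x. x \<in> carrier M \<Longrightarrow> \<zero> \<oplus> x = x"
    and smult_zero: "\<And>x. x \<in> carrier M \<Longrightarrow> 0 \<odot> x = \<zero>"
    and smult_one: "\<And>x. x \<in> carrier M \<Longrightarrow> 1 \<odot> x = x"
    and distl: "\<And>a b x. x \<in> carrier M \<Longrightarrow> (a + b) \<odot> x = a \<odot> x \<oplus> b \<odot> x"
    and distr: "\<And>a x y. \<lbrakk>x \<in> carrier M; y \<in> carrier M\<rbrakk> \<Longrightarrow> a \<odot> (x \<oplus> y) = a \<odot> x \<oplus> a \<odot> y"
    and assoc1: "\<And>a b x. x \<in> carrier M \<Longrightarrow> (a * b) \<odot> x = a \<odot> (b \<odot> x)"
  shows "module complex_ring M"
proof (rule moduleI[OF cring_complex_ring])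
  show "abelian_group M"
  proof (rule abelian_groupI)
    fix x assume x: "x \<in> carrier M"
    have "(-1) \<odot> x \<oplus> x = \<zero>"
      using distl[OF x, of "-1" 1] smult_one[OF x] smult_zero[OF x] by simp
    then show "\<exists>y\<in>carrier M. y \<oplus> x = \<zero>"
      using smult[OF x] by blast
  qed (use assms in auto)
qed (use assms in \<open>auto simp: complex_ring_def\<close>)

context inner_space
begin

text \<open>The module laws once more, now free of side conditions on
  \<open>carrier complex_ring\<close>; they are rederived by testing against all vectors.\<close>

lemma module_axioms_rules:
  "x \<in> carrier H \<Longrightarrow> 0 \<odot> x = \<zero>"
  "x \<in> carrier H \<Longrightarrow> 1 \<odot> x = x"
  "x \<in> carrier H \<Longrightarrow> (a + b) \<odot> x = a \<odot> x \<oplus> b \<odot> x"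
  "x \<in> carrier H \<Longrightarrow> y \<in> carrier H \<Longrightarrow> a \<odot> (x \<oplus> y) = a \<odot> x \<oplus> a \<odot> y"
  "x \<in> carrier H \<Longrightarrow> (a * b) \<odot> x = a \<odot> (b \<odot> x)"
  by (auto intro!: vec_eqI simp: algebra_simps)

section \<open>The antidual space and the Riesz-Berezansky operator\<close>

lemma antidual_simps [simp]:
  "\<zero>\<^bsub>antidual H\<^esub> = (\<lambda>_. 0)" "(\<phi> \<oplus>\<^bsub>antidual H\<^esub> \<psi>) = (\<lambda>x. \<phi> x + \<psi> x)"
  "c \<odot>\<^bsub>antidual H\<^esub> \<phi> = (\<lambda>x. c * \<phi> x)"
  by (auto simp: antidual_def)

lemma antidualI:
  assumes "\<And>x y. \<lbrakk>x \<in> carrier H; y \<in> carrier H\<rbrakk> \<Longrightarrow> \<phi> (x \<oplus> y) = \<phi> x + \<phi> y"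
    "\<And>c x. x \<in> carrier H \<Longrightarrow> \<phi> (c \<odot> x) = cnj c * \<phi> x"
    "\<And>x. x \<in> carrier H \<Longrightarrow> cmod (\<phi> x) \<le> C * hnorm H x"
    "\<And>x. x \<notin> carrier H \<Longrightarrow> \<phi> x = 0"
  shows "\<phi> \<in> carrier (antidual H)"
proof -
  have "\<exists>C. \<forall>x\<in>carrier H. cmod (\<phi> x) \<le> C * hnorm H x"
    using assms(3) by blast
  then show ?thesis
    using assms(1,2,4) by (simp add: antidual_def)
qed

lemma antidualD:
  assumes "\<phi> \<in> carrier (antidual H)"
  shows "\<lbrakk>x \<in> carrier H; y \<in> carrier H\<rbrakk> \<Longrightarrow> \<phi> (x \<oplus> y) = \<phi> x + \<phi> y"
    "x \<in> carrier H \<Longrightarrow> \<phi> (c \<odot> x) = cnj c * \<phi> x"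
    "x \<notin> carrier H \<Longrightarrow> \<phi> x = 0"
    "\<exists>C. \<forall>x\<in>carrier H. cmod (\<phi> x) \<le> C * hnorm H x"
  using assms by (auto simp: antidual_def)

lemma antidual_diffD:
  assumes "\<phi> \<in> carrier (antidual H)" "x \<in> carrier H" "y \<in> carrier H"
  shows "\<phi> (x \<ominus> y) = \<phi> x - \<phi> y"
  using assms antidualD(1)[OF assms(1), of x "(-1) \<odot> y"] antidualD(2)[OF assms(1), of y "-1"]
  by (simp add: diff_as_add)

lemma antidual_eqI:
  assumes "\<phi> \<in> carrier (antidual H)" "\<psi> \<in> carrier (antidual H)" "\<And>x. x \<in> carrier H \<Longrightarrow> \<phi> x = \<psi> x"
  shows "\<phi> = \<psi>"
  using assms antidualD(3) by (metis ext)

lemma antidual_add_in: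
  assumes "\<phi> \<in> carrier (antidual H)" "\<psi> \<in> carrier (antidual H)"
  shows "(\<lambda>x. \<phi> x + \<psi> x) \<in> carrier (antidual H)"
proof -
  obtain C D where "\<forall>x\<in>carrier H. cmod (\<phi> x) \<le> C * hnorm H x" "\<forall>x\<in>carrier H. cmod (\<psi> x) \<le> D * hnorm H x"
    using antidualD(4)[OF assms(1)] antidualD(4)[OF assms(2)] by blast
  then show ?thesis
    by (intro antidualI[where C="C + D"])
      (auto simp: antidualD[OF assms(1)] antidualD[OF assms(2)] algebra_simps
        intro!: norm_triangle_le add_mono)
qed

lemma antidual_smult_in:
  assumes "\<phi> \<in> carrier (antidual H)"
  shows "(\<lambda>x. c * \<phi> x) \<in> carrier (antidual H)"
proof -
  obtain C where "\<forall>x\<in>carrier H. cmod (\<phi> x) \<le> C * hnorm H x"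
    using antidualD(4)[OF assms(1)] by blast
  then have "cmod (c * \<phi> x) \<le> (cmod c * C) * hnorm H x" if "x \<in> carrier H" for x
    using that mult_left_mono[of "cmod (\<phi> x)" "C * hnorm H x" "cmod c"] by (simp add: norm_mult mult.assoc)
  then show ?thesis
    by (rule antidualI[rotated 2]) (simp_all add: antidualD[OF assms(1)] distrib_left)
qed

lemma antidual_module: "module complex_ring (antidual H)"
proof (rule module_complexI)
  show "\<zero>\<^bsub>antidual H\<^esub> \<in> carrier (antidual H)"
    by (simp, rule antidualI[where C=0]) auto
qed (auto intro: antidual_add_in antidual_smult_in simp: algebra_simps)

text \<open>Subtraction in the record is addition of a group inverse, which is only given by a
  description; it has to be identified with pointwise subtraction before impedance and model
  formulas can be evaluated.\<close>

lemma antidual_minus: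
  assumes "\<phi> \<in> carrier (antidual H)" "\<psi> \<in> carrier (antidual H)"
  shows "\<phi> \<ominus>\<^bsub>antidual H\<^esub> \<psi> = (\<lambda>x. \<phi> x - \<psi> x)"
proof -
  interpret N: module complex_ring "antidual H"
    by (rule antidual_module)
  have "(\<lambda>x. (-1) * \<psi> x) \<in> carrier (antidual H)"
    by (rule antidual_smult_in[OF assms(2)])
  then have "\<ominus>\<^bsub>antidual H\<^esub> \<psi> = (\<lambda>x. - \<psi> x)"
    using N.minus_equality[of "\<lambda>x. - \<psi> x" \<psi>] assms(2) by simp
  then show ?thesis
    by (simp add: a_minus_def)
qed

lemma cinner_antidual:
  assumes "g \<in> carrier H"
  shows "(\<lambda>f. if f \<in> carrier H then cinner H g f else 0) \<in> carrier (antidual H)"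
  using assms Cauchy_Schwarz[OF assms] by (intro antidualI[where C="hnorm H g"]) auto

end

context hilb
begin

text \<open>Elements of the antidual are conjugate-linear, so Riesz representation is applied to
  their conjugates.\<close>

lemma riesz_berezansky_ex1:
  assumes "\<phi> \<in> carrier (antidual H)"
  shows "\<exists>!h. h \<in> carrier H \<and> (\<forall>f\<in>carrier H. dual_pair f \<phi> = cinner H f h)"
proof -
  obtain C where C: "\<forall>x\<in>carrier H. cmod (\<phi> x) \<le> C * hnorm H x"
    using antidualD(4)[OF assms] by blast
  obtain h where h: "h \<in> carrier H" "\<And>f. f \<in> carrier H \<Longrightarrow> cnj (\<phi> f) = cinner H f h"
    by (rule riesz[of "\<lambda>f. cnj (\<phi> f)" C]) (use C antidualD(1,2)[OF assms] in auto)
  show ?thesis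
  proof (rule ex1I[of _ h])
    show "h \<in> carrier H \<and> (\<forall>f\<in>carrier H. dual_pair f \<phi> = cinner H f h)"
      using h by (simp add: dual_pair_def)
    fix h' assume h': "h' \<in> carrier H \<and> (\<forall>f\<in>carrier H. dual_pair f \<phi> = cinner H f h')"
    show "h' = h"
    proof (rule vec_eqI)
      fix w assume w: "w \<in> carrier H"
      then have "cinner H w h' = cinner H w h"
        using h h' by (simp add: dual_pair_def)
      then show "cinner H h' w = cinner H h w"
        using w h(1) h' cinner_commute[of w h'] cinner_commute[of w h] by simp
    qed (use h h' in auto)
  qed
qed

lemma riesz_berezansky:
  assumes "\<phi> \<in> carrier (antidual H)"
  shows "riesz_berezansky H \<phi> \<in> carrier H"
    "f \<in> carrier H \<Longrightarrow> cnj (\<phi> f) = cinner H f (riesz_berezansky H \<phi>)"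
  using theI'[OF riesz_berezansky_ex1[OF assms]] unfolding riesz_berezansky_def[symmetric]
  by (auto simp: dual_pair_def)

lemma riesz_berezansky_eqI:
  assumes "\<phi> \<in> carrier (antidual H)" "h \<in> carrier H" "\<And>f. f \<in> carrier H \<Longrightarrow> cnj (\<phi> f) = cinner H f h"
  shows "riesz_berezansky H \<phi> = h"
  using riesz_berezansky_ex1[OF assms(1)] riesz_berezansky[OF assms(1)] assms(2,3)
  by (metis dual_pair_def)

text \<open>Injectivity of the Riesz-Berezansky operator makes the \<open>inv_into\<close> in
  \<open>riesz_inv\<close> a genuine inverse. The vectors of the model that are written with it
  become explicit functionals on H_+.\<close>

lemma riesz_inv_eq:
  assumes g: "g \<in> carrier H"
  shows "riesz_inv H g = (\<lambda>f. if f \<in> carrier H then cinner H g f else 0)" (is "_ = ?\<phi>")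
proof -
  have \<phi>: "?\<phi> \<in> carrier (antidual H)"
    by (rule cinner_antidual[OF g])
  have rb: "riesz_berezansky H ?\<phi> = g"
    by (rule riesz_berezansky_eqI[OF \<phi> g]) (simp add: cinner_commute[OF g])
  have "inj_on (riesz_berezansky H) (carrier (antidual H))"
  proof (rule inj_onI)
    fix \<psi> \<theta> assume a: "\<psi> \<in> carrier (antidual H)" "\<theta> \<in> carrier (antidual H)"
      "riesz_berezansky H \<psi> = riesz_berezansky H \<theta>"
    show "\<psi> = \<theta>"
    proof (rule antidual_eqI[OF a(1,2)])
      fix x assume "x \<in> carrier H"
      then have "cnj (\<psi> x) = cnj (\<theta> x)"
        using riesz_berezansky(2)[OF a(1)] riesz_berezansky(2)[OF a(2)] a(3) by simp
      then show "\<psi> x = \<theta> x" by simp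
    qed
  qed
  then have "inv_into (carrier (antidual H)) (riesz_berezansky H) (riesz_berezansky H ?\<phi>) = ?\<phi>"
    using \<phi> by (rule inv_into_f_f)
  then show ?thesis
    unfolding riesz_inv_def rb .
qed

end

text \<open>Serves to pass from the graph norm to its two components, and between two spaces in
  which the same combinations have equal distances.\<close>

lemma hCauchy_mono:
  assumes "hCauchy K x" "\<And>n. y n \<in> carrier H"
    "\<And>m n. hnorm H (y m \<ominus>\<^bsub>H\<^esub> y n) \<le> hnorm K (x m \<ominus>\<^bsub>K\<^esub> x n)"
  shows "hCauchy H y"
  unfolding hCauchy_def
proof (intro conjI allI impI assms(2))
  fix e :: real assume "e > 0"
  then obtain N where "\<forall>m n. N \<le> m \<longrightarrow> N \<le> n \<longrightarrow> hnorm K (x m \<ominus>\<^bsub>K\<^esub> x n) < e"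
    using assms(1) unfolding hCauchy_def by blast
  then show "\<exists>N. \<forall>m n. N \<le> m \<longrightarrow> N \<le> n \<longrightarrow> hnorm H (y m \<ominus>\<^bsub>H\<^esub> y n) < e"
    using assms(3) by (meson le_less_trans)
qed

section \<open>The Hilbert space H_+ with the graph inner product of the adjoint\<close>

locale rigged = hilb +
  fixes S :: "'a rel"
  assumes lin: "linear_op H S" and dense: "densely_defined H S"
begin

abbreviation "P \<equiv> H_plus H S"
abbreviation "Sa \<equiv> adjoint_op H S"
abbreviation "st \<equiv> op_app (adjoint_op H S)"

lemma S_sub: "S \<subseteq> carrier H \<times> carrier H"
  using lin by (simp add: linear_op_def)

lemma single_Sa: "single_valued Sa"
  by (rule adjoint_single_valued[OF dense S_sub])

lemma st_eq: "(f, g) \<in> Sa \<Longrightarrow> st f = g"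
  by (rule op_app_eq[OF single_Sa])

lemma P_simps [simp]: "carrier P = Domain Sa" "\<zero>\<^bsub>P\<^esub> = \<zero>" "x \<oplus>\<^bsub>P\<^esub> y = x \<oplus> y" "c \<odot>\<^bsub>P\<^esub> x = c \<odot> x"
  "cinner P x y = cinner H x y + cinner H (st x) (st y)"
  by (auto simp: H_plus_def)

lemma st_graph: "f \<in> Domain Sa \<Longrightarrow> (f, st f) \<in> Sa"
  using st_eq by auto

lemma D_in: "f \<in> Domain Sa \<Longrightarrow> f \<in> carrier H" "f \<in> Domain Sa \<Longrightarrow> st f \<in> carrier H"
  using adjoint_opD(1,2)[OF st_graph] by auto

lemma D_add: "\<lbrakk>f \<in> Domain Sa; g \<in> Domain Sa\<rbrakk> \<Longrightarrow> f \<oplus> g \<in> Domain Sa"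
  and st_add: "\<lbrakk>f \<in> Domain Sa; g \<in> Domain Sa\<rbrakk> \<Longrightarrow> st (f \<oplus> g) = st f \<oplus> st g"
  using adjoint_op_add[OF S_sub st_graph st_graph, of f g] st_eq by auto

lemma D_smult: "f \<in> Domain Sa \<Longrightarrow> c \<odot> f \<in> Domain Sa"
  and st_smult: "f \<in> Domain Sa \<Longrightarrow> st (c \<odot> f) = c \<odot> st f"
  using adjoint_op_smult[OF S_sub st_graph, of f c] st_eq by auto

lemma D_zero: "\<zero> \<in> Domain Sa"
proof -
  have "(\<zero>, \<zero>) \<in> Sa"
    using S_sub by (intro adjoint_opI) auto
  then show ?thesis by blast
qed

lemma D_diff: "\<lbrakk>f \<in> Domain Sa; g \<in> Domain Sa\<rbrakk> \<Longrightarrow> f \<ominus> g \<in> Domain Sa"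
  and st_diff: "\<lbrakk>f \<in> Domain Sa; g \<in> Domain Sa\<rbrakk> \<Longrightarrow> st (f \<ominus> g) = st f \<ominus> st g"
  using adjoint_op_diff[OF S_sub st_graph st_graph, of f g] st_eq by auto

sublocale P: inner_space P
proof (rule inner_space.intro)
  show "module complex_ring P"
    by (rule module_complexI)
      (simp_all add: D_zero D_in D_add D_smult module_axioms_rules a_assoc a_comm a_lcomm)
  fix x y z c
  show "x \<in> carrier P \<Longrightarrow> y \<in> carrier P \<Longrightarrow> z \<in> carrier P \<Longrightarrow>
      cinner P (x \<oplus>\<^bsub>P\<^esub> y) z = cinner P x z + cinner P y z"
    using D_in by (simp add: st_add)
  show "x \<in> carrier P \<Longrightarrow> y \<in> carrier P \<Longrightarrow> cinner P (c \<odot>\<^bsub>P\<^esub> x) y = c * cinner P x y"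
    using D_in by (simp add: st_smult algebra_simps)
  show "x \<in> carrier P \<Longrightarrow> y \<in> carrier P \<Longrightarrow> cinner P y x = cnj (cinner P x y)"
    using D_in cinner_commute[of x y] cinner_commute[of "st x" "st y"] by simp
  show "0 < Re (cinner P x x)" if "x \<in> carrier P" "x \<noteq> \<zero>\<^bsub>P\<^esub>"
  proof -
    have "0 < Re (cinner H x x)" "0 \<le> Re (cinner H (st x) (st x))"
      using that D_in cinner_pos[of x] hnorm_sq[of "st x"] zero_le_power2[of "hnorm H (st x)"] by auto
    then show ?thesis by simp
  qed
qed

lemma P_minus: "\<lbrakk>f \<in> Domain Sa; g \<in> Domain Sa\<rbrakk> \<Longrightarrow> f \<ominus>\<^bsub>P\<^esub> g = f \<ominus> g"
  using P.diff_as_add[of f g] diff_as_add[of f g] D_in by simp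

lemma hnorm_P_sq: "f \<in> Domain Sa \<Longrightarrow> (hnorm P f)\<^sup>2 = (hnorm H f)\<^sup>2 + (hnorm H (st f))\<^sup>2"
  using P.hnorm_sq[of f] hnorm_sq[of f] hnorm_sq[of "st f"] D_in by simp

lemma hnorm_le_P: "f \<in> Domain Sa \<Longrightarrow> hnorm H f \<le> hnorm P f"
  "f \<in> Domain Sa \<Longrightarrow> hnorm H (st f) \<le> hnorm P f"
proof -
  assume f: "f \<in> Domain Sa"
  show "hnorm H f \<le> hnorm P f" "hnorm H (st f) \<le> hnorm P f"
    by (rule power2_le_imp_le; use f hnorm_P_sq[OF f] P.hnorm_nonneg[of f] in simp)+
qed

text \<open>Completeness in the graph norm is closedness of the adjoint: a Cauchy sequence splits
  into one of vectors and one of images, and \<open>adjoint_op_hlim\<close> keeps the pair of limits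
  in the graph.\<close>

sublocale P: hilb P
proof (intro hilb.intro P.inner_space_axioms hilb_axioms.intro)
  fix x assume x: "hCauchy P x"
  then have D: "x n \<in> Domain Sa" for n
    by (simp add: hCauchy_def)
  have le: "hnorm H (x m \<ominus> x n) \<le> hnorm P (x m \<ominus>\<^bsub>P\<^esub> x n)"
    "hnorm H (st (x m) \<ominus> st (x n)) \<le> hnorm P (x m \<ominus>\<^bsub>P\<^esub> x n)" for m n
    using hnorm_le_P[OF D_diff[OF D D], of m n] st_diff[OF D D, of m n] P_minus[OF D D] by auto
  have "hCauchy H x" "hCauchy H (\<lambda>n. st (x n))"
    by (rule hCauchy_mono[OF x]; use le D_in[OF D] in simp)+
  then obtain f g where f: "hlim H x f" and g: "hlim H (\<lambda>n. st (x n)) g"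
    using hCauchy_hlim by meson
  have fg: "(f, g) \<in> Sa"
    by (rule adjoint_op_hlim[OF S_sub st_graph[OF D] f g])
  have fD: "f \<in> Domain Sa" using fg by auto
  have "hlim P x f"
    unfolding hlim_def
  proof (intro conjI allI)
    have "(\<lambda>n. sqrt ((hnorm H (x n \<ominus> f))\<^sup>2 + (hnorm H (st (x n) \<ominus> g))\<^sup>2)) \<longlonglongrightarrow> sqrt (0\<^sup>2 + 0\<^sup>2)"
      using f g unfolding hlim_def by (intro tendsto_intros) auto
    moreover have "hnorm P (x n \<ominus>\<^bsub>P\<^esub> f) = sqrt ((hnorm H (x n \<ominus> f))\<^sup>2 + (hnorm H (st (x n) \<ominus> g))\<^sup>2)" for n
    proof -
      have "(hnorm P (x n \<ominus> f))\<^sup>2 = (hnorm H (x n \<ominus> f))\<^sup>2 + (hnorm H (st (x n) \<ominus> g))\<^sup>2"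
        using hnorm_P_sq[OF D_diff[OF D fD], of n] unfolding st_diff[OF D fD, of n] st_eq[OF fg] .
      moreover have "0 \<le> hnorm P (x n \<ominus> f)"
        using P.hnorm_nonneg[of "x n \<ominus> f"] D_diff[OF D fD, of n] by simp
      ultimately show ?thesis
        unfolding P_minus[OF D fD] by (metis real_sqrt_unique)
    qed
    ultimately show "(\<lambda>n. hnorm P (x n \<ominus>\<^bsub>P\<^esub> f)) \<longlonglongrightarrow> 0"
      by simp
  qed (use D fD in auto)
  then show "\<exists>l. hlim P x l" by blast
qed

lemma embed_minus_in: "g \<in> carrier H \<Longrightarrow> embed_minus H S g \<in> carrier (H_minus H S)"
  unfolding H_minus_def
proof (rule P.antidualI[where C="hnorm H g"])
  fix f assume g: "g \<in> carrier H" and "f \<in> carrier P"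
  then have f: "f \<in> Domain Sa" by simp
  have "cmod (cinner H g f) \<le> hnorm H g * hnorm H f"
    by (rule Cauchy_Schwarz[OF g D_in(1)[OF f]])
  also have "\<dots> \<le> hnorm H g * hnorm P f"
    using hnorm_le_P(1)[OF f] g by (intro mult_left_mono) auto
  finally show "cmod (embed_minus H S g f) \<le> hnorm H g * hnorm P f"
    using f by (simp add: embed_minus_def)
qed (auto simp: embed_minus_def D_in D_add D_smult simp del: Domain_iff)

end

section \<open>Unitary equivalence of gamma fields\<close>

text \<open>Combinations are coded by lists of (coefficient, point) so that one code can be
  evaluated in two spaces. Concatenating and rescaling codes give sums and scalar multiples.\<close>

fun comb :: "'a hilbert \<Rightarrow> (complex \<Rightarrow> 'a) \<Rightarrow> (complex \<times> complex) list \<Rightarrow> 'a" where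
  "comb H \<gamma> [] = \<zero>\<^bsub>H\<^esub>"
| "comb H \<gamma> (p # ps) = fst p \<odot>\<^bsub>H\<^esub> \<gamma> (snd p) \<oplus>\<^bsub>H\<^esub> comb H \<gamma> ps"

definition nonreal :: "(complex \<times> complex) list \<Rightarrow> bool"
  where "nonreal ps \<longleftrightarrow> (\<forall>p\<in>set ps. Im (snd p) \<noteq> 0)"

lemma nonreal_simps [simp]:
  "nonreal []" "nonreal (p # ps) \<longleftrightarrow> Im (snd p) \<noteq> 0 \<and> nonreal ps"
  "nonreal (ps @ qs) \<longleftrightarrow> nonreal ps \<and> nonreal qs"
  "nonreal (map (\<lambda>p. (c * fst p, snd p)) ps) \<longleftrightarrow> nonreal ps"
  by (auto simp: nonreal_def)

text \<open>\<open>\<gamma> z\<close> spans the defect space at \<open>z\<close>, and \<open>V\<close> is the associated Q-function. If \<open>\<gamma>\<close> is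
  total, then \<open>V\<close> determines the pair \<open>(B, \<gamma>)\<close> up to unitary equivalence.\<close>

locale defect_field = hilb +
  fixes B :: "'a rel" and \<gamma> :: "complex \<Rightarrow> 'a" and V :: "complex \<Rightarrow> complex"
  assumes B_lin: "linear_op H B" and B_sym: "symmetric_op H B"
    and B_range: "\<lbrakk>Im z \<noteq> 0; h \<in> carrier H\<rbrakk> \<Longrightarrow> \<exists>f. (f, h \<oplus> z \<odot> f) \<in> B"
    and \<gamma>_in [simp]: "Im z \<noteq> 0 \<Longrightarrow> \<gamma> z \<in> carrier H"
    and \<gamma>_B: "\<lbrakk>Im z \<noteq> 0; Im w \<noteq> 0\<rbrakk> \<Longrightarrow> (\<gamma> z \<ominus> \<gamma> w, z \<odot> \<gamma> z \<ominus> w \<odot> \<gamma> w) \<in> B"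
    and \<gamma>_inner: "\<lbrakk>Im z \<noteq> 0; Im w \<noteq> 0\<rbrakk> \<Longrightarrow> (z - cnj w) * cinner H (\<gamma> z) (\<gamma> w) = V z - cnj (V w)"
begin

lemma B_in: "(f, g) \<in> B \<Longrightarrow> f \<in> carrier H" "(f, g) \<in> B \<Longrightarrow> g \<in> carrier H"
  using linear_op_in[OF B_lin] by auto

text \<open>The difference \<open>\<gamma> z - \<gamma> w\<close> solves
  \<open>(B - z) f = (z - w) \<gamma> w\<close>, to which the resolvent bound applies.\<close>

lemma \<gamma>_Lipschitz:
  assumes z: "Im z \<noteq> 0" and w: "Im w \<noteq> 0"
  shows "\<bar>Im z\<bar> * hnorm H (\<gamma> z \<ominus> \<gamma> w) \<le> cmod (z - w) * hnorm H (\<gamma> w)"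
proof -
  have "(z \<odot> \<gamma> z \<ominus> w \<odot> \<gamma> w) \<ominus> z \<odot> (\<gamma> z \<ominus> \<gamma> w) = (z - w) \<odot> \<gamma> w"
    using z w by (intro vec_eqI) (auto simp: algebra_simps)
  then show ?thesis
    using symmetric_resolvent_bound[OF B_lin B_sym \<gamma>_B[OF z w], of z] w by simp
qed

text \<open>Approximates \<open>w\<close> by points different from it. Stretching away from 0 only
  enlarges the imaginary part, so the points stay off the real axis and the factor on the left of
  \<open>\<gamma>_Lipschitz\<close> does not degenerate.\<close>

definition near :: "complex \<Rightarrow> nat \<Rightarrow> complex"
  where "near w n = of_real (1 + 1 / Suc n) * w"

lemma Im_of_real_mult: "Im (of_real r * w) = r * Im w"
  by simp

lemma near: assumes "Im w \<noteq> 0" shows "Im (near w n) \<noteq> 0" "near w n \<noteq> w" "near w \<longlonglongrightarrow> w"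
proof -
  have "1 + 1 / real (Suc n) > 1" for n
    by simp
  then have *: "1 + 1 / real (Suc n) \<noteq> 0" "1 + 1 / real (Suc n) \<noteq> 1" for n
    by (smt (verit))+
  have "Im (near w n) = (1 + 1 / Suc n) * Im w"
    unfolding near_def by (rule Im_of_real_mult)
  then show "Im (near w n) \<noteq> 0"
    using * assms by (metis mult_eq_0_iff)
  show "near w n \<noteq> w"
    using * assms unfolding near_def by (metis mult_cancel_right1 of_real_eq_1_iff zero_complex.sel(2))
  have "(\<lambda>n. of_real (1 + 1 / Suc n) * w) \<longlonglongrightarrow> of_real (1 + 0) * w"
    by (intro tendsto_intros LIMSEQ_Suc[OF lim_1_over_n])
  then show "near w \<longlonglongrightarrow> w"
    unfolding near_def[abs_def] by simp
qed

lemma hlim_near: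
  assumes w: "Im w \<noteq> 0"
  shows "hlim H (\<lambda>n. \<gamma> (near w n)) (\<gamma> w)"
proof (rule hlim_squeeze)
  show "\<gamma> (near w n) \<in> carrier H" "\<gamma> w \<in> carrier H" for n
    using near w by auto
  show "hnorm H (\<gamma> (near w n) \<ominus> \<gamma> w) \<le> cmod (near w n - w) * hnorm H (\<gamma> w) / \<bar>Im w\<bar>" for n
  proof -
    have "Im (near w n) = (1 + 1 / Suc n) * Im w"
      unfolding near_def by (rule Im_of_real_mult)
    then have "\<bar>Im w\<bar> \<le> \<bar>Im (near w n)\<bar>"
      by (simp add: abs_mult mult_le_cancel_right1)
    then have "\<bar>Im w\<bar> * hnorm H (\<gamma> (near w n) \<ominus> \<gamma> w) \<le> \<bar>Im (near w n)\<bar> * hnorm H (\<gamma> (near w n) \<ominus> \<gamma> w)"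
      using near[OF w] w by (intro mult_right_mono) auto
    also have "\<dots> \<le> cmod (near w n - w) * hnorm H (\<gamma> w)"
      using near[OF w] w by (intro \<gamma>_Lipschitz)
    finally show ?thesis
      using w by (simp add: field_simps)
  qed
  have "(\<lambda>n. cmod (near w n - w) * hnorm H (\<gamma> w) / \<bar>Im w\<bar>) \<longlonglongrightarrow> cmod (w - w) * hnorm H (\<gamma> w) / \<bar>Im w\<bar>"
    using w by (intro tendsto_intros near) auto
  then show "(\<lambda>n. cmod (near w n - w) * hnorm H (\<gamma> w) / \<bar>Im w\<bar>) \<longlonglongrightarrow> 0"
    by simp
qed

text \<open>The vectors orthogonal to all \<open>\<gamma> w\<close> are invariant under the
  resolvent of \<open>B\<close>: symmetry against the pair belonging to \<open>cnj z\<close> and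
  \<open>w\<close> gives \<open>(z - cnj w) (f, \<gamma> w) = 0\<close>. The excluded point
  \<open>w = cnj z\<close> follows by continuity along \<open>near\<close>.\<close>

lemma resolvent_orthogonal:
  assumes fg: "(f, g) \<in> B" and z: "Im z \<noteq> 0"
    and orth: "\<And>w. Im w \<noteq> 0 \<Longrightarrow> cinner H (g \<ominus> z \<odot> f) (\<gamma> w) = 0" and w: "Im w \<noteq> 0"
  shows "cinner H f (\<gamma> w) = 0"
proof -
  have c: "f \<in> carrier H" "g \<in> carrier H"
    using B_in fg by auto
  have main: "cinner H f (\<gamma> w) = 0" if w: "Im w \<noteq> 0" "w \<noteq> cnj z" for w
  proof -
    have z': "Im (cnj z) \<noteq> 0" using z by simp
    have "cinner H g (\<gamma> (cnj z) \<ominus> \<gamma> w) = cinner H f (cnj z \<odot> \<gamma> (cnj z) \<ominus> w \<odot> \<gamma> w)"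
      by (rule symmetric_opD[OF B_sym fg \<gamma>_B[OF z' w(1)]])
    then have "cinner H (g \<ominus> z \<odot> f) (\<gamma> (cnj z)) - cinner H (g \<ominus> z \<odot> f) (\<gamma> w) = (z - cnj w) * cinner H f (\<gamma> w)"
      using c w z' by (simp add: algebra_simps)
    then have "(z - cnj w) * cinner H f (\<gamma> w) = 0"
      by (simp only: orth[OF z'] orth[OF w(1)] diff_self)
    moreover have "z - cnj w \<noteq> 0"
      using w(2) by (metis complex_cnj_cnj right_minus_eq)
    ultimately show ?thesis by simp
  qed
  show ?thesis
  proof (cases "w = cnj z")
    case True
    have "(\<lambda>n. cinner H f (\<gamma> (near w n))) \<longlonglongrightarrow> cinner H f (\<gamma> w)"
      by (rule hlim_cinner_right[OF hlim_near[OF w] c(1)])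
    moreover have "cinner H f (\<gamma> (near w n)) = 0" for n
      using main near[OF w] True by simp
    ultimately show ?thesis
      by (simp add: LIMSEQ_const_iff)
  qed (use main w in auto)
qed

end

locale gamma_field = defect_field +
  assumes total: "\<lbrakk>h \<in> carrier H; \<And>z. Im z \<noteq> 0 \<Longrightarrow> cinner H h (\<gamma> z) = 0\<rbrakk> \<Longrightarrow> h = \<zero>"
begin

text \<open>Totality survives the loss of one point by continuity. \<open>intertwine\<close> needs
  this for \<open>-\<i>\<close>, where the resolvent identity at \<i> carries the factor 0.\<close>

lemma total_except:
  assumes h: "h \<in> carrier H" and orth: "\<And>z. \<lbrakk>Im z \<noteq> 0; z \<noteq> w\<rbrakk> \<Longrightarrow> cinner H h (\<gamma> z) = 0"
  shows "h = \<zero>"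
proof (rule total[OF h])
  fix z assume z: "Im z \<noteq> 0"
  show "cinner H h (\<gamma> z) = 0"
  proof (cases "z = w")
    case True
    have "(\<lambda>n. cinner H h (\<gamma> (near z n))) \<longlonglongrightarrow> cinner H h (\<gamma> z)"
      by (rule hlim_cinner_right[OF hlim_near[OF z] h])
    moreover have "cinner H h (\<gamma> (near z n)) = 0" for n
      using orth near[OF z] True by simp
    ultimately show ?thesis
      by (simp add: LIMSEQ_const_iff)
  qed (use orth z in auto)
qed

lemma comb_in [simp]: "nonreal ps \<Longrightarrow> comb H \<gamma> ps \<in> carrier H"
  by (induction ps) auto

lemma comb_append: "\<lbrakk>nonreal ps; nonreal qs\<rbrakk> \<Longrightarrow> comb H \<gamma> (ps @ qs) = comb H \<gamma> ps \<oplus> comb H \<gamma> qs"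
  by (induction ps) (auto simp: a_assoc)

lemma comb_smult: "nonreal ps \<Longrightarrow> comb H \<gamma> (map (\<lambda>p. (c * fst p, snd p)) ps) = c \<odot> comb H \<gamma> ps"
proof (induction ps)
  case Nil
  then show ?case by (auto intro: vec_eqI)
next
  case (Cons p ps)
  then show ?case
    by (auto simp: module_axioms_rules)
qed

text \<open>The vectors that can be approximated form a closed subspace \<open>M\<close>; what the
  projection onto \<open>M\<close> leaves over is orthogonal to every \<open>\<gamma> z\<close> and
  therefore zero.\<close>

lemma comb_dense:
  assumes h: "h \<in> carrier H" and e: "e > 0"
  shows "\<exists>ps. nonreal ps \<and> hnorm H (h \<ominus> comb H \<gamma> ps) < e"
proof -
  define M where "M = {h \<in> carrier H. \<forall>e>0. \<exists>ps. nonreal ps \<and> hnorm H (h \<ominus> comb H \<gamma> ps) < e}"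
  have comb_M: "comb H \<gamma> ps \<in> M" if "nonreal ps" for ps
    using that unfolding M_def by (auto intro!: exI[of _ ps])
  have sub: "hsub H M"
    unfolding hsub_def
  proof (intro conjI ballI allI)
    show "M \<subseteq> carrier H"
      by (auto simp: M_def)
    show "\<zero> \<in> M"
      using comb_M[of "[]"] by simp
  next
    fix x y assume x: "x \<in> M" and y: "y \<in> M"
    show "x \<oplus> y \<in> M"
      unfolding M_def
    proof (intro CollectI conjI allI impI)
      fix e :: real assume "e > 0"
      then obtain ps qs where p: "nonreal ps" "hnorm H (x \<ominus> comb H \<gamma> ps) < e / 2"
        and q: "nonreal qs" "hnorm H (y \<ominus> comb H \<gamma> qs) < e / 2"
        using x y half_gt_zero[of e] unfolding M_def by blast
      have "(x \<oplus> y) \<ominus> comb H \<gamma> (ps @ qs) = (x \<ominus> comb H \<gamma> ps) \<oplus> (y \<ominus> comb H \<gamma> qs)"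
        using x y p q by (intro vec_eqI) (auto simp: M_def comb_append)
      moreover have "hnorm H ((x \<ominus> comb H \<gamma> ps) \<oplus> (y \<ominus> comb H \<gamma> qs)) < e"
        using hnorm_triangle[of "x \<ominus> comb H \<gamma> ps" "y \<ominus> comb H \<gamma> qs"] x y p q by (simp add: M_def)
      ultimately show "\<exists>ps. nonreal ps \<and> hnorm H ((x \<oplus> y) \<ominus> comb H \<gamma> ps) < e"
        using p q by (intro exI[of _ "ps @ qs"]) simp
    qed (use x y in \<open>auto simp: M_def\<close>)
  next
    fix c x assume x: "x \<in> M"
    show "c \<odot> x \<in> M"
      unfolding M_def
    proof (intro CollectI conjI allI impI)
      fix e :: real assume e: "e > 0"
      then have "e / (1 + cmod c) > 0"
        by (simp add: add_pos_nonneg)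
      then obtain ps where p: "nonreal ps" "hnorm H (x \<ominus> comb H \<gamma> ps) < e / (1 + cmod c)"
        using x unfolding M_def by blast
      have "c \<odot> x \<ominus> comb H \<gamma> (map (\<lambda>p. (c * fst p, snd p)) ps) = c \<odot> (x \<ominus> comb H \<gamma> ps)"
        unfolding comb_smult[OF p(1)] using x p(1)
        by (intro vec_eqI) (auto simp: M_def algebra_simps)
      moreover have "cmod c * hnorm H (x \<ominus> comb H \<gamma> ps) < e"
      proof -
        have "cmod c * hnorm H (x \<ominus> comb H \<gamma> ps) \<le> cmod c * (e / (1 + cmod c))"
          using p by (intro mult_left_mono) auto
        also have "\<dots> < e"
          using e by (simp add: divide_less_eq add_pos_nonneg field_simps)
        finally show ?thesis .
      qed
      ultimately show "\<exists>ps. nonreal ps \<and> hnorm H (c \<odot> x \<ominus> comb H \<gamma> ps) < e"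
        using p x by (intro exI[of _ "map (\<lambda>p. (c * fst p, snd p)) ps"]) (simp add: M_def)
    qed (use x in \<open>auto simp: M_def\<close>)
  qed
  have closed: "seq_closed H M"
    unfolding seq_closed_def
  proof (intro allI impI)
    fix x l assume x: "\<forall>n. x n \<in> M" and l: "hlim H x l"
    note c = hlim_in[OF l]
    show "l \<in> M"
      unfolding M_def
    proof (intro CollectI conjI allI impI c)
      fix e :: real assume "e > 0"
      then have e2: "e / 2 > 0" by simp
      have "\<forall>\<^sub>F n in sequentially. hnorm H (x n \<ominus> l) < e / 2"
        using l e2 unfolding hlim_def by (metis order_tendstoD(2))
      then obtain n where n: "hnorm H (x n \<ominus> l) < e / 2"
        unfolding eventually_sequentially by blast
      obtain ps where p: "nonreal ps" "hnorm H (x n \<ominus> comb H \<gamma> ps) < e / 2"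
        using x e2 unfolding M_def by blast
      have "hnorm H (l \<ominus> comb H \<gamma> ps) < e"
        using hnorm_diff_triangle[of l "x n" "comb H \<gamma> ps"] hnorm_diff_commute[of l "x n"] n p c by simp
      then show "\<exists>ps. nonreal ps \<and> hnorm H (l \<ominus> comb H \<gamma> ps) < e"
        using p by blast
    qed
  qed
  obtain m where m: "m \<in> M" "\<And>w. w \<in> M \<Longrightarrow> cinner H (h \<ominus> m) w = 0"
    using projection[OF sub closed h] by blast
  have mc: "m \<in> carrier H"
    using m by (simp add: M_def)
  have "h \<ominus> m = \<zero>"
  proof (rule total)
    fix z assume z: "Im z \<noteq> 0"
    have "comb H \<gamma> [(1, z)] \<in> M"
      using z by (intro comb_M) simp
    then have "\<gamma> z \<in> M"
      using z by (simp add: module_axioms_rules)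
    then show "cinner H (h \<ominus> m) (\<gamma> z) = 0"
      by (rule m(2))
  qed (use h mc in auto)
  then have "h \<in> M"
    using m(1) h mc by (simp add: minus_eq_zero_iff)
  then show ?thesis
    using e by (simp add: M_def)
qed

lemma comb_hlim:
  assumes h: "h \<in> carrier H"
  shows "\<exists>ps. (\<forall>n. nonreal (ps n)) \<and> hlim H (\<lambda>n. comb H \<gamma> (ps n)) h"
proof -
  have "\<forall>n. \<exists>ps. nonreal ps \<and> hnorm H (h \<ominus> comb H \<gamma> ps) < 1 / Suc n"
    using comb_dense[OF h] by simp
  then obtain ps where ps: "\<And>n. nonreal (ps n)" "\<And>n. hnorm H (h \<ominus> comb H \<gamma> (ps n)) < 1 / Suc n"
    by metis
  have "hlim H (\<lambda>n. comb H \<gamma> (ps n)) h"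
  proof (rule hlim_squeeze)
    show "hnorm H (comb H \<gamma> (ps n) \<ominus> h) \<le> 1 / Suc n" for n
      using ps(2)[of n] hnorm_diff_commute[of h "comb H \<gamma> (ps n)"] ps(1) h by simp
    show "(\<lambda>n. 1 / real (Suc n)) \<longlonglongrightarrow> 0"
      by (rule LIMSEQ_Suc[OF lim_1_over_n])
  qed (use ps h in auto)
  then show ?thesis
    using ps by blast
qed

text \<open>Symmetry of \<open>B\<close> between the given pair and the pair belonging to
  \<open>-\<i>\<close> and \<open>w\<close>. It expresses \<open>(f, \<gamma> w)\<close> through
  \<open>(B - \<i>) f\<close> alone, so inner products with defect vectors determine the
  resolvent.\<close>

lemma cinner_resolvent_\<gamma>:
  assumes fg: "(f, g) \<in> B" and w: "Im w \<noteq> 0"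
  shows "cinner H (g \<ominus> \<i> \<odot> f) (\<gamma> (-\<i>) \<ominus> \<gamma> w) = - cnj (w + \<i>) * cinner H f (\<gamma> w)"
proof -
  have c: "f \<in> carrier H" "g \<in> carrier H" "\<gamma> w \<in> carrier H" "\<gamma> (-\<i>) \<in> carrier H"
    using B_in fg w by auto
  have "cinner H g (\<gamma> (-\<i>) \<ominus> \<gamma> w) = cinner H f ((-\<i>) \<odot> \<gamma> (-\<i>) \<ominus> w \<odot> \<gamma> w)"
    using symmetric_opD[OF B_sym fg \<gamma>_B, of "-\<i>" w] w by simp
  then show ?thesis
    using c by (simp add: algebra_simps)
qed

text \<open>Von Neumann's decomposition with \<open>B\<close> in place of one defect space. For
  \<open>(f, k)\<close> in the adjoint, solving \<open>(B - \<i>) f0 = k - \<i> f\<close> leaves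
  \<open>u = f - f0\<close> in the eigenspace at \<i>. This eigenspace is spanned by
  \<open>\<gamma> \<i>\<close>, because every vector orthogonal to \<open>\<gamma> \<i>\<close> is
  in the range of \<open>S + \<i>\<close> and hence orthogonal to \<open>u\<close>.\<close>

lemma adjoint_restriction:
  assumes S: "S = {(f, g) \<in> B. cinner H (g \<oplus> \<i> \<odot> f) (\<gamma> \<i>) = 0}"
  shows "adjoint_op H S = {(f \<oplus> c \<odot> \<gamma> \<i>, g \<oplus> (\<i> * c) \<odot> \<gamma> \<i>) | f g c. (f, g) \<in> B}"
proof (intro equalityI subsetI)
  fix p assume "p \<in> {(f \<oplus> c \<odot> \<gamma> \<i>, g \<oplus> (\<i> * c) \<odot> \<gamma> \<i>) | f g c. (f, g) \<in> B}"
  then obtain f g c where p: "p = (f \<oplus> c \<odot> \<gamma> \<i>, g \<oplus> (\<i> * c) \<odot> \<gamma> \<i>)" and fg: "(f, g) \<in> B"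
    by auto
  have c: "f \<in> carrier H" "g \<in> carrier H" "\<gamma> \<i> \<in> carrier H"
    using B_in fg by auto
  show "p \<in> adjoint_op H S"
    unfolding p
  proof (rule adjoint_opI)
    fix u v assume "(u, v) \<in> S"
    then have uv: "(u, v) \<in> B" and 0: "cinner H (v \<oplus> \<i> \<odot> u) (\<gamma> \<i>) = 0"
      by (auto simp: S)
    have uvc: "u \<in> carrier H" "v \<in> carrier H"
      using B_in uv by auto
    have "cinner H v (\<gamma> \<i>) = - \<i> * cinner H u (\<gamma> \<i>)"
      using 0 uvc c by (simp add: eq_neg_iff_add_eq_0)
    then show "cinner H v (f \<oplus> c \<odot> \<gamma> \<i>) = cinner H u (g \<oplus> (\<i> * c) \<odot> \<gamma> \<i>)"
      using symmetric_opD[OF B_sym uv fg] uvc c by simp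
  qed (use c in auto)
next
  fix p assume "p \<in> adjoint_op H S"
  then obtain f k where p: "p = (f, k)" and fk: "(f, k) \<in> adjoint_op H S"
    by (cases p) auto
  have c: "f \<in> carrier H" "k \<in> carrier H" "\<gamma> \<i> \<in> carrier H"
    using adjoint_opD[OF fk] by auto
  have Sc: "S \<subseteq> carrier H \<times> carrier H"
    using B_in by (auto simp: S)
  have BS: "B \<subseteq> adjoint_op H S"
    using B_sym adjoint_op_antimono[of S B] unfolding symmetric_op_def S by blast
  obtain f0 where f0: "(f0, (k \<ominus> \<i> \<odot> f) \<oplus> \<i> \<odot> f0) \<in> B"
    using B_range[of \<i> "k \<ominus> \<i> \<odot> f"] c by auto
  have f0c: "f0 \<in> carrier H"
    using B_in f0 by blast
  define u where "u = f \<ominus> f0"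
  have u: "u \<in> carrier H"
    using c f0c by (simp add: u_def)
  have "(f \<ominus> f0, k \<ominus> ((k \<ominus> \<i> \<odot> f) \<oplus> \<i> \<odot> f0)) \<in> adjoint_op H S"
    using BS f0 by (intro adjoint_op_diff[OF Sc fk]) blast
  moreover have "k \<ominus> ((k \<ominus> \<i> \<odot> f) \<oplus> \<i> \<odot> f0) = \<i> \<odot> u"
    unfolding u_def using c f0c by (intro vec_eqI) (auto simp: algebra_simps)
  ultimately have uS: "(u, \<i> \<odot> u) \<in> adjoint_op H S"
    by (simp add: u_def)
  have orth: "cinner H h u = 0" if h: "h \<in> carrier H" and hg: "cinner H h (\<gamma> \<i>) = 0" for h
  proof -
    obtain v where v: "(v, h \<oplus> (-\<i>) \<odot> v) \<in> B"
      using B_range[of "-\<i>" h] h by auto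
    have vc: "v \<in> carrier H"
      using B_in v by blast
    have "(h \<oplus> (-\<i>) \<odot> v) \<oplus> \<i> \<odot> v = h"
      using h vc by (intro vec_eqI) auto
    then have "(v, h \<oplus> (-\<i>) \<odot> v) \<in> S"
      using v hg by (simp add: S)
    from adjoint_opD(3)[OF uS this] show ?thesis
      using h vc u by simp
  qed
  \<comment> \<open>Coefficient of the projection onto the span of \<open>\<gamma> \<i>\<close>. If
    \<open>\<gamma> \<i>\<close> is zero, division by zero makes it 0, which is correct because then
    \<open>u\<close> is zero too.\<close>
  define c' where "c' = cinner H u (\<gamma> \<i>) / cinner H (\<gamma> \<i>) (\<gamma> \<i>)"
  have "u \<ominus> c' \<odot> \<gamma> \<i> = \<zero>"
  proof (cases "\<gamma> \<i> = \<zero>")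
    case True
    have "u = \<zero>"
      using orth[OF u] True u by (intro cinner_self_eq_zero) auto
    then show ?thesis
      using True by (auto intro!: vec_eqI)
  next
    case False
    then have ne: "cinner H (\<gamma> \<i>) (\<gamma> \<i>) \<noteq> 0"
      using cinner_self_eq_zero c by blast
    define y where "y = u \<ominus> c' \<odot> \<gamma> \<i>"
    have y: "y \<in> carrier H"
      using u c by (simp add: y_def)
    have yg: "cinner H y (\<gamma> \<i>) = 0"
      using u c ne by (simp add: y_def c'_def)
    have "cinner H y y = cinner H y u - cnj c' * cinner H y (\<gamma> \<i>)"
      using y u c by (subst (2) y_def) simp
    then have "cinner H y y = 0"
      using orth[OF y yg] yg by simp
    then show ?thesis
      using cinner_self_eq_zero y by (simp add: y_def)
  qed
  then have ueq: "u = c' \<odot> \<gamma> \<i>"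
    using u c by (simp add: minus_eq_zero_iff)
  have "f = f0 \<oplus> c' \<odot> \<gamma> \<i>"
    unfolding ueq[symmetric] u_def using c f0c by (intro vec_eqI) auto
  moreover have "k = ((k \<ominus> \<i> \<odot> f) \<oplus> \<i> \<odot> f0) \<oplus> (\<i> * c') \<odot> \<gamma> \<i>"
  proof -
    have "(\<i> * c') \<odot> \<gamma> \<i> = \<i> \<odot> u"
      unfolding ueq using c by (simp add: module_axioms_rules)
    then show ?thesis
      unfolding u_def using c f0c by (intro vec_eqI) (auto simp: algebra_simps)
  qed
  ultimately show "p \<in> {(f \<oplus> c \<odot> \<gamma> \<i>, g \<oplus> (\<i> * c) \<odot> \<gamma> \<i>) | f g c. (f, g) \<in> B}"
    unfolding p using f0 by blast
qed

end

section \<open>Two gamma fields with the same Q-function\<close>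

locale gamma_field_pair =
  A: gamma_field H\<^sub>1 B\<^sub>1 \<gamma>\<^sub>1 V + C: gamma_field H\<^sub>2 B\<^sub>2 \<gamma>\<^sub>2 V
  for H\<^sub>1 :: "'a hilbert" and B\<^sub>1 \<gamma>\<^sub>1 V and H\<^sub>2 :: "'b hilbert" and B\<^sub>2 \<gamma>\<^sub>2
begin

text \<open>Division by \<open>z - cnj w\<close> where it is nonzero; both sides are continuous in
  \<open>w\<close>, which covers the remaining point. One sequence \<open>near\<close> serves both
  spaces, as it does not depend on the field.\<close>

lemma cinner_\<gamma>:
  assumes z: "Im z \<noteq> 0" and w: "Im w \<noteq> 0"
  shows "cinner H\<^sub>1 (\<gamma>\<^sub>1 z) (\<gamma>\<^sub>1 w) = cinner H\<^sub>2 (\<gamma>\<^sub>2 z) (\<gamma>\<^sub>2 w)"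
proof -
  have main: "cinner H\<^sub>1 (\<gamma>\<^sub>1 z) (\<gamma>\<^sub>1 w) = cinner H\<^sub>2 (\<gamma>\<^sub>2 z) (\<gamma>\<^sub>2 w)" if w: "Im w \<noteq> 0" "cnj w \<noteq> z" for w
  proof -
    have "(z - cnj w) * cinner H\<^sub>1 (\<gamma>\<^sub>1 z) (\<gamma>\<^sub>1 w) = (z - cnj w) * cinner H\<^sub>2 (\<gamma>\<^sub>2 z) (\<gamma>\<^sub>2 w)"
      using A.\<gamma>_inner[OF z w(1)] C.\<gamma>_inner[OF z w(1)] by simp
    then show ?thesis
      using w by simp
  qed
  show ?thesis
  proof (cases "cnj w = z")
    case False
    then show ?thesis using main w by blast
  next
    case True
    have "cinner H\<^sub>1 (\<gamma>\<^sub>1 z) (\<gamma>\<^sub>1 (A.near w n)) = cinner H\<^sub>2 (\<gamma>\<^sub>2 z) (\<gamma>\<^sub>2 (A.near w n))" for n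
    proof (rule main)
      show "Im (A.near w n) \<noteq> 0" by (rule A.near[OF w])
      show "cnj (A.near w n) \<noteq> z"
        using A.near(2)[OF w, of n] True by (metis complex_cnj_cnj)
    qed
    moreover have "(\<lambda>n. cinner H\<^sub>1 (\<gamma>\<^sub>1 z) (\<gamma>\<^sub>1 (A.near w n))) \<longlonglongrightarrow> cinner H\<^sub>1 (\<gamma>\<^sub>1 z) (\<gamma>\<^sub>1 w)"
      by (rule A.hlim_cinner_right[OF A.hlim_near[OF w] A.\<gamma>_in[OF z]])
    moreover have "(\<lambda>n. cinner H\<^sub>2 (\<gamma>\<^sub>2 z) (\<gamma>\<^sub>2 (A.near w n))) \<longlonglongrightarrow> cinner H\<^sub>2 (\<gamma>\<^sub>2 z) (\<gamma>\<^sub>2 w)"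
      using C.hlim_cinner_right[OF C.hlim_near[OF w] C.\<gamma>_in[OF z]]
      unfolding C.near_def A.near_def .
    ultimately show ?thesis
      by (simp add: LIMSEQ_unique)
  qed
qed

lemma cinner_comb:
  assumes "nonreal ps" "nonreal qs"
  shows "cinner H\<^sub>1 (comb H\<^sub>1 \<gamma>\<^sub>1 ps) (comb H\<^sub>1 \<gamma>\<^sub>1 qs) = cinner H\<^sub>2 (comb H\<^sub>2 \<gamma>\<^sub>2 ps) (comb H\<^sub>2 \<gamma>\<^sub>2 qs)"
  using assms
proof (induction ps)
  case (Cons p ps)
  have "cinner H\<^sub>1 (\<gamma>\<^sub>1 (snd p)) (comb H\<^sub>1 \<gamma>\<^sub>1 qs) = cinner H\<^sub>2 (\<gamma>\<^sub>2 (snd p)) (comb H\<^sub>2 \<gamma>\<^sub>2 qs)"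
    using Cons.prems(2) Cons.prems(1) by (induction qs) (auto simp: cinner_\<gamma>)
  then show ?case
    using Cons by simp
qed simp

lemma hnorm_comb_diff:
  assumes "nonreal ps" "nonreal qs"
  shows "hnorm H\<^sub>1 (comb H\<^sub>1 \<gamma>\<^sub>1 ps \<ominus>\<^bsub>H\<^sub>1\<^esub> comb H\<^sub>1 \<gamma>\<^sub>1 qs) = hnorm H\<^sub>2 (comb H\<^sub>2 \<gamma>\<^sub>2 ps \<ominus>\<^bsub>H\<^sub>2\<^esub> comb H\<^sub>2 \<gamma>\<^sub>2 qs)"
  unfolding hnorm_def using assms by (simp add: cinner_comb)

text \<open>The graph of the unitary operator before it is known to be a function: two vectors are
  related when the same codes converge to both. Since \<open>G\<close> preserves inner products and
  both of its projections are full, it is single-valued and injective.\<close>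

definition G :: "'a \<Rightarrow> 'b \<Rightarrow> bool"
  where "G h F \<longleftrightarrow> (\<exists>ps. (\<forall>n. nonreal (ps n)) \<and>
    hlim H\<^sub>1 (\<lambda>n. comb H\<^sub>1 \<gamma>\<^sub>1 (ps n)) h \<and> hlim H\<^sub>2 (\<lambda>n. comb H\<^sub>2 \<gamma>\<^sub>2 (ps n)) F)"

lemma G_in: "G h F \<Longrightarrow> h \<in> carrier H\<^sub>1" "G h F \<Longrightarrow> F \<in> carrier H\<^sub>2"
  unfolding G_def by (auto intro: hlim_in)

lemma G_inner:
  assumes "G h F" "G h' F'"
  shows "cinner H\<^sub>1 h h' = cinner H\<^sub>2 F F'"
proof -
  obtain ps qs where p: "\<And>n. nonreal (ps n)" "hlim H\<^sub>1 (\<lambda>n. comb H\<^sub>1 \<gamma>\<^sub>1 (ps n)) h" "hlim H\<^sub>2 (\<lambda>n. comb H\<^sub>2 \<gamma>\<^sub>2 (ps n)) F"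
    and q: "\<And>n. nonreal (qs n)" "hlim H\<^sub>1 (\<lambda>n. comb H\<^sub>1 \<gamma>\<^sub>1 (qs n)) h'" "hlim H\<^sub>2 (\<lambda>n. comb H\<^sub>2 \<gamma>\<^sub>2 (qs n)) F'"
    using assms unfolding G_def by blast
  show ?thesis
    using A.hlim_cinner[OF p(2) q(2)] C.hlim_cinner[OF p(3) q(3)]
    by (simp add: cinner_comb p(1) q(1) LIMSEQ_unique)
qed

lemma G_add:
  assumes "G h F" "G h' F'"
  shows "G (h \<oplus>\<^bsub>H\<^sub>1\<^esub> h') (F \<oplus>\<^bsub>H\<^sub>2\<^esub> F')"
proof -
  obtain ps qs where p: "\<And>n. nonreal (ps n)" "hlim H\<^sub>1 (\<lambda>n. comb H\<^sub>1 \<gamma>\<^sub>1 (ps n)) h" "hlim H\<^sub>2 (\<lambda>n. comb H\<^sub>2 \<gamma>\<^sub>2 (ps n)) F"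
    and q: "\<And>n. nonreal (qs n)" "hlim H\<^sub>1 (\<lambda>n. comb H\<^sub>1 \<gamma>\<^sub>1 (qs n)) h'" "hlim H\<^sub>2 (\<lambda>n. comb H\<^sub>2 \<gamma>\<^sub>2 (qs n)) F'"
    using assms unfolding G_def by blast
  show ?thesis
    unfolding G_def using A.hlim_add[OF p(2) q(2)] C.hlim_add[OF p(3) q(3)] p(1) q(1)
    by (intro exI[of _ "\<lambda>n. ps n @ qs n"]) (simp add: A.comb_append C.comb_append)
qed

lemma G_smult:
  assumes "G h F"
  shows "G (c \<odot>\<^bsub>H\<^sub>1\<^esub> h) (c \<odot>\<^bsub>H\<^sub>2\<^esub> F)"
proof -
  obtain ps where p: "\<And>n. nonreal (ps n)" "hlim H\<^sub>1 (\<lambda>n. comb H\<^sub>1 \<gamma>\<^sub>1 (ps n)) h" "hlim H\<^sub>2 (\<lambda>n. comb H\<^sub>2 \<gamma>\<^sub>2 (ps n)) F"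
    using assms unfolding G_def by blast
  show ?thesis
    unfolding G_def using A.hlim_smult[OF p(2), of c] C.hlim_smult[OF p(3), of c] p(1)
    by (intro exI[of _ "\<lambda>n. map (\<lambda>p. (c * fst p, snd p)) (ps n)"]) (simp add: A.comb_smult C.comb_smult)
qed

text \<open>Codes converging in the first space give a Cauchy sequence in the second, because
  distances between combinations agree.\<close>

lemma G_total: "h \<in> carrier H\<^sub>1 \<Longrightarrow> \<exists>F. G h F"
proof -
  assume "h \<in> carrier H\<^sub>1"
  then obtain ps where p: "\<And>n. nonreal (ps n)" "hlim H\<^sub>1 (\<lambda>n. comb H\<^sub>1 \<gamma>\<^sub>1 (ps n)) h"
    using A.comb_hlim by blast
  have "hCauchy H\<^sub>2 (\<lambda>n. comb H\<^sub>2 \<gamma>\<^sub>2 (ps n))"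
    by (rule hCauchy_mono[OF A.hlim_hCauchy[OF p(2)]]) (simp_all add: p(1) hnorm_comb_diff)
  then show ?thesis
    using C.hCauchy_hlim p unfolding G_def by blast
qed

lemma G_onto: "F \<in> carrier H\<^sub>2 \<Longrightarrow> \<exists>h. G h F"
proof -
  assume "F \<in> carrier H\<^sub>2"
  then obtain ps where p: "\<And>n. nonreal (ps n)" "hlim H\<^sub>2 (\<lambda>n. comb H\<^sub>2 \<gamma>\<^sub>2 (ps n)) F"
    using C.comb_hlim by blast
  have "hCauchy H\<^sub>1 (\<lambda>n. comb H\<^sub>1 \<gamma>\<^sub>1 (ps n))"
    by (rule hCauchy_mono[OF C.hlim_hCauchy[OF p(2)]]) (simp_all add: p(1) hnorm_comb_diff)
  then show ?thesis
    using A.hCauchy_hlim p unfolding G_def by blast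
qed

lemma G_unique: assumes "G h F" "G h F'" shows "F = F'"
proof (rule C.vec_eqI)
  fix X assume "X \<in> carrier H\<^sub>2"
  then obtain k where "G k X"
    using G_onto by blast
  then show "cinner H\<^sub>2 F X = cinner H\<^sub>2 F' X"
    using G_inner assms by metis
qed (use assms G_in in auto)

lemma G_inj: assumes "G h F" "G h' F" shows "h = h'"
proof (rule A.vec_eqI)
  fix x assume "x \<in> carrier H\<^sub>1"
  then obtain X where "G x X"
    using G_total by blast
  then show "cinner H\<^sub>1 h x = cinner H\<^sub>1 h' x"
    using G_inner assms by metis
qed (use assms G_in in auto)

lemma unitary_exists:
  "\<exists>U. unitary_op H\<^sub>1 H\<^sub>2 U \<and> (\<forall>z. Im z \<noteq> 0 \<longrightarrow> U (\<gamma>\<^sub>1 z) = \<gamma>\<^sub>2 z)"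
proof -
  define U where "U = (\<lambda>h. SOME F. G h F)"
  have GU: "G h (U h)" if "h \<in> carrier H\<^sub>1" for h
    unfolding U_def using someI_ex[OF G_total[OF that]] .
  have U_eq: "U h = F" if "G h F" for h F
    using GU[OF G_in(1)[OF that]] that by (rule G_unique)
  have "bij_betw U (carrier H\<^sub>1) (carrier H\<^sub>2)"
    unfolding bij_betw_def
  proof
    show "inj_on U (carrier H\<^sub>1)"
      by (rule inj_onI) (metis GU G_inj)
    show "U ` carrier H\<^sub>1 = carrier H\<^sub>2"
    proof (intro equalityI subsetI)
      fix F assume "F \<in> U ` carrier H\<^sub>1"
      then show "F \<in> carrier H\<^sub>2"
        using GU G_in by blast
    next
      fix F assume "F \<in> carrier H\<^sub>2"
      then obtain h where "G h F"
        using G_onto by blast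
      then show "F \<in> U ` carrier H\<^sub>1"
        using U_eq G_in by blast
    qed
  qed
  moreover have "U (x \<oplus>\<^bsub>H\<^sub>1\<^esub> y) = U x \<oplus>\<^bsub>H\<^sub>2\<^esub> U y" if "x \<in> carrier H\<^sub>1" "y \<in> carrier H\<^sub>1" for x y
    by (rule U_eq[OF G_add[OF GU GU]]) (use that in auto)
  moreover have "U (c \<odot>\<^bsub>H\<^sub>1\<^esub> x) = c \<odot>\<^bsub>H\<^sub>2\<^esub> U x" if "x \<in> carrier H\<^sub>1" for x c
    by (rule U_eq[OF G_smult[OF GU]]) (use that in auto)
  moreover have "cinner H\<^sub>2 (U x) (U y) = cinner H\<^sub>1 x y" if "x \<in> carrier H\<^sub>1" "y \<in> carrier H\<^sub>1" for x y
    using G_inner[OF GU[OF that(1)] GU[OF that(2)]] by simp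
  moreover have "U (\<gamma>\<^sub>1 z) = \<gamma>\<^sub>2 z" if z: "Im z \<noteq> 0" for z
  proof (rule U_eq)
    have "hlim H\<^sub>1 (\<lambda>n. comb H\<^sub>1 \<gamma>\<^sub>1 [(1, z)]) (\<gamma>\<^sub>1 z)" "hlim H\<^sub>2 (\<lambda>n. comb H\<^sub>2 \<gamma>\<^sub>2 [(1, z)]) (\<gamma>\<^sub>2 z)"
      using z by (simp_all add: A.module_axioms_rules C.module_axioms_rules)
    then show "G (\<gamma>\<^sub>1 z) (\<gamma>\<^sub>2 z)"
      unfolding G_def using z by (intro exI[of _ "\<lambda>_. [(1, z)]"]) simp
  qed
  ultimately show ?thesis
    unfolding unitary_op_def by blast
qed

end

lemma unitary_opD:
  assumes "unitary_op H H' U"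
  shows "x \<in> carrier H \<Longrightarrow> U x \<in> carrier H'"
    "\<lbrakk>x \<in> carrier H; y \<in> carrier H\<rbrakk> \<Longrightarrow> U (x \<oplus>\<^bsub>H\<^esub> y) = U x \<oplus>\<^bsub>H'\<^esub> U y"
    "x \<in> carrier H \<Longrightarrow> U (c \<odot>\<^bsub>H\<^esub> x) = c \<odot>\<^bsub>H'\<^esub> U x"
    "\<lbrakk>x \<in> carrier H; y \<in> carrier H\<rbrakk> \<Longrightarrow> cinner H' (U x) (U y) = cinner H x y"
    "y' \<in> carrier H' \<Longrightarrow> \<exists>x\<in>carrier H. U x = y'"
    "\<lbrakk>U x = U y; x \<in> carrier H; y \<in> carrier H\<rbrakk> \<Longrightarrow> x = y"
proof -
  have b: "inj_on U (carrier H)" "U ` carrier H = carrier H'"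
    using assms unfolding unitary_op_def bij_betw_def by auto
  show "y' \<in> carrier H' \<Longrightarrow> \<exists>x\<in>carrier H. U x = y'" "x \<in> carrier H \<Longrightarrow> U x \<in> carrier H'"
    using b(2) by (metis imageE imageI)+
  show "\<lbrakk>U x = U y; x \<in> carrier H; y \<in> carrier H\<rbrakk> \<Longrightarrow> x = y"
    using b(1) by (rule inj_onD)
qed (use assms in \<open>simp_all add: unitary_op_def\<close>)

context gamma_field_pair
begin

text \<open>Put \<open>h = (B\<^sub>1 - \<i>) f\<close> and let \<open>f2\<close> solve
  \<open>(B\<^sub>2 - \<i>) f2 = U h\<close>. By \<open>cinner_resolvent_\<gamma>\<close>, applied
  in both spaces, \<open>f2\<close> and \<open>U f\<close> have the same inner products with all
  \<open>\<gamma>\<^sub>2 w\<close> except at one point, so they coincide.\<close>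

lemma intertwine:
  assumes U: "unitary_op H\<^sub>1 H\<^sub>2 U" and U\<gamma>: "\<And>z. Im z \<noteq> 0 \<Longrightarrow> U (\<gamma>\<^sub>1 z) = \<gamma>\<^sub>2 z"
    and fg: "(f, g) \<in> B\<^sub>1"
  shows "(U f, U g) \<in> B\<^sub>2"
proof -
  note u = unitary_opD[OF U]
  have Udiff: "U (x \<ominus>\<^bsub>H\<^sub>1\<^esub> y) = U x \<ominus>\<^bsub>H\<^sub>2\<^esub> U y" if "x \<in> carrier H\<^sub>1" "y \<in> carrier H\<^sub>1" for x y
    using that by (simp add: A.diff_as_add C.diff_as_add u)
  have c: "f \<in> carrier H\<^sub>1" "g \<in> carrier H\<^sub>1"
    using A.B_in fg by auto
  define h where "h = g \<ominus>\<^bsub>H\<^sub>1\<^esub> \<i> \<odot>\<^bsub>H\<^sub>1\<^esub> f"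
  have h: "h \<in> carrier H\<^sub>1"
    using c by (simp add: h_def)
  obtain f2 where f2: "(f2, U h \<oplus>\<^bsub>H\<^sub>2\<^esub> \<i> \<odot>\<^bsub>H\<^sub>2\<^esub> f2) \<in> B\<^sub>2"
    using C.B_range[of \<i> "U h"] u(1)[OF h] by auto
  have f2c: "f2 \<in> carrier H\<^sub>2"
    using C.B_in f2 by blast
  have "f2 \<ominus>\<^bsub>H\<^sub>2\<^esub> U f = \<zero>\<^bsub>H\<^sub>2\<^esub>"
  proof (rule C.total_except[where w="-\<i>"])
    fix w assume w: "Im w \<noteq> 0" "w \<noteq> - \<i>"
    have "(U h \<oplus>\<^bsub>H\<^sub>2\<^esub> \<i> \<odot>\<^bsub>H\<^sub>2\<^esub> f2) \<ominus>\<^bsub>H\<^sub>2\<^esub> \<i> \<odot>\<^bsub>H\<^sub>2\<^esub> f2 = U h"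
      using u(1)[OF h] f2c by (intro C.vec_eqI) auto
    then have 2: "cinner H\<^sub>2 (U h) (\<gamma>\<^sub>2 (-\<i>) \<ominus>\<^bsub>H\<^sub>2\<^esub> \<gamma>\<^sub>2 w) = - cnj (w + \<i>) * cinner H\<^sub>2 f2 (\<gamma>\<^sub>2 w)"
      using C.cinner_resolvent_\<gamma>[OF f2 w(1)] by simp
    have "cinner H\<^sub>2 (U h) (U (\<gamma>\<^sub>1 (-\<i>) \<ominus>\<^bsub>H\<^sub>1\<^esub> \<gamma>\<^sub>1 w)) = - cnj (w + \<i>) * cinner H\<^sub>2 (U f) (U (\<gamma>\<^sub>1 w))"
      using A.cinner_resolvent_\<gamma>[OF fg w(1)] h c w(1) unfolding h_def[symmetric] by (simp add: u(4))
    then have "cinner H\<^sub>2 (U h) (\<gamma>\<^sub>2 (-\<i>) \<ominus>\<^bsub>H\<^sub>2\<^esub> \<gamma>\<^sub>2 w) = - cnj (w + \<i>) * cinner H\<^sub>2 (U f) (\<gamma>\<^sub>2 w)"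
      using w(1) by (simp add: Udiff U\<gamma>)
    with 2 have "cnj (w + \<i>) * cinner H\<^sub>2 f2 (\<gamma>\<^sub>2 w) = cnj (w + \<i>) * cinner H\<^sub>2 (U f) (\<gamma>\<^sub>2 w)"
      by (metis minus_equation_iff mult_minus_left)
    moreover have "cnj (w + \<i>) \<noteq> 0"
      using w(2) unfolding complex_cnj_zero_iff by (simp add: add_eq_0_iff2)
    ultimately have "cinner H\<^sub>2 f2 (\<gamma>\<^sub>2 w) = cinner H\<^sub>2 (U f) (\<gamma>\<^sub>2 w)"
      using mult_left_cancel by blast
    then show "cinner H\<^sub>2 (f2 \<ominus>\<^bsub>H\<^sub>2\<^esub> U f) (\<gamma>\<^sub>2 w) = 0"
      using f2c u(1)[OF c(1)] w(1) by simp
  qed (use f2c u(1) c in auto)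
  then have "f2 = U f"
    using f2c u(1) c by (simp add: C.minus_eq_zero_iff)
  moreover have "U h \<oplus>\<^bsub>H\<^sub>2\<^esub> \<i> \<odot>\<^bsub>H\<^sub>2\<^esub> U f = U g"
  proof -
    have "h \<oplus>\<^bsub>H\<^sub>1\<^esub> \<i> \<odot>\<^bsub>H\<^sub>1\<^esub> f = g"
      unfolding h_def using c by (intro A.vec_eqI) auto
    then show ?thesis
      using h c by (metis A.smult_in u(2,3))
  qed
  ultimately show ?thesis
    using f2 by simp
qed

text \<open>Surjectivity of \<open>B\<^sub>1 - \<i>\<close> leaves no room for more in
  \<open>B\<^sub>2\<close>: an element of \<open>B\<^sub>2\<close> differs from the image of a
  solution in \<open>B\<^sub>1\<close> by an eigenvector at \<i>, which is zero.\<close>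

lemma intertwine_image:
  assumes U: "unitary_op H\<^sub>1 H\<^sub>2 U" and U\<gamma>: "\<And>z. Im z \<noteq> 0 \<Longrightarrow> U (\<gamma>\<^sub>1 z) = \<gamma>\<^sub>2 z"
  shows "B\<^sub>2 = map_prod U U ` B\<^sub>1"
proof (intro equalityI subsetI)
  fix p assume "p \<in> map_prod U U ` B\<^sub>1"
  then show "p \<in> B\<^sub>2"
    using intertwine[OF U U\<gamma>] by auto
next
  note u = unitary_opD[OF U]
  fix p assume p: "p \<in> B\<^sub>2"
  then obtain F K where FK: "(F, K) \<in> B\<^sub>2" "p = (F, K)"
    by (cases p) auto
  have c: "F \<in> carrier H\<^sub>2" "K \<in> carrier H\<^sub>2"
    using C.B_in FK by auto
  obtain h where h: "h \<in> carrier H\<^sub>1" "U h = K \<ominus>\<^bsub>H\<^sub>2\<^esub> \<i> \<odot>\<^bsub>H\<^sub>2\<^esub> F"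
    using u(5)[of "K \<ominus>\<^bsub>H\<^sub>2\<^esub> \<i> \<odot>\<^bsub>H\<^sub>2\<^esub> F"] c by auto
  obtain f where f: "(f, h \<oplus>\<^bsub>H\<^sub>1\<^esub> \<i> \<odot>\<^bsub>H\<^sub>1\<^esub> f) \<in> B\<^sub>1"
    using A.B_range[of \<i> h] h by auto
  have fc: "f \<in> carrier H\<^sub>1"
    using A.B_in f by blast
  have "(U f, U (h \<oplus>\<^bsub>H\<^sub>1\<^esub> \<i> \<odot>\<^bsub>H\<^sub>1\<^esub> f)) \<in> B\<^sub>2"
    by (rule intertwine[OF U U\<gamma> f])
  then have 1: "(U f, U h \<oplus>\<^bsub>H\<^sub>2\<^esub> \<i> \<odot>\<^bsub>H\<^sub>2\<^esub> U f) \<in> B\<^sub>2"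
    using h fc by (simp add: u)
  have "K \<ominus>\<^bsub>H\<^sub>2\<^esub> (U h \<oplus>\<^bsub>H\<^sub>2\<^esub> \<i> \<odot>\<^bsub>H\<^sub>2\<^esub> U f) = \<i> \<odot>\<^bsub>H\<^sub>2\<^esub> (F \<ominus>\<^bsub>H\<^sub>2\<^esub> U f)"
    unfolding h(2) using c u(1)[OF fc] by (intro C.vec_eqI) (auto simp: algebra_simps)
  then have "(F \<ominus>\<^bsub>H\<^sub>2\<^esub> U f, \<i> \<odot>\<^bsub>H\<^sub>2\<^esub> (F \<ominus>\<^bsub>H\<^sub>2\<^esub> U f)) \<in> B\<^sub>2"
    using C.linear_op_diff[OF C.B_lin FK(1) 1] by simp
  then have "F \<ominus>\<^bsub>H\<^sub>2\<^esub> U f = \<zero>\<^bsub>H\<^sub>2\<^esub>"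
    by (rule C.symmetric_eigen_zero[OF C.B_lin C.B_sym]) simp
  then have "F = U f"
    using c u(1)[OF fc] by (simp add: C.minus_eq_zero_iff)
  moreover have "K = U (h \<oplus>\<^bsub>H\<^sub>1\<^esub> \<i> \<odot>\<^bsub>H\<^sub>1\<^esub> f)"
    using C.linear_op_unique[OF C.B_lin _ \<open>(U f, U (h \<oplus>\<^bsub>H\<^sub>1\<^esub> \<i> \<odot>\<^bsub>H\<^sub>1\<^esub> f)) \<in> B\<^sub>2\<close>] FK \<open>F = U f\<close> by blast
  ultimately show "p \<in> map_prod U U ` B\<^sub>1"
    using f FK by (auto intro!: image_eqI)
qed

end

section \<open>The structure of an L-system\<close>

locale lsystem_data = rigged +
  fixes T :: "'a rel" and A :: "'a \<Rightarrow> 'a \<Rightarrow> complex" and K :: "complex \<Rightarrow> 'a \<Rightarrow> complex"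
  assumes S_sym: "symmetric_op H S" and T_main: "main_operator H S T" and A_ext: "star_extension H S T A"
    and K_bounded: "bounded_op complex_space (H_minus H S) K"
    and Im_A: "\<And>f. f \<in> carrier (H_plus H S) \<Longrightarrow> pm_Im (H_plus H S) A f = K (channel_adjoint K f)"
begin

abbreviation "D \<equiv> Domain (adjoint_op H S)"

definition "chi = K 1"
text \<open>The sesquilinear form of Re A, obtained by subtracting \<i> Im A, which is the rank one
  form of \<open>chi\<close>. It avoids the adjoint of \<open>A\<close>; \<open>pm_Re_eq\<close>
  compares it with \<open>pm_Re\<close> on H_+.\<close>

definition "R f h = A f h - \<i> * cnj (chi f) * chi h"

lemma K_eq: "K c = (\<lambda>x. c * chi x)"
proof -
  have "\<forall>c. \<forall>x\<in>carrier complex_space. K (c \<odot>\<^bsub>complex_space\<^esub> x) = c \<odot>\<^bsub>H_minus H S\<^esub> K x"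
    using K_bounded unfolding bounded_op_def by blast
  then have "K (c \<odot>\<^bsub>complex_space\<^esub> 1) = c \<odot>\<^bsub>H_minus H S\<^esub> K 1"
    by (simp add: complex_space_def) (metis mult.right_neutral)
  then show ?thesis
    by (simp add: complex_space_def H_minus_def chi_def)
qed

lemma chi_in: "chi \<in> carrier (antidual P)"
  using K_bounded unfolding bounded_op_def chi_def H_minus_def by (auto simp: complex_space_def Pi_iff)

lemma A_in: "f \<in> D \<Longrightarrow> A f \<in> carrier (antidual P)"
  using A_ext unfolding star_extension_def bounded_op_def H_minus_def by (auto simp: Pi_iff)

lemma A_add: "f \<in> D \<Longrightarrow> g \<in> D \<Longrightarrow> A (f \<oplus> g) h = A f h + A g h"
  and A_smult: "f \<in> D \<Longrightarrow> A (c \<odot> f) h = c * A f h"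
  using A_ext unfolding star_extension_def bounded_op_def H_minus_def by (auto simp: Pi_iff)

lemma chi_rules:
  "f \<in> D \<Longrightarrow> g \<in> D \<Longrightarrow> chi (f \<oplus> g) = chi f + chi g"
  "f \<in> D \<Longrightarrow> chi (c \<odot> f) = cnj c * chi f"
  "f \<in> D \<Longrightarrow> g \<in> D \<Longrightarrow> chi (f \<ominus> g) = chi f - chi g"
  "f \<notin> D \<Longrightarrow> chi f = 0"
  using P.antidualD[OF chi_in] P.antidual_diffD[OF chi_in, of f g] P_minus[of f g] by auto

lemma A_minus_adjoint:
  assumes "f \<in> D" "h \<in> D"
  shows "A f h - cnj (A h f) = 2 * \<i> * (cnj (chi f) * chi h)"
proof -
  have "pm_Im P A f h = K (channel_adjoint K f) h"
    using Im_A[of f] assms by simp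
  then have "(A f h - cnj (A h f)) / (2 * \<i>) = cnj (chi f) * chi h"
    using assms(2) by (simp add: pm_Im_def pm_adjoint_def channel_adjoint_def dual_pair_def K_eq)
  then show ?thesis
    by (simp add: field_simps)
qed

lemma R_hermitian: "f \<in> D \<Longrightarrow> h \<in> D \<Longrightarrow> R f h = cnj (R h f)"
  using A_minus_adjoint[of f h] by (simp add: R_def algebra_simps)

lemma pm_Re_eq: "f \<in> D \<Longrightarrow> h \<in> D \<Longrightarrow> pm_Re P A f h = R f h"
  using A_minus_adjoint[of f h] by (simp add: R_def pm_Re_def pm_adjoint_def field_simps)

lemma pm_Re_outside: "f \<in> D \<Longrightarrow> h \<notin> D \<Longrightarrow> pm_Re P A f h = 0"
  using P.antidualD(3)[OF A_in, of f h] by (simp add: pm_Re_def pm_adjoint_def)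

lemma pm_Re_in:
  assumes f: "f \<in> D"
  shows "pm_Re P A f \<in> carrier (antidual P)"
proof -
  have "pm_Re P A f = (\<lambda>h. A f h + (- \<i> * cnj (chi f)) * chi h)"
  proof
    fix h show "pm_Re P A f h = A f h + (- \<i> * cnj (chi f)) * chi h"
      using pm_Re_eq[OF f, of h] pm_Re_outside[OF f, of h] P.antidualD(3)[OF A_in[OF f], of h] chi_rules(4)[of h]
      by (cases "h \<in> D") (auto simp: R_def)
  qed
  then show ?thesis
    using P.antidual_add_in[OF A_in[OF f] P.antidual_smult_in[OF chi_in]] by metis
qed

lemma R_rules:
  assumes "f \<in> D" "g \<in> D"
  shows "R (f \<oplus> g) h = R f h + R g h" "R (c \<odot> f) h = c * R f h" "R (f \<ominus> g) h = R f h - R g h"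
proof -
  have 1: "R (f \<oplus> g) h = R f h + R g h" if "f \<in> D" "g \<in> D" for f g
    using that by (simp add: R_def A_add chi_rules algebra_simps)
  have 2: "R (c \<odot> f) h = c * R f h" if "f \<in> D" for f c
    using that by (simp add: R_def A_smult chi_rules algebra_simps)
  show "R (f \<oplus> g) h = R f h + R g h" "R (c \<odot> f) h = c * R f h"
    using 1 2 assms by auto
  show "R (f \<ominus> g) h = R f h - R g h"
    using 1[OF assms(1) D_smult[OF assms(2)], of "-1"] 2[OF assms(2), of "-1"] D_in assms
    by (simp add: diff_as_add)
qed

section \<open>Quasi-kernel, symmetric operator and main operator\<close>

definition "B = quasi_kernel H S (pm_Re P A)"

lemma B_iff: "(f, g) \<in> B \<longleftrightarrow> f \<in> D \<and> g \<in> carrier H \<and> (\<forall>h\<in>D. R f h = cinner H g h)"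
proof -
  have "pm_Re P A f = embed_minus H S g \<longleftrightarrow> (\<forall>h\<in>D. R f h = cinner H g h)" if "f \<in> D"
    unfolding fun_eq_iff using that pm_Re_eq[OF that] pm_Re_outside[OF that]
    by (auto simp: embed_minus_def simp del: Domain_iff)
  then show ?thesis
    unfolding B_def quasi_kernel_def by auto
qed

lemma B_self_adjoint: "self_adjoint_op H B"
  using A_ext unfolding star_extension_def B_def by blast

lemma B_linear: "linear_op H B" and B_symmetric: "symmetric_op H B" and B_adj: "adjoint_op H B = B"
  using B_self_adjoint by (auto simp: self_adjoint_op_def symmetric_op_def)

lemma B_mem: "(f, g) \<in> B \<Longrightarrow> f \<in> carrier H" "(f, g) \<in> B \<Longrightarrow> g \<in> carrier H" "(f, g) \<in> B \<Longrightarrow> f \<in> D"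
  by (rule linear_op_in[OF B_linear], assumption)+ (simp add: B_iff)

lemma T_facts: "linear_op H T" "\<not> symmetric_op H T" "S \<subseteq> T" "T \<subseteq> Sa" "resolvent_set H T \<noteq> {}"
  "Domain S = Domain T \<inter> Domain (adjoint_op H T)"
  using T_main by (auto simp: main_operator_def)

lemma A_T: "(f, g) \<in> T \<Longrightarrow> h \<in> D \<Longrightarrow> A f h = cinner H g h"
proof -
  assume a: "(f, g) \<in> T" and h: "h \<in> D"
  then have "A f h = embed_minus H S g h"
    using A_ext unfolding star_extension_def by fastforce
  then show ?thesis
    using h by (simp add: embed_minus_def)
qed

lemma A_T_adjoint: "(f, g) \<in> adjoint_op H T \<Longrightarrow> h \<in> D \<Longrightarrow> cnj (A h f) = cinner H g h"
proof -
  assume a: "(f, g) \<in> adjoint_op H T" and h: "h \<in> D"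
  then have "pm_adjoint P A f h = embed_minus H S g h"
    using A_ext unfolding star_extension_def by fastforce
  then show ?thesis
    using h by (simp add: pm_adjoint_def embed_minus_def)
qed

lemma S_adj_T: "S \<subseteq> adjoint_op H T"
  using A_ext unfolding star_extension_def by blast

lemma S_sub_Sa: "S \<subseteq> Sa"
  using S_sym by (simp add: symmetric_op_def)

text \<open>On Dom S both \<open>A\<close> and its adjoint act as \<open>S\<close>, so Im A vanishes
  there, and on the diagonal Im A is \<open>|chi f|^2\<close>. Once \<open>chi f = 0\<close>, Re A
  and \<open>A\<close> agree on \<open>f\<close>, which puts the pair into the quasi-kernel.\<close>

lemma chi_S: "(f, g) \<in> S \<Longrightarrow> chi f = 0" and S_sub_B: "S \<subseteq> B"
proof -
  have *: "chi f = 0 \<and> (f, g) \<in> B" if fg: "(f, g) \<in> S" for f g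
  proof -
    have f: "f \<in> D" using S_sub_Sa fg by auto
    have eq: "A f h = cinner H g h" "cnj (A h f) = cinner H g h" if "h \<in> D" for h
      using A_T A_T_adjoint T_facts(3) S_adj_T fg that by blast+
    have 0: "chi f = 0"
      using A_minus_adjoint[OF f f] eq[OF f] by simp
    then show ?thesis
      using f fg S_sub eq by (auto simp: B_iff R_def)
  qed
  show "(f, g) \<in> S \<Longrightarrow> chi f = 0"
    using * by blast
  show "S \<subseteq> B"
    using * by auto
qed

text \<open>If \<open>chi\<close> vanished on Dom T, then \<open>A\<close> and Re A would agree
  there, \<open>T\<close> would be a restriction of the self-adjoint \<open>B\<close> and hence
  symmetric.\<close>

lemma chi_nonzero: obtains t s where "(t, s) \<in> T" "chi t \<noteq> 0"
proof -
  have "\<exists>t s. (t, s) \<in> T \<and> chi t \<noteq> 0"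
  proof (rule ccontr)
    assume *: "\<not> ?thesis"
    have "T \<subseteq> B"
    proof
      fix p assume "p \<in> T"
      then obtain f g where p: "p = (f, g)" "(f, g) \<in> T"
        by (cases p) auto
      then have f: "f \<in> D"
        using T_facts by blast
      then show "p \<in> B"
        using p * A_T[OF p(2)] linear_op_in[OF T_facts(1) p(2)] by (auto simp: B_iff R_def)
    qed
    then have "symmetric_op H T"
      using adjoint_op_antimono[of T B] B_adj unfolding symmetric_op_def by blast
    then show False
      using T_facts by blast
  qed
  then show thesis
    using that by blast
qed

text \<open>Existence starts from a vector of Dom T on which \<open>chi\<close> does not vanish: Re
  A maps it to an element of H plus a nonzero multiple of \<open>chi\<close>. After normalizing this
  multiple, the element of H is corrected by the resolvent of \<open>B\<close>. Two solutions differ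
  by an eigenvector of \<open>B\<close> at a nonreal point.\<close>

lemma defect_ex1:
  assumes z: "Im z \<noteq> 0"
  shows "\<exists>!f. f \<in> D \<and> (\<forall>h\<in>D. R f h = z * cinner H f h + chi h)"
proof -
  obtain t0 s0 where ts: "(t0, s0) \<in> T" "chi t0 \<noteq> 0"
    by (rule chi_nonzero)
  \<comment> \<open>\<open>A t0 = s0\<close> gives \<open>R t0 = s0 - \<i> cnj (chi t0) chi\<close>;
    this factor turns the coefficient of \<open>chi\<close> into 1.\<close>
  define c where "c = \<i> / cnj (chi t0)"
  define t s where "t = c \<odot> t0" and "s = c \<odot> s0"
  have t0: "t0 \<in> D" "s0 \<in> carrier H"
    using ts T_facts linear_op_in by blast+
  have t: "t \<in> D" and s: "s \<in> carrier H"
    using t0 D_smult by (auto simp: t_def s_def)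
  have Rt: "R t h = cinner H s h + chi h" if h: "h \<in> D" for h
  proof -
    have eq: "R t0 h = cinner H s0 h - \<i> * cnj (chi t0) * chi h"
      using A_T[OF ts(1) h] by (simp add: R_def)
    show ?thesis
      unfolding t_def R_rules(2)[OF t0(1) t0(1)] eq using ts(2) t0 D_in[OF h]
      by (simp add: s_def c_def field_simps)
  qed
  have tH: "t \<in> carrier H" using D_in t by blast
  obtain f0 where f0: "(f0, (s \<ominus> z \<odot> t) \<oplus> z \<odot> f0) \<in> B"
    by (rule self_adjoint_range[OF B_self_adjoint z, of "s \<ominus> z \<odot> t"]) (use s tH in auto)
  have f0c: "f0 \<in> D" "f0 \<in> carrier H" using B_mem f0 by blast+
  have g: "t \<ominus> f0 \<in> D" "\<And>h. h \<in> D \<Longrightarrow> R (t \<ominus> f0) h = z * cinner H (t \<ominus> f0) h + chi h"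
  proof -
    show "t \<ominus> f0 \<in> D" by (rule D_diff[OF t f0c(1)])
    fix h assume h: "h \<in> D"
    have "R f0 h = cinner H ((s \<ominus> z \<odot> t) \<oplus> z \<odot> f0) h"
      using f0 h by (simp add: B_iff)
    then show "R (t \<ominus> f0) h = z * cinner H (t \<ominus> f0) h + chi h"
      unfolding R_rules(3)[OF t f0c(1)] Rt[OF h] using s tH f0c(2) D_in[OF h] by (simp add: algebra_simps)
  qed
  show ?thesis
  proof (rule ex1I[of _ "t \<ominus> f0"])
    show "t \<ominus> f0 \<in> D \<and> (\<forall>h\<in>D. R (t \<ominus> f0) h = z * cinner H (t \<ominus> f0) h + chi h)"
      using g by blast
  next
    fix f assume f: "f \<in> D \<and> (\<forall>h\<in>D. R f h = z * cinner H f h + chi h)"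
    have fH: "f \<in> carrier H" "t \<ominus> f0 \<in> carrier H"
      using f D_in tH f0c by auto
    have "(f \<ominus> (t \<ominus> f0), z \<odot> (f \<ominus> (t \<ominus> f0))) \<in> B"
      unfolding B_iff
    proof (intro conjI ballI)
      fix h assume h: "h \<in> D"
      show "R (f \<ominus> (t \<ominus> f0)) h = cinner H (z \<odot> (f \<ominus> (t \<ominus> f0))) h"
        using R_rules(3)[OF conjunct1[OF f] g(1), of h] g(2)[OF h] f h fH D_in[OF h] by (simp add: algebra_simps del: cinner_diff_left) (simp add: algebra_simps)
    qed (use f g D_diff fH in auto)
    then have "f \<ominus> (t \<ominus> f0) = \<zero>"
      by (rule symmetric_eigen_zero[OF B_linear B_symmetric _ z])
    then show "f = t \<ominus> f0"
      using fH by (simp add: minus_eq_zero_iff)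
  qed
qed

text \<open>Written exactly as in \<open>impedance\<close>, so that \<open>V\<close> becomes the
  impedance function by unfolding. \<open>\<gamma>_equation_iff\<close> translates the equation
  between functionals into one for the form \<open>R\<close>.\<close>

definition "\<gamma> z = (THE f. f \<in> carrier P \<and>
  pm_Re P A f \<ominus>\<^bsub>H_minus H S\<^esub> z \<odot>\<^bsub>H_minus H S\<^esub> embed_minus H S f = K 1)"

lemma \<gamma>_equation_iff:
  assumes f: "f \<in> D"
  shows "pm_Re P A f \<ominus>\<^bsub>H_minus H S\<^esub> z \<odot>\<^bsub>H_minus H S\<^esub> embed_minus H S f = K 1 \<longleftrightarrow>
    (\<forall>h\<in>D. R f h = z * cinner H f h + chi h)"
proof -
  have e: "embed_minus H S f \<in> carrier (antidual P)"
    using embed_minus_in[OF D_in(1)[OF f]] by (simp add: H_minus_def)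
  have "pm_Re P A f \<ominus>\<^bsub>H_minus H S\<^esub> z \<odot>\<^bsub>H_minus H S\<^esub> embed_minus H S f
      = (\<lambda>h. pm_Re P A f h - z * embed_minus H S f h)"
    unfolding H_minus_def using P.antidual_minus[OF pm_Re_in[OF f] P.antidual_smult_in[OF e, of z]] by simp
  moreover have "(\<lambda>h. pm_Re P A f h - z * embed_minus H S f h) = chi \<longleftrightarrow> (\<forall>h\<in>D. R f h = z * cinner H f h + chi h)"
  proof
    assume eq: "(\<lambda>h. pm_Re P A f h - z * embed_minus H S f h) = chi"
    show "\<forall>h\<in>D. R f h = z * cinner H f h + chi h"
    proof
      fix h assume h: "h \<in> D"
      show "R f h = z * cinner H f h + chi h"
        using fun_cong[OF eq, of h] pm_Re_eq[OF f h] h by (simp add: embed_minus_def algebra_simps)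
    qed
  next
    assume a: "\<forall>h\<in>D. R f h = z * cinner H f h + chi h"
    show "(\<lambda>h. pm_Re P A f h - z * embed_minus H S f h) = chi"
    proof
      fix h
      show "pm_Re P A f h - z * embed_minus H S f h = chi h"
      proof (cases "h \<in> D")
        case True
        then show ?thesis using a pm_Re_eq[OF f True] by (simp add: embed_minus_def)
      next
        case False
        then show ?thesis using pm_Re_outside[OF f False] chi_rules(4)[OF False] by (simp add: embed_minus_def)
      qed
    qed
  qed
  ultimately show ?thesis
    by (simp add: chi_def)
qed

section \<open>The defect vectors as a gamma field with the impedance as Q-function\<close>

lemma \<gamma>_equation: assumes "Im z \<noteq> 0" shows "\<gamma> z \<in> D" "h \<in> D \<Longrightarrow> R (\<gamma> z) h = z * cinner H (\<gamma> z) h + chi h"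
proof -
  have "\<gamma> z = (THE f. f \<in> D \<and> (\<forall>h\<in>D. R f h = z * cinner H f h + chi h))"
    unfolding \<gamma>_def by (rule arg_cong[of _ _ The], rule ext, rule conj_cong) (simp_all add: \<gamma>_equation_iff)
  then have "\<gamma> z \<in> D \<and> (\<forall>h\<in>D. R (\<gamma> z) h = z * cinner H (\<gamma> z) h + chi h)"
    using theI'[OF defect_ex1[OF assms]] by metis
  then show "\<gamma> z \<in> D" "h \<in> D \<Longrightarrow> R (\<gamma> z) h = z * cinner H (\<gamma> z) h + chi h"
    by blast+
qed

definition "V z = channel_adjoint K (\<gamma> z)"

lemma V_eq: "V z = cnj (chi (\<gamma> z))"
  by (simp add: V_def channel_adjoint_def dual_pair_def chi_def)

lemma \<gamma>_inH [simp]: "Im z \<noteq> 0 \<Longrightarrow> \<gamma> z \<in> carrier H"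
  using D_in \<gamma>_equation by blast

text \<open>The Hermitian form \<open>R\<close> at \<open>\<gamma> z\<close> and \<open>f\<close>
  equals \<open>(\<gamma> z, g)\<close> through \<open>B\<close>, and
  \<open>z (\<gamma> z, f) + chi f\<close> through the equation of \<open>\<gamma> z\<close>. So on
  Dom B the functional \<open>chi\<close> is \<open>B - cnj z\<close> followed by the pairing with
  \<open>\<gamma> z\<close>.\<close>

lemma chi_B:
  assumes fg: "(f, g) \<in> B" and z: "Im z \<noteq> 0"
  shows "chi f = cinner H (\<gamma> z) (g \<ominus> cnj z \<odot> f)"
proof -
  have c: "f \<in> D" "f \<in> carrier H" "g \<in> carrier H" using B_mem fg by auto
  have "R (\<gamma> z) f = cnj (cinner H g (\<gamma> z))"
    using R_hermitian[OF \<gamma>_equation(1)[OF z] c(1)] fg \<gamma>_equation(1)[OF z] by (simp add: B_iff)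
  then have "R (\<gamma> z) f = cinner H (\<gamma> z) g"
    using cinner_commute[OF c(3) \<gamma>_inH[OF z]] by simp
  then show ?thesis
    using \<gamma>_equation(2)[OF z c(1)] c z by (simp add: algebra_simps)
qed

sublocale defect_field H B \<gamma> V
proof
  show "linear_op H B" by (rule B_linear)
  show "symmetric_op H B" by (rule B_symmetric)
  show "\<exists>f. (f, h \<oplus> z \<odot> f) \<in> B" if "Im z \<noteq> 0" "h \<in> carrier H" for z h
    using self_adjoint_range[OF B_self_adjoint that] by blast
  show "Im z \<noteq> 0 \<Longrightarrow> \<gamma> z \<in> carrier H" for z by simp
  fix z w assume z: "Im z \<noteq> 0" and w: "Im w \<noteq> 0"
  show "(\<gamma> z \<ominus> \<gamma> w, z \<odot> \<gamma> z \<ominus> w \<odot> \<gamma> w) \<in> B"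
    unfolding B_iff
  proof (intro conjI ballI)
    fix h assume h: "h \<in> D"
    show "R (\<gamma> z \<ominus> \<gamma> w) h = cinner H (z \<odot> \<gamma> z \<ominus> w \<odot> \<gamma> w) h"
      using R_rules(3)[OF \<gamma>_equation(1)[OF z] \<gamma>_equation(1)[OF w], of h] \<gamma>_equation(2)[OF z h] \<gamma>_equation(2)[OF w h] z w D_in[OF h] by simp
  qed (use z w D_diff \<gamma>_equation(1) in auto)
  \<comment> \<open>The Hermitian form on two defect vectors, evaluated through the equation of
    either one; \<open>V\<close> is the conjugate of \<open>chi\<close> on them.\<close>
  have "z * cinner H (\<gamma> z) (\<gamma> w) + chi (\<gamma> w) = cnj (w * cinner H (\<gamma> w) (\<gamma> z) + chi (\<gamma> z))"
    using R_hermitian[OF \<gamma>_equation(1)[OF z] \<gamma>_equation(1)[OF w]] \<gamma>_equation(2)[OF z \<gamma>_equation(1)[OF w]] \<gamma>_equation(2)[OF w \<gamma>_equation(1)[OF z]] by simp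
  then show "(z - cnj w) * cinner H (\<gamma> z) (\<gamma> w) = V z - cnj (V w)"
    using cinner_commute[OF \<gamma>_inH[OF w] \<gamma>_inH[OF z]] by (simp add: V_eq algebra_simps)
qed

text \<open>Maximality of \<open>T\<close>. For a resolvent point \<open>l\<close>, let
  \<open>u\<close> in Dom T solve \<open>(T - l) u = g - l f\<close>. Then \<open>d = f - u\<close>
  satisfies \<open>(A - l) d = 0\<close>, while \<open>d\<close> is also in the range of the adjoint
  of \<open>T - l\<close>; pairing the two facts gives \<open>(d, d) = 0\<close>.\<close>

lemma mem_TI:
  assumes f: "f \<in> D" and g: "g \<in> carrier H" and A: "\<And>h. h \<in> D \<Longrightarrow> A f h = cinner H g h"
  shows "(f, g) \<in> T"
proof -
  obtain l where l: "l \<in> resolvent_set H T"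
    using T_facts by blast
  have fH: "f \<in> carrier H" using D_in f by blast
  have res: "(y \<ominus> l \<odot> x, x) \<in> resolvent H T l" if "(x, y) \<in> T" for x y
    using that unfolding resolvent_def by auto
  have sv: "single_valued (resolvent H T l)" and dom: "Domain (resolvent H T l) = carrier H"
    using l by (auto simp: resolvent_set_def)
  obtain C where C: "\<And>h f. (h, f) \<in> resolvent H T l \<Longrightarrow> hnorm H f \<le> C * hnorm H h"
    using l unfolding resolvent_set_def by blast
  have ex: "\<exists>x y. (x, y) \<in> T \<and> k = y \<ominus> l \<odot> x" if "k \<in> carrier H" for k
    using that dom[symmetric] unfolding resolvent_def by auto
  obtain u v where uv: "(u, v) \<in> T" "g \<ominus> l \<odot> f = v \<ominus> l \<odot> u"
    using ex[of "g \<ominus> l \<odot> f"] fH g by auto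
  have uvc: "u \<in> carrier H" "v \<in> carrier H" "u \<in> D"
    using linear_op_in[OF T_facts(1) uv(1)] T_facts(4) uv(1) by auto
  define d where "d = f \<ominus> u"
  have d: "d \<in> D" "d \<in> carrier H"
    using D_diff f uvc fH by (auto simp: d_def)
  have Ad: "A d h = l * cinner H d h" if h: "h \<in> D" for h
  proof -
    have "A d h = A f h - A u h"
      using A_add[OF f D_smult[OF uvc(3)], of "-1" h] A_smult[OF uvc(3), of "-1" h] fH uvc
      by (simp add: d_def diff_as_add)
    also have "\<dots> = cinner H (g \<ominus> v) h"
      using A[OF h] A_T[OF uv(1) h] g uvc D_in[OF h] by simp
    also have "g \<ominus> v = l \<odot> d"
    proof (rule vec_eqI)
      fix w assume w: "w \<in> carrier H"
      have "cinner H (g \<ominus> l \<odot> f) w = cinner H (v \<ominus> l \<odot> u) w"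
        by (simp only: uv(2))
      then show "cinner H (g \<ominus> v) w = cinner H (l \<odot> d) w"
        using w g fH uvc by (simp add: d_def algebra_simps)
    qed (use g uvc d in auto)
    finally show ?thesis
      using d D_in[OF h] by simp
  qed
  \<comment> \<open>The Riesz vector \<open>w\<close> of the functional sending \<open>k\<close> to
    \<open>((T - l)^-1 k, d)\<close> solves the adjoint equation with right-hand side
    \<open>d\<close>. The functional is bounded because \<open>l\<close> is a resolvent
    point.\<close>
  define \<phi> where "\<phi> k = cinner H (op_app (resolvent H T l) k) d" for k
  have \<phi>: "\<phi> (y \<ominus> l \<odot> x) = cinner H x d" if "(x, y) \<in> T" for x y
    unfolding \<phi>_def using op_app_eq[OF sv res[OF that]] by simp
  obtain w where w: "w \<in> carrier H" "\<And>k. k \<in> carrier H \<Longrightarrow> \<phi> k = cinner H k w"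
  proof (rule riesz[of \<phi> "C * hnorm H d"])
    fix a b assume ab: "a \<in> carrier H" "b \<in> carrier H"
    obtain x y x' y' where xy: "(x, y) \<in> T" "a = y \<ominus> l \<odot> x" "(x', y') \<in> T" "b = y' \<ominus> l \<odot> x'"
      using ex ab by metis
    note c = linear_op_in[OF T_facts(1) xy(1)] linear_op_in[OF T_facts(1) xy(3)]
    have "a \<oplus> b = (y \<oplus> y') \<ominus> l \<odot> (x \<oplus> x')"
      unfolding xy using c by (intro vec_eqI) (auto simp: algebra_simps)
    then show "\<phi> (a \<oplus> b) = \<phi> a + \<phi> b"
      using \<phi>[OF linear_op_add[OF T_facts(1) xy(1,3)]] \<phi>[OF xy(1)] \<phi>[OF xy(3)] xy c d by simp
  next
    fix e a assume a: "a \<in> carrier H"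
    obtain x y where xy: "(x, y) \<in> T" "a = y \<ominus> l \<odot> x"
      using ex a by metis
    note c = linear_op_in[OF T_facts(1) xy(1)]
    have "e \<odot> a = (e \<odot> y) \<ominus> l \<odot> (e \<odot> x)"
      unfolding xy using c by (intro vec_eqI) (auto simp: algebra_simps)
    then show "\<phi> (e \<odot> a) = e * \<phi> a"
      using \<phi>[OF linear_op_smult[OF T_facts(1) xy(1)], of e] \<phi>[OF xy(1)] xy c d by simp
  next
    fix a assume a: "a \<in> carrier H"
    obtain x y where xy: "(x, y) \<in> T" "a = y \<ominus> l \<odot> x"
      using ex a by metis
    note c = linear_op_in[OF T_facts(1) xy(1)]
    have "cmod (\<phi> a) \<le> hnorm H x * hnorm H d"
      unfolding xy(2) \<phi>[OF xy(1)] by (rule Cauchy_Schwarz[OF c(1) d(2)])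
    also have "\<dots> \<le> (C * hnorm H a) * hnorm H d"
      using C[OF res[OF xy(1)]] d(2) unfolding xy(2) by (intro mult_right_mono) auto
    finally show "cmod (\<phi> a) \<le> C * hnorm H d * hnorm H a"
      by (simp add: algebra_simps)
  qed blast
  have "(w, d \<oplus> cnj l \<odot> w) \<in> adjoint_op H T"
  proof (rule adjoint_opI)
    fix x y assume xy: "(x, y) \<in> T"
    note c = linear_op_in[OF T_facts(1) xy]
    have "cinner H x d = cinner H (y \<ominus> l \<odot> x) w"
      using \<phi>[OF xy] w(2)[of "y \<ominus> l \<odot> x"] c by simp
    then show "cinner H y w = cinner H x (d \<oplus> cnj l \<odot> w)"
      using c w(1) d by (simp add: algebra_simps)
  qed (use w d in auto)
  \<comment> \<open>On the domain of the adjoint of \<open>T\<close>, the adjoint of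
    \<open>A\<close> acts as the adjoint of \<open>T\<close>; so the pairing of \<open>A d\<close>
    with \<open>w\<close> can be computed from either side.\<close>
  then have *: "cnj (A d w) = cinner H (d \<oplus> cnj l \<odot> w) d" and "w \<in> Domain (adjoint_op H T)"
    using A_T_adjoint d by auto
  then have wD: "w \<in> D"
    using adjoint_op_antimono[OF T_facts(3)] by blast
  have "cnj (l * cinner H d w) = cinner H d d + cnj l * cinner H w d"
    using * Ad[OF wD] w d by simp
  then have "cinner H d d = 0"
    using cinner_commute[OF d(2) w(1)] by simp
  then have "f = u"
    using cinner_self_eq_zero[OF d(2)] fH uvc by (simp add: d_def minus_eq_zero_iff)
  moreover have "g = v"
  proof -
    have "g \<ominus> l \<odot> f = v \<ominus> l \<odot> f"
      using uv(2) \<open>f = u\<close> by simp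
    then have "(g \<ominus> l \<odot> f) \<oplus> l \<odot> f = (v \<ominus> l \<odot> f) \<oplus> l \<odot> f"
      by simp
    moreover have "(y \<ominus> l \<odot> f) \<oplus> l \<odot> f = y" if "y \<in> carrier H" for y
      using that fH by (intro vec_eqI) auto
    ultimately show ?thesis
      using g uvc by simp
  qed
  ultimately show ?thesis
    using uv by simp
qed

text \<open>For \<open>f\<close> in Dom B with \<open>chi f = 0\<close>, the operators
  \<open>A\<close> and Re A agree, so \<open>A f\<close> lies in H and maximality puts
  \<open>f\<close> into Dom T. Hermitian symmetry puts it into the domain of the adjoint of
  \<open>T\<close> as well, and the axioms identify the intersection with Dom S.\<close>

lemma S_eq: "S = {(f, g) \<in> B. chi f = 0}"
proof (intro equalityI subsetI)
  fix p assume "p \<in> S"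
  then show "p \<in> {(f, g) \<in> B. chi f = 0}"
    using S_sub_B chi_S by auto
next
  fix p assume "p \<in> {(f, g) \<in> B. chi f = 0}"
  then obtain f g where p: "p = (f, g)" "(f, g) \<in> B" "chi f = 0"
    by auto
  have c: "f \<in> D" "f \<in> carrier H" "g \<in> carrier H"
    using B_mem[OF p(2)] by simp_all
  have Rf: "R f h = cinner H g h" if "h \<in> D" for h
    using p that by (simp add: B_iff)
  have "(f, g) \<in> T"
    by (rule mem_TI) (use c Rf p in \<open>auto simp: R_def\<close>)
  moreover have "(f, g) \<in> adjoint_op H T"
  proof (rule adjoint_opI)
    fix u v assume uv: "(u, v) \<in> T"
    have u: "u \<in> D" "u \<in> carrier H"
      using T_facts(4) uv D_in by blast+
    have "cinner H v f = R u f"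
      using A_T[OF uv c(1)] p(3) by (simp add: R_def)
    also have "\<dots> = cnj (cinner H g u)"
      using R_hermitian[OF u(1) c(1)] Rf[OF u(1)] by simp
    also have "\<dots> = cinner H u g"
      using cinner_commute[OF c(3) u(2)] by simp
    finally show "cinner H v f = cinner H u g" .
  qed (use c in auto)
  ultimately have "f \<in> Domain S"
    using T_facts(6) by blast
  then obtain g' where g': "(f, g') \<in> S" by auto
  then have "g' = g"
    using linear_op_unique[OF B_linear _ p(2)] S_sub_B by blast
  then show "p \<in> S"
    using g' p by simp
qed

text \<open>The orthogonal complement \<open>M\<close> of the defect vectors is invariant under the
  resolvents of \<open>B\<close>. For right-hand sides in \<open>M\<close>, \<open>chi\<close>
  vanishes on the solutions, so they lie in \<open>S\<close>. Hence the part of \<open>S\<close> in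
  \<open>M\<close> has full ranges at nonreal points and is self-adjoint, \<open>M\<close> reduces
  \<open>S\<close>, and primeness leaves only the zero subspace.\<close>

lemma defect_orth_zero:
  assumes prime: "prime_op H S" and h: "h \<in> carrier H" and orth: "\<And>z. Im z \<noteq> 0 \<Longrightarrow> cinner H h (\<gamma> z) = 0"
  shows "h = \<zero>"
proof -
  define M where "M = {h \<in> carrier H. \<forall>z. Im z \<noteq> 0 \<longrightarrow> cinner H h (\<gamma> z) = 0}"
  have M_in: "x \<in> carrier H" if "x \<in> M" for x
    using that by (simp add: M_def)
  have sub: "hsub H M"
    by (auto simp: hsub_def M_def)
  have closed: "seq_closed H M"
    unfolding seq_closed_def
  proof (intro allI impI)
    fix x l assume x: "\<forall>n. x n \<in> M" and l: "hlim H x l"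
    have "cinner H l (\<gamma> z) = 0" if z: "Im z \<noteq> 0" for z
      using hlim_cinner_left[OF l \<gamma>_inH[OF z]] x z by (simp add: M_def LIMSEQ_const_iff)
    then show "l \<in> M"
      using hlim_in[OF l] by (simp add: M_def)
  qed
  have M_add: "x \<oplus> y \<in> M" and M_smult: "c \<odot> x \<in> M" and M_diff: "x \<ominus> y \<in> M" if "x \<in> M" "y \<in> M" for x y c
    using that by (auto simp: M_def)
  have inv: "f \<in> M" if fg: "(f, k \<oplus> z \<odot> f) \<in> B" and k: "k \<in> M" and z: "Im z \<noteq> 0" for f k z
  proof -
    have f: "f \<in> carrier H" using B_mem fg by blast
    have "(k \<oplus> z \<odot> f) \<ominus> z \<odot> f = k"
      using f M_in[OF k] by (intro vec_eqI) auto
    then have "cinner H f (\<gamma> w) = 0" if "Im w \<noteq> 0" for w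
      using resolvent_orthogonal[OF fg z _ that] k by (simp add: M_def)
    then show ?thesis
      using f by (simp add: M_def)
  qed
  have inS: "(f, k \<oplus> z \<odot> f) \<in> S" if fg: "(f, k \<oplus> z \<odot> f) \<in> B" and k: "k \<in> M" and z: "Im z \<noteq> 0" for f k z
  proof -
    have f: "f \<in> carrier H" using B_mem fg by blast
    have z': "Im (cnj z) \<noteq> 0" using z by simp
    have "(k \<oplus> z \<odot> f) \<ominus> cnj (cnj z) \<odot> f = k"
      using f M_in[OF k] by (intro vec_eqI) auto
    then have "chi f = cinner H (\<gamma> (cnj z)) k"
      using chi_B[OF fg z'] by simp
    also have "\<dots> = cnj (cinner H k (\<gamma> (cnj z)))"
      by (rule cinner_commute[OF M_in[OF k] \<gamma>_inH[OF z']])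
    finally have "chi f = 0"
      using k z' by (simp add: M_def)
    then show ?thesis
      using fg by (subst S_eq) simp
  qed
  have solve: "\<exists>f. f \<in> M \<and> (f, k \<oplus> z \<odot> f) \<in> S" if k: "k \<in> M" and z: "Im z \<noteq> 0" for k z
    using self_adjoint_range[OF B_self_adjoint z M_in[OF k]] inv[OF _ k z] inS[OF _ k z] by metis
  have "reducing_subspace H S M"
    unfolding reducing_subspace_def closed_subspace_iff
  proof (intro conjI sub closed ballI, clarify)
    fix f g assume fg: "(f, g) \<in> S"
    have c: "f \<in> carrier H" "g \<in> carrier H"
      using linear_op_in[OF lin fg] by auto
    obtain h1 where h1: "h1 \<in> M" "\<And>w. w \<in> M \<Longrightarrow> cinner H ((g \<ominus> \<i> \<odot> f) \<ominus> h1) w = 0"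
      using projection[OF sub closed, of "g \<ominus> \<i> \<odot> f"] c by blast
    obtain f1 where f1: "f1 \<in> M" "(f1, h1 \<oplus> \<i> \<odot> f1) \<in> S"
      using solve[OF h1(1), of \<i>] by auto
    define g1 where "g1 = h1 \<oplus> \<i> \<odot> f1"
    define f2 g2 where "f2 = f \<ominus> f1" and "g2 = g \<ominus> g1"
    have g1: "g1 \<in> M"
      unfolding g1_def by (rule M_add[OF h1(1) M_smult[OF f1(1) f1(1)]])
    have c1: "f1 \<in> carrier H" "g1 \<in> carrier H" "h1 \<in> carrier H"
      using f1 g1 h1 M_in by auto
    have c2: "f2 \<in> carrier H" "g2 \<in> carrier H"
      using c c1 by (auto simp: f2_def g2_def)
    have S2: "(f2, g2) \<in> S"
      unfolding f2_def g2_def using linear_op_diff[OF lin fg f1(2)] by (simp add: g1_def)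
    have h2: "g2 \<ominus> \<i> \<odot> f2 = (g \<ominus> \<i> \<odot> f) \<ominus> h1"
      unfolding g2_def f2_def g1_def using c c1 by (intro vec_eqI) (auto simp: algebra_simps)
    \<comment> \<open>\<open>m\<close> is \<open>(S + \<i>) n\<close> for some \<open>n\<close> in
      \<open>M\<close>. Symmetry turns \<open>(f2, m)\<close> into the pairing of
      \<open>(S - \<i>) f2\<close> with \<open>n\<close>, which vanishes by the choice of
      \<open>h1\<close>.\<close>
    have f2M: "cinner H f2 m = 0" if m: "m \<in> M" for m
    proof -
      obtain n where n: "n \<in> M" "(n, m \<oplus> (-\<i>) \<odot> n) \<in> S"
        using solve[OF m, of "-\<i>"] by auto
      have nm: "n \<in> carrier H" "m \<in> carrier H"
        using n m M_in by auto
      have "cinner H g2 n = cinner H f2 (m \<oplus> (-\<i>) \<odot> n)"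
        by (rule symmetric_opD[OF S_sym S2 n(2)])
      moreover have "cinner H (g2 \<ominus> \<i> \<odot> f2) n = 0"
        unfolding h2 by (rule h1(2)[OF n(1)])
      ultimately show ?thesis
        using c2 nm by simp
    qed
    have g2M: "cinner H g2 m = 0" if m: "m \<in> M" for m
    proof -
      have "cinner H (g2 \<ominus> \<i> \<odot> f2) m = 0"
        unfolding h2 by (rule h1(2)[OF m])
      then show ?thesis
        using f2M[OF m] c2 M_in[OF m] by simp
    qed
    have "f = f1 \<oplus> f2"
      unfolding f2_def using c c1 by (intro vec_eqI) auto
    moreover have "(f1, g1) \<in> S \<inter> M \<times> M"
      using f1 g1 by (simp add: g1_def)
    moreover have "(f2, g2) \<in> S \<inter> orth_compl H M \<times> orth_compl H M"
      using S2 f2M g2M c2 by (simp add: orth_compl_def)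
    ultimately show "\<exists>(f\<^sub>1, g\<^sub>1)\<in>S \<inter> M \<times> M. \<exists>(f\<^sub>2, g\<^sub>2)\<in>S \<inter> orth_compl H M \<times> orth_compl H M. f = f\<^sub>1 \<oplus> f\<^sub>2"
      by blast
  qed
  moreover have "self_adjoint_op (H\<lparr>carrier := M\<rparr>) (S \<inter> M \<times> M)"
    unfolding self_adjoint_op_def
  proof
    show "linear_op (H\<lparr>carrier := M\<rparr>) (S \<inter> M \<times> M)"
      unfolding linear_op_def
    proof (intro conjI)
      show "single_valued (S \<inter> M \<times> M)"
        using lin unfolding linear_op_def single_valued_def by blast
      show "(\<zero>\<^bsub>H\<lparr>carrier := M\<rparr>\<^esub>, \<zero>\<^bsub>H\<lparr>carrier := M\<rparr>\<^esub>) \<in> S \<inter> M \<times> M"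
        using linear_op_zero[OF lin] sub by (auto simp: hsub_def)
    qed (auto intro: linear_op_add[OF lin] linear_op_smult[OF lin] M_add M_smult)
    have "(f, k) \<in> S \<inter> M \<times> M" if fk: "(f, k) \<in> adjoint_op (H\<lparr>carrier := M\<rparr>) (S \<inter> M \<times> M)" for f k
    proof -
      have fM: "f \<in> M" and kM: "k \<in> M"
        and adj: "\<And>u v. (u, v) \<in> S \<Longrightarrow> u \<in> M \<Longrightarrow> v \<in> M \<Longrightarrow> cinner H v f = cinner H u k"
        using fk by (auto simp: adjoint_op_def)
      have c: "f \<in> carrier H" "k \<in> carrier H"
        using fM kM M_in by auto
      \<comment> \<open>\<open>f\<close> is compared with the solution \<open>f0\<close> in
        \<open>M\<close> of \<open>(S - \<i>) f0 = k - \<i> f\<close>; the difference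
        \<open>d\<close> is then tested against a \<open>u\<close> in \<open>M\<close> with
        \<open>(S + \<i>) u = d\<close>, which gives \<open>(d, d) = 0\<close>.\<close>
      define h where "h = k \<ominus> \<i> \<odot> f"
      have hM: "h \<in> M"
        unfolding h_def by (rule M_diff[OF kM M_smult[OF fM fM]])
      obtain f0 where f0: "f0 \<in> M" "(f0, h \<oplus> \<i> \<odot> f0) \<in> S"
        using solve[OF hM, of \<i>] by auto
      define d where "d = f \<ominus> f0"
      have dM: "d \<in> M"
        unfolding d_def by (rule M_diff[OF fM f0(1)])
      have c0: "f0 \<in> carrier H" "d \<in> carrier H" "h \<in> carrier H"
        using f0 dM hM M_in by auto
      obtain u where u: "u \<in> M" "(u, d \<oplus> (-\<i>) \<odot> u) \<in> S"
        using solve[OF dM, of "-\<i>"] by auto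
      have uc: "u \<in> carrier H"
        using u M_in by auto
      have "d \<oplus> (-\<i>) \<odot> u \<in> M"
        by (rule M_add[OF dM M_smult[OF u(1) u(1)]])
      then have 1: "cinner H (d \<oplus> (-\<i>) \<odot> u) f = cinner H u k"
        using adj u by blast
      have 2: "cinner H (d \<oplus> (-\<i>) \<odot> u) f0 = cinner H u (h \<oplus> \<i> \<odot> f0)"
        by (rule symmetric_opD[OF S_sym u(2) f0(2)])
      have "cinner H d d = 0"
      proof -
        have "cinner H d f - cinner H d f0 = 0"
          using 1 2 c c0 uc by (simp add: h_def algebra_simps)
        then have "cinner H d (f \<ominus> f0) = 0"
          using c c0 by simp
        then show ?thesis by (simp only: d_def[symmetric])
      qed
      then have "d = \<zero>"
        using cinner_self_eq_zero c0 by blast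
      then have "f = f0"
        using c c0 by (simp add: d_def minus_eq_zero_iff)
      moreover have "h \<oplus> \<i> \<odot> f = k"
        unfolding h_def using c by (intro vec_eqI) auto
      ultimately show ?thesis
        using f0 fM kM by simp
    qed
    moreover have "(f, k) \<in> adjoint_op (H\<lparr>carrier := M\<rparr>) (S \<inter> M \<times> M)" if "(f, k) \<in> S \<inter> M \<times> M" for f k
    proof -
      have "cinner H v f = cinner H u k" if "(u, v) \<in> S" for u v
        by (rule symmetric_opD[OF S_sym that]) (use \<open>(f, k) \<in> S \<inter> M \<times> M\<close> in blast)
      then show ?thesis
        using that by (simp add: adjoint_op_def split_beta)
    qed
    ultimately show "adjoint_op (H\<lparr>carrier := M\<rparr>) (S \<inter> M \<times> M) = S \<inter> M \<times> M"
      by (intro equalityI subrelI)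
  qed
  ultimately have "M = {\<zero>}"
    using prime unfolding prime_op_def by blast
  moreover have "h \<in> M"
    using h orth by (simp add: M_def)
  ultimately show ?thesis by blast
qed

end

section \<open>Prime systems: the operators in terms of B and the defect vector at i\<close>

locale prime_lsystem_data = lsystem_data +
  assumes prime: "prime_op H S"
begin

sublocale gamma_field H B \<gamma> V
  by unfold_locales (rule defect_orth_zero[OF prime])

lemma chi_B_i: "(f, g) \<in> B \<Longrightarrow> chi f = cinner H (\<gamma> \<i>) (g \<oplus> \<i> \<odot> f)"
  using chi_B[of f g \<i>] B_mem[of f g] by simp

lemma S_eq_restriction: "S = {(f, g) \<in> B. cinner H (g \<oplus> \<i> \<odot> f) (\<gamma> \<i>) = 0}"
proof -
  have "chi f = 0 \<longleftrightarrow> cinner H (g \<oplus> \<i> \<odot> f) (\<gamma> \<i>) = 0" if "(f, g) \<in> B" for f g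
    using chi_B_i[OF that] cinner_commute[of "g \<oplus> \<i> \<odot> f" "\<gamma> \<i>"] B_mem[OF that]
    by (simp del: cinner_add_left cinner_add_right)
  then show ?thesis
    unfolding S_eq[symmetric] by (subst S_eq) auto
qed

lemma Sa_eq: "Sa = {(f \<oplus> c \<odot> \<gamma> \<i>, g \<oplus> (\<i> * c) \<odot> \<gamma> \<i>) | f g c. (f, g) \<in> B}"
  by (rule adjoint_restriction[OF S_eq_restriction])

lemma chi_formula:
  assumes "(f, g) \<in> B"
  shows "chi (f \<oplus> c \<odot> \<gamma> \<i>) = cinner H (\<gamma> \<i>) (g \<oplus> \<i> \<odot> f) + cnj (c * V \<i>)"
  using chi_rules(1)[OF B_mem(3)[OF assms] D_smult[OF \<gamma>_equation(1)[of \<i>], of c]]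
    chi_rules(2)[OF \<gamma>_equation(1)[of \<i>], of c] chi_B_i[OF assms] by (simp add: V_eq)

text \<open>Re A acts as \<open>B\<close> on Dom B and adds \<open>chi\<close> on
  \<open>\<gamma> \<i>\<close> by the defining equation; Im A contributes the other multiple of
  \<open>chi\<close>. With \<open>chi_formula\<close>, the right side depends only on
  \<open>B\<close>, \<open>\<gamma> \<i>\<close> and \<open>V \<i>\<close>, all of which an
  equivalence of gamma fields preserves.\<close>

lemma A_formula:
  assumes fg: "(f, g) \<in> B" and h: "h \<in> D"
  shows "A (f \<oplus> c \<odot> \<gamma> \<i>) h =
    cinner H (g \<oplus> (\<i> * c) \<odot> \<gamma> \<i>) h + (c + \<i> * cnj (chi (f \<oplus> c \<odot> \<gamma> \<i>))) * chi h"
proof -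
  have i: "\<gamma> \<i> \<in> D" by (rule \<gamma>_equation(1)) simp
  have "A (f \<oplus> c \<odot> \<gamma> \<i>) h = R (f \<oplus> c \<odot> \<gamma> \<i>) h + \<i> * cnj (chi (f \<oplus> c \<odot> \<gamma> \<i>)) * chi h"
    by (simp add: R_def)
  also have "R (f \<oplus> c \<odot> \<gamma> \<i>) h = R f h + c * R (\<gamma> \<i>) h"
    using R_rules(1)[OF B_mem(3)[OF fg] D_smult[OF i], of c h] R_rules(2)[OF i i, of c h] by simp
  also have "R f h = cinner H g h"
    using fg h by (simp add: B_iff)
  also have "R (\<gamma> \<i>) h = \<i> * cinner H (\<gamma> \<i>) h + chi h"
    by (rule \<gamma>_equation(2)[OF _ h]) simp
  finally show ?thesis
    using B_mem[OF fg] D_in[OF h] by (simp add: algebra_simps)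
qed

text \<open>If the coefficient of \<open>chi\<close> in \<open>A_formula\<close> vanishes, the image
  lies in H and maximality applies. Conversely, for an element of \<open>T\<close> the formula is
  compared with the action of \<open>T\<close> at a vector on which \<open>chi\<close> does not
  vanish.\<close>

lemma T_eq: "T = {(f \<oplus> c \<odot> \<gamma> \<i>, g \<oplus> (\<i> * c) \<odot> \<gamma> \<i>) | f g c.
    (f, g) \<in> B \<and> c + \<i> * cnj (chi (f \<oplus> c \<odot> \<gamma> \<i>)) = 0}"
proof (intro equalityI subsetI)
  fix p assume p: "p \<in> T"
  then have "p \<in> Sa"
    using T_facts by blast
  then obtain f g c where fgc: "p = (f \<oplus> c \<odot> \<gamma> \<i>, g \<oplus> (\<i> * c) \<odot> \<gamma> \<i>)" and fg: "(f, g) \<in> B"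
    unfolding Sa_eq by auto
  obtain t s where t: "(t, s) \<in> T" "chi t \<noteq> 0"
    by (rule chi_nonzero)
  have tD: "t \<in> D"
    using t T_facts by blast
  have "A (f \<oplus> c \<odot> \<gamma> \<i>) t = cinner H (g \<oplus> (\<i> * c) \<odot> \<gamma> \<i>) t"
    by (rule A_T[OF p[unfolded fgc] tD])
  then have "c + \<i> * cnj (chi (f \<oplus> c \<odot> \<gamma> \<i>)) = 0"
    using A_formula[OF fg tD, of c] t(2) by simp
  then show "p \<in> {(f \<oplus> c \<odot> \<gamma> \<i>, g \<oplus> (\<i> * c) \<odot> \<gamma> \<i>) | f g c.
    (f, g) \<in> B \<and> c + \<i> * cnj (chi (f \<oplus> c \<odot> \<gamma> \<i>)) = 0}"
    using fgc fg by blast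
next
  fix p assume "p \<in> {(f \<oplus> c \<odot> \<gamma> \<i>, g \<oplus> (\<i> * c) \<odot> \<gamma> \<i>) | f g c.
    (f, g) \<in> B \<and> c + \<i> * cnj (chi (f \<oplus> c \<odot> \<gamma> \<i>)) = 0}"
  then obtain f g c where p: "p = (f \<oplus> c \<odot> \<gamma> \<i>, g \<oplus> (\<i> * c) \<odot> \<gamma> \<i>)" and fg: "(f, g) \<in> B"
    and 0: "c + \<i> * cnj (chi (f \<oplus> c \<odot> \<gamma> \<i>)) = 0"
    by blast
  have "p \<in> Sa"
    unfolding Sa_eq p using fg by blast
  then show "p \<in> T"
    unfolding p using B_mem[OF fg] A_formula[OF fg, of _ c] 0 by (intro mem_TI) auto
qed

end

section \<open>The Hilbert space of square integrable functions\<close>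

locale l2 =
  fixes \<mu> :: "real measure"
  assumes sets_\<mu>: "sets \<mu> = sets borel"
begin

lemma space_\<mu> [simp]: "space \<mu> = UNIV"
  using sets_eq_imp_space_eq[OF sets_\<mu>] by simp

lemma measurable_\<mu> [simp]: "borel_measurable \<mu> = borel_measurable borel"
  by (rule measurable_cong_sets[OF sets_\<mu> refl])

lemma l2_funI: "\<lbrakk>f \<in> borel_measurable borel; integrable \<mu> (\<lambda>x. (cmod (f x))\<^sup>2)\<rbrakk> \<Longrightarrow> f \<in> l2_fun \<mu>"
  by (simp add: l2_fun_def)

lemma l2_funD: "f \<in> l2_fun \<mu> \<Longrightarrow> f \<in> borel_measurable borel"
  "f \<in> l2_fun \<mu> \<Longrightarrow> integrable \<mu> (\<lambda>x. (cmod (f x))\<^sup>2)"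
  by (simp_all add: l2_fun_def)

lemma l2_fun_dominated:
  assumes "f \<in> borel_measurable borel" "integrable \<mu> g" "\<And>x. (cmod (f x))\<^sup>2 \<le> g x"
  shows "f \<in> l2_fun \<mu>"
proof (rule l2_funI[OF assms(1)], rule Bochner_Integration.integrable_bound[OF assms(2)])
  show "(\<lambda>x. (cmod (f x))\<^sup>2) \<in> borel_measurable \<mu>"
    using assms(1) by simp
  show "AE x in \<mu>. norm ((cmod (f x))\<^sup>2) \<le> norm (g x)"
    using assms(3) by (auto intro!: AE_I2 order_trans[OF assms(3)])
qed

lemma l2_fun_add:
  assumes f: "f \<in> l2_fun \<mu>" and g: "g \<in> l2_fun \<mu>"
  shows "(\<lambda>x. f x + g x) \<in> l2_fun \<mu>"
proof (rule l2_fun_dominated)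
  show "(\<lambda>x. f x + g x) \<in> borel_measurable borel"
    using l2_funD(1)[OF f] l2_funD(1)[OF g] by simp
  show "integrable \<mu> (\<lambda>x. 2 * (cmod (f x))\<^sup>2 + 2 * (cmod (g x))\<^sup>2)"
    using l2_funD(2)[OF f] l2_funD(2)[OF g] by simp
  fix x
  have "(cmod (f x + g x))\<^sup>2 \<le> (cmod (f x) + cmod (g x))\<^sup>2"
    by (intro power_mono norm_triangle_ineq) simp
  also have "\<dots> \<le> 2 * (cmod (f x))\<^sup>2 + 2 * (cmod (g x))\<^sup>2"
    using zero_le_power2[of "cmod (f x) - cmod (g x)"] by (simp add: power2_sum power2_diff)
  finally show "(cmod (f x + g x))\<^sup>2 \<le> 2 * (cmod (f x))\<^sup>2 + 2 * (cmod (g x))\<^sup>2" .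
qed

lemma l2_fun_smult: "f \<in> l2_fun \<mu> \<Longrightarrow> (\<lambda>x. c * f x) \<in> l2_fun \<mu>"
  by (auto simp: l2_fun_def norm_mult power_mult_distrib)

lemma l2_fun_zero: "(\<lambda>_. 0) \<in> l2_fun \<mu>"
  by (simp add: l2_fun_def)

lemma l2_fun_diff: "\<lbrakk>f \<in> l2_fun \<mu>; g \<in> l2_fun \<mu>\<rbrakk> \<Longrightarrow> (\<lambda>x. f x - g x) \<in> l2_fun \<mu>"
  using l2_fun_add[of f "\<lambda>x. - 1 * g x"] l2_fun_smult[of g "-1"] by simp

lemma borel_measurable_cnj [measurable (raw)]:
  "f \<in> borel_measurable M \<Longrightarrow> (\<lambda>x. cnj (f x)) \<in> borel_measurable M"
  using measurable_compose[of f M borel cnj borel] borel_measurable_continuous_onI[of cnj]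
  by (simp add: continuous_on_cnj)

lemma l2_integrable_mult:
  assumes f: "f \<in> l2_fun \<mu>" and g: "g \<in> l2_fun \<mu>"
  shows "integrable \<mu> (\<lambda>x. f x * cnj (g x))"
proof (rule Bochner_Integration.integrable_bound[of _ "\<lambda>x. (cmod (f x))\<^sup>2 + (cmod (g x))\<^sup>2"])
  show "integrable \<mu> (\<lambda>x. (cmod (f x))\<^sup>2 + (cmod (g x))\<^sup>2)"
    using l2_funD(2)[OF f] l2_funD(2)[OF g] by simp
  show "(\<lambda>x. f x * cnj (g x)) \<in> borel_measurable \<mu>"
    using l2_funD(1)[OF f] l2_funD(1)[OF g] by (simp add: borel_measurable_cnj)
  show "AE x in \<mu>. norm (f x * cnj (g x)) \<le> norm ((cmod (f x))\<^sup>2 + (cmod (g x))\<^sup>2)"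
  proof (intro AE_I2)
    fix x
    have "2 * (cmod (f x) * cmod (g x)) \<le> (cmod (f x))\<^sup>2 + (cmod (g x))\<^sup>2"
      using zero_le_power2[of "cmod (f x) - cmod (g x)"] by (simp add: power2_diff)
    moreover have "0 \<le> cmod (f x) * cmod (g x)"
      by simp
    ultimately have "cmod (f x) * cmod (g x) \<le> (cmod (f x))\<^sup>2 + (cmod (g x))\<^sup>2"
      by linarith
    then show "norm (f x * cnj (g x)) \<le> norm ((cmod (f x))\<^sup>2 + (cmod (g x))\<^sup>2)"
      by (simp add: norm_mult)
  qed
qed

lemma l2_fun_AE:
  assumes "f \<in> l2_fun \<mu>" "g \<in> borel_measurable borel" "AE x in \<mu>. f x = g x"
  shows "g \<in> l2_fun \<mu>"
proof (rule l2_funI[OF assms(2)])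
  show "integrable \<mu> (\<lambda>x. (cmod (g x))\<^sup>2)"
    using l2_funD[OF assms(1)] assms(2,3)
    by (subst integrable_cong_AE[where g="\<lambda>x. (cmod (f x))\<^sup>2"]) auto
qed

section \<open>Classes of square integrable functions\<close>

abbreviation "cl \<equiv> l2_class \<mu>"

lemma equiv_l2: "equiv (l2_fun \<mu>) (l2_rel \<mu>)"
proof (rule equivI)
  show "l2_rel \<mu> \<subseteq> l2_fun \<mu> \<times> l2_fun \<mu>" "refl_on (l2_fun \<mu>) (l2_rel \<mu>)"
    by (auto simp: refl_on_def l2_rel_def)
  show "sym (l2_rel \<mu>)"
    by (auto simp: sym_def l2_rel_def elim: AE_mp)
  show "trans (l2_rel \<mu>)"
    unfolding trans_def l2_rel_def by (auto elim!: AE_mp)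
qed

lemma cl_in [simp, intro]: "f \<in> l2_fun \<mu> \<Longrightarrow> cl f \<in> carrier (L2 \<mu>)"
  by (simp add: L2_def l2_class_def quotientI)

lemma cl_eq_iff: "\<lbrakk>f \<in> l2_fun \<mu>; g \<in> l2_fun \<mu>\<rbrakk> \<Longrightarrow> cl f = cl g \<longleftrightarrow> (AE x in \<mu>. f x = g x)"
  unfolding l2_class_def using eq_equiv_class_iff[OF equiv_l2, of f g] by (simp add: l2_rel_def)

lemma carrier_E:
  assumes "F \<in> carrier (L2 \<mu>)"
  obtains f where "f \<in> l2_fun \<mu>" "F = cl f"
  using assms by (auto simp: L2_def l2_class_def elim: quotientE)

text \<open>\<open>l2_rep\<close> picks an arbitrary member of the class, so it recovers
  \<open>f\<close> only almost everywhere. Through this fact the operations of \<open>L2\<close> are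
  computed on given functions.\<close>

lemma rep_cl:
  assumes f: "f \<in> l2_fun \<mu>"
  shows "l2_rep (cl f) \<in> l2_fun \<mu>" "AE x in \<mu>. l2_rep (cl f) x = f x"
proof -
  have "f \<in> cl f"
    using f by (simp add: l2_class_def l2_rel_def)
  then have "l2_rep (cl f) \<in> cl f"
    unfolding l2_rep_def by (rule someI[of "\<lambda>g. g \<in> cl f"])
  then show "l2_rep (cl f) \<in> l2_fun \<mu>" "AE x in \<mu>. l2_rep (cl f) x = f x"
    by (auto simp: l2_class_def l2_rel_def elim: AE_mp)
qed

lemma rep_in: "F \<in> carrier (L2 \<mu>) \<Longrightarrow> l2_rep F \<in> l2_fun \<mu>"
  by (metis carrier_E rep_cl(1))

lemma cl_rep: "F \<in> carrier (L2 \<mu>) \<Longrightarrow> cl (l2_rep F) = F"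
  by (metis carrier_E rep_cl cl_eq_iff)

lemma add_cl [simp]:
  assumes f: "f \<in> l2_fun \<mu>" and g: "g \<in> l2_fun \<mu>"
  shows "cl f \<oplus>\<^bsub>L2 \<mu>\<^esub> cl g = cl (\<lambda>x. f x + g x)"
proof -
  have "AE x in \<mu>. l2_rep (cl f) x + l2_rep (cl g) x = f x + g x"
    using rep_cl(2)[OF f] rep_cl(2)[OF g] by eventually_elim simp
  then show ?thesis
    using f g by (simp add: L2_def cl_eq_iff l2_fun_add rep_cl)
qed

lemma smult_cl [simp]:
  assumes f: "f \<in> l2_fun \<mu>"
  shows "c \<odot>\<^bsub>L2 \<mu>\<^esub> cl f = cl (\<lambda>x. c * f x)"
proof -
  have "AE x in \<mu>. c * l2_rep (cl f) x = c * f x"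
    using rep_cl(2)[OF f] by eventually_elim simp
  then show ?thesis
    using f by (simp add: L2_def cl_eq_iff l2_fun_smult rep_cl)
qed

lemma zero_L2: "\<zero>\<^bsub>L2 \<mu>\<^esub> = cl (\<lambda>_. 0)"
  by (simp add: L2_def)

lemma integral_rep:
  assumes f: "f \<in> l2_fun \<mu>"
  shows "(\<integral>x. l2_rep (cl f) x \<partial>\<mu>) = (\<integral>x. f x \<partial>\<mu>)"
  using rep_cl[OF f] l2_funD(1) f by (intro integral_cong_AE) auto

lemma cinner_cl [simp]:
  assumes f: "f \<in> l2_fun \<mu>" and g: "g \<in> l2_fun \<mu>"
  shows "cinner (L2 \<mu>) (cl f) (cl g) = (\<integral>x. f x * cnj (g x) \<partial>\<mu>)"
proof -
  have "AE x in \<mu>. l2_rep (cl f) x * cnj (l2_rep (cl g) x) = f x * cnj (g x)"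
    using rep_cl(2)[OF f] rep_cl(2)[OF g] by eventually_elim simp
  then show ?thesis
    using rep_cl(1)[OF f] rep_cl(1)[OF g] f g
    by (simp add: L2_def, intro integral_cong_AE) (auto intro!: borel_measurable_times borel_measurable_cnj dest: l2_funD(1))
qed

sublocale L2: inner_space "L2 \<mu>"
proof (rule inner_space.intro)
  note rules = l2_fun_add l2_fun_smult l2_fun_zero
  show "module complex_ring (L2 \<mu>)"
    by (rule module_complexI) (auto elim!: carrier_E simp: rules zero_L2 algebra_simps)
  fix F G K c
  show "cinner (L2 \<mu>) (F \<oplus>\<^bsub>L2 \<mu>\<^esub> G) K = cinner (L2 \<mu>) F K + cinner (L2 \<mu>) G K"
    if F: "F \<in> carrier (L2 \<mu>)" and G: "G \<in> carrier (L2 \<mu>)" and K: "K \<in> carrier (L2 \<mu>)"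
  proof -
    obtain f where f: "f \<in> l2_fun \<mu>" "F = cl f" using carrier_E[OF F] .
    obtain g where g: "g \<in> l2_fun \<mu>" "G = cl g" using carrier_E[OF G] .
    obtain k where k: "k \<in> l2_fun \<mu>" "K = cl k" using carrier_E[OF K] .
    show ?thesis
      unfolding f(2) g(2) k(2) using f(1) g(1) k(1)
      by (simp add: rules distrib_right l2_integrable_mult)
  qed
  show "cinner (L2 \<mu>) (c \<odot>\<^bsub>L2 \<mu>\<^esub> F) G = c * cinner (L2 \<mu>) F G"
    if F: "F \<in> carrier (L2 \<mu>)" and G: "G \<in> carrier (L2 \<mu>)"
  proof -
    obtain f where f: "f \<in> l2_fun \<mu>" "F = cl f" using carrier_E[OF F] .
    obtain g where g: "g \<in> l2_fun \<mu>" "G = cl g" using carrier_E[OF G] .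
    note fg = f g
    show ?thesis
      unfolding fg(2,4) using fg(1,3) by (simp add: rules mult.assoc)
  qed
  show "cinner (L2 \<mu>) G F = cnj (cinner (L2 \<mu>) F G)" if F: "F \<in> carrier (L2 \<mu>)" and G: "G \<in> carrier (L2 \<mu>)"
  proof -
    obtain f where f: "f \<in> l2_fun \<mu>" "F = cl f" using carrier_E[OF F] .
    obtain g where g: "g \<in> l2_fun \<mu>" "G = cl g" using carrier_E[OF G] .
    note fg = f g
    have "(\<integral>x. g x * cnj (f x) \<partial>\<mu>) = (\<integral>x. cnj (f x * cnj (g x)) \<partial>\<mu>)"
      by (intro Bochner_Integration.integral_cong) auto
    also have "\<dots> = cnj (\<integral>x. f x * cnj (g x) \<partial>\<mu>)"
      by (rule Bochner_Integration.integral_cnj)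
    finally show ?thesis
      using fg by simp
  qed
  show "0 < Re (cinner (L2 \<mu>) F F)" if F: "F \<in> carrier (L2 \<mu>)" "F \<noteq> \<zero>\<^bsub>L2 \<mu>\<^esub>"
  proof -
    obtain f where f: "f \<in> l2_fun \<mu>" "F = cl f"
      using carrier_E[OF F(1)] .
    have "(\<lambda>x. f x * cnj (f x)) = (\<lambda>x. complex_of_real ((cmod (f x))\<^sup>2))"
      by (simp only: complex_norm_square)
    then have eq: "cinner (L2 \<mu>) F F = of_real (\<integral>x. (cmod (f x))\<^sup>2 \<partial>\<mu>)"
      using f by (simp del: of_real_power)
    have "(\<integral>x. (cmod (f x))\<^sup>2 \<partial>\<mu>) \<noteq> 0"
    proof
      assume "(\<integral>x. (cmod (f x))\<^sup>2 \<partial>\<mu>) = 0"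
      then have "AE x in \<mu>. (cmod (f x))\<^sup>2 = 0"
        using integral_nonneg_eq_0_iff_AE[OF l2_funD(2)[OF f(1)]] by simp
      then have "AE x in \<mu>. f x = 0"
        by simp
      then show False
        using F(2) f l2_fun_zero by (simp add: zero_L2 cl_eq_iff)
    qed
    moreover have "0 \<le> (\<integral>x. (cmod (f x))\<^sup>2 \<partial>\<mu>)"
      by (intro integral_nonneg_AE) simp
    ultimately have "0 < (\<integral>x. (cmod (f x))\<^sup>2 \<partial>\<mu>)"
      by linarith
    then show ?thesis
      unfolding eq by (simp del: of_real_power)
  qed
qed

lemma diff_cl [simp]:
  assumes f: "f \<in> l2_fun \<mu>" and g: "g \<in> l2_fun \<mu>"
  shows "cl f \<ominus>\<^bsub>L2 \<mu>\<^esub> cl g = cl (\<lambda>x. f x - g x)"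
  using add_cl[OF f l2_fun_smult[OF g, of "-1"]] smult_cl[OF g, of "-1"] f g
  by (simp add: L2.diff_as_add)

lemma hnorm_cl_sq: "f \<in> l2_fun \<mu> \<Longrightarrow> (hnorm (L2 \<mu>) (cl f))\<^sup>2 = (\<integral>x. (cmod (f x))\<^sup>2 \<partial>\<mu>)"
proof -
  assume f: "f \<in> l2_fun \<mu>"
  have "(\<lambda>x. f x * cnj (f x)) = (\<lambda>x. complex_of_real ((cmod (f x))\<^sup>2))"
    by (simp only: complex_norm_square)
  then show ?thesis
    using f L2.hnorm_sq[of "cl f"] by (simp del: of_real_power)
qed

lemma nn_integral_cl:
  assumes f: "f \<in> l2_fun \<mu>"
  shows "(\<integral>\<^sup>+x. ennreal ((cmod (f x))\<^sup>2) \<partial>\<mu>) = ennreal ((hnorm (L2 \<mu>) (cl f))\<^sup>2)"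
  unfolding hnorm_cl_sq[OF f] by (rule nn_integral_eq_integral[OF l2_funD(2)[OF f]]) simp

text \<open>Riesz--Fischer: the summability of \<open>2\<^sup>n \<bar>d\<^sub>n\<bar>\<^sup>2\<close> controls that of \<open>\<bar>d\<^sub>n\<bar>\<close> through
  \<open>\<bar>d\<^sub>n\<bar> \<le> 2\<^sup>-\<^sup>n + 2\<^sup>n \<bar>d\<^sub>n\<bar>\<^sup>2\<close>, which avoids the Minkowski inequality for series.\<close>

lemma L2_complete:
  assumes F: "hCauchy (L2 \<mu>) F"
  shows "\<exists>L. hlim (L2 \<mu>) F L"
proof -
  have Fc: "F n \<in> carrier (L2 \<mu>)" for n
    using F by (simp add: hCauchy_def)
  define f where "f n = l2_rep (F n)" for n
  have f: "f n \<in> l2_fun \<mu>" "F n = cl (f n)" for n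
    using rep_in[OF Fc] cl_rep[OF Fc] by (auto simp: f_def)
  have fm [measurable]: "f n \<in> borel_measurable borel" for n
    using f l2_funD by blast
  have "\<exists>N. \<forall>p q. N \<le> p \<longrightarrow> N \<le> q \<longrightarrow> hnorm (L2 \<mu>) (F p \<ominus>\<^bsub>L2 \<mu>\<^esub> F q) < (1/2) ^ n" for n
    using F unfolding hCauchy_def by simp
  then obtain M where M: "\<And>n p q. M n \<le> p \<Longrightarrow> M n \<le> q \<Longrightarrow> hnorm (L2 \<mu>) (F p \<ominus>\<^bsub>L2 \<mu>\<^esub> F q) < (1/2) ^ n"
    by metis
  \<comment> \<open>Summing makes \<open>r m\<close> dominate every \<open>M n\<close> with
    \<open>n <= m\<close>, so one sequence of indices meets all earlier tolerances as well.\<close>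
  define r where "r n = (\<Sum>i\<le>n. M i)" for n
  have r: "M n \<le> r m" if "n \<le> m" for n m
    unfolding r_def using that by (intro member_le_sum) auto
  define g where "g n = f (r n)" for n
  have gm [measurable]: "g n \<in> borel_measurable borel" for n
    by (simp add: g_def)
  have bound: "(\<integral>\<^sup>+x. ennreal ((cmod (f p x - f q x))\<^sup>2) \<partial>\<mu>) \<le> ennreal ((1/4) ^ n)" if "M n \<le> p" "M n \<le> q" for n p q
  proof -
    have "0 \<le> hnorm (L2 \<mu>) (cl (\<lambda>x. f p x - f q x))"
      using f by (intro L2.hnorm_nonneg cl_in l2_fun_diff)
    moreover have "hnorm (L2 \<mu>) (cl (\<lambda>x. f p x - f q x)) < (1/2) ^ n"
      using M[OF that] f by simp
    ultimately have "(hnorm (L2 \<mu>) (cl (\<lambda>x. f p x - f q x)))\<^sup>2 \<le> ((1/2) ^ n)\<^sup>2"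
      by (intro power_mono) auto
    also have "\<dots> = (1/4) ^ n"
      by (simp add: power2_eq_square flip: power_mult_distrib)
    finally show ?thesis
      using nn_integral_cl[OF l2_fun_diff[OF f(1) f(1)], of p q] by (simp add: ennreal_leI)
  qed
  define w where "w n x = 2 ^ n * (cmod (g (Suc n) x - g n x))\<^sup>2" for n x
  have "(\<integral>\<^sup>+x. (\<Sum>n. ennreal (w n x)) \<partial>\<mu>) = (\<Sum>n. \<integral>\<^sup>+x. ennreal (w n x) \<partial>\<mu>)"
    by (rule nn_integral_suminf) (simp add: w_def)
  also have "\<dots> \<le> (\<Sum>n. ennreal ((1/2) ^ n))"
  proof (rule suminf_le)
    fix n
    have "(\<integral>\<^sup>+x. ennreal (w n x) \<partial>\<mu>) = (\<integral>\<^sup>+x. ennreal (2 ^ n) * ennreal ((cmod (f (r (Suc n)) x - f (r n) x))\<^sup>2) \<partial>\<mu>)"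
      by (simp add: w_def g_def ennreal_mult)
    also have "\<dots> = ennreal (2 ^ n) * (\<integral>\<^sup>+x. ennreal ((cmod (f (r (Suc n)) x - f (r n) x))\<^sup>2) \<partial>\<mu>)"
      by (rule nn_integral_cmult) simp
    also have "\<dots> \<le> ennreal (2 ^ n) * ennreal ((1/4) ^ n)"
      by (intro mult_left_mono bound r) auto
    also have "\<dots> = ennreal ((1/2) ^ n)"
      by (simp flip: ennreal_mult power_mult_distrib)
    finally show "(\<integral>\<^sup>+x. ennreal (w n x) \<partial>\<mu>) \<le> ennreal ((1/2) ^ n)" .
  qed auto
  also have "\<dots> < \<infinity>"
    using geometric_sums[of "1/2::real"] by (subst suminf_ennreal_eq[where x=2]) auto
  finally have fin: "(\<integral>\<^sup>+x. (\<Sum>n. ennreal (w n x)) \<partial>\<mu>) \<noteq> \<infinity>"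
    by simp
  have "AE x in \<mu>. (\<Sum>n. ennreal (w n x)) \<noteq> \<infinity>"
    by (rule nn_integral_noteq_infinite) (use fin in \<open>auto simp: w_def\<close>)
  then have conv: "AE x in \<mu>. (\<lambda>n. g n x) \<longlonglongrightarrow> lim (\<lambda>n. g n x)"
  proof eventually_elim
    case (elim x)
    have "summable (\<lambda>n. w n x)"
      using elim by (intro summable_suminf_not_top) (simp_all add: w_def)
    then have "summable (\<lambda>n. (1/2) ^ n + w n x)"
      by (intro summable_add summable_geometric) auto
    then have "summable (\<lambda>n. g (Suc n) x - g n x)"
    proof (rule summable_comparison_test[rotated], intro exI allI impI)
      fix n
      define d where "d = cmod (g (Suc n) x - g n x)"
      have "0 \<le> 2 ^ n * (d - (1/2) ^ n)\<^sup>2"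
        by simp
      also have "\<dots> = 2 ^ n * d\<^sup>2 - 2 * ((2 * (1/2)) ^ n) * d + (2 * (1/2)) ^ n * (1/2) ^ n"
        unfolding power_mult_distrib by (simp add: power2_diff algebra_simps power2_eq_square)
      finally have "2 * d \<le> (1/2) ^ n + 2 ^ n * d\<^sup>2"
        by simp
      moreover have "0 \<le> d" by (simp add: d_def)
      ultimately have "d \<le> (1/2) ^ n + 2 ^ n * d\<^sup>2"
        by linarith
      then show "norm (g (Suc n) x - g n x) \<le> (1/2) ^ n + w n x"
        by (simp add: d_def w_def)
    qed
    then have "convergent (\<lambda>n. \<Sum>i<n. g (Suc i) x - g i x)"
      by (simp add: summable_iff_convergent)
    then have "convergent (\<lambda>n. g n x - g 0 x)"
      by (simp only: sum_lessThan_telescope[of "\<lambda>i. g i x"])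
    then have "convergent (\<lambda>n. g n x)"
      using convergent_add[OF _ convergent_const[of "g 0 x"]] by fastforce
    then show ?case
      by (simp add: convergent_LIMSEQ_iff)
  qed
  define G where "G x = lim (\<lambda>n. g n x)" for x
  have Gm [measurable]: "G \<in> borel_measurable borel"
    unfolding G_def[abs_def] by (rule borel_measurable_lim_metric) simp
  \<comment> \<open>Fatou's lemma along the almost everywhere convergent subsequence. The shift by
    \<open>n\<close> makes all indices \<open>r (m + n)\<close> at least \<open>M n\<close>, so that
    \<open>bound\<close> applies to every term.\<close>
  have fatou: "(\<integral>\<^sup>+x. ennreal ((cmod (f p x - G x))\<^sup>2) \<partial>\<mu>) \<le> ennreal ((1/4) ^ n)" if p: "M n \<le> p" for n p
  proof -
    have "(\<integral>\<^sup>+x. ennreal ((cmod (f p x - G x))\<^sup>2) \<partial>\<mu>)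
        = (\<integral>\<^sup>+x. liminf (\<lambda>m. ennreal ((cmod (f p x - g (m + n) x))\<^sup>2)) \<partial>\<mu>)"
    proof (rule nn_integral_cong_AE, use conv in eventually_elim)
      case (elim x)
      have "(\<lambda>m. g (m + n) x) \<longlonglongrightarrow> G x"
        using elim unfolding G_def by (rule LIMSEQ_ignore_initial_segment)
      then have "(\<lambda>m. ennreal ((cmod (f p x - g (m + n) x))\<^sup>2)) \<longlonglongrightarrow> ennreal ((cmod (f p x - G x))\<^sup>2)"
        by (intro tendsto_intros)
      then show ?case
        by (rule lim_imp_Liminf[OF trivial_limit_sequentially, symmetric])
    qed
    also have "\<dots> \<le> liminf (\<lambda>m. \<integral>\<^sup>+x. ennreal ((cmod (f p x - g (m + n) x))\<^sup>2) \<partial>\<mu>)"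
      by (rule nn_integral_liminf) simp
    also have "\<dots> \<le> liminf (\<lambda>m. ennreal ((1/4) ^ n))"
      unfolding g_def by (intro Liminf_mono always_eventually allI bound p r) simp
    also have "\<dots> = ennreal ((1/4) ^ n)"
      by (simp add: Liminf_const)
    finally show ?thesis .
  qed
  have diff: "(\<lambda>x. f p x - G x) \<in> l2_fun \<mu>" if "M 0 \<le> p" for p
  proof (rule l2_funI)
    have "(\<integral>\<^sup>+x. ennreal ((cmod (f p x - G x))\<^sup>2) \<partial>\<mu>) < \<infinity>"
      using fatou[OF that] by (rule order_le_less_trans) simp
    then show "integrable \<mu> (\<lambda>x. (cmod (f p x - G x))\<^sup>2)"
      by (intro integrableI_nonneg) auto
  qed simp
  have "(\<lambda>x. f (M 0) x - (f (M 0) x - G x)) \<in> l2_fun \<mu>"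
    by (rule l2_fun_diff[OF f(1) diff]) simp
  then have G: "G \<in> l2_fun \<mu>" by simp
  have "hlim (L2 \<mu>) F (cl G)"
    unfolding hlim_def
  proof (intro conjI allI Fc cl_in G)
    show "(\<lambda>n. hnorm (L2 \<mu>) (F n \<ominus>\<^bsub>L2 \<mu>\<^esub> cl G)) \<longlonglongrightarrow> 0"
    proof (rule LIMSEQ_I)
      fix e :: real assume e: "0 < e"
      obtain n where n: "(1/2) ^ n < e"
        using real_arch_pow_inv[OF e, of "1/2"] by auto
      have "norm (hnorm (L2 \<mu>) (F p \<ominus>\<^bsub>L2 \<mu>\<^esub> cl G) - 0) < e" if p: "M n \<le> p" for p
      proof -
        have "ennreal ((hnorm (L2 \<mu>) (cl (\<lambda>x. f p x - G x)))\<^sup>2) \<le> ennreal ((1/4) ^ n)"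
          using fatou[OF p] nn_integral_cl[OF l2_fun_diff[OF f(1) G]] by metis
        then have "(hnorm (L2 \<mu>) (cl (\<lambda>x. f p x - G x)))\<^sup>2 \<le> (1/4) ^ n"
          by (simp add: ennreal_le_iff)
        also have "(1/4::real) ^ n = ((1/2) ^ n)\<^sup>2"
          by (simp add: power2_eq_square flip: power_mult_distrib)
        finally have "hnorm (L2 \<mu>) (cl (\<lambda>x. f p x - G x)) \<le> (1/2) ^ n"
          by (rule power2_le_imp_le) simp
        then show ?thesis
          using n f G L2.hnorm_nonneg[OF cl_in[OF l2_fun_diff[OF f(1) G]], of p] by simp
      qed
      then show "\<exists>N. \<forall>p\<ge>N. norm (hnorm (L2 \<mu>) (F p \<ominus>\<^bsub>L2 \<mu>\<^esub> cl G) - 0) < e"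
        by blast
    qed
  qed
  then show ?thesis by blast
qed

sublocale L2: hilb "L2 \<mu>"
  by unfold_locales (rule L2_complete)

end

section \<open>Cauchy kernels in the model space\<close>

text \<open>Transition width \<open>1 / n^2\<close> against a shift of the left end by
  \<open>1 / n\<close>: at \<open>x = c\<close> the shift outruns the width, so the limit is the
  indicator of the open ray, without a half weight at its end point.\<close>

lemma arctan_kernel_limit:
  fixes c x :: real
  shows "(\<lambda>n. arctan ((real n - x) * (real n)\<^sup>2) - arctan ((c + 1 / real n - x) * (real n)\<^sup>2))
    \<longlonglongrightarrow> pi * indicator {c<..} x"
proof -
  have *: "(\<lambda>n. arctan (f n)) \<longlonglongrightarrow> pi / 2" if "filterlim f at_top sequentially" for f :: "nat \<Rightarrow> real"
    by (rule filterlim_compose[OF tendsto_arctan_at_top that])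
  have **: "(\<lambda>n. arctan (f n)) \<longlonglongrightarrow> - (pi / 2)" if "filterlim f at_bot sequentially" for f :: "nat \<Rightarrow> real"
    by (rule filterlim_compose[OF tendsto_arctan_at_bot that])
  have 1: "(\<lambda>n. arctan ((real n - x) * (real n)\<^sup>2)) \<longlonglongrightarrow> pi / 2"
    by (rule *) real_asymp
  show ?thesis
  proof (cases "c < x")
    case True
    define d where "d = x - c"
    have d: "d > 0" using True by (simp add: d_def)
    have "filterlim (\<lambda>n. (1 / real n - d) * (real n)\<^sup>2) at_bot sequentially"
      using d by real_asymp
    then have "(\<lambda>n. arctan ((c + 1 / real n - x) * (real n)\<^sup>2)) \<longlonglongrightarrow> - (pi / 2)"
      by (intro **) (simp add: d_def algebra_simps)
    from tendsto_diff[OF 1 this] show ?thesis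
      using True by simp
  next
    case False
    have "filterlim (\<lambda>n. (c + 1 / real n - x) * (real n)\<^sup>2) at_top sequentially"
    proof (rule filterlim_at_top_mono[OF filterlim_real_sequentially], rule eventually_sequentiallyI[of 1])
      fix n :: nat assume "1 \<le> n"
      then have "real n = (1 / real n) * (real n)\<^sup>2"
        by (simp add: power2_eq_square)
      also have "\<dots> \<le> (c + 1 / real n - x) * (real n)\<^sup>2"
        using False by (intro mult_right_mono) auto
      finally show "real n \<le> (c + 1 / real n - x) * (real n)\<^sup>2" .
    qed
    from tendsto_diff[OF 1 *[OF this]] show ?thesis
      using False by simp
  qed
qed

text \<open>Stieltjes inversion. Integrating the Poisson kernel in \<open>t\<close> over an interval
  gives arctangent differences, and in the limit \<open>h\<close> has integral 0 over every ray
  \<open>{c<..}\<close>. Rays determine measures that are finite on them, so the positive and the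
  negative part of \<open>h\<close> are densities of the same measure.\<close>

lemma AE_zero_of_poisson:
  fixes \<mu> :: "real measure" and h :: "real \<Rightarrow> real"
  assumes sf: "sigma_finite_measure \<mu>" and sets: "sets \<mu> = sets borel" and h: "integrable \<mu> h"
    and zero: "\<And>e t. \<lbrakk>0 < e; e < 1\<rbrakk> \<Longrightarrow> (\<integral>x. h x * (e / ((x - t)\<^sup>2 + e\<^sup>2)) \<partial>\<mu>) = 0"
  shows "AE x in \<mu>. h x = 0"
proof -
  interpret sigma_finite_measure \<mu> by (rule sf)
  interpret pair_sigma_finite \<mu> lborel ..
  have sets' [measurable_cong]: "sets \<mu> = sets borel" by (rule sets)
  have hm [measurable]: "h \<in> borel_measurable \<mu>"
    using h by (rule borel_measurable_integrable)
  have space: "space \<mu> = UNIV"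
    using sets_eq_imp_space_eq[OF sets] by simp
  have bnd: "\<bar>arctan u - arctan v\<bar> \<le> pi" for u v :: real
    using arctan_bounded[of u] arctan_bounded[of v] by (simp add: abs_le_iff)
  have bnd2: "\<bar>r\<bar> * \<bar>arctan u - arctan v\<bar> \<le> pi * \<bar>r\<bar>" for r u v :: real
    using mult_left_mono[OF bnd abs_ge_zero] by (simp add: mult.commute)
  have step: "(\<integral>x. h x * (arctan ((d - x) / e) - arctan ((c - x) / e)) \<partial>\<mu>) = 0"
    if e: "0 < e" "e < 1" and cd: "c \<le> d" for e c d
  proof -
    define k where "k x t = e / ((x - t)\<^sup>2 + e\<^sup>2) * indicator {c..d} t" for x t :: real
    have k0: "0 \<le> k x t" for x t
      using e by (simp add: k_def)
    have deriv: "((\<lambda>t. arctan ((t - x) / e)) has_real_derivative e / ((x - t)\<^sup>2 + e\<^sup>2)) (at t)" for x t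
    proof -
      have "((\<lambda>t. arctan ((t - x) / e)) has_real_derivative inverse (1 + ((t - x) / e)\<^sup>2) * (1 / e)) (at t)"
        using e by (auto intro!: derivative_eq_intros)
      moreover have "inverse (1 + ((t - x) / e)\<^sup>2) * (1 / e) = e / ((x - t)\<^sup>2 + e\<^sup>2)"
      proof -
        have "1 + ((t - x) / e)\<^sup>2 = ((x - t)\<^sup>2 + e\<^sup>2) / e\<^sup>2"
          using e by (simp add: power_divide field_simps power2_commute)
        then show ?thesis
          using e by (simp add: power2_eq_square)
      qed
      ultimately show ?thesis by simp
    qed
    have kint: "integrable lborel (k x)" "(\<integral>t. k x t \<partial>lborel) = arctan ((d - x) / e) - arctan ((c - x) / e)" for x
      unfolding k_def
      by (rule integrable_FTC_Icc_nonneg[where F="\<lambda>t. arctan ((t - x) / e)"]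
          integral_FTC_Icc_nonneg[where F="\<lambda>t. arctan ((t - x) / e)"]; use deriv e cd in simp)+
    have meas: "(\<lambda>(x, t). h x * k x t) \<in> borel_measurable (\<mu> \<Otimes>\<^sub>M lborel)"
      unfolding k_def by measurable
    have "integrable (\<mu> \<Otimes>\<^sub>M lborel) (\<lambda>(x, t). h x * k x t)"
    proof (rule Fubini_integrable[OF meas])
      have "integrable \<mu> (\<lambda>x. \<bar>h x\<bar> * (arctan ((d - x) / e) - arctan ((c - x) / e)))"
      proof (rule Bochner_Integration.integrable_bound[of _ "\<lambda>x. pi * \<bar>h x\<bar>"])
        show "AE x in \<mu>. norm (\<bar>h x\<bar> * (arctan ((d - x) / e) - arctan ((c - x) / e))) \<le> norm (pi * \<bar>h x\<bar>)"
          by (intro AE_I2) (simp add: abs_mult bnd2)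
      qed (use h in auto)
      then show "integrable \<mu> (\<lambda>x. \<integral>t. norm (case (x, t) of (x, t) \<Rightarrow> h x * k x t) \<partial>lborel)"
        using k0 by (simp add: abs_mult kint)
      show "AE x in \<mu>. integrable lborel (\<lambda>t. case (x, t) of (x, t) \<Rightarrow> h x * k x t)"
        using kint by simp
    qed
    then have "(\<integral>t. (\<integral>x. h x * k x t \<partial>\<mu>) \<partial>lborel) = (\<integral>x. (\<integral>t. h x * k x t \<partial>lborel) \<partial>\<mu>)"
      by (rule Fubini_integral)
    moreover have "(\<integral>x. h x * k x t \<partial>\<mu>) = 0" for t
    proof -
      have "(\<integral>x. h x * k x t \<partial>\<mu>) = (\<integral>x. h x * (e / ((x - t)\<^sup>2 + e\<^sup>2)) * indicator {c..d} t \<partial>\<mu>)"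
        by (simp add: k_def mult.assoc)
      also have "\<dots> = (\<integral>x. h x * (e / ((x - t)\<^sup>2 + e\<^sup>2)) \<partial>\<mu>) * indicator {c..d} t"
        by (rule integral_mult_left_zero)
      finally show ?thesis
        using zero[OF e] by simp
    qed
    ultimately show ?thesis
      by (simp add: kint)
  qed
  have ray: "(\<integral>x. h x * indicator {c<..} x \<partial>\<mu>) = 0" for c
  proof -
    \<comment> \<open>\<open>step\<close> with height \<open>1 / n^2\<close> on the interval from
      \<open>c + 1 / n\<close> to \<open>n\<close>; it applies as soon as \<open>n > 1\<close> and
      \<open>c + 1 / n <= n\<close>.\<close>
    define A where "A n x = arctan ((real n - x) * (real n)\<^sup>2) - arctan ((c + 1 / real n - x) * (real n)\<^sup>2)" for n x
    have lim: "(\<lambda>n. \<integral>x. h x * A n x \<partial>\<mu>) \<longlonglongrightarrow> (\<integral>x. h x * (pi * indicator {c<..} x) \<partial>\<mu>)"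
    proof (rule integral_dominated_convergence[where w="\<lambda>x. pi * \<bar>h x\<bar>"])
      show "AE x in \<mu>. (\<lambda>n. h x * A n x) \<longlonglongrightarrow> h x * (pi * indicator {c<..} x)"
        unfolding A_def by (intro AE_I2 tendsto_mult tendsto_const arctan_kernel_limit)
      show "AE x in \<mu>. norm (h x * A n x) \<le> pi * \<bar>h x\<bar>" for n
        unfolding A_def by (intro AE_I2) (simp only: real_norm_def abs_mult bnd2)
      show "(\<lambda>x. h x * A n x) \<in> borel_measurable \<mu>" for n
        unfolding A_def by measurable
    qed (use h in auto)
    have ev: "eventually (\<lambda>n. (\<integral>x. h x * A n x \<partial>\<mu>) = 0) sequentially"
    proof -
      obtain N :: nat where N: "c + 2 < real N"
        using reals_Archimedean2 by blast
      show ?thesis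
      proof (rule eventually_sequentiallyI[of "N + 2"])
        fix n assume n: "N + 2 \<le> n"
        then have n2: "2 \<le> real n" "c + 2 < real n"
          using N by linarith+
        have "1 < (real n)\<^sup>2"
          using n2 by (intro one_less_power) auto
        moreover have "1 / real n \<le> 1"
          using n2 by simp
        then have "c + 1 / real n \<le> real n"
          using n2 by linarith
        ultimately have "(\<integral>x. h x * (arctan ((real n - x) / (1 / (real n)\<^sup>2)) - arctan ((c + 1 / real n - x) / (1 / (real n)\<^sup>2))) \<partial>\<mu>) = 0"
          using n2 by (intro step) auto
        then show "(\<integral>x. h x * A n x \<partial>\<mu>) = 0"
          by (simp add: A_def)
      qed
    qed
    have "(\<integral>x. h x * (pi * indicator {c<..} x) \<partial>\<mu>) = 0"
      by (rule LIMSEQ_unique[OF lim tendsto_eventually[OF ev]])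
    moreover have "(\<integral>x. h x * (pi * indicator {c<..} x) \<partial>\<mu>) = pi * (\<integral>x. h x * indicator {c<..} x \<partial>\<mu>)"
      by (subst integral_mult_right_zero[symmetric]) (simp add: mult_ac)
    ultimately show ?thesis by simp
  qed
  define p where "p x = max 0 (h x)" for x
  define m where "m x = max 0 (- h x)" for x
  have pm [measurable]: "p \<in> borel_measurable \<mu>" "m \<in> borel_measurable \<mu>"
    unfolding p_def[abs_def] m_def[abs_def] by measurable
  have int: "integrable \<mu> (\<lambda>x. p x * indicator {c<..} x)" "integrable \<mu> (\<lambda>x. m x * indicator {c<..} x)" for c
    by (rule Bochner_Integration.integrable_bound[OF h]; auto simp: p_def m_def indicator_def)+
  have em: "emeasure (density \<mu> (\<lambda>x. ennreal (q x))) {c<..} = ennreal (\<integral>x. q x * indicator {c<..} x \<partial>\<mu>)"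
    if [measurable]: "q \<in> borel_measurable \<mu>" and q: "\<And>x. 0 \<le> q x"
      and "integrable \<mu> (\<lambda>x. q x * indicator {c<..} x)" for q c
  proof -
    have "emeasure (density \<mu> (\<lambda>x. ennreal (q x))) {c<..} = (\<integral>\<^sup>+x. ennreal (q x) * indicator {c<..} x \<partial>\<mu>)"
      by (rule emeasure_density) auto
    also have "\<dots> = (\<integral>\<^sup>+x. ennreal (q x * indicator {c<..} x) \<partial>\<mu>)"
      by (intro nn_integral_cong) (simp add: indicator_def)
    also have "\<dots> = ennreal (\<integral>x. q x * indicator {c<..} x \<partial>\<mu>)"
      using that by (intro nn_integral_eq_integral) auto
    finally show ?thesis .
  qed
  have "density \<mu> (\<lambda>x. ennreal (p x)) = density \<mu> (\<lambda>x. ennreal (m x))"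
  proof (rule measure_eqI_lessThan)
    fix c
    have "(\<integral>x. h x * indicator {c<..} x \<partial>\<mu>) = (\<integral>x. p x * indicator {c<..} x - m x * indicator {c<..} x \<partial>\<mu>)"
      by (intro Bochner_Integration.integral_cong) (auto simp: p_def m_def indicator_def)
    also have "\<dots> = (\<integral>x. p x * indicator {c<..} x \<partial>\<mu>) - (\<integral>x. m x * indicator {c<..} x \<partial>\<mu>)"
      by (rule Bochner_Integration.integral_diff[OF int])
    finally have "(\<integral>x. p x * indicator {c<..} x \<partial>\<mu>) = (\<integral>x. m x * indicator {c<..} x \<partial>\<mu>)"
      using ray[of c] by simp
    moreover have e: "emeasure (density \<mu> (\<lambda>x. ennreal (p x))) {c<..} = ennreal (\<integral>x. p x * indicator {c<..} x \<partial>\<mu>)"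
      "emeasure (density \<mu> (\<lambda>x. ennreal (m x))) {c<..} = ennreal (\<integral>x. m x * indicator {c<..} x \<partial>\<mu>)"
      using int by (intro em; auto simp: p_def m_def)+
    ultimately show "emeasure (density \<mu> (\<lambda>x. ennreal (p x))) {c<..} = emeasure (density \<mu> (\<lambda>x. ennreal (m x))) {c<..}"
      by simp
    show "emeasure (density \<mu> (\<lambda>x. ennreal (p x))) {c<..} < \<infinity>"
      unfolding e by simp
  qed (simp_all add: sets)
  then have "AE x in \<mu>. ennreal (p x) = ennreal (m x)"
    using sigma_finite_measure.density_unique_iff[OF sf, of "\<lambda>x. ennreal (p x)" "\<lambda>x. ennreal (m x)"] by simp
  then show ?thesis
    by eventually_elim (auto simp: p_def m_def max_def split: if_splits)
qed

definition gf :: "complex \<Rightarrow> real \<Rightarrow> complex"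
  where "gf z x = 1 / (complex_of_real x - z)"

lemma g_vec_eq: "g_vec \<mu> z = l2_class \<mu> (gf z)"
  by (simp add: g_vec_def gf_def[abs_def])

lemma gf_measurable [measurable]: "gf z \<in> borel_measurable borel"
  unfolding gf_def[abs_def] by measurable

lemma of_real_neq_nonreal: "Im z \<noteq> 0 \<Longrightarrow> complex_of_real x - z \<noteq> 0"
  by (auto simp: complex_eq_iff)

lemma cnj_gf: "cnj (gf z x) = gf (cnj z) x"
  by (simp add: gf_def)

lemma of_real_sq_neq: "1 + (complex_of_real x)\<^sup>2 \<noteq> 0"
proof
  assume "1 + (complex_of_real x)\<^sup>2 = 0"
  then have "Re (1 + (complex_of_real x)\<^sup>2) = 0" by simp
  then show False
    by (simp add: power2_eq_square) (metis add_nonneg_eq_0_iff zero_le_one zero_le_square zero_neq_one)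
qed

locale model_measure = l2 +
  assumes weight: "(\<integral>x. 1 / (1 + x\<^sup>2) \<partial>\<mu>) = 1"
begin

text \<open>The Bochner integral of a nonintegrable function is 0 by convention, so the value 1
  already forces integrability.\<close>

lemma weight_integrable: "integrable \<mu> (\<lambda>x. 1 / (1 + x\<^sup>2))"
  using weight not_integrable_integral_eq by fastforce

text \<open>On \<open>[-n, n]\<close> the integrable weight is bounded below by
  \<open>1 / (1 + n^2)\<close>, so these intervals have finite measure.\<close>

lemma sigma_finite: "sigma_finite_measure \<mu>"
proof
  define A where "A n = {- real n .. real n}" for n
  have "emeasure \<mu> (A n) \<noteq> \<infinity>" for n
  proof -
    have "integrable \<mu> (indicator (A n) :: real \<Rightarrow> real)"
    proof (rule Bochner_Integration.integrable_bound)
      show "integrable \<mu> (\<lambda>x. (1 + (real n)\<^sup>2) * (1 / (1 + x\<^sup>2)))"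
        using weight_integrable by (rule integrable_mult_right)
      show "indicator (A n) \<in> borel_measurable \<mu>"
        by (simp add: A_def)
      show "AE x in \<mu>. norm (indicator (A n) x :: real) \<le> norm ((1 + (real n)\<^sup>2) * (1 / (1 + x\<^sup>2)))"
      proof (intro AE_I2)
        fix x :: real
        have "x\<^sup>2 \<le> (real n)\<^sup>2" if "x \<in> A n"
          using that by (intro power2_le_iff_abs_le[THEN iffD2]) (auto simp: A_def abs_le_iff)
        then show "norm (indicator (A n) x :: real) \<le> norm ((1 + (real n)\<^sup>2) * (1 / (1 + x\<^sup>2)))"
          by (auto simp: indicator_def divide_simps add_pos_nonneg)
      qed
    qed
    then show ?thesis
      by (simp add: integrable_indicator_iff A_def sets_\<mu>)
  qed
  moreover have "\<Union> (range A) = space \<mu>"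
  proof -
    have "\<exists>n. x \<in> A n" for x
      using real_arch_simple[of "\<bar>x\<bar>"] by (auto simp: A_def abs_le_iff minus_le_iff)
    then show ?thesis by auto
  qed
  moreover have "range A \<subseteq> sets \<mu>"
    by (auto simp: A_def sets_\<mu>)
  ultimately show "\<exists>A. countable A \<and> A \<subseteq> sets \<mu> \<and> \<Union> A = space \<mu> \<and> (\<forall>a\<in>A. emeasure \<mu> a \<noteq> \<infinity>)"
    by (intro exI[of _ "range A"]) auto
qed

lemma gf_l2: assumes z: "Im z \<noteq> 0" shows "gf z \<in> l2_fun \<mu>"
proof (rule l2_fun_dominated)
  \<comment> \<open>From \<open>|x| <= r + |z|\<close> one gets
    \<open>1 + x^2 <= 2 r^2 + 1 + 2 |z|^2\<close>, and \<open>|Im z| <= r\<close> absorbs the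
    constant part into a multiple of \<open>r^2\<close>.\<close>
  define C where "C = 2 + (1 + 2 * (cmod z)\<^sup>2) / (Im z)\<^sup>2"
  show "integrable \<mu> (\<lambda>x. C * (1 / (1 + x\<^sup>2)))"
    using weight_integrable by (rule integrable_mult_right)
  fix x :: real
  define r where "r = cmod (complex_of_real x - z)"
  have r: "\<bar>Im z\<bar> \<le> r"
    using abs_Im_le_cmod[of "complex_of_real x - z"] by (simp add: r_def)
  then have r0: "r > 0" using z by simp
  have "\<bar>x\<bar> \<le> r + cmod z"
    using norm_triangle_ineq[of "complex_of_real x - z" z] by (simp add: r_def)
  then have "\<bar>x\<bar>\<^sup>2 \<le> (r + cmod z)\<^sup>2"
    by (intro power_mono) auto
  also have "\<dots> \<le> 2 * r\<^sup>2 + 2 * (cmod z)\<^sup>2"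
    using zero_le_power2[of "r - cmod z"] by (simp add: power2_sum power2_diff)
  finally have "1 + x\<^sup>2 \<le> 2 * r\<^sup>2 + (1 + 2 * (cmod z)\<^sup>2)"
    by simp
  also have "1 + 2 * (cmod z)\<^sup>2 = (1 + 2 * (cmod z)\<^sup>2) / (Im z)\<^sup>2 * (Im z)\<^sup>2"
    using z by simp
  also have "\<dots> \<le> (1 + 2 * (cmod z)\<^sup>2) / (Im z)\<^sup>2 * r\<^sup>2"
    using r by (intro mult_left_mono) (auto simp: abs_le_square_iff[symmetric])
  finally have "1 + x\<^sup>2 \<le> C * r\<^sup>2"
    by (simp add: C_def algebra_simps)
  moreover have "0 < 1 + x\<^sup>2"
    by (simp add: add_pos_nonneg)
  ultimately have "1 / r\<^sup>2 \<le> C * (1 / (1 + x\<^sup>2))"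
    using r0 by (simp add: field_simps)
  then show "(cmod (gf z x))\<^sup>2 \<le> C * (1 / (1 + x\<^sup>2))"
    by (simp add: gf_def r_def norm_divide power_divide)
qed simp

lemma weight_l2: "(\<lambda>x. complex_of_real (1 / (1 + x\<^sup>2))) \<in> l2_fun \<mu>"
proof (rule l2_fun_dominated[OF _ weight_integrable])
  fix x :: real
  have "0 \<le> 1 / (1 + x\<^sup>2)" "1 / (1 + x\<^sup>2) \<le> 1"
    by (auto simp: add_pos_nonneg)
  then have "(1 / (1 + x\<^sup>2)) * (1 / (1 + x\<^sup>2)) \<le> (1 / (1 + x\<^sup>2)) * 1"
    by (intro mult_left_mono)
  then show "(cmod (complex_of_real (1 / (1 + x\<^sup>2))))\<^sup>2 \<le> 1 / (1 + x\<^sup>2)"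
    unfolding norm_of_real power2_abs by (simp only: power2_eq_square mult_1_right)
qed simp

text \<open>A square integrable \<open>f\<close> need not be integrable, so inversion is applied to
  \<open>F = f / (1 + x^2)\<close>. Partial fractions write \<open>F\<close> times the kernel at
  \<open>z\<close> as a combination of \<open>f\<close> times the kernels at \<open>z\<close>,
  \<open>\<i>\<close> and \<open>-\<i>\<close>; this requires \<open>z^2 + 1\<close> to be
  nonzero.\<close>

lemma gf_total:
  assumes f: "f \<in> l2_fun \<mu>" and orth: "\<And>z. Im z \<noteq> 0 \<Longrightarrow> (\<integral>x. f x * gf z x \<partial>\<mu>) = 0"
  shows "AE x in \<mu>. f x = 0"
proof -
  define w where "w x = complex_of_real (1 / (1 + x\<^sup>2))" for x :: real
  define F where "F x = f x * w x" for x
  have fg: "integrable \<mu> (\<lambda>x. f x * gf z x)" if "Im z \<noteq> 0" for z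
    using l2_integrable_mult[OF f gf_l2[of "cnj z"]] that by (simp add: cnj_gf)
  have F: "integrable \<mu> F"
    using l2_integrable_mult[OF f weight_l2] unfolding F_def[abs_def] w_def by simp
  have Fg: "integrable \<mu> (\<lambda>x. F x * gf z x)" "(\<integral>x. F x * gf z x \<partial>\<mu>) = 0"
    if z: "Im z \<noteq> 0" and z1: "z \<noteq> \<i>" "z \<noteq> - \<i>" for z
  proof -
    have z2: "z\<^sup>2 + 1 \<noteq> 0"
      using z1 power2_eq_iff[of z \<i>] by (simp add: add_eq_0_iff2)
    have eq: "F x * gf z x = (1 / (z\<^sup>2 + 1)) * (f x * gf z x - (1 - \<i> * z) / 2 * (f x * gf \<i> x) - (1 + \<i> * z) / 2 * (f x * gf (-\<i>) x))" for x
    proof -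
      define y where "y = complex_of_real x"
      have n: "y - z \<noteq> 0" "y - \<i> \<noteq> 0" "y + \<i> \<noteq> 0"
        using of_real_neq_nonreal[OF z] of_real_neq_nonreal[of \<i>] of_real_neq_nonreal[of "-\<i>"] by (auto simp: y_def)
      have w: "w x = gf \<i> x * gf (-\<i>) x"
        by (simp add: w_def gf_def algebra_simps power2_eq_square)
      have "1 / ((y - \<i>) * (y + \<i>)) * (1 / (y - z)) =
          (1 / (z\<^sup>2 + 1)) * (1 / (y - z) - (1 - \<i> * z) / 2 * (1 / (y - \<i>)) - (1 + \<i> * z) / 2 * (1 / (y + \<i>)))"
      proof -
        define E where "E = (y - \<i>) * (y + \<i>)"
        have E: "E \<noteq> 0" "E = y\<^sup>2 + 1"
          using n by (simp add: E_def, simp add: E_def algebra_simps power2_eq_square)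
        have "(1 - \<i> * z) / 2 * (1 / (y - \<i>)) + (1 + \<i> * z) / 2 * (1 / (y + \<i>)) =
            ((1 - \<i> * z) / 2 * (y + \<i>) + (1 + \<i> * z) / 2 * (y - \<i>)) / E"
          unfolding E_def add_divide_distrib using n by simp
        also have "(1 - \<i> * z) / 2 * (y + \<i>) + (1 + \<i> * z) / 2 * (y - \<i>) = y + z"
          by (simp add: field_simps)
        finally have s: "1 / (y - z) - (1 - \<i> * z) / 2 * (1 / (y - \<i>)) - (1 + \<i> * z) / 2 * (1 / (y + \<i>)) =
            1 / (y - z) - (y + z) / E"
          by (simp add: diff_diff_eq)
        have "1 / (y - z) - (y + z) / E = (z\<^sup>2 + 1) / ((y - z) * E)"
          using n(1) E(1) by (simp add: diff_frac_eq E(2) algebra_simps power2_eq_square)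
        then show ?thesis
          unfolding s E_def[symmetric] using z2 by simp
      qed
      then have "gf \<i> x * gf (-\<i>) x * gf z x =
          (1 / (z\<^sup>2 + 1)) * (gf z x - (1 - \<i> * z) / 2 * gf \<i> x - (1 + \<i> * z) / 2 * gf (-\<i>) x)"
        by (simp add: gf_def y_def)
      then have "f x * (gf \<i> x * gf (-\<i>) x * gf z x) =
          f x * ((1 / (z\<^sup>2 + 1)) * (gf z x - (1 - \<i> * z) / 2 * gf \<i> x - (1 + \<i> * z) / 2 * gf (-\<i>) x))"
        by (simp only:)
      then show ?thesis
        unfolding F_def w by (simp only: right_diff_distrib mult_ac)
    qed
    note i = fg[OF z] fg[of \<i>] fg[of "-\<i>"]
    show "integrable \<mu> (\<lambda>x. F x * gf z x)"
      unfolding eq using i by (intro integrable_mult_right Bochner_Integration.integrable_diff) auto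
    show "(\<integral>x. F x * gf z x \<partial>\<mu>) = 0"
      unfolding eq using i orth[OF z] orth[of \<i>] orth[of "-\<i>"] by simp
  qed
  have P: "(\<integral>x. F x * complex_of_real (e / ((x - t)\<^sup>2 + e\<^sup>2)) \<partial>\<mu>) = 0"
    "integrable \<mu> (\<lambda>x. F x * complex_of_real (e / ((x - t)\<^sup>2 + e\<^sup>2)))"
    if e: "0 < e" "e < 1" for e t :: real
  proof -
    \<comment> \<open>The Poisson kernel is \<open>(gf z - gf (cnj z)) / (2 \<i>)\<close> at
      \<open>z = t + \<i> e\<close>, and \<open>0 < e < 1\<close> keeps both points off the real
      axis and away from \<open>\<i>\<close> and \<open>-\<i>\<close>.\<close>
    define z where "z = Complex t e"
    have z: "Im z \<noteq> 0" "z \<noteq> \<i>" "z \<noteq> - \<i>" "Im (cnj z) \<noteq> 0" "cnj z \<noteq> \<i>" "cnj z \<noteq> - \<i>"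
      using e by (auto simp: z_def complex_eq_iff)
    have eq: "F x * complex_of_real (e / ((x - t)\<^sup>2 + e\<^sup>2)) = (1 / (2 * \<i>)) * (F x * gf z x - F x * gf (cnj z) x)" for x
    proof -
      have n: "complex_of_real x - z \<noteq> 0" "complex_of_real x - cnj z \<noteq> 0"
        using of_real_neq_nonreal z by blast+
      have "(complex_of_real x - z) * (complex_of_real x - cnj z) = complex_of_real ((x - t)\<^sup>2 + e\<^sup>2)"
        by (simp add: z_def complex_eq_iff power2_eq_square algebra_simps)
      moreover have "z - cnj z = 2 * \<i> * complex_of_real e"
        by (simp add: z_def complex_eq_iff)
      moreover have "gf z x - gf (cnj z) x = (z - cnj z) / ((complex_of_real x - z) * (complex_of_real x - cnj z))"
        using n by (simp add: gf_def diff_frac_eq)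
      ultimately have "gf z x - gf (cnj z) x = 2 * \<i> * complex_of_real (e / ((x - t)\<^sup>2 + e\<^sup>2))"
        by simp
      then have "complex_of_real (e / ((x - t)\<^sup>2 + e\<^sup>2)) = (1 / (2 * \<i>)) * (gf z x - gf (cnj z) x)"
        by simp
      then show ?thesis
        by (simp only: right_diff_distrib mult.left_commute)
    qed
    note i = Fg[OF z(1-3)] Fg[OF z(4-6)]
    show "(\<integral>x. F x * complex_of_real (e / ((x - t)\<^sup>2 + e\<^sup>2)) \<partial>\<mu>) = 0"
      unfolding eq using i by simp
    show "integrable \<mu> (\<lambda>x. F x * complex_of_real (e / ((x - t)\<^sup>2 + e\<^sup>2)))"
      unfolding eq using i by (intro integrable_mult_right Bochner_Integration.integrable_diff)
  qed
  have "AE x in \<mu>. Re (F x) = 0"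
  proof (rule AE_zero_of_poisson[OF sigma_finite sets_\<mu>])
    show "integrable \<mu> (\<lambda>x. Re (F x))"
      using F by simp
    fix e t :: real assume e: "0 < e" "e < 1"
    have "(\<integral>x. Re (F x) * (e / ((x - t)\<^sup>2 + e\<^sup>2)) \<partial>\<mu>) = (\<integral>x. Re (F x * complex_of_real (e / ((x - t)\<^sup>2 + e\<^sup>2))) \<partial>\<mu>)"
      by simp
    also have "\<dots> = 0"
      by (subst integral_Re[OF P(2)[OF e]]) (simp only: P(1)[OF e] zero_complex.sel)
    finally show "(\<integral>x. Re (F x) * (e / ((x - t)\<^sup>2 + e\<^sup>2)) \<partial>\<mu>) = 0" .
  qed
  moreover have "AE x in \<mu>. Im (F x) = 0"
  proof (rule AE_zero_of_poisson[OF sigma_finite sets_\<mu>])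
    show "integrable \<mu> (\<lambda>x. Im (F x))"
      using F by simp
    fix e t :: real assume e: "0 < e" "e < 1"
    have "(\<integral>x. Im (F x) * (e / ((x - t)\<^sup>2 + e\<^sup>2)) \<partial>\<mu>) = (\<integral>x. Im (F x * complex_of_real (e / ((x - t)\<^sup>2 + e\<^sup>2))) \<partial>\<mu>)"
      by simp
    also have "\<dots> = 0"
      by (subst integral_Im[OF P(2)[OF e]]) (simp only: P(1)[OF e] zero_complex.sel)
    finally show "(\<integral>x. Im (F x) * (e / ((x - t)\<^sup>2 + e\<^sup>2)) \<partial>\<mu>) = 0" .
  qed
  ultimately show ?thesis
  proof eventually_elim
    case (elim x)
    then have "F x = 0"
      by (simp add: complex_eq_iff)
    moreover have "w x \<noteq> 0"
      using of_real_sq_neq[of x] by (simp add: w_def)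
    ultimately show ?case
      by (simp add: F_def)
  qed
qed

section \<open>The multiplication operator and its Q-function\<close>

abbreviation "mx f \<equiv> (\<lambda>x. complex_of_real x * f x)"

lemma mult_opI: "\<lbrakk>f \<in> l2_fun \<mu>; mx f \<in> l2_fun \<mu>\<rbrakk> \<Longrightarrow> (cl f, cl (mx f)) \<in> mult_op \<mu>"
  by (auto simp: mult_op_def)

lemma mult_opE:
  assumes "(F, G) \<in> mult_op \<mu>"
  obtains f where "f \<in> l2_fun \<mu>" "mx f \<in> l2_fun \<mu>" "F = cl f" "G = cl (mx f)"
  using assms by (auto simp: mult_op_def)

lemma mult_op_linear: "linear_op (L2 \<mu>) (mult_op \<mu>)"
  unfolding linear_op_def
proof (intro conjI)
  show "mult_op \<mu> \<subseteq> carrier (L2 \<mu>) \<times> carrier (L2 \<mu>)"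
    by (auto elim!: mult_opE)
  show "single_valued (mult_op \<mu>)"
  proof (rule single_valuedI)
    fix F G G' assume 1: "(F, G) \<in> mult_op \<mu>" and 2: "(F, G') \<in> mult_op \<mu>"
    obtain f where f: "f \<in> l2_fun \<mu>" "mx f \<in> l2_fun \<mu>" "F = cl f" "G = cl (mx f)"
      using mult_opE[OF 1] .
    obtain g where g: "g \<in> l2_fun \<mu>" "mx g \<in> l2_fun \<mu>" "F = cl g" "G' = cl (mx g)"
      using mult_opE[OF 2] .
    have "cl f = cl g"
      using f(3) g(3) by simp
    then have "AE x in \<mu>. f x = g x"
      using f(1) g(1) by (simp add: cl_eq_iff)
    then have "AE x in \<mu>. complex_of_real x * f x = complex_of_real x * g x"
      by eventually_elim simp
    then show "G = G'"
      using f g by (simp add: cl_eq_iff)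
  qed
  show "(\<zero>\<^bsub>L2 \<mu>\<^esub>, \<zero>\<^bsub>L2 \<mu>\<^esub>) \<in> mult_op \<mu>"
    using mult_opI[of "\<lambda>_. 0"] l2_fun_zero by (simp add: zero_L2)
  show "\<forall>(F, G)\<in>mult_op \<mu>. \<forall>(F', G')\<in>mult_op \<mu>. (F \<oplus>\<^bsub>L2 \<mu>\<^esub> F', G \<oplus>\<^bsub>L2 \<mu>\<^esub> G') \<in> mult_op \<mu>"
  proof (clarify elim!: mult_opE)
    fix f g assume fg: "f \<in> l2_fun \<mu>" "mx f \<in> l2_fun \<mu>" "g \<in> l2_fun \<mu>" "mx g \<in> l2_fun \<mu>"
    have "mx (\<lambda>x. f x + g x) = (\<lambda>x. mx f x + mx g x)"
      by (simp add: distrib_left)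
    then show "(cl f \<oplus>\<^bsub>L2 \<mu>\<^esub> cl g, cl (mx f) \<oplus>\<^bsub>L2 \<mu>\<^esub> cl (mx g)) \<in> mult_op \<mu>"
      using mult_opI[of "\<lambda>x. f x + g x"] l2_fun_add[OF fg(1,3)] l2_fun_add[OF fg(2,4)] fg by simp
  qed
  show "\<forall>c. \<forall>(F, G)\<in>mult_op \<mu>. (c \<odot>\<^bsub>L2 \<mu>\<^esub> F, c \<odot>\<^bsub>L2 \<mu>\<^esub> G) \<in> mult_op \<mu>"
  proof (clarify elim!: mult_opE)
    fix c f assume f: "f \<in> l2_fun \<mu>" "mx f \<in> l2_fun \<mu>"
    have "mx (\<lambda>x. c * f x) = (\<lambda>x. c * mx f x)"
      by (simp add: mult.left_commute)
    then show "(c \<odot>\<^bsub>L2 \<mu>\<^esub> cl f, c \<odot>\<^bsub>L2 \<mu>\<^esub> cl (mx f)) \<in> mult_op \<mu>"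
      using mult_opI[of "\<lambda>x. c * f x"] l2_fun_smult[OF f(1), of c] l2_fun_smult[OF f(2), of c] f by simp
  qed
qed

lemma mult_op_symmetric: "symmetric_op (L2 \<mu>) (mult_op \<mu>)"
  unfolding symmetric_op_def
proof (rule subrelI, rule L2.adjoint_opI)
  fix F G assume FG: "(F, G) \<in> mult_op \<mu>"
  show "F \<in> carrier (L2 \<mu>)" "G \<in> carrier (L2 \<mu>)"
    using L2.linear_op_in[OF mult_op_linear FG] .
  fix F' G' assume FG': "(F', G') \<in> mult_op \<mu>"
  obtain f where f: "f \<in> l2_fun \<mu>" "mx f \<in> l2_fun \<mu>" "F = cl f" "G = cl (mx f)"
    using mult_opE[OF FG] .
  obtain g where g: "g \<in> l2_fun \<mu>" "mx g \<in> l2_fun \<mu>" "F' = cl g" "G' = cl (mx g)"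
    using mult_opE[OF FG'] .
  show "cinner (L2 \<mu>) G' F = cinner (L2 \<mu>) F' G"
    using f g by (simp add: mult.assoc mult.left_commute)
qed

lemma mult_op_range:
  assumes z: "Im z \<noteq> 0" and h: "h \<in> carrier (L2 \<mu>)"
  shows "\<exists>F. (F, h \<oplus>\<^bsub>L2 \<mu>\<^esub> z \<odot>\<^bsub>L2 \<mu>\<^esub> F) \<in> mult_op \<mu>"
proof -
  obtain f where f: "f \<in> l2_fun \<mu>" "h = cl f"
    using carrier_E[OF h] .
  have fm [measurable]: "f \<in> borel_measurable borel"
    using l2_funD(1)[OF f(1)] .
  define u where "u x = f x * gf z x" for x
  have u: "u \<in> l2_fun \<mu>"
  proof (rule l2_fun_dominated)
    show "u \<in> borel_measurable borel"
      unfolding u_def[abs_def] by measurable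
    show "integrable \<mu> (\<lambda>x. (1 / (Im z)\<^sup>2) * (cmod (f x))\<^sup>2)"
      by (rule integrable_mult_right[OF l2_funD(2)[OF f(1)]])
    fix x
    have "\<bar>Im z\<bar> \<le> cmod (complex_of_real x - z)"
      using abs_Im_le_cmod[of "complex_of_real x - z"] by simp
    then have "(Im z)\<^sup>2 \<le> (cmod (complex_of_real x - z))\<^sup>2"
      by (simp add: abs_le_square_iff[symmetric])
    then have "(cmod (gf z x))\<^sup>2 \<le> 1 / (Im z)\<^sup>2"
      using z by (simp add: gf_def norm_divide power_divide frac_le)
    then have "(cmod (gf z x))\<^sup>2 * (cmod (f x))\<^sup>2 \<le> 1 / (Im z)\<^sup>2 * (cmod (f x))\<^sup>2"
      by (intro mult_right_mono) auto
    then show "(cmod (u x))\<^sup>2 \<le> 1 / (Im z)\<^sup>2 * (cmod (f x))\<^sup>2"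
      by (simp add: u_def norm_mult power_mult_distrib mult.commute)
  qed
  have eq: "mx u = (\<lambda>x. f x + z * u x)"
  proof
    fix x
    show "mx u x = f x + z * u x"
      using of_real_neq_nonreal[OF z, of x] by (simp add: u_def gf_def field_simps)
  qed
  have "(cl u, cl (mx u)) \<in> mult_op \<mu>"
    using u f by (intro mult_opI u) (simp add: eq l2_fun_add l2_fun_smult)
  then show ?thesis
    using u f by (intro exI[of _ "cl u"]) (simp add: eq l2_fun_smult)
qed

text \<open>The Nevanlinna kernel. The subtracted term improves the decay at infinity from order
  \<open>1 / x\<close> to order \<open>1 / x^2\<close>, which matches the integrable weight.\<close>

definition kf :: "complex \<Rightarrow> real \<Rightarrow> complex"
  where "kf z x = 1 / (complex_of_real x - z) - complex_of_real x / (1 + (complex_of_real x)\<^sup>2)"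

lemma weight_eq: "complex_of_real (1 / (1 + x\<^sup>2)) = gf \<i> x * gf (-\<i>) x"
  by (simp add: gf_def algebra_simps power2_eq_square)

lemma integral_weight: "(\<integral>x. gf \<i> x * gf (-\<i>) x \<partial>\<mu>) = 1" "integrable \<mu> (\<lambda>x. gf \<i> x * gf (-\<i>) x)"
proof -
  have "(\<integral>x. complex_of_real (1 / (1 + x\<^sup>2)) \<partial>\<mu>) = complex_of_real (\<integral>x. 1 / (1 + x\<^sup>2) \<partial>\<mu>)"
    by (rule integral_complex_of_real)
  then show "(\<integral>x. gf \<i> x * gf (-\<i>) x \<partial>\<mu>) = 1"
    unfolding weight_eq weight by simp
  have "integrable \<mu> (\<lambda>x. complex_of_real (1 / (1 + x\<^sup>2)))"
    using weight_integrable by (rule integrable_of_real)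
  then show "integrable \<mu> (\<lambda>x. gf \<i> x * gf (-\<i>) x)"
    unfolding weight_eq .
qed

text \<open>At these two points the kernel is a multiple of the weight, so the normalization of the
  measure yields the value \<i> at \<i>.\<close>

lemma kf_i: "kf \<i> x = \<i> * (gf \<i> x * gf (-\<i>) x)" "kf (-\<i>) x = - \<i> * (gf \<i> x * gf (-\<i>) x)"
proof -
  define y where "y = complex_of_real x"
  have n: "y - \<i> \<noteq> 0" "y + \<i> \<noteq> 0"
    using of_real_neq_nonreal[of \<i>] of_real_neq_nonreal[of "-\<i>"] by (auto simp: y_def)
  have e: "1 + y\<^sup>2 = (y - \<i>) * (y + \<i>)"
    by (simp add: algebra_simps power2_eq_square)
  show "kf \<i> x = \<i> * (gf \<i> x * gf (-\<i>) x)" "kf (-\<i>) x = - \<i> * (gf \<i> x * gf (-\<i>) x)"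
    unfolding kf_def gf_def y_def[symmetric] e
    using n by (simp_all add: divide_simps)
qed

lemma kf_diff:
  assumes "AE x in \<mu>. complex_of_real x \<noteq> z" "AE x in \<mu>. complex_of_real x \<noteq> w"
  shows "AE x in \<mu>. kf z x - kf w x = (z - w) * (gf z x * gf w x)"
  using assms
proof eventually_elim
  case (elim x)
  then show ?case
    by (simp add: kf_def gf_def diff_frac_eq)
qed

lemma AE_nonreal: "Im z \<noteq> 0 \<Longrightarrow> AE x in \<mu>. complex_of_real x \<noteq> z"
  by (intro AE_I2) auto

lemma kf_integrable:
  assumes "AE x in \<mu>. complex_of_real x \<noteq> z" and g: "gf z \<in> l2_fun \<mu>"
  shows "integrable \<mu> (kf z)"
proof -
  have 1: "integrable \<mu> (\<lambda>x. (z - \<i>) * (gf z x * gf \<i> x) + kf \<i> x)"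
    unfolding kf_i using l2_integrable_mult[OF g gf_l2[of "-\<i>"]] integral_weight(2)
    by (simp add: cnj_gf)
  have m: "kf z \<in> borel_measurable borel"
    unfolding kf_def[abs_def] by measurable
  have "AE x in \<mu>. kf z x = (z - \<i>) * (gf z x * gf \<i> x) + kf \<i> x"
    using kf_diff[OF assms(1) AE_nonreal, of \<i>] by (simp add: diff_eq_eq)
  then show ?thesis
    using 1 m by (subst integrable_cong_AE) (auto dest: borel_measurable_integrable)
qed

definition "Mf z = (\<integral>x. kf z x \<partial>\<mu>)"

lemma Mf_diff:
  assumes "AE x in \<mu>. complex_of_real x \<noteq> z" "gf z \<in> l2_fun \<mu>" "AE x in \<mu>. complex_of_real x \<noteq> w" "gf w \<in> l2_fun \<mu>"
  shows "Mf z - Mf w = (z - w) * (\<integral>x. gf z x * gf w x \<partial>\<mu>)"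
proof -
  have "Mf z - Mf w = (\<integral>x. kf z x - kf w x \<partial>\<mu>)"
    unfolding Mf_def using kf_integrable assms by simp
  also have "\<dots> = (\<integral>x. (z - w) * (gf z x * gf w x) \<partial>\<mu>)"
    using kf_diff[OF assms(1,3)] by (intro integral_cong_AE) (auto simp: kf_def)
  finally show ?thesis by simp
qed

lemma Mf_i: "Mf \<i> = \<i>"
  using integral_weight by (simp add: Mf_def kf_i)

lemma cnj_Mf: "cnj (Mf z) = Mf (cnj z)"
  unfolding Mf_def by (subst Bochner_Integration.integral_cnj[symmetric]) (simp add: kf_def[abs_def])

lemma Mf_inner:
  assumes z: "Im z \<noteq> 0" and w: "Im w \<noteq> 0"
  shows "(z - cnj w) * cinner (L2 \<mu>) (g_vec \<mu> z) (g_vec \<mu> w) = Mf z - cnj (Mf w)"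
  using Mf_diff[OF AE_nonreal gf_l2 AE_nonreal gf_l2, of z "cnj w"] z w
  by (simp add: g_vec_eq gf_l2 cnj_gf cnj_Mf)

text \<open>The real constant \<open>Q\<close> drops out of \<open>V z - cnj (V w)\<close>, and
  \<open>a\<close> is the squared modulus of the scalar in front of \<open>g_vec\<close>; so the
  same vectors serve every \<open>Q\<close>.\<close>

lemma gamma_field_mult_op:
  assumes a: "a > 0"
  shows "gamma_field (L2 \<mu>) (mult_op \<mu>) (\<lambda>z. (\<i> * complex_of_real (sqrt a)) \<odot>\<^bsub>L2 \<mu>\<^esub> g_vec \<mu> z)
    (\<lambda>z. complex_of_real Q + complex_of_real a * Mf z)"
proof (intro gamma_field.intro defect_field.intro L2.hilb_axioms defect_field_axioms.intro gamma_field_axioms.intro)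
  show "linear_op (L2 \<mu>) (mult_op \<mu>)" by (rule mult_op_linear)
  show "symmetric_op (L2 \<mu>) (mult_op \<mu>)" by (rule mult_op_symmetric)
  show "\<exists>f. (f, h \<oplus>\<^bsub>L2 \<mu>\<^esub> z \<odot>\<^bsub>L2 \<mu>\<^esub> f) \<in> mult_op \<mu>" if "Im z \<noteq> 0" "h \<in> carrier (L2 \<mu>)" for z h
    by (rule mult_op_range[OF that])
  define c where "c = \<i> * complex_of_real (sqrt a)"
  have cc: "c * cnj c = complex_of_real a"
    using a unfolding complex_norm_square[symmetric] by (simp add: c_def norm_mult flip: of_real_power)
  show "c \<odot>\<^bsub>L2 \<mu>\<^esub> g_vec \<mu> z \<in> carrier (L2 \<mu>)" if "Im z \<noteq> 0" for z
    using gf_l2[OF that] by (simp add: g_vec_eq l2_fun_smult)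
  show "((c \<odot>\<^bsub>L2 \<mu>\<^esub> g_vec \<mu> z) \<ominus>\<^bsub>L2 \<mu>\<^esub> (c \<odot>\<^bsub>L2 \<mu>\<^esub> g_vec \<mu> w),
      z \<odot>\<^bsub>L2 \<mu>\<^esub> (c \<odot>\<^bsub>L2 \<mu>\<^esub> g_vec \<mu> z) \<ominus>\<^bsub>L2 \<mu>\<^esub> w \<odot>\<^bsub>L2 \<mu>\<^esub> (c \<odot>\<^bsub>L2 \<mu>\<^esub> g_vec \<mu> w)) \<in> mult_op \<mu>"
    if z: "Im z \<noteq> 0" and w: "Im w \<noteq> 0" for z w
  proof -
    define f where "f x = c * gf z x - c * gf w x" for x
    have 1: "mx f = (\<lambda>x. z * (c * gf z x) - w * (c * gf w x))"
    proof
      fix x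
      have "complex_of_real x * gf u x = 1 + u * gf u x" if "Im u \<noteq> 0" for u
        using of_real_neq_nonreal[OF that, of x] by (simp add: gf_def field_simps)
      from this[OF z] this[OF w] show "mx f x = z * (c * gf z x) - w * (c * gf w x)"
        by (simp add: f_def right_diff_distrib mult.left_commute[of _ c] distrib_left)
    qed
    have l: "gf z \<in> l2_fun \<mu>" "gf w \<in> l2_fun \<mu>"
      using gf_l2 z w by auto
    have f: "f \<in> l2_fun \<mu>"
      unfolding f_def[abs_def] using l by (intro l2_fun_diff l2_fun_smult)
    have "mx f \<in> l2_fun \<mu>"
      unfolding 1 using l by (intro l2_fun_diff l2_fun_smult)
    from mult_opI[OF f this] show ?thesis
      unfolding 1 using l by (simp add: f_def[abs_def] g_vec_eq l2_fun_smult)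
  qed
  show "(z - cnj w) * cinner (L2 \<mu>) (c \<odot>\<^bsub>L2 \<mu>\<^esub> g_vec \<mu> z) (c \<odot>\<^bsub>L2 \<mu>\<^esub> g_vec \<mu> w) =
      (complex_of_real Q + complex_of_real a * Mf z) - cnj (complex_of_real Q + complex_of_real a * Mf w)"
    if z: "Im z \<noteq> 0" and w: "Im w \<noteq> 0" for z w
  proof -
    have "g_vec \<mu> z \<in> carrier (L2 \<mu>)" "g_vec \<mu> w \<in> carrier (L2 \<mu>)"
      using gf_l2 z w by (auto simp: g_vec_eq)
    then have "(z - cnj w) * cinner (L2 \<mu>) (c \<odot>\<^bsub>L2 \<mu>\<^esub> g_vec \<mu> z) (c \<odot>\<^bsub>L2 \<mu>\<^esub> g_vec \<mu> w) =
        (c * cnj c) * ((z - cnj w) * cinner (L2 \<mu>) (g_vec \<mu> z) (g_vec \<mu> w))"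
      by (simp add: algebra_simps)
    then show ?thesis
      unfolding cc Mf_inner[OF z w] by (simp add: algebra_simps)
  qed
  show "h = \<zero>\<^bsub>L2 \<mu>\<^esub>"
    if h: "h \<in> carrier (L2 \<mu>)" and orth: "\<And>z. Im z \<noteq> 0 \<Longrightarrow> cinner (L2 \<mu>) h (c \<odot>\<^bsub>L2 \<mu>\<^esub> g_vec \<mu> z) = 0" for h
  proof -
    obtain f where f: "f \<in> l2_fun \<mu>" "h = cl f"
      using carrier_E[OF h] .
    have c0: "c \<noteq> 0" using a by (simp add: c_def)
    have "(\<integral>x. f x * gf z x \<partial>\<mu>) = 0" if z: "Im z \<noteq> 0" for z
    proof -
      have z': "Im (cnj z) \<noteq> 0" using z by simp
      have "cnj c * cinner (L2 \<mu>) h (g_vec \<mu> (cnj z)) = 0"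
        using orth[OF z'] h gf_l2[OF z'] by (simp add: g_vec_eq del: smult_cl)
      then show ?thesis
        using c0 f gf_l2[OF z'] by (simp add: g_vec_eq cnj_gf)
    qed
    then have "AE x in \<mu>. f x = 0"
      by (rule gf_total[OF f(1)])
    then show ?thesis
      using f l2_fun_zero by (simp add: zero_L2 cl_eq_iff)
  qed
qed

end

section \<open>Transport of L-systems along unitary operators\<close>

lemma resolventI: "(f, g) \<in> R \<Longrightarrow> (g \<ominus>\<^bsub>H\<^esub> z \<odot>\<^bsub>H\<^esub> f, f) \<in> resolvent H R z"
  by (auto simp: resolvent_def)

locale unitary_map = A: hilb H\<^sub>1 + C: hilb H\<^sub>2 for H\<^sub>1 :: "'a hilbert" and H\<^sub>2 :: "'b hilbert" +
  fixes U :: "'a \<Rightarrow> 'b"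
  assumes U: "unitary_op H\<^sub>1 H\<^sub>2 U"
begin

abbreviation "W \<equiv> map_prod U U"

lemmas u = unitary_opD[OF U]

lemma U_eq_iff: "\<lbrakk>x \<in> carrier H\<^sub>1; y \<in> carrier H\<^sub>1\<rbrakk> \<Longrightarrow> U x = U y \<longleftrightarrow> x = y"
  using u(6) by blast

lemma U_zero: "U \<zero>\<^bsub>H\<^sub>1\<^esub> = \<zero>\<^bsub>H\<^sub>2\<^esub>"
proof -
  have "0 \<odot>\<^bsub>H\<^sub>1\<^esub> \<zero>\<^bsub>H\<^sub>1\<^esub> = \<zero>\<^bsub>H\<^sub>1\<^esub>"
    by (simp add: A.module_axioms_rules)
  then show ?thesis
    using u(3)[of "\<zero>\<^bsub>H\<^sub>1\<^esub>" 0] u(1)[of "\<zero>\<^bsub>H\<^sub>1\<^esub>"] by (simp add: C.module_axioms_rules)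
qed

lemma U_diff: "\<lbrakk>x \<in> carrier H\<^sub>1; y \<in> carrier H\<^sub>1\<rbrakk> \<Longrightarrow> U (x \<ominus>\<^bsub>H\<^sub>1\<^esub> y) = U x \<ominus>\<^bsub>H\<^sub>2\<^esub> U y"
  by (simp add: A.diff_as_add C.diff_as_add u)

lemma U_image: "U ` carrier H\<^sub>1 = carrier H\<^sub>2"
  using U unfolding unitary_op_def bij_betw_def by blast

lemma U_onto: "y \<in> carrier H\<^sub>2 \<Longrightarrow> (\<And>x. x \<in> carrier H\<^sub>1 \<Longrightarrow> y = U x \<Longrightarrow> thesis) \<Longrightarrow> thesis"
  using u(5) by blast

lemma hnorm_U: "x \<in> carrier H\<^sub>1 \<Longrightarrow> hnorm H\<^sub>2 (U x) = hnorm H\<^sub>1 x"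
  by (simp add: hnorm_def u(4))

lemma hlim_U: "hlim H\<^sub>1 x l \<Longrightarrow> hlim H\<^sub>2 (\<lambda>n. U (x n)) (U l)"
  using hnorm_U unfolding hlim_def by (simp add: U_diff[symmetric] u(1))

lemma W_mem_iff:
  assumes "R \<subseteq> carrier H\<^sub>1 \<times> carrier H\<^sub>1" "f \<in> carrier H\<^sub>1" "g \<in> carrier H\<^sub>1"
  shows "(U f, U g) \<in> W ` R \<longleftrightarrow> (f, g) \<in> R"
proof
  assume "(U f, U g) \<in> W ` R"
  then obtain f' g' where "(f', g') \<in> R" "U f = U f'" "U g = U g'"
    by auto
  moreover from this have "f' \<in> carrier H\<^sub>1" "g' \<in> carrier H\<^sub>1"
    using assms(1) by auto
  ultimately show "(f, g) \<in> R"
    using assms U_eq_iff by metis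
next
  assume "(f, g) \<in> R"
  then show "(U f, U g) \<in> W ` R"
    by (rule map_prod_imageI)
qed

lemma W_E: "(F, G) \<in> W ` R \<Longrightarrow> (\<And>f g. (f, g) \<in> R \<Longrightarrow> F = U f \<Longrightarrow> G = U g \<Longrightarrow> thesis) \<Longrightarrow> thesis"
  by auto

lemma W_sub: "R \<subseteq> carrier H\<^sub>1 \<times> carrier H\<^sub>1 \<Longrightarrow> W ` R \<subseteq> carrier H\<^sub>2 \<times> carrier H\<^sub>2"
  using u(1) by auto

lemma linear_op_sub: "linear_op H\<^sub>1 R \<Longrightarrow> R \<subseteq> carrier H\<^sub>1 \<times> carrier H\<^sub>1"
  by (simp add: linear_op_def)

lemma linear_op_W:
  assumes R: "linear_op H\<^sub>1 R"
  shows "linear_op H\<^sub>2 (W ` R)"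
  unfolding linear_op_def
proof (intro conjI)
  note sub = linear_op_sub[OF R]
  show "W ` R \<subseteq> carrier H\<^sub>2 \<times> carrier H\<^sub>2"
    by (rule W_sub[OF sub])
  show "single_valued (W ` R)"
  proof (rule single_valuedI)
    fix F G G' assume "(F, G) \<in> W ` R" "(F, G') \<in> W ` R"
    then obtain f g f' g' where a: "(f, g) \<in> R" "F = U f" "G = U g" "(f', g') \<in> R" "F = U f'" "G' = U g'"
      by auto
    have "f = f'"
      using a sub by (intro u(6)) auto
    then show "G = G'"
      using A.linear_op_unique[OF R] a by blast
  qed
  show "(\<zero>\<^bsub>H\<^sub>2\<^esub>, \<zero>\<^bsub>H\<^sub>2\<^esub>) \<in> W ` R"
    using map_prod_imageI[OF A.linear_op_zero[OF R], of U U] by (simp add: U_zero)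
  show "\<forall>(F, G)\<in>W ` R. \<forall>(F', G')\<in>W ` R. (F \<oplus>\<^bsub>H\<^sub>2\<^esub> F', G \<oplus>\<^bsub>H\<^sub>2\<^esub> G') \<in> W ` R"
  proof clarify
    fix f g f' g' assume a: "(f, g) \<in> R" "(f', g') \<in> R"
    then have "f \<in> carrier H\<^sub>1" "g \<in> carrier H\<^sub>1" "f' \<in> carrier H\<^sub>1" "g' \<in> carrier H\<^sub>1"
      using sub by auto
    then show "(U f \<oplus>\<^bsub>H\<^sub>2\<^esub> U f', U g \<oplus>\<^bsub>H\<^sub>2\<^esub> U g') \<in> W ` R"
      using map_prod_imageI[OF A.linear_op_add[OF R a], of U U] by (simp add: u(2))
  qed
  show "\<forall>c. \<forall>(F, G)\<in>W ` R. (c \<odot>\<^bsub>H\<^sub>2\<^esub> F, c \<odot>\<^bsub>H\<^sub>2\<^esub> G) \<in> W ` R"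
  proof clarify
    fix c f g assume a: "(f, g) \<in> R"
    then have "f \<in> carrier H\<^sub>1" "g \<in> carrier H\<^sub>1"
      using sub by auto
    then show "(c \<odot>\<^bsub>H\<^sub>2\<^esub> U f, c \<odot>\<^bsub>H\<^sub>2\<^esub> U g) \<in> W ` R"
      using map_prod_imageI[OF A.linear_op_smult[OF R a, of c], of U U] by (simp add: u(3))
  qed
qed

lemma adjoint_op_W:
  assumes R: "R \<subseteq> carrier H\<^sub>1 \<times> carrier H\<^sub>1"
  shows "adjoint_op H\<^sub>2 (W ` R) = W ` adjoint_op H\<^sub>1 R"
proof -
  have *: "(U g, U h) \<in> adjoint_op H\<^sub>2 (W ` R) \<longleftrightarrow> (g, h) \<in> adjoint_op H\<^sub>1 R"
    if c: "g \<in> carrier H\<^sub>1" "h \<in> carrier H\<^sub>1" for g h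
  proof
    assume a: "(U g, U h) \<in> adjoint_op H\<^sub>2 (W ` R)"
    show "(g, h) \<in> adjoint_op H\<^sub>1 R"
    proof (rule A.adjoint_opI[OF c])
      fix f k assume fk: "(f, k) \<in> R"
      then have "f \<in> carrier H\<^sub>1" "k \<in> carrier H\<^sub>1"
        using R by auto
      then show "cinner H\<^sub>1 k g = cinner H\<^sub>1 f h"
        using C.adjoint_opD(3)[OF a map_prod_imageI[OF fk]] c by (simp add: u(4))
    qed
  next
    assume a: "(g, h) \<in> adjoint_op H\<^sub>1 R"
    show "(U g, U h) \<in> adjoint_op H\<^sub>2 (W ` R)"
    proof (rule C.adjoint_opI)
      fix F K assume "(F, K) \<in> W ` R"
      then obtain f k where fk: "(f, k) \<in> R" "F = U f" "K = U k"
        by auto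
      then have "f \<in> carrier H\<^sub>1" "k \<in> carrier H\<^sub>1"
        using R by auto
      then show "cinner H\<^sub>2 K (U g) = cinner H\<^sub>2 F (U h)"
        using A.adjoint_opD(3)[OF a fk(1)] c fk by (simp add: u(4))
    qed (use c u(1) in auto)
  qed
  show ?thesis
  proof (intro equalityI subsetI)
    fix p assume p: "p \<in> adjoint_op H\<^sub>2 (W ` R)"
    then have "fst p \<in> carrier H\<^sub>2" "snd p \<in> carrier H\<^sub>2"
      by (auto simp: adjoint_op_def)
    then obtain g h where "g \<in> carrier H\<^sub>1" "h \<in> carrier H\<^sub>1" "p = (U g, U h)"
      using u(5) by (metis prod.collapse)
    then show "p \<in> W ` adjoint_op H\<^sub>1 R"
      using p * map_prod_imageI by metis
  next
    fix p assume "p \<in> W ` adjoint_op H\<^sub>1 R"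
    then obtain g h where gh: "(g, h) \<in> adjoint_op H\<^sub>1 R" "p = (U g, U h)"
      by auto
    then show "p \<in> adjoint_op H\<^sub>2 (W ` R)"
      using * A.adjoint_opD(1,2)[OF gh(1)] by simp
  qed
qed

lemma adjoint_sub: "adjoint_op H\<^sub>1 R \<subseteq> carrier H\<^sub>1 \<times> carrier H\<^sub>1"
  by (auto simp: adjoint_op_def)

lemma W_mono_iff:
  assumes "R \<subseteq> carrier H\<^sub>1 \<times> carrier H\<^sub>1" "R' \<subseteq> carrier H\<^sub>1 \<times> carrier H\<^sub>1"
  shows "W ` R \<subseteq> W ` R' \<longleftrightarrow> R \<subseteq> R'"
proof
  assume s: "W ` R \<subseteq> W ` R'"
  show "R \<subseteq> R'"
  proof (rule subrelI)
    fix f g assume fg: "(f, g) \<in> R"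
    then have "(U f, U g) \<in> W ` R'"
      using s map_prod_imageI[OF fg, of U U] by blast
    moreover have "f \<in> carrier H\<^sub>1" "g \<in> carrier H\<^sub>1"
      using fg assms(1) by auto
    ultimately show "(f, g) \<in> R'"
      using W_mem_iff[OF assms(2)] by simp
  qed
qed (rule image_mono)

lemma symmetric_op_W:
  "R \<subseteq> carrier H\<^sub>1 \<times> carrier H\<^sub>1 \<Longrightarrow> symmetric_op H\<^sub>2 (W ` R) \<longleftrightarrow> symmetric_op H\<^sub>1 R"
  unfolding symmetric_op_def by (simp add: adjoint_op_W W_mono_iff adjoint_sub)

lemma self_adjoint_op_W: "self_adjoint_op H\<^sub>1 R \<Longrightarrow> self_adjoint_op H\<^sub>2 (W ` R)"
  unfolding self_adjoint_op_def using linear_op_W adjoint_op_W linear_op_sub by metis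

lemma Domain_W: "Domain (W ` R) = U ` Domain R"
  by (force simp: Domain.simps image_iff)

text \<open>Closedness of a graph and density of a domain are stated topologically, so they are
  transported along a homeomorphism rather than through sequences.\<close>

lemma homeomorphic_U: "homeomorphic_map (htop H\<^sub>1) (htop H\<^sub>2) U"
proof -
  interpret Metric_space12 "carrier H\<^sub>1" "hdist H\<^sub>1" "carrier H\<^sub>2" "hdist H\<^sub>2"
    by (intro Metric_space12.intro A.metric C.metric)
  show ?thesis
    unfolding htop_def
  proof (rule isometry_imp_homeomorphic_map[OF U_image])
    fix x y assume "x \<in> carrier H\<^sub>1" "y \<in> carrier H\<^sub>1"
    then show "hdist H\<^sub>2 (U x) (U y) = hdist H\<^sub>1 x y"
      using hnorm_U[of "x \<ominus>\<^bsub>H\<^sub>1\<^esub> y"] by (simp add: hdist_def u(1) U_diff)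
  qed
qed

lemma closed_op_W:
  assumes "R \<subseteq> carrier H\<^sub>1 \<times> carrier H\<^sub>1" "closed_op H\<^sub>1 R"
  shows "closed_op H\<^sub>2 (W ` R)"
proof -
  have "homeomorphic_map (prod_topology (htop H\<^sub>1) (htop H\<^sub>1)) (prod_topology (htop H\<^sub>2) (htop H\<^sub>2)) (\<lambda>(x, y). (U x, U y))"
    using homeomorphic_U unfolding homeomorphic_map_maps by (metis homeomorphic_maps_prod)
  moreover have "(\<lambda>(x, y). (U x, U y)) ` R = W ` R"
    by (auto simp: map_prod_def)
  ultimately show ?thesis
    using assms(2) homeomorphic_map_closedness[of _ _ _ R] closedin_subset[of _ R] unfolding closed_op_def
    by metis
qed

lemma topspace_htop: "topspace (htop H\<^sub>1) = carrier H\<^sub>1" "topspace (htop H\<^sub>2) = carrier H\<^sub>2"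
  unfolding htop_def using Metric_space.topspace_mtopology[OF A.metric] Metric_space.topspace_mtopology[OF C.metric] by auto

lemma densely_defined_W:
  assumes "R \<subseteq> carrier H\<^sub>1 \<times> carrier H\<^sub>1" "densely_defined H\<^sub>1 R"
  shows "densely_defined H\<^sub>2 (W ` R)"
proof -
  have "Domain R \<subseteq> topspace (htop H\<^sub>1)"
    using assms(1) by (auto simp: topspace_htop)
  then have "htop H\<^sub>2 closure_of (U ` Domain R) = U ` (htop H\<^sub>1 closure_of Domain R)"
    by (rule homeomorphic_map_closure_of[OF homeomorphic_U])
  then show ?thesis
    using assms(2) U_image unfolding densely_defined_def Domain_W by simp
qed

lemma eigenspace_W:
  assumes "R \<subseteq> carrier H\<^sub>1 \<times> carrier H\<^sub>1"
  shows "eigenspace H\<^sub>2 (W ` R) z = U ` eigenspace H\<^sub>1 R z"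
proof -
  have *: "U f \<in> eigenspace H\<^sub>2 (W ` R) z \<longleftrightarrow> f \<in> eigenspace H\<^sub>1 R z" if "f \<in> carrier H\<^sub>1" for f
    using W_mem_iff[OF assms that A.smult_in[OF that], of z] that by (simp add: eigenspace_def u)
  show ?thesis
  proof (intro equalityI subsetI)
    fix F assume F: "F \<in> eigenspace H\<^sub>2 (W ` R) z"
    then obtain f where "f \<in> carrier H\<^sub>1" "F = U f"
      using U_onto by (metis (mono_tags, lifting) eigenspace_def mem_Collect_eq)
    then show "F \<in> U ` eigenspace H\<^sub>1 R z"
      using * F by blast
  next
    fix F assume "F \<in> U ` eigenspace H\<^sub>1 R z"
    then show "F \<in> eigenspace H\<^sub>2 (W ` R) z"
      using * by (auto simp: eigenspace_def)
  qed
qed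

lemma one_dimensional_U:
  assumes "one_dimensional H\<^sub>1 M"
  shows "one_dimensional H\<^sub>2 (U ` M)"
proof -
  obtain g where g: "g \<in> carrier H\<^sub>1" "g \<noteq> \<zero>\<^bsub>H\<^sub>1\<^esub>" "M = range (\<lambda>c. c \<odot>\<^bsub>H\<^sub>1\<^esub> g)"
    using assms unfolding one_dimensional_def by blast
  have "U ` M = range (\<lambda>c. c \<odot>\<^bsub>H\<^sub>2\<^esub> U g)"
    unfolding g(3) image_image by (simp add: u(3)[OF g(1)])
  moreover have "U g \<noteq> \<zero>\<^bsub>H\<^sub>2\<^esub>"
    using g U_eq_iff[OF g(1) A.zero_closed] U_zero by metis
  ultimately show ?thesis
    unfolding one_dimensional_def using u(1)[OF g(1)] by blast
qed

lemma deficiency_W: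
  assumes "R \<subseteq> carrier H\<^sub>1 \<times> carrier H\<^sub>1" "deficiency_indices_1_1 H\<^sub>1 R"
  shows "deficiency_indices_1_1 H\<^sub>2 (W ` R)"
  using assms(2) unfolding deficiency_indices_1_1_def adjoint_op_W[OF assms(1)]
  by (simp add: eigenspace_W[OF adjoint_sub] one_dimensional_U)

lemma resolvent_W:
  assumes "R \<subseteq> carrier H\<^sub>1 \<times> carrier H\<^sub>1"
  shows "resolvent H\<^sub>2 (W ` R) z = W ` resolvent H\<^sub>1 R z"
proof -
  have eq: "U g \<ominus>\<^bsub>H\<^sub>2\<^esub> z \<odot>\<^bsub>H\<^sub>2\<^esub> U f = U (g \<ominus>\<^bsub>H\<^sub>1\<^esub> z \<odot>\<^bsub>H\<^sub>1\<^esub> f)" if "(f, g) \<in> R" for f g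
  proof -
    have "f \<in> carrier H\<^sub>1" "g \<in> carrier H\<^sub>1"
      using assms that by auto
    then show ?thesis by (simp add: U_diff u)
  qed
  show ?thesis
  proof (intro equalityI subsetI)
    fix p assume "p \<in> resolvent H\<^sub>2 (W ` R) z"
    then obtain f g where "(f, g) \<in> R" "p = (U g \<ominus>\<^bsub>H\<^sub>2\<^esub> z \<odot>\<^bsub>H\<^sub>2\<^esub> U f, U f)"
      by (auto simp: resolvent_def)
    moreover from this have "(g \<ominus>\<^bsub>H\<^sub>1\<^esub> z \<odot>\<^bsub>H\<^sub>1\<^esub> f, f) \<in> resolvent H\<^sub>1 R z"
      by (intro resolventI)
    ultimately show "p \<in> W ` resolvent H\<^sub>1 R z"
      using eq map_prod_imageI[of _ _ "resolvent H\<^sub>1 R z" U U] by metis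
  next
    fix p assume "p \<in> W ` resolvent H\<^sub>1 R z"
    then obtain f g where fg: "(f, g) \<in> R" "p = (U (g \<ominus>\<^bsub>H\<^sub>1\<^esub> z \<odot>\<^bsub>H\<^sub>1\<^esub> f), U f)"
      by (auto simp: resolvent_def)
    have "(U f, U g) \<in> W ` R"
      using map_prod_imageI[OF fg(1)] .
    then show "p \<in> resolvent H\<^sub>2 (W ` R) z"
      unfolding fg(2) eq[OF fg(1), symmetric] by (rule resolventI)
  qed
qed

lemma resolvent_set_W:
  assumes R: "R \<subseteq> carrier H\<^sub>1 \<times> carrier H\<^sub>1" and z: "z \<in> resolvent_set H\<^sub>1 R"
  shows "z \<in> resolvent_set H\<^sub>2 (W ` R)"
proof -
  have sub: "resolvent H\<^sub>1 R z \<subseteq> carrier H\<^sub>1 \<times> carrier H\<^sub>1"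
    using R by (auto simp: resolvent_def)
  have sv: "single_valued (resolvent H\<^sub>1 R z)" and dom: "Domain (resolvent H\<^sub>1 R z) = carrier H\<^sub>1"
    using z by (auto simp: resolvent_set_def)
  obtain C where C: "\<And>h f. (h, f) \<in> resolvent H\<^sub>1 R z \<Longrightarrow> hnorm H\<^sub>1 f \<le> C * hnorm H\<^sub>1 h"
    using z unfolding resolvent_set_def by blast
  have "single_valued (W ` resolvent H\<^sub>1 R z)"
  proof (rule single_valuedI)
    fix F G G' assume "(F, G) \<in> W ` resolvent H\<^sub>1 R z" "(F, G') \<in> W ` resolvent H\<^sub>1 R z"
    then obtain f g f' g' where a: "(f, g) \<in> resolvent H\<^sub>1 R z" "F = U f" "G = U g"
      "(f', g') \<in> resolvent H\<^sub>1 R z" "F = U f'" "G' = U g'"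
      by auto
    have "f = f'"
      using a sub by (intro u(6)) auto
    then show "G = G'"
      using sv a unfolding single_valued_def by blast
  qed
  moreover have "Domain (W ` resolvent H\<^sub>1 R z) = carrier H\<^sub>2"
    by (simp add: Domain_W dom U_image)
  moreover have "hnorm H\<^sub>2 F \<le> C * hnorm H\<^sub>2 K" if KF: "(K, F) \<in> W ` resolvent H\<^sub>1 R z" for K F
  proof -
    obtain k f where kf: "(k, f) \<in> resolvent H\<^sub>1 R z" "K = U k" "F = U f"
      by (rule W_E[OF KF])
    then have "k \<in> carrier H\<^sub>1" "f \<in> carrier H\<^sub>1"
      using sub by auto
    then show ?thesis
      using C[OF kf(1)] kf by (simp add: hnorm_U)
  qed
  ultimately show ?thesis
    unfolding resolvent_set_def resolvent_W[OF R] by blast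
qed

lemma Domain_inter: "Domain R \<subseteq> carrier H\<^sub>1 \<Longrightarrow> Domain R' \<subseteq> carrier H\<^sub>1 \<Longrightarrow>
  Domain (W ` R) \<inter> Domain (W ` R') = U ` (Domain R \<inter> Domain R')"
  unfolding Domain_W using U unfolding unitary_op_def bij_betw_def by (metis inj_on_image_Int)

lemma main_operator_W:
  assumes S: "S \<subseteq> carrier H\<^sub>1 \<times> carrier H\<^sub>1" and T: "main_operator H\<^sub>1 S T"
  shows "main_operator H\<^sub>2 (W ` S) (W ` T)"
proof -
  have t: "linear_op H\<^sub>1 T" "\<not> symmetric_op H\<^sub>1 T" "S \<subseteq> T" "T \<subseteq> adjoint_op H\<^sub>1 S"
    "resolvent_set H\<^sub>1 T \<noteq> {}" "Domain S = Domain T \<inter> Domain (adjoint_op H\<^sub>1 T)"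
    using T by (auto simp: main_operator_def)
  note Ts = linear_op_sub[OF t(1)]
  have d: "Domain T \<subseteq> carrier H\<^sub>1" "Domain (adjoint_op H\<^sub>1 T) \<subseteq> carrier H\<^sub>1"
    using Ts adjoint_sub[of T] by auto
  have "Domain (W ` S) = U ` (Domain T \<inter> Domain (adjoint_op H\<^sub>1 T))"
    unfolding Domain_W t(6) ..
  then have dom: "Domain (W ` S) = Domain (W ` T) \<inter> Domain (adjoint_op H\<^sub>2 (W ` T))"
    unfolding adjoint_op_W[OF Ts] Domain_inter[OF d] .
  obtain z where z: "z \<in> resolvent_set H\<^sub>1 T"
    using t(5) by blast
  show ?thesis
    unfolding main_operator_def
  proof (intro conjI)
    show "resolvent_set H\<^sub>2 (W ` T) \<noteq> {}"
      using resolvent_set_W[OF Ts z] by blast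
    show "W ` S \<subseteq> W ` T" "W ` T \<subseteq> adjoint_op H\<^sub>2 (W ` S)"
      unfolding adjoint_op_W[OF S] by (rule image_mono[OF t(3)], rule image_mono[OF t(4)])
    show "\<not> symmetric_op H\<^sub>2 (W ` T)"
      using symmetric_op_W[OF Ts] t(2) by simp
  qed (rule linear_op_W[OF t(1)] dom)+
qed

text \<open>A nonzero reducing subspace of the image with self-adjoint part pulls back to one of
  \<open>S\<close>. The part lives in the record with restricted carrier, which is why its adjoint
  is compared by hand instead of by \<open>adjoint_op_W\<close>.\<close>

lemma prime_op_W:
  assumes S: "S \<subseteq> carrier H\<^sub>1 \<times> carrier H\<^sub>1" and lin: "linear_op H\<^sub>1 S" and prime: "prime_op H\<^sub>1 S"
  shows "prime_op H\<^sub>2 (W ` S)"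
proof (rule ccontr)
  assume "\<not> prime_op H\<^sub>2 (W ` S)"
  then obtain N where red: "reducing_subspace H\<^sub>2 (W ` S) N" and N0: "N \<noteq> {\<zero>\<^bsub>H\<^sub>2\<^esub>}"
    and sa: "self_adjoint_op (H\<^sub>2\<lparr>carrier := N\<rparr>) (W ` S \<inter> N \<times> N)"
    by (auto simp: prime_op_def)
  define M where "M = {x \<in> carrier H\<^sub>1. U x \<in> N}"
  have subN: "hsub H\<^sub>2 N" and closN: "seq_closed H\<^sub>2 N"
    using red by (auto simp: reducing_subspace_def C.closed_subspace_iff)
  have Nc: "N \<subseteq> carrier H\<^sub>2"
    using subN by (simp add: hsub_def)
  have subM: "hsub H\<^sub>1 M"
    using subN unfolding hsub_def M_def by (auto simp: U_zero u)
  have closM: "seq_closed H\<^sub>1 M"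
    unfolding seq_closed_def
  proof (intro allI impI)
    fix x l assume x: "\<forall>n. x n \<in> M" and l: "hlim H\<^sub>1 x l"
    have "U l \<in> N"
      using closN[unfolded seq_closed_def, rule_format, OF _ hlim_U[OF l]] x by (simp add: M_def)
    then show "l \<in> M"
      using hlim_in(2)[OF l] by (simp add: M_def)
  qed
  have inM: "x \<in> M \<longleftrightarrow> U x \<in> N" if "x \<in> carrier H\<^sub>1" for x
    using that by (simp add: M_def)
  have orth: "x \<in> orth_compl H\<^sub>1 M \<longleftrightarrow> U x \<in> orth_compl H\<^sub>2 N" if x: "x \<in> carrier H\<^sub>1" for x
  proof -
    have "(\<forall>y\<in>M. cinner H\<^sub>1 x y = 0) \<longleftrightarrow> (\<forall>y\<in>N. cinner H\<^sub>2 (U x) y = 0)"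
    proof
      assume a: "\<forall>y\<in>M. cinner H\<^sub>1 x y = 0"
      show "\<forall>y\<in>N. cinner H\<^sub>2 (U x) y = 0"
      proof
        fix y assume y: "y \<in> N"
        then obtain y' where "y' \<in> carrier H\<^sub>1" "y = U y'"
          using U_onto Nc by (metis subsetD)
        then show "cinner H\<^sub>2 (U x) y = 0"
          using a y x by (simp add: u(4) M_def)
      qed
    next
      assume a: "\<forall>y\<in>N. cinner H\<^sub>2 (U x) y = 0"
      show "\<forall>y\<in>M. cinner H\<^sub>1 x y = 0"
      proof
        fix y assume "y \<in> M"
        then show "cinner H\<^sub>1 x y = 0"
          using a x u(4)[OF x, of y] by (simp add: M_def)
      qed
    qed
    then show ?thesis
      using x u(1)[OF x] by (simp add: orth_compl_def)
  qed
  have "reducing_subspace H\<^sub>1 S M"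
    unfolding reducing_subspace_def A.closed_subspace_iff
  proof (intro conjI subM closM ballI, clarify)
    fix f g assume fg: "(f, g) \<in> S"
    then have fgc: "f \<in> carrier H\<^sub>1" "g \<in> carrier H\<^sub>1"
      using S by auto
    obtain p q where p: "p \<in> W ` S \<inter> N \<times> N" and q: "q \<in> W ` S \<inter> orth_compl H\<^sub>2 N \<times> orth_compl H\<^sub>2 N"
      and sum: "U f = fst p \<oplus>\<^bsub>H\<^sub>2\<^esub> fst q"
      using red map_prod_imageI[OF fg, of U U] unfolding reducing_subspace_def by (fastforce simp: split_beta)
    obtain f1 g1 where f1: "(f1, g1) \<in> S" "p = (U f1, U g1)" using p by auto
    obtain f2 g2 where f2: "(f2, g2) \<in> S" "q = (U f2, U g2)" using q by auto
    have c: "f1 \<in> carrier H\<^sub>1" "g1 \<in> carrier H\<^sub>1" "f2 \<in> carrier H\<^sub>1" "g2 \<in> carrier H\<^sub>1"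
      using S f1 f2 by auto
    have "(f1, g1) \<in> S \<inter> M \<times> M"
      using f1 p c by (simp add: inM)
    moreover have "(f2, g2) \<in> S \<inter> orth_compl H\<^sub>1 M \<times> orth_compl H\<^sub>1 M"
      using f2 q c by (simp add: orth)
    moreover have "f = f1 \<oplus>\<^bsub>H\<^sub>1\<^esub> f2"
      using sum f1 f2 c fgc by (intro u(6)) (auto simp: u(2))
    ultimately show "\<exists>(f\<^sub>1, g\<^sub>1)\<in>S \<inter> M \<times> M. \<exists>(f\<^sub>2, g\<^sub>2)\<in>S \<inter> orth_compl H\<^sub>1 M \<times> orth_compl H\<^sub>1 M. f = f\<^sub>1 \<oplus>\<^bsub>H\<^sub>1\<^esub> f\<^sub>2"
      by blast
  qed
  moreover have "M \<noteq> {\<zero>\<^bsub>H\<^sub>1\<^esub>}"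
  proof -
    obtain y where y: "y \<in> N" "y \<noteq> \<zero>\<^bsub>H\<^sub>2\<^esub>"
      using N0 subN unfolding hsub_def by blast
    then obtain x where x: "x \<in> carrier H\<^sub>1" "y = U x"
      using U_onto Nc by (metis subsetD)
    then have "x \<in> M" "x \<noteq> \<zero>\<^bsub>H\<^sub>1\<^esub>"
      using y by (auto simp: M_def U_zero)
    then show ?thesis by blast
  qed
  moreover have "self_adjoint_op (H\<^sub>1\<lparr>carrier := M\<rparr>) (S \<inter> M \<times> M)"
    unfolding self_adjoint_op_def
  proof
    show "linear_op (H\<^sub>1\<lparr>carrier := M\<rparr>) (S \<inter> M \<times> M)"
      unfolding linear_op_def
    proof (intro conjI)
      show "single_valued (S \<inter> M \<times> M)"
        using lin unfolding linear_op_def single_valued_def by blast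
      show "(\<zero>\<^bsub>H\<^sub>1\<lparr>carrier := M\<rparr>\<^esub>, \<zero>\<^bsub>H\<^sub>1\<lparr>carrier := M\<rparr>\<^esub>) \<in> S \<inter> M \<times> M"
        using A.linear_op_zero[OF lin] subM by (auto simp: hsub_def)
    qed (use subM in \<open>auto intro: A.linear_op_add[OF lin] A.linear_op_smult[OF lin] simp: hsub_def\<close>)
    have "(g, h) \<in> adjoint_op (H\<^sub>1\<lparr>carrier := M\<rparr>) (S \<inter> M \<times> M) \<longleftrightarrow> (g, h) \<in> S \<inter> M \<times> M" for g h
    proof (cases "g \<in> M \<and> h \<in> M")
      case True
      then have c: "g \<in> carrier H\<^sub>1" "h \<in> carrier H\<^sub>1"
        by (auto simp: M_def)
      have "(g, h) \<in> adjoint_op (H\<^sub>1\<lparr>carrier := M\<rparr>) (S \<inter> M \<times> M) \<longleftrightarrow>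
          (\<forall>f k. (f, k) \<in> S \<longrightarrow> f \<in> M \<longrightarrow> k \<in> M \<longrightarrow> cinner H\<^sub>1 k g = cinner H\<^sub>1 f h)"
        using True by (auto simp: adjoint_op_def)
      also have "\<dots> \<longleftrightarrow> (\<forall>F K. (F, K) \<in> W ` S \<longrightarrow> F \<in> N \<longrightarrow> K \<in> N \<longrightarrow> cinner H\<^sub>2 K (U g) = cinner H\<^sub>2 F (U h))"
      proof
        assume a: "\<forall>f k. (f, k) \<in> S \<longrightarrow> f \<in> M \<longrightarrow> k \<in> M \<longrightarrow> cinner H\<^sub>1 k g = cinner H\<^sub>1 f h"
        show "\<forall>F K. (F, K) \<in> W ` S \<longrightarrow> F \<in> N \<longrightarrow> K \<in> N \<longrightarrow> cinner H\<^sub>2 K (U g) = cinner H\<^sub>2 F (U h)"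
        proof (intro allI impI)
          fix F K assume "(F, K) \<in> W ` S" and FK: "F \<in> N" "K \<in> N"
          then obtain f k where fk: "(f, k) \<in> S" "F = U f" "K = U k" by auto
          then have fkc: "f \<in> carrier H\<^sub>1" "k \<in> carrier H\<^sub>1" using S by auto
          then have "cinner H\<^sub>1 k g = cinner H\<^sub>1 f h"
            using a fk FK by (simp add: inM)
          then show "cinner H\<^sub>2 K (U g) = cinner H\<^sub>2 F (U h)"
            using fk fkc c by (simp add: u(4))
        qed
      next
        assume a: "\<forall>F K. (F, K) \<in> W ` S \<longrightarrow> F \<in> N \<longrightarrow> K \<in> N \<longrightarrow> cinner H\<^sub>2 K (U g) = cinner H\<^sub>2 F (U h)"
        show "\<forall>f k. (f, k) \<in> S \<longrightarrow> f \<in> M \<longrightarrow> k \<in> M \<longrightarrow> cinner H\<^sub>1 k g = cinner H\<^sub>1 f h"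
        proof (intro allI impI)
          fix f k assume fk: "(f, k) \<in> S" and M: "f \<in> M" "k \<in> M"
          then have fkc: "f \<in> carrier H\<^sub>1" "k \<in> carrier H\<^sub>1" using S by auto
          have "U f \<in> N" "U k \<in> N"
            using M by (simp_all add: M_def)
          then have "cinner H\<^sub>2 (U k) (U g) = cinner H\<^sub>2 (U f) (U h)"
            using a map_prod_imageI[OF fk, of U U] by simp
          then show "cinner H\<^sub>1 k g = cinner H\<^sub>1 f h"
            using fkc c by (simp add: u(4))
        qed
      qed
      also have "\<dots> \<longleftrightarrow> (U g, U h) \<in> adjoint_op (H\<^sub>2\<lparr>carrier := N\<rparr>) (W ` S \<inter> N \<times> N)"
        using True by (auto simp: adjoint_op_def M_def)
      also have "\<dots> \<longleftrightarrow> (U g, U h) \<in> W ` S \<inter> N \<times> N"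
        using sa by (simp add: self_adjoint_op_def)
      also have "\<dots> \<longleftrightarrow> (g, h) \<in> S \<inter> M \<times> M"
        using True W_mem_iff[OF S c] c by (simp add: inM)
      finally show ?thesis .
    qed (auto simp: adjoint_op_def)
    then show "adjoint_op (H\<^sub>1\<lparr>carrier := M\<rparr>) (S \<inter> M \<times> M) = S \<inter> M \<times> M"
      by (intro equalityI subrelI) blast+
  qed
  ultimately show False
    using prime unfolding prime_op_def by blast
qed

end

section \<open>Transport of the rigged space\<close>

locale rigged_map = unitary_map H\<^sub>1 H\<^sub>2 U + R1: rigged H\<^sub>1 S\<^sub>1
  for H\<^sub>1 :: "'a hilbert" and H\<^sub>2 :: "'b hilbert" and U :: "'a \<Rightarrow> 'b" and S\<^sub>1 :: "'a rel" +
  fixes S\<^sub>2 :: "'b rel"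
  assumes S2: "S\<^sub>2 = map_prod U U ` S\<^sub>1"
begin

sublocale R2: rigged H\<^sub>2 S\<^sub>2
  using linear_op_W[OF R1.lin] densely_defined_W[OF R1.S_sub R1.dense] by unfold_locales (simp_all add: S2)

abbreviation "D\<^sub>1 \<equiv> Domain (adjoint_op H\<^sub>1 S\<^sub>1)"
abbreviation "D\<^sub>2 \<equiv> Domain (adjoint_op H\<^sub>2 S\<^sub>2)"

lemma adjoint_S2: "adjoint_op H\<^sub>2 S\<^sub>2 = W ` adjoint_op H\<^sub>1 S\<^sub>1"
  unfolding S2 by (rule adjoint_op_W[OF R1.S_sub])

lemma D2: "D\<^sub>2 = U ` D\<^sub>1"
  unfolding adjoint_S2 by (rule Domain_W)

lemma UD: "f \<in> D\<^sub>1 \<Longrightarrow> U f \<in> D\<^sub>2"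
  unfolding D2 by blast

lemma D2E: "F \<in> D\<^sub>2 \<Longrightarrow> (\<And>f. f \<in> D\<^sub>1 \<Longrightarrow> F = U f \<Longrightarrow> thesis) \<Longrightarrow> thesis"
  unfolding D2 by blast

lemma st_U: "f \<in> D\<^sub>1 \<Longrightarrow> R2.st (U f) = U (R1.st f)"
  by (rule R2.st_eq) (use map_prod_imageI[OF R1.st_graph, of f U U] in \<open>simp add: adjoint_S2\<close>)

lemma unitary_P: "unitary_op R1.P R2.P U"
  unfolding unitary_op_def
proof (intro conjI ballI allI)
  show "bij_betw U (carrier R1.P) (carrier R2.P)"
    unfolding bij_betw_def using D2 U_eq_iff R1.D_in by (auto simp: inj_on_def simp del: Domain_iff)
qed (use R1.D_in in \<open>simp_all add: u st_U\<close>)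

sublocale P: unitary_map R1.P R2.P U
  by unfold_locales (rule unitary_P)

text \<open>Explicit form of \<open>U\<^sub>-\<close>: composition with the inverse of
  \<open>U\<close>, extended by zero. Agreement with \<open>U_minus\<close> is shown on the
  antidual, inside \<open>bi_unitarily_equivalent_map\<close>.\<close>

definition push :: "('a \<Rightarrow> complex) \<Rightarrow> 'b \<Rightarrow> complex"
  where "push \<phi> = (\<lambda>X. if X \<in> D\<^sub>2 then \<phi> (inv_into (carrier H\<^sub>1) U X) else 0)"

lemma push_U: "f \<in> D\<^sub>1 \<Longrightarrow> push \<phi> (U f) = \<phi> f"
proof -
  assume f: "f \<in> D\<^sub>1"
  have "inj_on U (carrier H\<^sub>1)"
    by (rule inj_onI) (rule u(6))
  then have "inv_into (carrier H\<^sub>1) U (U f) = f"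
    using R1.D_in(1)[OF f] by (rule inv_into_f_f)
  then show ?thesis
    using UD[OF f] by (simp add: push_def del: Domain_iff)
qed

lemma push_outside: "X \<notin> D\<^sub>2 \<Longrightarrow> push \<phi> X = 0"
  by (simp add: push_def)

lemma push_eqI:
  assumes "\<And>X. X \<notin> D\<^sub>2 \<Longrightarrow> \<psi> X = 0" "\<And>f. f \<in> D\<^sub>1 \<Longrightarrow> \<psi> (U f) = \<phi> f"
  shows "\<psi> = push \<phi>"
proof
  fix X show "\<psi> X = push \<phi> X"
  proof (cases "X \<in> D\<^sub>2")
    case True
    then obtain f where "f \<in> D\<^sub>1" "X = U f"
      by (rule D2E)
    then show ?thesis
      using assms(2) push_U by simp
  qed (use assms(1) push_outside in simp)
qed

lemma push_inj:
  assumes "push \<phi> = push \<psi>" "\<And>x. x \<notin> D\<^sub>1 \<Longrightarrow> \<phi> x = 0" "\<And>x. x \<notin> D\<^sub>1 \<Longrightarrow> \<psi> x = 0"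
  shows "\<phi> = \<psi>"
proof
  fix x show "\<phi> x = \<psi> x"
    using assms push_U by (cases "x \<in> D\<^sub>1") metis+
qed

lemma push_in:
  assumes \<phi>: "\<phi> \<in> carrier (antidual R1.P)"
  shows "push \<phi> \<in> carrier (antidual R2.P)"
proof -
  obtain C where C: "\<forall>x\<in>carrier R1.P. cmod (\<phi> x) \<le> C * hnorm R1.P x"
    using R1.P.antidualD(4)[OF \<phi>] by blast
  show ?thesis
  proof (rule R2.P.antidualI[where C=C])
    fix F assume F: "F \<in> carrier R2.P"
    then have "F \<in> D\<^sub>2" by simp
    then obtain f where f: "f \<in> D\<^sub>1" "F = U f" by (rule D2E)
    show "push \<phi> (c \<odot>\<^bsub>R2.P\<^esub> F) = cnj c * push \<phi> F" for c
      using R1.P.antidualD(2)[OF \<phi>, of f c] f R1.D_in[OF f(1)] push_U[OF R1.D_smult[OF f(1)], of \<phi> c] push_U[OF f(1)]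
      by (simp add: u(3))
    show "cmod (push \<phi> F) \<le> C * hnorm R2.P F"
      using C f push_U[OF f(1), of \<phi>] P.hnorm_U[of f] by simp
    fix G assume G: "G \<in> carrier R2.P"
    then have "G \<in> D\<^sub>2" by simp
    then obtain g where g: "g \<in> D\<^sub>1" "G = U g" by (rule D2E)
    show "push \<phi> (F \<oplus>\<^bsub>R2.P\<^esub> G) = push \<phi> F + push \<phi> G"
      using R1.P.antidualD(1)[OF \<phi>, of f g] f g R1.D_in[OF f(1)] R1.D_in[OF g(1)]
        push_U[OF R1.D_add[OF f(1) g(1)], of \<phi>] push_U[OF f(1)] push_U[OF g(1)]
      by (simp add: u(2))
  qed (simp add: push_def)
qed

lemma riesz_push:
  assumes \<phi>: "\<phi> \<in> carrier (antidual R1.P)"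
  shows "riesz_berezansky R2.P (push \<phi>) = U (riesz_berezansky R1.P \<phi>)"
proof (rule R2.P.riesz_berezansky_eqI[OF push_in[OF \<phi>]])
  note rb = R1.P.riesz_berezansky[OF \<phi>]
  show "U (riesz_berezansky R1.P \<phi>) \<in> carrier R2.P"
    by (rule P.u(1)[OF rb(1)])
  fix F assume "F \<in> carrier R2.P"
  then have "F \<in> D\<^sub>2" by simp
  then obtain f where f: "f \<in> D\<^sub>1" "F = U f" by (rule D2E)
  then have fP: "f \<in> carrier R1.P" by simp
  show "cnj (push \<phi> F) = cinner R2.P F (U (riesz_berezansky R1.P \<phi>))"
    using rb(2)[OF fP] P.u(4)[OF fP rb(1)] f push_U[OF f(1), of \<phi>] by metis
qed

lemma hnorm_push:
  assumes \<phi>: "\<phi> \<in> carrier (antidual R1.P)"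
  shows "hnorm (antidual R2.P) (push \<phi>) = hnorm (antidual R1.P) \<phi>"
proof -
  have "cinner (antidual R2.P) (push \<phi>) (push \<phi>) = cinner (antidual R1.P) \<phi> \<phi>"
    using riesz_push[OF \<phi>] P.u(4)[OF R1.P.riesz_berezansky(1)[OF \<phi>] R1.P.riesz_berezansky(1)[OF \<phi>]]
    by (simp add: antidual_def)
  then show ?thesis
    by (simp add: hnorm_def)
qed

lemma push_add: "push (\<lambda>x. \<phi> x + \<psi> x) = (\<lambda>X. push \<phi> X + push \<psi> X)"
  and push_smult: "push (\<lambda>x. c * \<phi> x) = (\<lambda>X. c * push \<phi> X)"
  by (auto simp: push_def)

lemma embed_U: "g \<in> carrier H\<^sub>1 \<Longrightarrow> embed_minus H\<^sub>2 S\<^sub>2 (U g) = push (embed_minus H\<^sub>1 S\<^sub>1 g)"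
  by (rule push_eqI) (use UD R1.D_in in \<open>simp_all add: embed_minus_def u(4) del: Domain_iff\<close>)

text \<open>\<open>V\<close> is an isometric reparametrization of the source: the inverse of
  \<open>U\<close> on H_+ when the state operator is transported, the identity of the complex
  numbers for the channel.\<close>

lemma bounded_op_push:
  assumes "bounded_op K (antidual R1.P) B" "V \<in> carrier K' \<rightarrow> carrier K"
    "\<And>x. x \<in> carrier K' \<Longrightarrow> B' x = push (B (V x))"
    "\<And>x y. x \<in> carrier K' \<Longrightarrow> y \<in> carrier K' \<Longrightarrow> x \<oplus>\<^bsub>K'\<^esub> y \<in> carrier K' \<and> V (x \<oplus>\<^bsub>K'\<^esub> y) = V x \<oplus>\<^bsub>K\<^esub> V y"
    "\<And>c x. x \<in> carrier K' \<Longrightarrow> c \<odot>\<^bsub>K'\<^esub> x \<in> carrier K' \<and> V (c \<odot>\<^bsub>K'\<^esub> x) = c \<odot>\<^bsub>K\<^esub> V x"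
    "\<And>x. x \<in> carrier K' \<Longrightarrow> hnorm K (V x) = hnorm K' x"
  shows "bounded_op K' (antidual R2.P) B'"
proof -
  have B: "B x \<in> carrier (antidual R1.P)" if "x \<in> carrier K" for x
    using assms(1) that by (auto simp: bounded_op_def)
  have Badd: "B (x \<oplus>\<^bsub>K\<^esub> y) = (\<lambda>h. B x h + B y h)" if "x \<in> carrier K" "y \<in> carrier K" for x y
    using assms(1) that by (simp add: bounded_op_def)
  have Bsm: "B (c \<odot>\<^bsub>K\<^esub> x) = (\<lambda>h. c * B x h)" if "x \<in> carrier K" for x c
    using assms(1) that by (simp add: bounded_op_def)
  obtain C where C: "\<forall>x\<in>carrier K. hnorm (antidual R1.P) (B x) \<le> C * hnorm K x"
    using assms(1) unfolding bounded_op_def by blast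
  have V: "V x \<in> carrier K" if "x \<in> carrier K'" for x
    using assms(2) that by blast
  show ?thesis
    unfolding bounded_op_def
  proof (intro conjI ballI allI)
    show "B' \<in> carrier K' \<rightarrow> carrier (antidual R2.P)"
      using assms(3) push_in[OF B[OF V]] by auto
    show "B' (x \<oplus>\<^bsub>K'\<^esub> y) = B' x \<oplus>\<^bsub>antidual R2.P\<^esub> B' y" if "x \<in> carrier K'" "y \<in> carrier K'" for x y
      using assms(3,4) that Badd[OF V V] by (simp add: push_add)
    show "B' (c \<odot>\<^bsub>K'\<^esub> x) = c \<odot>\<^bsub>antidual R2.P\<^esub> B' x" if "x \<in> carrier K'" for c x
      using assms(3,5) that Bsm[OF V] by (simp add: push_smult)
    have "hnorm (antidual R2.P) (B' x) \<le> C * hnorm K' x" if "x \<in> carrier K'" for x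
      using C V[OF that] hnorm_push[OF B[OF V[OF that]]] assms(3,6) that by metis
    then show "\<exists>C. \<forall>x\<in>carrier K'. hnorm (antidual R2.P) (B' x) \<le> C * hnorm K' x"
      by blast
  qed
qed

end

section \<open>Transport of an L-system\<close>

locale lsystem_map = rigged_map H\<^sub>1 H\<^sub>2 U S\<^sub>1 S\<^sub>2 + L1: lsystem_data H\<^sub>1 S\<^sub>1 T\<^sub>1 A\<^sub>1 K\<^sub>1
  for H\<^sub>1 :: "'a hilbert" and H\<^sub>2 :: "'b hilbert" and U :: "'a \<Rightarrow> 'b" and S\<^sub>1 :: "'a rel" and S\<^sub>2 :: "'b rel"
    and T\<^sub>1 A\<^sub>1 K\<^sub>1 +
  fixes T\<^sub>2 :: "'b rel" and A\<^sub>2 :: "'b \<Rightarrow> 'b \<Rightarrow> complex" and K\<^sub>2 :: "complex \<Rightarrow> 'b \<Rightarrow> complex"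
  assumes T2: "T\<^sub>2 = map_prod U U ` T\<^sub>1"
    and A2: "\<And>f. f \<in> Domain (adjoint_op H\<^sub>1 S\<^sub>1) \<Longrightarrow> A\<^sub>2 (U f) = push (A\<^sub>1 f)"
    and K2: "\<And>c. K\<^sub>2 c = push (K\<^sub>1 c)"
begin

lemma T1_sub: "T\<^sub>1 \<subseteq> carrier H\<^sub>1 \<times> carrier H\<^sub>1"
  using L1.T_facts(1) by (simp add: linear_op_def)

lemma pm_adjoint_U: "f \<in> D\<^sub>1 \<Longrightarrow> pm_adjoint R2.P A\<^sub>2 (U f) = push (pm_adjoint R1.P A\<^sub>1 f)"
  by (rule push_eqI) (use UD in \<open>simp_all add: pm_adjoint_def A2 push_U del: Domain_iff\<close>)

lemma pm_Re_U: "f \<in> D\<^sub>1 \<Longrightarrow> pm_Re R2.P A\<^sub>2 (U f) = push (pm_Re R1.P A\<^sub>1 f)"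
  by (rule push_eqI) (simp_all add: pm_Re_def pm_adjoint_U A2 push_U push_outside del: Domain_iff)

lemma pm_Im_U: "f \<in> D\<^sub>1 \<Longrightarrow> pm_Im R2.P A\<^sub>2 (U f) = push (pm_Im R1.P A\<^sub>1 f)"
  by (rule push_eqI) (simp_all add: pm_Im_def pm_adjoint_U A2 push_U push_outside del: Domain_iff)

text \<open>\<open>push\<close> is injective on functionals that vanish off H_+, so the defining
  equation between functionals holds on one side exactly when it holds on the other.\<close>

lemma quasi_kernel_W: "quasi_kernel H\<^sub>2 S\<^sub>2 (pm_Re R2.P A\<^sub>2) = W ` quasi_kernel H\<^sub>1 S\<^sub>1 (pm_Re R1.P A\<^sub>1)"
proof -
  have *: "(U f, U g) \<in> quasi_kernel H\<^sub>2 S\<^sub>2 (pm_Re R2.P A\<^sub>2) \<longleftrightarrow> (f, g) \<in> quasi_kernel H\<^sub>1 S\<^sub>1 (pm_Re R1.P A\<^sub>1)"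
    if f: "f \<in> D\<^sub>1" and g: "g \<in> carrier H\<^sub>1" for f g
  proof -
    have "push (pm_Re R1.P A\<^sub>1 f) = push (embed_minus H\<^sub>1 S\<^sub>1 g) \<longleftrightarrow> pm_Re R1.P A\<^sub>1 f = embed_minus H\<^sub>1 S\<^sub>1 g"
    proof
      assume "push (pm_Re R1.P A\<^sub>1 f) = push (embed_minus H\<^sub>1 S\<^sub>1 g)"
      then show "pm_Re R1.P A\<^sub>1 f = embed_minus H\<^sub>1 S\<^sub>1 g"
        by (rule push_inj) (simp_all add: L1.pm_Re_outside[OF f] embed_minus_def)
    qed simp
    then show ?thesis
      using f g UD[OF f] u(1)[OF g] by (simp add: quasi_kernel_def pm_Re_U embed_U del: Domain_iff)
  qed
  show ?thesis
  proof (intro equalityI subsetI)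
    fix p assume p: "p \<in> quasi_kernel H\<^sub>2 S\<^sub>2 (pm_Re R2.P A\<^sub>2)"
    then have "fst p \<in> D\<^sub>2" "snd p \<in> carrier H\<^sub>2"
      by (auto simp: quasi_kernel_def)
    then obtain f g where "f \<in> D\<^sub>1" "g \<in> carrier H\<^sub>1" "p = (U f, U g)"
      using D2E u(5) by (metis prod.collapse)
    then show "p \<in> W ` quasi_kernel H\<^sub>1 S\<^sub>1 (pm_Re R1.P A\<^sub>1)"
      using p * map_prod_imageI by metis
  next
    fix p assume "p \<in> W ` quasi_kernel H\<^sub>1 S\<^sub>1 (pm_Re R1.P A\<^sub>1)"
    then obtain f g where fg: "(f, g) \<in> quasi_kernel H\<^sub>1 S\<^sub>1 (pm_Re R1.P A\<^sub>1)" "p = (U f, U g)"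
      by auto
    then have "f \<in> D\<^sub>1" "g \<in> carrier H\<^sub>1"
      by (auto simp: quasi_kernel_def)
    then show "p \<in> quasi_kernel H\<^sub>2 S\<^sub>2 (pm_Re R2.P A\<^sub>2)"
      using * fg by simp
  qed
qed

lemma star_extension_map: "star_extension H\<^sub>2 S\<^sub>2 T\<^sub>2 A\<^sub>2"
  unfolding star_extension_def
proof (intro conjI)
  have A1: "bounded_op R1.P (antidual R1.P) A\<^sub>1"
    using L1.A_ext unfolding star_extension_def H_minus_def by blast
  define V where "V = inv_into (carrier H\<^sub>1) U"
  have VU: "V (U f) = f" if "f \<in> carrier H\<^sub>1" for f
    unfolding V_def using that by (intro inv_into_f_f inj_onI u(6))
  have V: "V F \<in> D\<^sub>1 \<and> F = U (V F)" if "F \<in> D\<^sub>2" for F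
    using that VU R1.D_in(1) by (metis D2E)
  show "bounded_op R2.P (H_minus H\<^sub>2 S\<^sub>2) A\<^sub>2"
    unfolding H_minus_def
  proof (rule bounded_op_push[OF A1, of V])
    show "V \<in> carrier R2.P \<rightarrow> carrier R1.P"
      using V by (simp del: Domain_iff)
    show "A\<^sub>2 F = push (A\<^sub>1 (V F))" if "F \<in> carrier R2.P" for F
      using V[of F] A2[of "V F"] that by (simp del: Domain_iff)
    show "hnorm R1.P (V F) = hnorm R2.P F" if "F \<in> carrier R2.P" for F
      using V[of F] P.hnorm_U[of "V F"] that by (simp del: Domain_iff)
    show "F \<oplus>\<^bsub>R2.P\<^esub> G \<in> carrier R2.P \<and> V (F \<oplus>\<^bsub>R2.P\<^esub> G) = V F \<oplus>\<^bsub>R1.P\<^esub> V G"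
      if "F \<in> carrier R2.P" "G \<in> carrier R2.P" for F G
    proof -
      have FG: "F \<in> D\<^sub>2" "G \<in> D\<^sub>2" using that by simp_all
      note v = V[OF FG(1)] V[OF FG(2)]
      have c: "V F \<in> carrier H\<^sub>1" "V G \<in> carrier H\<^sub>1"
        using v R1.D_in(1) by blast+
      have "F \<oplus>\<^bsub>H\<^sub>2\<^esub> G = U (V F \<oplus>\<^bsub>H\<^sub>1\<^esub> V G)"
        using v u(2)[OF c] by simp
      then have "V (F \<oplus>\<^bsub>H\<^sub>2\<^esub> G) = V F \<oplus>\<^bsub>H\<^sub>1\<^esub> V G"
        using VU c by simp
      then show ?thesis
        using R2.D_add[OF FG] by simp
    qed
    show "c \<odot>\<^bsub>R2.P\<^esub> F \<in> carrier R2.P \<and> V (c \<odot>\<^bsub>R2.P\<^esub> F) = c \<odot>\<^bsub>R1.P\<^esub> V F"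
      if "F \<in> carrier R2.P" for c F
    proof -
      have F: "F \<in> D\<^sub>2" using that by simp
      note v = V[OF F]
      have c: "V F \<in> carrier H\<^sub>1"
        using v R1.D_in(1) by blast
      have "c \<odot>\<^bsub>H\<^sub>2\<^esub> F = U (c \<odot>\<^bsub>H\<^sub>1\<^esub> V F)"
        using v u(3)[OF c] by simp
      then have "V (c \<odot>\<^bsub>H\<^sub>2\<^esub> F) = c \<odot>\<^bsub>H\<^sub>1\<^esub> V F"
        using VU c by simp
      then show ?thesis
        using R2.D_smult[OF F] by simp
    qed
  qed
  show "S\<^sub>2 \<subseteq> T\<^sub>2"
    unfolding S2 T2 by (rule image_mono[OF L1.T_facts(3)])
  show "S\<^sub>2 \<subseteq> adjoint_op H\<^sub>2 T\<^sub>2"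
    unfolding S2 T2 adjoint_op_W[OF T1_sub] by (rule image_mono[OF L1.S_adj_T])
  show "\<forall>(F, G)\<in>T\<^sub>2. A\<^sub>2 F = embed_minus H\<^sub>2 S\<^sub>2 G"
    unfolding T2
  proof clarify
    fix f g assume fg: "(f, g) \<in> T\<^sub>1"
    then have c: "f \<in> D\<^sub>1" "g \<in> carrier H\<^sub>1"
      using L1.T_facts(4) T1_sub by blast+
    have "A\<^sub>1 f = embed_minus H\<^sub>1 S\<^sub>1 g"
      using L1.A_ext fg unfolding star_extension_def by fastforce
    then show "A\<^sub>2 (U f) = embed_minus H\<^sub>2 S\<^sub>2 (U g)"
      using A2[OF c(1)] embed_U[OF c(2)] by simp
  qed
  show "\<forall>(F, G)\<in>adjoint_op H\<^sub>2 T\<^sub>2. pm_adjoint R2.P A\<^sub>2 F = embed_minus H\<^sub>2 S\<^sub>2 G"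
    unfolding T2 adjoint_op_W[OF T1_sub]
  proof clarify
    fix f g assume fg: "(f, g) \<in> adjoint_op H\<^sub>1 T\<^sub>1"
    then have c: "f \<in> D\<^sub>1" "g \<in> carrier H\<^sub>1"
      using A.adjoint_op_antimono[OF L1.T_facts(3)] A.adjoint_opD(2) by blast+
    have "pm_adjoint R1.P A\<^sub>1 f = embed_minus H\<^sub>1 S\<^sub>1 g"
      using L1.A_ext fg unfolding star_extension_def by fastforce
    then show "pm_adjoint R2.P A\<^sub>2 (U f) = embed_minus H\<^sub>2 S\<^sub>2 (U g)"
      using pm_adjoint_U[OF c(1)] embed_U[OF c(2)] by simp
  qed
  show "self_adjoint_op H\<^sub>2 (quasi_kernel H\<^sub>2 S\<^sub>2 (pm_Re R2.P A\<^sub>2))"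
    unfolding quasi_kernel_W using self_adjoint_op_W[OF L1.B_self_adjoint] unfolding L1.B_def .
qed

lemma K2_bounded: "bounded_op complex_space (H_minus H\<^sub>2 S\<^sub>2) K\<^sub>2"
  unfolding H_minus_def
  by (rule bounded_op_push[OF L1.K_bounded[unfolded H_minus_def], of "\<lambda>c. c"])
    (auto simp: K2 complex_space_def)

lemma channel_adjoint_U: "f \<in> D\<^sub>1 \<Longrightarrow> channel_adjoint K\<^sub>2 (U f) = channel_adjoint K\<^sub>1 f"
  using push_U[of f "K\<^sub>1 1"] by (simp add: channel_adjoint_def dual_pair_def K2 del: Domain_iff)

end

lemma L_system_data:
  assumes "L_system \<Theta>"
  shows "lsystem_data (state_space \<Theta>) (symm_op \<Theta>) (main_op \<Theta>) (state_op \<Theta>) (channel_op \<Theta>)"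
  using assms unfolding L_system_def Let_def hilbert_space_iff_hilb
  by (intro lsystem_data.intro rigged.intro rigged_axioms.intro lsystem_data_axioms.intro) simp_all

text \<open>Bi-unitary equivalence demands that both systems be minimal L-systems. The second one is
  given as the image of the first under \<open>U\<close>, and each axiom is carried over along
  \<open>U\<close>.\<close>

lemma bi_unitarily_equivalent_map:
  assumes min: "minimal_L_system \<Theta>\<^sub>1"
    and map: "lsystem_map (state_space \<Theta>\<^sub>1) (state_space \<Theta>\<^sub>2) U (symm_op \<Theta>\<^sub>1) (symm_op \<Theta>\<^sub>2) (main_op \<Theta>\<^sub>1)
      (state_op \<Theta>\<^sub>1) (channel_op \<Theta>\<^sub>1) (main_op \<Theta>\<^sub>2) (state_op \<Theta>\<^sub>2) (channel_op \<Theta>\<^sub>2)"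
  shows "bi_unitarily_equivalent \<Theta>\<^sub>1 \<Theta>\<^sub>2"
proof -
  define H\<^sub>1 S\<^sub>1 T\<^sub>1 A\<^sub>1 K\<^sub>1 where d1: "H\<^sub>1 = state_space \<Theta>\<^sub>1" "S\<^sub>1 = symm_op \<Theta>\<^sub>1" "T\<^sub>1 = main_op \<Theta>\<^sub>1"
    "A\<^sub>1 = state_op \<Theta>\<^sub>1" "K\<^sub>1 = channel_op \<Theta>\<^sub>1"
  define H\<^sub>2 S\<^sub>2 T\<^sub>2 A\<^sub>2 K\<^sub>2 where d2: "H\<^sub>2 = state_space \<Theta>\<^sub>2" "S\<^sub>2 = symm_op \<Theta>\<^sub>2" "T\<^sub>2 = main_op \<Theta>\<^sub>2"
    "A\<^sub>2 = state_op \<Theta>\<^sub>2" "K\<^sub>2 = channel_op \<Theta>\<^sub>2"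
  interpret lsystem_map H\<^sub>1 H\<^sub>2 U S\<^sub>1 S\<^sub>2 T\<^sub>1 A\<^sub>1 K\<^sub>1 T\<^sub>2 A\<^sub>2 K\<^sub>2
    using map by (simp only: d1 d2)
  have L: "closed_op H\<^sub>1 S\<^sub>1" "deficiency_indices_1_1 H\<^sub>1 S\<^sub>1" "prime_op H\<^sub>1 S\<^sub>1"
    "range K\<^sub>1 = pm_Im R1.P A\<^sub>1 ` carrier R1.P"
    using min unfolding minimal_L_system_def L_system_def Let_def d1[symmetric] by simp_all
  have Im2: "pm_Im R2.P A\<^sub>2 F = K\<^sub>2 (channel_adjoint K\<^sub>2 F)" if "F \<in> carrier R2.P" for F
  proof -
    have "F \<in> D\<^sub>2" using that by simp
    then obtain f where f: "f \<in> D\<^sub>1" "F = U f" by (rule D2E)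
    then show ?thesis
      using L1.Im_A[of f] by (simp add: pm_Im_U K2 channel_adjoint_U del: Domain_iff)
  qed
  have "range K\<^sub>2 = push ` range K\<^sub>1"
    unfolding image_image K2 ..
  also have "\<dots> = (\<lambda>f. push (pm_Im R1.P A\<^sub>1 f)) ` D\<^sub>1"
    unfolding L(4) image_image by simp
  also have "\<dots> = (\<lambda>f. pm_Im R2.P A\<^sub>2 (U f)) ` D\<^sub>1"
    by (rule image_cong[OF refl]) (simp only: pm_Im_U)
  also have "\<dots> = pm_Im R2.P A\<^sub>2 ` carrier R2.P"
    unfolding R2.P_simps(1) D2 image_image ..
  finally have range2: "range K\<^sub>2 = pm_Im R2.P A\<^sub>2 ` carrier R2.P" .
  have "hilbert_space H\<^sub>2"
    unfolding hilbert_space_iff_hilb by (rule C.hilb_axioms)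
  moreover have "closed_op H\<^sub>2 S\<^sub>2" "symmetric_op H\<^sub>2 S\<^sub>2" "deficiency_indices_1_1 H\<^sub>2 S\<^sub>2"
    unfolding S2 using closed_op_W[OF R1.S_sub L(1)] deficiency_W[OF R1.S_sub L(2)]
      symmetric_op_W[OF R1.S_sub] L1.S_sym by simp_all
  moreover have "main_operator H\<^sub>2 S\<^sub>2 T\<^sub>2"
    unfolding S2 T2 by (rule main_operator_W[OF R1.S_sub L1.T_main])
  ultimately have "L_system \<Theta>\<^sub>2"
    unfolding L_system_def Let_def d2[symmetric]
    using R2.lin R2.dense star_extension_map K2_bounded Im2 range2 by blast
  moreover have "prime_op H\<^sub>2 S\<^sub>2"
    unfolding S2 by (rule prime_op_W[OF R1.S_sub R1.lin L(3)])
  ultimately have min2: "minimal_L_system \<Theta>\<^sub>2"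
    unfolding minimal_L_system_def d2[symmetric] by blast
  have graph: "T\<^sub>1 O {(f, U f) | f. f \<in> carrier H\<^sub>1} = {(f, U f) | f. f \<in> carrier H\<^sub>1} O T\<^sub>2" (is "?l = ?r")
  proof (intro equalityI subrelI)
    fix x y assume "(x, y) \<in> ?l"
    then obtain f where f: "(x, f) \<in> T\<^sub>1" "y = U f"
      by auto
    then have "x \<in> carrier H\<^sub>1" "(U x, y) \<in> T\<^sub>2"
      unfolding T2 using T1_sub by auto
    then show "(x, y) \<in> ?r"
      by blast
  next
    fix x y assume "(x, y) \<in> ?r"
    then have x: "x \<in> carrier H\<^sub>1" and "(U x, y) \<in> T\<^sub>2"
      by auto
    then have xy: "(U x, y) \<in> W ` T\<^sub>1"
      by (simp only: T2)
    obtain f g where fg: "(f, g) \<in> T\<^sub>1" "U x = U f" "y = U g"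
      by (rule W_E[OF xy])
    then have "f \<in> carrier H\<^sub>1" "g \<in> carrier H\<^sub>1"
      using T1_sub by auto
    then have "x = f" "g \<in> carrier H\<^sub>1"
      using u(6)[OF fg(2) x] by auto
    then show "(x, y) \<in> ?l"
      using fg by blast
  qed
  \<comment> \<open>\<open>push \<phi>\<close> is the only element of the antidual that
    \<open>U_plus_adjoint\<close> maps to \<open>\<phi>\<close>, so \<open>inv_into\<close> must
    return it.\<close>
  have U_minus: "U_minus R1.P R2.P U \<phi> = push \<phi>" if \<phi>: "\<phi> \<in> carrier (antidual R1.P)" for \<phi>
  proof -
    have adj: "U_plus_adjoint R1.P U (push \<phi>) = \<phi>"
      using push_U[of _ \<phi>] R1.P.antidualD(3)[OF \<phi>] by (auto simp: U_plus_adjoint_def fun_eq_iff simp del: Domain_iff)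
    have "inj_on (U_plus_adjoint R1.P U) (carrier (antidual R2.P))"
    proof (rule inj_onI)
      fix \<psi> \<theta> assume a: "\<psi> \<in> carrier (antidual R2.P)" "\<theta> \<in> carrier (antidual R2.P)"
        and eq: "U_plus_adjoint R1.P U \<psi> = U_plus_adjoint R1.P U \<theta>"
      show "\<psi> = \<theta>"
      proof (rule R2.P.antidual_eqI[OF a])
        fix F assume "F \<in> carrier R2.P"
        then have "F \<in> D\<^sub>2" by simp
        then obtain f where "f \<in> D\<^sub>1" "F = U f" by (rule D2E)
        then show "\<psi> F = \<theta> F"
          using fun_cong[OF eq, of f] by (simp add: U_plus_adjoint_def del: Domain_iff)
      qed
    qed
    then show ?thesis
      unfolding U_minus_def using inv_into_f_f[OF _ push_in[OF \<phi>]] adj by metis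
  qed
  have "U_minus R1.P R2.P U (A\<^sub>1 f) = A\<^sub>2 (U f)" if "f \<in> carrier R1.P" for f
  proof -
    have "f \<in> D\<^sub>1" using that by simp
    then show ?thesis
      using U_minus[OF L1.A_in] A2 by simp
  qed
  moreover have "U_minus R1.P R2.P U (K\<^sub>1 c) = K\<^sub>2 c" for c
    using U_minus R1.P.antidual_smult_in[OF L1.chi_in, of c] by (simp add: K2 L1.K_eq)
  ultimately show ?thesis
    unfolding bi_unitarily_equivalent_def Let_def d1[symmetric] d2[symmetric]
    using min min2 U unitary_P graph by (intro conjI exI[of _ U]) auto
qed

section \<open>The universal model\<close>

text \<open>The condition that cuts out \<open>S\<close> is the eigenvector relation for
  \<open>\<gamma> \<i>\<close>, and \<open>\<gamma>_B\<close> carries it from \<i> to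
  \<open>z\<close>.\<close>

lemma (in defect_field) \<gamma>_adjoint:
  assumes S: "S = {(f, g) \<in> B. cinner H (g \<oplus> \<i> \<odot> f) (\<gamma> \<i>) = 0}" and z: "Im z \<noteq> 0"
  shows "(\<gamma> z, z \<odot> \<gamma> z) \<in> adjoint_op H S"
proof (rule adjoint_opI)
  fix u v assume "(u, v) \<in> S"
  then have uv: "(u, v) \<in> B" and 0: "cinner H (v \<oplus> \<i> \<odot> u) (\<gamma> \<i>) = 0"
    by (auto simp: S)
  have c: "u \<in> carrier H" "v \<in> carrier H" "\<gamma> \<i> \<in> carrier H"
    using B_in[OF uv] by auto
  have "cinner H v (\<gamma> z \<ominus> \<gamma> \<i>) = cinner H u (z \<odot> \<gamma> z \<ominus> \<i> \<odot> \<gamma> \<i>)"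
    using symmetric_opD[OF B_sym uv \<gamma>_B[OF z, of \<i>]] by simp
  then show "cinner H v (\<gamma> z) = cinner H u (z \<odot> \<gamma> z)"
    using 0 c z by (simp add: algebra_simps)
qed (use z in auto)

lemma gamma_field_cong:
  assumes "gamma_field H B \<gamma> V" "\<And>z. Im z \<noteq> 0 \<Longrightarrow> V z = V' z"
  shows "gamma_field H B \<gamma> V'"
  using assms unfolding gamma_field_def defect_field_def defect_field_axioms_def by simp

section \<open>Algebra of the model constants\<close>

locale model_parameters =
  fixes Q a :: real
  assumes Q: "Q \<noteq> 0" and a: "a > 0"
begin

definition "rt = sqrt (Q\<^sup>2 + 4 * a\<^sup>2)"

lemma rt: "rt > 0" "rt\<^sup>2 = Q\<^sup>2 + 4 * a\<^sup>2" "complex_of_real rt * complex_of_real rt = (complex_of_real Q)\<^sup>2 + 4 * (complex_of_real a)\<^sup>2"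
proof -
  have p: "0 < Q\<^sup>2 + 4 * a\<^sup>2"
    using a by (simp add: add_nonneg_pos)
  show "rt > 0"
    using p by (simp add: rt_def)
  show r2: "rt\<^sup>2 = Q\<^sup>2 + 4 * a\<^sup>2"
    using p by (simp add: rt_def)
  have "complex_of_real rt * complex_of_real rt = complex_of_real (rt\<^sup>2)"
    by (simp add: power2_eq_square)
  then show "complex_of_real rt * complex_of_real rt = (complex_of_real Q)\<^sup>2 + 4 * (complex_of_real a)\<^sup>2"
    by (simp add: r2)
qed

abbreviation "\<kappa> \<equiv> complex_of_real (model_kappa Q a)"
abbreviation "UU \<equiv> model_U Q a"
definition "k' = of_real (Q / \<bar>Q\<bar>) * ((of_real Q + 2 * of_real a * \<i>) / of_real (sqrt (Q\<^sup>2 + 4 * a\<^sup>2)) :: complex)"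
abbreviation "cQ \<equiv> complex_of_real Q"
abbreviation "ca \<equiv> complex_of_real a"

lemma sgn_sq: "complex_of_real (Q / \<bar>Q\<bar>) * complex_of_real (Q / \<bar>Q\<bar>) = 1"
  using Q by (simp flip: of_real_mult)

lemma \<kappa>_sq: "\<kappa>\<^sup>2 = cQ\<^sup>2 / (complex_of_real rt)\<^sup>2"
  by (simp add: model_kappa_def rt_def[symmetric] power_divide flip: of_real_power)

lemma \<kappa>_U: "\<kappa> * UU = cQ * (- cQ + 2 * ca * \<i>) / (complex_of_real rt)\<^sup>2"
proof -
  have "\<bar>Q\<bar> * (Q / \<bar>Q\<bar>) = Q"
    using Q by simp
  then have 1: "complex_of_real \<bar>Q\<bar> * complex_of_real (Q / \<bar>Q\<bar>) = cQ"
    by (metis of_real_mult)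
  have "\<kappa> * UU = (complex_of_real \<bar>Q\<bar> * complex_of_real (Q / \<bar>Q\<bar>)) * ((- cQ + 2 * ca * \<i>) / (complex_of_real rt)\<^sup>2)"
    unfolding model_kappa_def model_U_def rt_def[symmetric] power2_eq_square[of "complex_of_real rt"]
    by (simp only: of_real_divide) simp
  then show ?thesis
    unfolding 1 by simp
qed

text \<open>The property for which the phase \<open>k'\<close> is chosen: it cancels the terms with
  \<open>e F K\<close> in \<open>model_B_formula\<close>, so that the real part of the model
  operator acts as multiplication on the domain of multiplication.\<close>

lemma k'_U: "UU * k' = - 1"
proof -
  have "UU * k' = (complex_of_real (Q / \<bar>Q\<bar>) * complex_of_real (Q / \<bar>Q\<bar>)) *
      (((- cQ + 2 * ca * \<i>) * (cQ + 2 * ca * \<i>)) / (complex_of_real rt * complex_of_real rt))"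
    unfolding k'_def model_U_def rt_def[symmetric] by (simp only: times_divide_times_eq mult_ac)
  also have "(- cQ + 2 * ca * \<i>) * (cQ + 2 * ca * \<i>) = - (complex_of_real rt * complex_of_real rt)"
    unfolding rt(3) by (simp add: algebra_simps power2_eq_square)
  finally show ?thesis
    using rt(1) unfolding sgn_sq by simp
qed

lemma sqrt_1_kappa: "sqrt (1 - (model_kappa Q a)\<^sup>2) = 2 * a / rt"
proof -
  have "1 - (model_kappa Q a)\<^sup>2 = (2 * a / rt)\<^sup>2"
  proof -
    have "(model_kappa Q a)\<^sup>2 = Q\<^sup>2 / rt\<^sup>2" "(2 * a / rt)\<^sup>2 = 4 * a\<^sup>2 / rt\<^sup>2"
      by (simp_all add: model_kappa_def rt_def[symmetric] power_divide power_mult_distrib)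
    moreover have "Q\<^sup>2 / rt\<^sup>2 + 4 * a\<^sup>2 / rt\<^sup>2 = 1"
      unfolding add_divide_distrib[symmetric] rt(2)[symmetric] using rt(1) by simp
    ultimately show ?thesis by linarith
  qed
  then show ?thesis
    using a rt(1) by (simp add: real_sqrt_abs)
qed

lemma one_\<kappa>_U: "1 + \<kappa> * UU = 2 * ca * (2 * ca + cQ * \<i>) / (complex_of_real rt)\<^sup>2"
proof -
  have r: "(complex_of_real rt)\<^sup>2 \<noteq> 0"
    using rt(1) by simp
  have "1 + \<kappa> * UU = ((complex_of_real rt)\<^sup>2 + cQ * (- cQ + 2 * ca * \<i>)) / (complex_of_real rt)\<^sup>2"
    unfolding \<kappa>_U add_divide_distrib using r by simp
  also have "(complex_of_real rt)\<^sup>2 + cQ * (- cQ + 2 * ca * \<i>) = 2 * ca * (2 * ca + cQ * \<i>)"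
    unfolding power2_eq_square[of "complex_of_real rt"] rt(3) by (simp add: algebra_simps power2_eq_square)
  finally show ?thesis .
qed

lemma cmod_one_\<kappa>_U: "cmod (1 + \<kappa> * UU) = 2 * a / rt"
proof -
  have "cmod (2 * ca + cQ * \<i>) = rt"
    by (simp add: cmod_def rt_def power2_eq_square algebra_simps)
  then show ?thesis
    unfolding one_\<kappa>_U using a rt(1) by (simp add: norm_divide norm_mult norm_power power2_eq_square)
qed

definition "dd = complex_of_real (cmod (1 + \<kappa> * UU) * sqrt (1 - (model_kappa Q a)\<^sup>2))"

lemma dd: "dd = 4 * ca\<^sup>2 / (complex_of_real rt)\<^sup>2"
  unfolding dd_def cmod_one_\<kappa>_U sqrt_1_kappa by (simp add: power2_eq_square)

text \<open>Together with \<open>beta\<close> this reduces the coefficients of the channel vector,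
  phase included, to \<open>(a + Q \<i>) / a\<close> and \<open>- (a - Q \<i>) / a\<close>.
  Inserting \<open>rt^2 = Q^2 + 4 a^2\<close> brings out the common factor \<open>4 a\<close> in
  both numerators.\<close>

lemma alpha: "(\<kappa>\<^sup>2 + 1 + 2 * \<kappa> * UU) / dd = (ca + cQ * \<i>) / ca"
proof -
  have r: "(complex_of_real rt)\<^sup>2 \<noteq> 0" "ca \<noteq> 0"
    using rt(1) a by simp_all
  have "\<kappa>\<^sup>2 + 1 + 2 * \<kappa> * UU = (cQ\<^sup>2 + (complex_of_real rt)\<^sup>2 + 2 * (cQ * (- cQ + 2 * ca * \<i>))) / (complex_of_real rt)\<^sup>2"
    unfolding mult.assoc \<kappa>_U \<kappa>_sq add_divide_distrib using r by simp
  also have "cQ\<^sup>2 + (complex_of_real rt)\<^sup>2 + 2 * (cQ * (- cQ + 2 * ca * \<i>)) = 4 * ca * (ca + cQ * \<i>)"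
    unfolding power2_eq_square[of "complex_of_real rt"] rt(3) by (simp add: algebra_simps power2_eq_square)
  finally show ?thesis
    unfolding dd using r by (simp add: power2_eq_square)
qed

lemma beta: "(\<kappa>\<^sup>2 * UU + 2 * \<kappa> + UU) / dd * k' = - (ca - cQ * \<i>) / ca"
proof -
  have r: "(complex_of_real rt)\<^sup>2 \<noteq> 0" "ca \<noteq> 0"
    using rt(1) a by simp_all
  have k: "\<kappa> * k' = cQ * (cQ + 2 * ca * \<i>) / (complex_of_real rt)\<^sup>2"
  proof -
    have "\<bar>Q\<bar> * (Q / \<bar>Q\<bar>) = Q"
      using Q by simp
    then have 1: "complex_of_real \<bar>Q\<bar> * complex_of_real (Q / \<bar>Q\<bar>) = cQ"
      by (metis of_real_mult)
    have "\<kappa> * k' = (complex_of_real \<bar>Q\<bar> * complex_of_real (Q / \<bar>Q\<bar>)) * ((cQ + 2 * ca * \<i>) / (complex_of_real rt)\<^sup>2)"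
      unfolding model_kappa_def k'_def rt_def[symmetric] power2_eq_square[of "complex_of_real rt"]
      by (simp only: of_real_divide) simp
    then show ?thesis
      unfolding 1 by simp
  qed
  have "(\<kappa>\<^sup>2 * UU + 2 * \<kappa> + UU) * k' = \<kappa>\<^sup>2 * (UU * k') + 2 * (\<kappa> * k') + UU * k'"
    by (simp only: distrib_right mult.assoc)
  also have "\<dots> = - (cQ\<^sup>2 + (complex_of_real rt)\<^sup>2 - 2 * (cQ * (cQ + 2 * ca * \<i>))) / (complex_of_real rt)\<^sup>2"
    unfolding k k'_U \<kappa>_sq minus_diff_eq diff_divide_distrib add_divide_distrib using r by simp
  also have "cQ\<^sup>2 + (complex_of_real rt)\<^sup>2 - 2 * (cQ * (cQ + 2 * ca * \<i>)) = 4 * ca * (ca - cQ * \<i>)"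
    unfolding power2_eq_square[of "complex_of_real rt"] rt(3) by (simp add: algebra_simps power2_eq_square)
  finally have "(\<kappa>\<^sup>2 * UU + 2 * \<kappa> + UU) * k' = - (4 * ca * (ca - cQ * \<i>)) / (complex_of_real rt)\<^sup>2" .
  then have "(\<kappa>\<^sup>2 * UU + 2 * \<kappa> + UU) / dd * k' = - (4 * ca * (ca - cQ * \<i>)) / (complex_of_real rt)\<^sup>2 / dd"
    by simp
  also have "- (4 * ca * (ca - cQ * \<i>)) / (complex_of_real rt)\<^sup>2 / dd = - (ca - cQ * \<i>) / ca"
  proof -
    have "- (4 * ca * N) / P / (4 * ca\<^sup>2 / P) = - N / ca" if "P \<noteq> 0" for N P
      using that r(2) by (simp add: power2_eq_square)
    from this[OF r(1)] show ?thesis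
      unfolding dd .
  qed
  finally show ?thesis .
qed

lemma denominators: "1 + ca + cQ * \<i> \<noteq> 0" "1 - ca + cQ * \<i> \<noteq> 0" "cQ + 2 * ca * \<i> \<noteq> 0"
  using Q by (auto simp: complex_eq_iff)

text \<open>The denominator of the definition factors as
  \<open>- (1 + a + Q \<i>) (Q + 2 a \<i>)\<close>, and the second factor cancels.\<close>

lemma model_k_eq: "model_k Q a = (1 - ca + cQ * \<i>) / (1 + ca + cQ * \<i>)"
proof -
  have n: "complex_of_real ((a - 1) * Q) - complex_of_real (Q\<^sup>2 + 2 * a\<^sup>2 + 2 * a) * \<i> = - (1 + ca + cQ * \<i>) * (cQ + 2 * ca * \<i>)"
    by (simp add: algebra_simps power2_eq_square)
  have n': "complex_of_real a - 1 - complex_of_real Q * \<i> = - (1 - ca + cQ * \<i>)"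
    by simp
  have "model_k Q a = (- (1 - ca + cQ * \<i>) * (cQ + 2 * ca * \<i>)) / (- (1 + ca + cQ * \<i>) * (cQ + 2 * ca * \<i>))"
    unfolding model_k_def n n' ..
  moreover have "(- A * N) / (- P * N) = A / P" if "N \<noteq> 0" for A N P :: complex
    using that by simp
  ultimately show ?thesis
    using denominators(3) by metis
qed

text \<open>The form in which \<open>k\<close> meets \<open>T_cond\<close>: it balances the defect
  coefficient against the integral for the vector that spans Dom T over Dom S.\<close>

lemma k_identity: "(1 - model_k Q a) * (1 - ca + cQ * \<i>) = 2 * ca * model_k Q a" "model_k Q a \<noteq> 1"
proof -
  have "1 - model_k Q a = 2 * ca / (1 + ca + cQ * \<i>)"
    unfolding model_k_eq using denominators(1) by (simp add: diff_divide_eq_iff)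
  then show "(1 - model_k Q a) * (1 - ca + cQ * \<i>) = 2 * ca * model_k Q a"
    unfolding model_k_eq by simp
  show "model_k Q a \<noteq> 1"
    using \<open>1 - model_k Q a = 2 * ca / (1 + ca + cQ * \<i>)\<close> denominators(1) a by auto
qed

text \<open>Rewrites \<open>p(z)\<close> as \<open>a / (a M(z) + Q - \<i>)\<close>, the form in
  which Krein's formula produces it.\<close>

lemma k_ratio: "\<i> * ((model_k Q a + 1) / (model_k Q a - 1)) = (cQ - \<i>) / ca"
proof -
  have 1: "model_k Q a + 1 = 2 * (1 + cQ * \<i>) / (1 + ca + cQ * \<i>)"
    "model_k Q a - 1 = - 2 * ca / (1 + ca + cQ * \<i>)"
  proof -
    have *: "x / n + 1 = (x + n) / n" "x / n - 1 = (x - n) / n" if "n \<noteq> 0" for x n :: complex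
      using that by (simp_all add: add_divide_distrib diff_divide_distrib)
    show "model_k Q a + 1 = 2 * (1 + cQ * \<i>) / (1 + ca + cQ * \<i>)"
      "model_k Q a - 1 = - 2 * ca / (1 + ca + cQ * \<i>)"
      unfolding model_k_eq *[OF denominators(1)] by (simp_all only: algebra_simps) simp_all
  qed
  have "(2 * x / n) / (- 2 * y / n) = - x / y" if "n \<noteq> 0" for n x y :: complex
    using that by simp
  then have "(model_k Q a + 1) / (model_k Q a - 1) = - (1 + cQ * \<i>) / ca"
    unfolding 1 using denominators(1) by blast
  moreover have "\<i> * - (1 + cQ * \<i>) = cQ - \<i>"
    by (simp add: algebra_simps)
  ultimately show ?thesis
    by (metis times_divide_eq_right)
qed

end

section \<open>The model operators and the domain of T\<close>

locale universal = model_measure \<mu> + model_parameters Q a for \<mu> :: "real measure" and Q a :: real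
begin

text \<open>\<open>\<bar>C0\<bar>\<^sup>2 = a\<close> makes \<open>Q + a M\<close> the Q-function of \<open>C0 g\<^sub>z\<close>; the phase of \<open>C0\<close> is dictated by
  the channel vector of the model, see \<open>chi_formula\<close> below.\<close>

definition "C0 = \<i> * complex_of_real (sqrt a)"

lemma C0: "C0 \<noteq> 0" "C0 * cnj C0 = ca" "cnj C0 = - C0" "C0 * C0 = - ca"
proof -
  have s: "complex_of_real (sqrt a) * complex_of_real (sqrt a) = ca"
    using a by (simp flip: of_real_mult)
  show "C0 \<noteq> 0" using a by (simp add: C0_def)
  show "cnj C0 = - C0" by (simp add: C0_def)
  have "C0 * C0 = (\<i> * \<i>) * (complex_of_real (sqrt a) * complex_of_real (sqrt a))"
    unfolding C0_def by (simp only: mult_ac)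
  then show "C0 * C0 = - ca"
    unfolding s by simp
  then show "C0 * cnj C0 = ca"
    by (simp add: \<open>cnj C0 = - C0\<close>)
qed

abbreviation "X \<equiv> L2 \<mu>"
abbreviation "g \<equiv> g_vec \<mu>"
abbreviation "M \<equiv> mult_op \<mu>"
abbreviation "Md \<equiv> mult_op_dot \<mu>"
abbreviation "\<gamma> \<equiv> \<lambda>z. C0 \<odot>\<^bsub>L2 \<mu>\<^esub> g_vec \<mu> z"

sublocale G: gamma_field X M \<gamma> "\<lambda>z. cQ + ca * Mf z"
  unfolding C0_def by (rule gamma_field_mult_op[OF a])

lemma g_in: "Im z \<noteq> 0 \<Longrightarrow> g z \<in> carrier X"
  using gf_l2 by (auto simp: g_vec_eq)

lemma g_pm [simp]: "g \<i> \<in> carrier X" "g (-\<i>) \<in> carrier X"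
  by (auto intro: g_in)

lemma g_unit: "cinner X (g \<i>) (g \<i>) = 1"
  using integral_weight(1) gf_l2[of \<i>] by (simp add: g_vec_eq cnj_gf)

lemma mult_op_g_diff: "(g \<i> \<ominus>\<^bsub>X\<^esub> g (-\<i>), \<i> \<odot>\<^bsub>X\<^esub> g \<i> \<oplus>\<^bsub>X\<^esub> \<i> \<odot>\<^bsub>X\<^esub> g (-\<i>)) \<in> M"
proof -
  have "((1 / C0) \<odot>\<^bsub>X\<^esub> (\<gamma> \<i> \<ominus>\<^bsub>X\<^esub> \<gamma> (-\<i>)), (1 / C0) \<odot>\<^bsub>X\<^esub> (\<i> \<odot>\<^bsub>X\<^esub> \<gamma> \<i> \<ominus>\<^bsub>X\<^esub> (-\<i>) \<odot>\<^bsub>X\<^esub> \<gamma> (-\<i>))) \<in> M"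
    by (rule L2.linear_op_smult[OF G.B_lin G.\<gamma>_B]) auto
  moreover have "(1 / C0) \<odot>\<^bsub>X\<^esub> (\<gamma> \<i> \<ominus>\<^bsub>X\<^esub> \<gamma> (-\<i>)) = g \<i> \<ominus>\<^bsub>X\<^esub> g (-\<i>)"
    using C0 by (intro L2.vec_eqI) (auto simp: algebra_simps)
  moreover have "(1 / C0) \<odot>\<^bsub>X\<^esub> (\<i> \<odot>\<^bsub>X\<^esub> \<gamma> \<i> \<ominus>\<^bsub>X\<^esub> (-\<i>) \<odot>\<^bsub>X\<^esub> \<gamma> (-\<i>)) = \<i> \<odot>\<^bsub>X\<^esub> g \<i> \<oplus>\<^bsub>X\<^esub> \<i> \<odot>\<^bsub>X\<^esub> g (-\<i>)"
    using C0 by (intro L2.vec_eqI) (auto simp: algebra_simps)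
  ultimately show ?thesis by simp
qed

text \<open>The conjugate of \<open>g\<^sub>i\<close> undoes multiplication by
  \<open>x + \<i>\<close>. The integral thus becomes an inner product with a defect vector, which
  identifies the restricted operator as an instance of \<open>adjoint_restriction\<close>.\<close>

lemma integral_dom:
  assumes "(F, K) \<in> M"
  shows "cinner X (K \<oplus>\<^bsub>X\<^esub> \<i> \<odot>\<^bsub>X\<^esub> F) (g \<i>) = (\<integral>x. l2_rep F x \<partial>\<mu>)"
proof -
  obtain f where f: "f \<in> l2_fun \<mu>" "mx f \<in> l2_fun \<mu>" "F = cl f" "K = cl (mx f)"
    using mult_opE[OF assms] .
  have "(complex_of_real x * f x + \<i> * f x) * cnj (gf \<i> x) = f x" for x
  proof -
    have n: "complex_of_real x + \<i> \<noteq> 0"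
      using of_real_neq_nonreal[of "-\<i>" x] by simp
    have "complex_of_real x * f x + \<i> * f x = f x * (complex_of_real x + \<i>)"
      by (simp add: algebra_simps)
    then show ?thesis
      using n by (simp add: gf_def)
  qed
  then show ?thesis
    using f gf_l2[of \<i>] by (simp add: g_vec_eq l2_fun_smult l2_fun_add integral_rep)
qed

text \<open>Symmetry of multiplication against \<open>g\<^sub>i - g\<^sub>-\<^sub>i\<close>, which
  lies in its domain. The second representation of the integral is what evaluates the Riesz preimage
  of \<open>g\<^sub>-\<^sub>i\<close>.\<close>

lemma integral_dom_minus:
  assumes FK: "(F, K) \<in> M"
  shows "cinner X (K \<ominus>\<^bsub>X\<^esub> \<i> \<odot>\<^bsub>X\<^esub> F) (g (-\<i>)) = cinner X (K \<oplus>\<^bsub>X\<^esub> \<i> \<odot>\<^bsub>X\<^esub> F) (g \<i>)"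
  using L2.symmetric_opD[OF mult_op_symmetric FK mult_op_g_diff] G.B_in[OF FK] by (simp add: algebra_simps)

lemma Md_eq: "Md = {(F, K) \<in> M. cinner X (K \<oplus>\<^bsub>X\<^esub> \<i> \<odot>\<^bsub>X\<^esub> F) (\<gamma> \<i>) = 0}"
proof -
  have "(\<integral>x. l2_rep F x \<partial>\<mu>) = 0 \<longleftrightarrow> cinner X (K \<oplus>\<^bsub>X\<^esub> \<i> \<odot>\<^bsub>X\<^esub> F) (\<gamma> \<i>) = 0" if FK: "(F, K) \<in> M" for F K
    using integral_dom[OF FK] G.B_in[OF FK] C0
      L2.cinner_smult_right[of "g \<i>" "K \<oplus>\<^bsub>X\<^esub> \<i> \<odot>\<^bsub>X\<^esub> F" C0] by (simp del: L2.cinner_add_left)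
  then show ?thesis
    unfolding mult_op_dot_def by blast
qed

abbreviation "Ma \<equiv> adjoint_op X Md"

lemmas Ma_eq = G.adjoint_restriction[OF Md_eq]
lemmas \<gamma>_Ma = G.\<gamma>_adjoint[OF Md_eq]

lemma Md_sub: "Md \<subseteq> carrier X \<times> carrier X"
  using G.B_in by (auto simp: mult_op_dot_def)

lemma g_Ma: assumes z: "Im z \<noteq> 0" shows "(g z, z \<odot>\<^bsub>X\<^esub> g z) \<in> Ma"
proof -
  have "((1 / C0) \<odot>\<^bsub>X\<^esub> \<gamma> z, (1 / C0) \<odot>\<^bsub>X\<^esub> (z \<odot>\<^bsub>X\<^esub> \<gamma> z)) \<in> Ma"
    by (rule L2.adjoint_op_smult[OF Md_sub \<gamma>_Ma[OF z]])
  moreover have "(1 / C0) \<odot>\<^bsub>X\<^esub> \<gamma> z = g z" "(1 / C0) \<odot>\<^bsub>X\<^esub> (z \<odot>\<^bsub>X\<^esub> \<gamma> z) = z \<odot>\<^bsub>X\<^esub> g z"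
    by (rule L2.vec_eqI; use C0(1) g_in[OF z] in simp)+
  ultimately show ?thesis by simp
qed

text \<open>\<open>e F K\<close> is \<open>\<integral>F d\<mu>\<close> when \<open>K = \<B> F\<close>.\<close>

definition "e F K = cinner X (K \<oplus>\<^bsub>X\<^esub> \<i> \<odot>\<^bsub>X\<^esub> F) (g \<i>)"

text \<open>The left side is the coefficient \<open>d + \<i> cnj (chi f)\<close> of
  \<open>chi\<close> in the image of \<open>f = F + d \<gamma> \<i>\<close>, with the formula for
  \<open>chi\<close> inserted; compare \<open>T_eq\<close> and \<open>T_cond_iff\<close>.\<close>

definition "T_cond F K d \<longleftrightarrow> d * (1 - ca + cQ * \<i>) + complex_of_real (sqrt a) * e F K = 0"

lemma e_add: "(F, K) \<in> M \<Longrightarrow> (F', K') \<in> M \<Longrightarrow> e (F \<oplus>\<^bsub>X\<^esub> F') (K \<oplus>\<^bsub>X\<^esub> K') = e F K + e F' K'"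
  and e_smult: "(F, K) \<in> M \<Longrightarrow> e (c \<odot>\<^bsub>X\<^esub> F) (c \<odot>\<^bsub>X\<^esub> K) = c * e F K"
  using G.B_in by (auto simp: e_def algebra_simps)

lemma e_g_diff: "e (g \<i> \<ominus>\<^bsub>X\<^esub> g (-\<i>)) (\<i> \<odot>\<^bsub>X\<^esub> g \<i> \<oplus>\<^bsub>X\<^esub> \<i> \<odot>\<^bsub>X\<^esub> g (-\<i>)) = 2 * \<i>"
  using g_unit by (simp add: e_def algebra_simps)

text \<open>A change of coordinates: \<open>\<phi> + c (g\<^sub>i - k g\<^sub>-\<^sub>i)\<close> is
  regrouped as \<open>\<phi> + c k (g\<^sub>i - g\<^sub>-\<^sub>i)\<close>, in the domain of
  multiplication, plus \<open>c (1 - k) g\<^sub>i\<close>. The first part has integral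
  \<open>2 \<i> c k\<close>, and \<open>k_identity\<close> turns the relation between the two
  coefficients into \<open>T_cond\<close>. Single-valuedness of the adjoint then settles the
  images.\<close>

lemma model_T_eq: "model_T \<mu> Q a = {(F \<oplus>\<^bsub>X\<^esub> d \<odot>\<^bsub>X\<^esub> \<gamma> \<i>, K \<oplus>\<^bsub>X\<^esub> (\<i> * d) \<odot>\<^bsub>X\<^esub> \<gamma> \<i>) | F K d. (F, K) \<in> M \<and> T_cond F K d}"
  if sv: "single_valued Ma"
proof -
  define k where "k = model_k Q a"
  have k1: "1 - k \<noteq> 0" and kid: "(1 - k) * (1 - ca + cQ * \<i>) = 2 * ca * k"
    using k_identity by (auto simp: k_def)
  define sa where "sa = complex_of_real (sqrt a)"
  have sa: "sa \<noteq> 0" "sa * sa = ca" "C0 = \<i> * sa"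
    using a by (simp_all add: sa_def C0_def flip: of_real_mult)
  let ?\<delta> = "g \<i> \<ominus>\<^bsub>X\<^esub> g (-\<i>)" and ?\<delta>' = "\<i> \<odot>\<^bsub>X\<^esub> g \<i> \<oplus>\<^bsub>X\<^esub> \<i> \<odot>\<^bsub>X\<^esub> g (-\<i>)"
  show ?thesis
  proof (intro equalityI subsetI)
    fix p assume "p \<in> model_T \<mu> Q a"
    then have "p \<in> Ma \<and> (\<exists>\<phi>\<in>Domain Md. \<exists>c. fst p = \<phi> \<oplus>\<^bsub>X\<^esub> c \<odot>\<^bsub>X\<^esub> (g \<i> \<ominus>\<^bsub>X\<^esub> k \<odot>\<^bsub>X\<^esub> g (-\<i>)))"
      unfolding model_T_def Let_def k_def[symmetric] by (cases p) simp
    then obtain \<phi> c where p: "p \<in> Ma" "\<phi> \<in> Domain Md" "fst p = \<phi> \<oplus>\<^bsub>X\<^esub> c \<odot>\<^bsub>X\<^esub> (g \<i> \<ominus>\<^bsub>X\<^esub> k \<odot>\<^bsub>X\<^esub> g (-\<i>))"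
      by blast
    obtain K where K: "(\<phi>, K) \<in> Md" using p(2) by auto
    then have KM: "(\<phi>, K) \<in> M" and e0: "e \<phi> K = 0"
      using integral_dom[of \<phi> K] by (auto simp: mult_op_dot_def e_def)
    note c = G.B_in[OF KM]
    define F where "F = \<phi> \<oplus>\<^bsub>X\<^esub> (c * k) \<odot>\<^bsub>X\<^esub> ?\<delta>"
    define K' where "K' = K \<oplus>\<^bsub>X\<^esub> (c * k) \<odot>\<^bsub>X\<^esub> ?\<delta>'"
    define d where "d = c * (1 - k) / C0"
    have FK: "(F, K') \<in> M"
      unfolding F_def K'_def by (rule L2.linear_op_add[OF G.B_lin KM L2.linear_op_smult[OF G.B_lin mult_op_g_diff]])
    have "e F K' = 2 * \<i> * (c * k)"
      unfolding F_def K'_def e_add[OF KM L2.linear_op_smult[OF G.B_lin mult_op_g_diff]] e_smult[OF mult_op_g_diff] e_g_diff e0 by simp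
    then have "d * (1 - ca + cQ * \<i>) + sa * e F K' = c * ((1 - k) * (1 - ca + cQ * \<i>)) / C0 + 2 * \<i> * sa * (c * k)"
      by (simp add: d_def)
    also have "\<dots> = 0"
      unfolding kid sa(3) using sa(1) by (simp add: field_simps sa(2)[symmetric])
    finally have cond: "T_cond F K' d"
      by (simp add: T_cond_def sa_def)
    have "fst p = F \<oplus>\<^bsub>X\<^esub> d \<odot>\<^bsub>X\<^esub> \<gamma> \<i>"
      unfolding p(3) F_def d_def using c C0(1) by (intro L2.vec_eqI) (simp_all add: field_simps)
    moreover have "(F \<oplus>\<^bsub>X\<^esub> d \<odot>\<^bsub>X\<^esub> \<gamma> \<i>, K' \<oplus>\<^bsub>X\<^esub> (\<i> * d) \<odot>\<^bsub>X\<^esub> \<gamma> \<i>) \<in> Ma"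
      unfolding Ma_eq using FK by blast
    ultimately have "p = (F \<oplus>\<^bsub>X\<^esub> d \<odot>\<^bsub>X\<^esub> \<gamma> \<i>, K' \<oplus>\<^bsub>X\<^esub> (\<i> * d) \<odot>\<^bsub>X\<^esub> \<gamma> \<i>)"
      using sv p(1) unfolding single_valued_def by (metis prod.collapse)
    then show "p \<in> {(F \<oplus>\<^bsub>X\<^esub> d \<odot>\<^bsub>X\<^esub> \<gamma> \<i>, K \<oplus>\<^bsub>X\<^esub> (\<i> * d) \<odot>\<^bsub>X\<^esub> \<gamma> \<i>) | F K d. (F, K) \<in> M \<and> T_cond F K d}"
      using FK cond by blast
  next
    fix p assume "p \<in> {(F \<oplus>\<^bsub>X\<^esub> d \<odot>\<^bsub>X\<^esub> \<gamma> \<i>, K \<oplus>\<^bsub>X\<^esub> (\<i> * d) \<odot>\<^bsub>X\<^esub> \<gamma> \<i>) | F K d. (F, K) \<in> M \<and> T_cond F K d}"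
    then obtain F K d where p: "p = (F \<oplus>\<^bsub>X\<^esub> d \<odot>\<^bsub>X\<^esub> \<gamma> \<i>, K \<oplus>\<^bsub>X\<^esub> (\<i> * d) \<odot>\<^bsub>X\<^esub> \<gamma> \<i>)"
      and FK: "(F, K) \<in> M" and cond: "T_cond F K d"
      by blast
    note c = G.B_in[OF FK]
    \<comment> \<open>Inverts the relation \<open>d = c (1 - k) / C0\<close> of the first inclusion,
      which is possible as \<open>k\<close> differs from 1.\<close>
    define c' where "c' = C0 * d / (1 - k)"
    have dc: "d = c' * (1 - k) / C0"
      using k1 C0 by (simp add: c'_def)
    have "sa * e F K = - (d * (1 - ca + cQ * \<i>))"
      using cond by (simp add: T_cond_def sa_def eq_neg_iff_add_eq_0 add.commute)
    also have "\<dots> = - (c' * ((1 - k) * (1 - ca + cQ * \<i>)) / C0)"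
      unfolding dc by simp
    also have "\<dots> = sa * (2 * \<i> * (c' * k))"
      unfolding kid sa(3) using sa(1) by (simp add: field_simps sa(2)[symmetric])
    finally have eF: "e F K = 2 * \<i> * (c' * k)"
      using sa(1) mult_left_cancel by blast
    define \<phi> where "\<phi> = F \<oplus>\<^bsub>X\<^esub> (- (c' * k)) \<odot>\<^bsub>X\<^esub> ?\<delta>"
    define K' where "K' = K \<oplus>\<^bsub>X\<^esub> (- (c' * k)) \<odot>\<^bsub>X\<^esub> ?\<delta>'"
    have \<phi>M: "(\<phi>, K') \<in> M"
      unfolding \<phi>_def K'_def by (rule L2.linear_op_add[OF G.B_lin FK L2.linear_op_smult[OF G.B_lin mult_op_g_diff]])
    have "e \<phi> K' = 0"
      unfolding \<phi>_def K'_def e_add[OF FK L2.linear_op_smult[OF G.B_lin mult_op_g_diff]] e_smult[OF mult_op_g_diff] e_g_diff eF by simp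
    then have "(\<phi>, K') \<in> Md"
      using \<phi>M integral_dom[OF \<phi>M] by (simp add: mult_op_dot_def e_def)
    then have "\<phi> \<in> Domain Md" by auto
    moreover have "F \<oplus>\<^bsub>X\<^esub> d \<odot>\<^bsub>X\<^esub> \<gamma> \<i> = \<phi> \<oplus>\<^bsub>X\<^esub> c' \<odot>\<^bsub>X\<^esub> (g \<i> \<ominus>\<^bsub>X\<^esub> k \<odot>\<^bsub>X\<^esub> g (-\<i>))"
      unfolding \<phi>_def dc using c C0(1) by (intro L2.vec_eqI) (simp_all add: field_simps)
    moreover have "p \<in> Ma"
      unfolding Ma_eq p using FK by blast
    ultimately show "p \<in> model_T \<mu> Q a"
      unfolding model_T_def Let_def k_def p by blast
  qed
qed

end

text \<open>Density of \<open>Dom \<B>\<close> is inherited from the given L-system, not derived from \<open>\<mu>(\<real>) = \<infinity>\<close>.\<close>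

locale universal_dense = universal +
  assumes rigged_Md: "rigged (L2 \<mu>) (mult_op_dot \<mu>)"
begin

sublocale R: rigged X Md
  by (rule rigged_Md)

lemma st_g: "Im z \<noteq> 0 \<Longrightarrow> g z \<in> Domain Ma" "Im z \<noteq> 0 \<Longrightarrow> R.st (g z) = z \<odot>\<^bsub>X\<^esub> g z"
  using g_Ma[of z] R.st_eq[OF g_Ma[of z]] by auto

lemma dom_in: "(F, K) \<in> M \<Longrightarrow> F \<oplus>\<^bsub>X\<^esub> d \<odot>\<^bsub>X\<^esub> \<gamma> \<i> \<in> Domain Ma"
  and st_dom: "(F, K) \<in> M \<Longrightarrow> R.st (F \<oplus>\<^bsub>X\<^esub> d \<odot>\<^bsub>X\<^esub> \<gamma> \<i>) = K \<oplus>\<^bsub>X\<^esub> (\<i> * d) \<odot>\<^bsub>X\<^esub> \<gamma> \<i>"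
proof -
  assume "(F, K) \<in> M"
  then have "(F \<oplus>\<^bsub>X\<^esub> d \<odot>\<^bsub>X\<^esub> \<gamma> \<i>, K \<oplus>\<^bsub>X\<^esub> (\<i> * d) \<odot>\<^bsub>X\<^esub> \<gamma> \<i>) \<in> Ma"
    unfolding Ma_eq by blast
  then show "F \<oplus>\<^bsub>X\<^esub> d \<odot>\<^bsub>X\<^esub> \<gamma> \<i> \<in> Domain Ma" "R.st (F \<oplus>\<^bsub>X\<^esub> d \<odot>\<^bsub>X\<^esub> \<gamma> \<i>) = K \<oplus>\<^bsub>X\<^esub> (\<i> * d) \<odot>\<^bsub>X\<^esub> \<gamma> \<i>"
    using R.st_eq by auto
qed

text \<open>The adjoint maps \<open>g\<^sub>i\<close> to \<open>\<i> g\<^sub>i\<close>, so the graph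
  inner product combines the two components of the graph element. On the domain of multiplication
  this gives the conjugate of \<open>e\<close>; on \<open>\<gamma> \<i>\<close> the two summands are
  equal, hence the factor 2.\<close>

lemma P_g_plus:
  assumes FK: "(F, K) \<in> M"
  shows "cinner R.P (g \<i>) (F \<oplus>\<^bsub>X\<^esub> d \<odot>\<^bsub>X\<^esub> \<gamma> \<i>) = \<i> * cnj (e F K) + 2 * cnj d * cnj C0"
proof -
  have c: "F \<in> carrier X" "K \<in> carrier X" using G.B_in[OF FK] by auto
  have "cnj (e F K) = cinner X (g \<i>) K - \<i> * cinner X (g \<i>) F"
    unfolding e_def using c L2.cinner_commute[OF g_pm(1), of "K \<oplus>\<^bsub>X\<^esub> \<i> \<odot>\<^bsub>X\<^esub> F"]
      L2.cinner_commute[of "K \<oplus>\<^bsub>X\<^esub> \<i> \<odot>\<^bsub>X\<^esub> F" "g \<i>"] by simp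
  then have "\<i> * cnj (e F K) = \<i> * (cinner X (g \<i>) K - \<i> * cinner X (g \<i>) F)"
    by (simp only:)
  then have "\<i> * cnj (e F K) = \<i> * cinner X (g \<i>) K + cinner X (g \<i>) F"
    by (simp only: right_diff_distrib mult.assoc[symmetric] i_squared) simp
  then show ?thesis
    using c g_unit st_dom[OF FK, of d] st_g(2)[of \<i>] by (simp add: algebra_simps)
qed

text \<open>The component along \<open>\<gamma> \<i>\<close> is invisible, because the defect spaces
  at \<open>\<i>\<close> and \<open>-\<i>\<close> are orthogonal in H_+.\<close>

lemma P_g_minus:
  assumes FK: "(F, K) \<in> M"
  shows "cinner R.P (g (-\<i>)) (F \<oplus>\<^bsub>X\<^esub> d \<odot>\<^bsub>X\<^esub> \<gamma> \<i>) = - \<i> * cnj (e F K)"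
proof -
  have c: "F \<in> carrier X" "K \<in> carrier X" using G.B_in[OF FK] by auto
  have "cnj (e F K) = cinner X (g (-\<i>)) K + \<i> * cinner X (g (-\<i>)) F"
    unfolding e_def integral_dom_minus[OF FK, symmetric]
    using c L2.cinner_commute[of "K \<ominus>\<^bsub>X\<^esub> \<i> \<odot>\<^bsub>X\<^esub> F" "g (-\<i>)"] by simp
  then have "\<i> * cnj (e F K) = \<i> * (cinner X (g (-\<i>)) K + \<i> * cinner X (g (-\<i>)) F)"
    by (simp only:)
  then have "\<i> * cnj (e F K) = \<i> * cinner X (g (-\<i>)) K - cinner X (g (-\<i>)) F"
    by (simp only: distrib_left mult.assoc[symmetric] i_squared) simp
  then show ?thesis
    using c st_dom[OF FK, of d] st_g(2)[of "-\<i>"] by (simp add: algebra_simps)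
qed

definition "Rp = (\<lambda>f. if f \<in> carrier R.P then cinner R.P (g \<i>) f else 0)"
definition "Rm = (\<lambda>f. if f \<in> carrier R.P then k' * cinner R.P (g (-\<i>)) f else 0)"

lemma Rp: "riesz_inv R.P (g \<i>) = Rp" "Rp \<in> carrier (antidual R.P)"
  using R.P.riesz_inv_eq[of "g \<i>"] R.P.cinner_antidual[of "g \<i>"] st_g(1)[of \<i>] by (auto simp: Rp_def)

lemma Rm: "riesz_inv R.P (model_g_minus \<mu> Q a) = Rm" "Rm \<in> carrier (antidual R.P)"
proof -
  have g: "g (-\<i>) \<in> carrier R.P" using st_g(1)[of "-\<i>"] by simp
  have eq: "model_g_minus \<mu> Q a = k' \<odot>\<^bsub>R.P\<^esub> g (-\<i>)"
    by (simp add: model_g_minus_def k'_def)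
  have kg: "k' \<odot>\<^bsub>R.P\<^esub> g (-\<i>) \<in> carrier R.P"
    by (rule R.P.smult_in[OF g])
  have "Rm = (\<lambda>f. if f \<in> carrier R.P then cinner R.P (k' \<odot>\<^bsub>R.P\<^esub> g (-\<i>)) f else 0)"
  proof
    fix f show "Rm f = (if f \<in> carrier R.P then cinner R.P (k' \<odot>\<^bsub>R.P\<^esub> g (-\<i>)) f else 0)"
      unfolding Rm_def by (cases "f \<in> carrier R.P") (simp_all only: if_True if_False R.P.cinner_smult_left[OF g])
  qed
  then show "riesz_inv R.P (model_g_minus \<mu> Q a) = Rm" "Rm \<in> carrier (antidual R.P)"
    unfolding eq using R.P.riesz_inv_eq[OF kg] R.P.cinner_antidual[OF kg] by simp_all
qed

abbreviation "chi \<equiv> model_chi \<mu> Q a"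

lemma chi_eq: "chi = (\<lambda>f. complex_of_real (sqrt a / 2) * ((ca + cQ * \<i>) / ca * Rp f + (\<kappa>\<^sup>2 * UU + 2 * \<kappa> + UU) / dd * Rm f))"
  unfolding model_chi_def Let_def H_minus_def Rp(1) Rm(1) dd_def[symmetric] alpha by simp

lemma chi_in: "chi \<in> carrier (antidual R.P)"
  unfolding chi_eq by (intro R.P.antidual_smult_in R.P.antidual_add_in Rp Rm)

text \<open>The first term is \<open>(\<gamma> \<i>, (B + \<i>) F)\<close> and the second is the
  conjugate of \<open>d V(\<i>)\<close> with \<open>V(\<i>) = Q + a \<i>\<close>, exactly as for an
  abstract prime system. The factors \<i> from \<open>P_g_plus\<close> and \<open>P_g_minus\<close>
  are the reason why \<open>C0\<close> is imaginary.\<close>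

lemma chi_formula:
  assumes FK: "(F, K) \<in> M"
  shows "chi (F \<oplus>\<^bsub>X\<^esub> d \<odot>\<^bsub>X\<^esub> \<gamma> \<i>) = C0 * cnj (e F K) + (cQ - ca * \<i>) * cnj d"
proof -
  have D: "F \<oplus>\<^bsub>X\<^esub> d \<odot>\<^bsub>X\<^esub> \<gamma> \<i> \<in> carrier R.P"
    using dom_in[OF FK] by simp
  define L where "L = cnj (e F K)"
  define sa where "sa = complex_of_real (sqrt a)"
  have sa: "sa \<noteq> 0" "ca = sa * sa" "C0 = \<i> * sa" "ca \<noteq> 0"
    using a by (simp_all add: sa_def C0_def flip: of_real_mult)
  have p: "Rp (F \<oplus>\<^bsub>X\<^esub> d \<odot>\<^bsub>X\<^esub> \<gamma> \<i>) = \<i> * L - 2 * \<i> * sa * cnj d"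
  proof -
    have "cnj C0 = - (\<i> * sa)"
      unfolding C0(3) by (simp only: sa(3))
    then show ?thesis
      unfolding Rp_def if_P[OF D] P_g_plus[OF FK] L_def by simp
  qed
  have m: "Rm (F \<oplus>\<^bsub>X\<^esub> d \<odot>\<^bsub>X\<^esub> \<gamma> \<i>) = k' * (- \<i> * L)"
    unfolding Rm_def if_P[OF D] P_g_minus[OF FK] L_def ..
  have "chi (F \<oplus>\<^bsub>X\<^esub> d \<odot>\<^bsub>X\<^esub> \<gamma> \<i>) = sa / 2 * ((ca + cQ * \<i>) / ca * (\<i> * L - 2 * \<i> * sa * cnj d)
      + ((\<kappa>\<^sup>2 * UU + 2 * \<kappa> + UU) / dd * k') * (- \<i> * L))"
    unfolding chi_eq p m by (simp add: sa_def)
  also have "\<dots> = \<i> * sa * L + (cQ - ca * \<i>) * cnj d"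
  proof -
    have "sa / 2 * ((ca + cQ * \<i>) / ca * (\<i> * L - 2 * \<i> * sa * cnj d) + - (ca - cQ * \<i>) / ca * (- \<i> * L))
      = (sa / (2 * ca)) * ((ca + cQ * \<i>) * (\<i> * L - 2 * \<i> * sa * cnj d) + (ca - cQ * \<i>) * (\<i> * L))"
    proof -
      have "sa / 2 * (N1 / ca * A + - N2 / ca * (- \<i> * L)) = (sa / (2 * ca)) * (N1 * A + N2 * (\<i> * L))" for N1 N2 A
        using sa(4) by (simp add: field_simps)
      then show ?thesis .
    qed
    also have "(ca + cQ * \<i>) * (\<i> * L - 2 * \<i> * sa * cnj d) + (ca - cQ * \<i>) * (\<i> * L) = 2 * (ca * \<i> * L - sa * (ca * \<i> - cQ) * cnj d)"
      by (simp add: algebra_simps)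
    also have "(sa / (2 * ca)) * (2 * (ca * \<i> * L - sa * (ca * \<i> - cQ) * cnj d)) = \<i> * sa * L + (cQ - ca * \<i>) * cnj d"
    proof -
      have "(sa / (2 * ca)) * (2 * (ca * \<i> * L - sa * (ca * \<i> - cQ) * cnj d)) = sa * \<i> * L - (sa * sa / ca) * (ca * \<i> - cQ) * cnj d"
        using sa(4) by (simp add: field_simps)
      also have "sa * sa / ca = 1"
        using sa by simp
      finally show ?thesis
        by (simp add: algebra_simps)
    qed
    finally show ?thesis
      unfolding beta .
  qed
  finally show ?thesis
    by (simp add: sa(3) L_def)
qed

text \<open>The functional in \<open>model_Re_B\<close> annihilates the domain of multiplication and
  returns a multiple of \<open>d\<close>. Its prefactor is such that the correction added to the
  adjoint is exactly \<open>d chi\<close>, in agreement with \<open>A_formula\<close>.\<close>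

lemma model_B_formula:
  assumes FK: "(F, K) \<in> M"
  shows "Y \<in> Domain Ma \<Longrightarrow> model_B \<mu> Q a (F \<oplus>\<^bsub>X\<^esub> d \<odot>\<^bsub>X\<^esub> \<gamma> \<i>) Y =
    cinner X (K \<oplus>\<^bsub>X\<^esub> (\<i> * d) \<odot>\<^bsub>X\<^esub> \<gamma> \<i>) Y + (d + \<i> * cnj (chi (F \<oplus>\<^bsub>X\<^esub> d \<odot>\<^bsub>X\<^esub> \<gamma> \<i>))) * chi Y"
    and model_B_outside: "Z \<notin> Domain Ma \<Longrightarrow> model_B \<mu> Q a (F \<oplus>\<^bsub>X\<^esub> d \<odot>\<^bsub>X\<^esub> \<gamma> \<i>) Z = 0"
proof -
  let ?F = "F \<oplus>\<^bsub>X\<^esub> d \<odot>\<^bsub>X\<^esub> \<gamma> \<i>" and ?K = "K \<oplus>\<^bsub>X\<^esub> (\<i> * d) \<odot>\<^bsub>X\<^esub> \<gamma> \<i>"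
  have c: "?K \<in> carrier X"
    using G.B_in[OF FK] by simp
  have D: "?F \<in> carrier R.P"
    using dom_in[OF FK] by simp
  define s where "s = \<i> * complex_of_real (sqrt (1 - (model_kappa Q a)\<^sup>2) / (2 * sqrt a * cmod (1 + \<kappa> * UU)))"
  define sa where "sa = complex_of_real (sqrt a)"
  have sa: "sa \<noteq> 0" "C0 = \<i> * sa"
    using a by (simp_all add: sa_def C0_def)
  \<comment> \<open>Both \<open>sqrt (1 - \<kappa>^2)\<close> and \<open>|1 + \<kappa> U|\<close>
    equal \<open>2 a / rt\<close>, so they cancel.\<close>
  have "s = \<i> / (2 * sa)"
    unfolding s_def sqrt_1_kappa cmod_one_\<kappa>_U sa_def using a rt(1) by simp
  have RU: "UU \<odot>\<^bsub>antidual R.P\<^esub> Rm \<in> carrier (antidual R.P)"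
    using R.P.antidual_smult_in[OF Rm(2), of UU] by simp
  have "(Rp \<ominus>\<^bsub>antidual R.P\<^esub> UU \<odot>\<^bsub>antidual R.P\<^esub> Rm) ?F = Rp ?F - UU * Rm ?F"
    unfolding R.P.antidual_minus[OF Rp(2) RU] by simp
  also have "\<dots> = cinner R.P (g \<i>) ?F - UU * k' * cinner R.P (g (-\<i>)) ?F"
    unfolding Rp_def Rm_def if_P[OF D] by simp
  also have "\<dots> = - 2 * \<i> * sa * cnj d"
  proof -
    have "cnj C0 = - (\<i> * sa)"
      unfolding C0(3) by (simp only: sa(2))
    then show ?thesis
      unfolding k'_U P_g_plus[OF FK] P_g_minus[OF FK] by simp
  qed
  finally have dp: "dual_pair ?F (Rp \<ominus>\<^bsub>antidual R.P\<^esub> UU \<odot>\<^bsub>antidual R.P\<^esub> Rm) = 2 * \<i> * sa * d"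
    by (simp add: dual_pair_def sa_def)
  have sd: "s * dual_pair ?F (Rp \<ominus>\<^bsub>antidual R.P\<^esub> UU \<odot>\<^bsub>antidual R.P\<^esub> Rm) = - d"
    unfolding dp \<open>s = \<i> / (2 * sa)\<close> using sa(1) by simp
  have emb: "embed_minus X Md ?K \<in> carrier (antidual R.P)"
    using R.embed_minus_in[OF c] by (simp add: H_minus_def)
  have chid: "(- d) \<odot>\<^bsub>antidual R.P\<^esub> chi \<in> carrier (antidual R.P)"
    using R.P.antidual_smult_in[OF chi_in, of "- d"] by simp
  have "model_Re_B \<mu> Q a ?F = embed_minus X Md ?K \<ominus>\<^bsub>antidual R.P\<^esub> (- d) \<odot>\<^bsub>antidual R.P\<^esub> chi"
    unfolding model_Re_B_def Let_def H_minus_def Rp(1) Rm(1) st_dom[OF FK] s_def[symmetric] sd ..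
  also have "\<dots> = (\<lambda>Y. embed_minus X Md ?K Y + d * chi Y)"
    unfolding R.P.antidual_minus[OF emb chid] by simp
  finally have Re: "model_Re_B \<mu> Q a ?F = (\<lambda>Y. embed_minus X Md ?K Y + d * chi Y)" .
  have B: "model_B \<mu> Q a ?F = (\<lambda>Y. embed_minus X Md ?K Y + d * chi Y + \<i> * cnj (chi ?F) * chi Y)"
    unfolding model_B_def Let_def H_minus_def Re by (simp add: dual_pair_def)
  show "model_B \<mu> Q a ?F Y = cinner X ?K Y + (d + \<i> * cnj (chi ?F)) * chi Y" if "Y \<in> Domain Ma"
    unfolding B using that by (simp add: embed_minus_def algebra_simps)
  show "model_B \<mu> Q a ?F Z = 0" if "Z \<notin> Domain Ma"
    unfolding B using that R.P.antidualD(3)[OF chi_in, of Z] by (simp add: embed_minus_def)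
qed

end

section \<open>The resolvent of the main operator\<close>

context model_measure
begin

lemma resolvent_cl:
  "(h, F) \<in> resolvent (L2 \<mu>) (mult_op \<mu>) z \<longleftrightarrow>
    (\<exists>f. f \<in> l2_fun \<mu> \<and> mx f \<in> l2_fun \<mu> \<and> F = cl f \<and> h = cl (\<lambda>x. mx f x - z * f x))"
proof -
  have "cl (mx f) \<ominus>\<^bsub>L2 \<mu>\<^esub> z \<odot>\<^bsub>L2 \<mu>\<^esub> cl f = cl (\<lambda>x. mx f x - z * f x)" if "f \<in> l2_fun \<mu>" "mx f \<in> l2_fun \<mu>" for f
    using that by (simp add: l2_fun_smult)
  then show ?thesis
    unfolding resolvent_def mult_op_def by (fastforce simp: converse_unfold)
qed

text \<open>For real \<open>z\<close>, an atom at \<open>z\<close> would make its indicator an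
  eigenvector. Applying the resolvent to \<open>g\<^sub>i\<close> shows that
  \<open>g\<^sub>i g\<^sub>z\<close> is square integrable, and then so is
  \<open>g\<^sub>z = g\<^sub>i + (z - \<i>) g\<^sub>i g\<^sub>z\<close>.\<close>

lemma resolvent_set_mult_op:
  assumes z: "z \<in> resolvent_set (L2 \<mu>) (mult_op \<mu>)"
  shows "AE x in \<mu>. complex_of_real x \<noteq> z" "gf z \<in> l2_fun \<mu>" "(\<lambda>x. gf \<i> x * gf z x) \<in> l2_fun \<mu>"
proof -
  have sv: "single_valued (resolvent (L2 \<mu>) (mult_op \<mu>) z)" and
    dom: "Domain (resolvent (L2 \<mu>) (mult_op \<mu>) z) = carrier (L2 \<mu>)"
    using z by (auto simp: resolvent_set_def)
  show ne: "AE x in \<mu>. complex_of_real x \<noteq> z"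
  proof (cases "Im z = 0")
    case True
    then obtain r where r: "z = complex_of_real r"
      by (metis complex_is_Real_iff Reals_cases)
    define f where "f x = (indicator {r} x :: complex)" for x
    have f: "f \<in> l2_fun \<mu>"
    proof (rule l2_fun_dominated)
      show "f \<in> borel_measurable borel"
        by (simp add: f_def[abs_def])
      show "integrable \<mu> (\<lambda>x. (1 + r\<^sup>2) * (1 / (1 + x\<^sup>2)))"
        using weight_integrable by (rule integrable_mult_right)
      show "(cmod (f x))\<^sup>2 \<le> (1 + r\<^sup>2) * (1 / (1 + x\<^sup>2))" for x
        by (auto simp: f_def indicator_def divide_simps add_pos_nonneg)
    qed
    have m: "mx f = (\<lambda>x. z * f x)"
      by (auto simp: f_def r indicator_def)
    have "mx f \<in> l2_fun \<mu>"
      unfolding m by (rule l2_fun_smult[OF f])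
    moreover have "cl (\<lambda>_. 0) = cl (\<lambda>x. mx f x - z * f x)"
    proof -
      have "mx f x - z * f x = 0" for x
        using fun_cong[OF m, of x] by simp
      then show ?thesis by (simp only:)
    qed
    ultimately have "(cl (\<lambda>_. 0), cl f) \<in> resolvent (L2 \<mu>) (mult_op \<mu>) z"
      unfolding resolvent_cl using f by blast
    moreover have "(cl (\<lambda>_. 0), cl (\<lambda>_. 0)) \<in> resolvent (L2 \<mu>) (mult_op \<mu>) z"
      unfolding resolvent_cl using l2_fun_zero by (intro exI[of _ "\<lambda>_. 0"]) simp
    ultimately have "cl f = cl (\<lambda>_. 0)"
      using sv by (auto simp: single_valued_def)
    then have "AE x in \<mu>. f x = 0"
      using cl_eq_iff[OF f l2_fun_zero] by simp
    then show ?thesis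
      by eventually_elim (auto simp: f_def r indicator_def)
  qed (rule AE_nonreal)
  have "cl (gf \<i>) \<in> Domain (resolvent (L2 \<mu>) (mult_op \<mu>) z)"
    unfolding dom using gf_l2[of \<i>] by auto
  then obtain F where "(cl (gf \<i>), F) \<in> resolvent (L2 \<mu>) (mult_op \<mu>) z"
    by blast
  then obtain f where f: "f \<in> l2_fun \<mu>" "mx f \<in> l2_fun \<mu>" and fi: "cl (gf \<i>) = cl (\<lambda>x. mx f x - z * f x)"
    unfolding resolvent_cl by blast
  have "(\<lambda>x. mx f x - z * f x) \<in> l2_fun \<mu>"
    using f by (intro l2_fun_diff l2_fun_smult)
  then have "AE x in \<mu>. gf \<i> x = mx f x - z * f x"
    using fi cl_eq_iff[OF gf_l2[of \<i>]] by simp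
  then have *: "AE x in \<mu>. f x = gf \<i> x * gf z x" "AE x in \<mu>. gf \<i> x + (z - \<i>) * f x = gf z x"
  proof -
    assume "AE x in \<mu>. gf \<i> x = mx f x - z * f x"
    then have "AE x in \<mu>. f x = gf \<i> x * gf z x \<and> gf \<i> x + (z - \<i>) * f x = gf z x"
      using ne
    proof eventually_elim
      case (elim x)
      have n: "complex_of_real x - z \<noteq> 0" "complex_of_real x - \<i> \<noteq> 0"
        using elim(2) of_real_neq_nonreal[of \<i> x] by auto
      have "gf \<i> x = f x * (complex_of_real x - z)"
        using elim(1) by (simp add: algebra_simps)
      then have "f x = gf \<i> x * gf z x"
        using n(1) by (simp add: gf_def[of z])
      moreover have "gf \<i> x + (z - \<i>) * (gf \<i> x * gf z x) = gf z x"
        using n by (simp add: gf_def divide_simps)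
      ultimately show ?case
        by simp
    qed
    then show "AE x in \<mu>. f x = gf \<i> x * gf z x" "AE x in \<mu>. gf \<i> x + (z - \<i>) * f x = gf z x"
      by simp_all
  qed
  show "gf z \<in> l2_fun \<mu>"
    by (rule l2_fun_AE[OF l2_fun_add[OF gf_l2[of \<i>] l2_fun_smult[OF f(1)]] _ *(2)]) simp_all
  show "(\<lambda>x. gf \<i> x * gf z x) \<in> l2_fun \<mu>"
    by (rule l2_fun_AE[OF f(1) _ *(1)]) simp
qed

context
  fixes z
  assumes ne: "AE x in \<mu>. complex_of_real x \<noteq> z" and gz: "gf z \<in> l2_fun \<mu>"
begin

lemma gf_cnj_l2: "gf (cnj z) \<in> l2_fun \<mu>"
proof (rule l2_funI)
  have "cmod (gf (cnj z) x) = cmod (gf z x)" for x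
    using complex_mod_cnj[of "gf z x"] by (simp only: cnj_gf)
  then show "integrable \<mu> (\<lambda>x. (cmod (gf (cnj z) x))\<^sup>2)"
    using l2_funD(2)[OF gz] by simp
qed simp

text \<open>The constant 1 in \<open>x g\<^sub>z = 1 + z g\<^sub>z\<close> cancels in the
  difference, which therefore stays square integrable after multiplication. Its integral is that of
  a difference of Nevanlinna kernels, in which the subtracted terms cancel.\<close>

lemma mult_op_gf_diff:
  "(g_vec \<mu> z \<ominus>\<^bsub>L2 \<mu>\<^esub> g_vec \<mu> \<i>, z \<odot>\<^bsub>L2 \<mu>\<^esub> g_vec \<mu> z \<ominus>\<^bsub>L2 \<mu>\<^esub> \<i> \<odot>\<^bsub>L2 \<mu>\<^esub> g_vec \<mu> \<i>) \<in> mult_op \<mu>"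
    and integral_gf_diff: "(\<integral>x. l2_rep (g_vec \<mu> z \<ominus>\<^bsub>L2 \<mu>\<^esub> g_vec \<mu> \<i>) x \<partial>\<mu>) = Mf z - \<i>"
proof -
  have gi: "gf \<i> \<in> l2_fun \<mu>" by (rule gf_l2) simp
  define f where "f x = gf z x - gf \<i> x" for x
  define m where "m x = z * gf z x - \<i> * gf \<i> x" for x
  have f: "f \<in> l2_fun \<mu>" and m: "m \<in> l2_fun \<mu>"
    unfolding f_def[abs_def] m_def[abs_def] using gz gi by (auto intro: l2_fun_diff l2_fun_smult)
  have mf: "AE x in \<mu>. m x = mx f x"
    using ne
  proof eventually_elim
    case (elim x)
    have "complex_of_real x - \<i> \<noteq> 0"
      by (rule of_real_neq_nonreal) simp
    then show ?case
      using elim by (simp add: m_def f_def gf_def divide_simps) (simp add: algebra_simps)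
  qed
  have "mx f \<in> borel_measurable borel"
    using l2_funD(1)[OF f] by measurable
  then have mxf: "mx f \<in> l2_fun \<mu>"
    using l2_fun_AE[OF m _ mf] by blast
  then have "cl m = cl (mx f)"
    using cl_eq_iff[OF m] mf by simp
  moreover have d: "g_vec \<mu> z \<ominus>\<^bsub>L2 \<mu>\<^esub> g_vec \<mu> \<i> = cl f"
    using gz gi by (simp add: g_vec_eq f_def[abs_def])
  moreover have "z \<odot>\<^bsub>L2 \<mu>\<^esub> g_vec \<mu> z \<ominus>\<^bsub>L2 \<mu>\<^esub> \<i> \<odot>\<^bsub>L2 \<mu>\<^esub> g_vec \<mu> \<i> = cl m"
    using gz gi by (simp add: g_vec_eq m_def[abs_def] l2_fun_smult)
  ultimately show "(g_vec \<mu> z \<ominus>\<^bsub>L2 \<mu>\<^esub> g_vec \<mu> \<i>, z \<odot>\<^bsub>L2 \<mu>\<^esub> g_vec \<mu> z \<ominus>\<^bsub>L2 \<mu>\<^esub> \<i> \<odot>\<^bsub>L2 \<mu>\<^esub> g_vec \<mu> \<i>) \<in> mult_op \<mu>"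
    using mult_opI[OF f mxf] by simp
  have "(\<integral>x. f x \<partial>\<mu>) = (\<integral>x. kf z x - kf \<i> x \<partial>\<mu>)"
    by (simp add: f_def gf_def kf_def)
  also have "\<dots> = Mf z - \<i>"
    using kf_integrable[OF ne gz] kf_integrable[OF AE_nonreal gi] Mf_i by (simp add: Mf_def)
  finally show "(\<integral>x. l2_rep (g_vec \<mu> z \<ominus>\<^bsub>L2 \<mu>\<^esub> g_vec \<mu> \<i>) x \<partial>\<mu>) = Mf z - \<i>"
    unfolding d integral_rep[OF f] .
qed

text \<open>Origin of the functional given by \<open>g\<close> at \<open>cnj z\<close> in the
  resolvent formula: it is the boundary functional applied to \<open>(B - z)^-1 h\<close>.\<close>

lemma integral_resolvent:
  assumes hF: "(h, F) \<in> resolvent (L2 \<mu>) (mult_op \<mu>) z"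
  shows "(\<integral>x. l2_rep F x \<partial>\<mu>) = cinner (L2 \<mu>) h (g_vec \<mu> (cnj z))"
proof -
  obtain f where f: "f \<in> l2_fun \<mu>" "mx f \<in> l2_fun \<mu>" "F = cl f" "h = cl (\<lambda>x. mx f x - z * f x)"
    using hF unfolding resolvent_cl by blast
  have h: "(\<lambda>x. mx f x - z * f x) \<in> l2_fun \<mu>"
    using f by (intro l2_fun_diff l2_fun_smult)
  have "AE x in \<mu>. f x = (mx f x - z * f x) * gf z x"
    using ne
  proof eventually_elim
    case (elim x)
    have "(complex_of_real x * f x - z * f x) * gf z x = f x * ((complex_of_real x - z) * gf z x)"
      by (simp add: algebra_simps)
    then show ?case
      using elim by (simp add: gf_def)
  qed
  then have "(\<integral>x. f x \<partial>\<mu>) = (\<integral>x. (mx f x - z * f x) * gf z x \<partial>\<mu>)"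
    using l2_funD(1)[OF f(1)] l2_funD(1)[OF h] by (intro integral_cong_AE) (auto intro: borel_measurable_times)
  then show ?thesis
    unfolding f(3,4) g_vec_eq using h gf_cnj_l2 by (simp add: integral_rep[OF f(1)] cnj_gf)
qed

end

text \<open>The multiplier \<open>(1 + z x) / (x - z)\<close> times the weight, which arises as
  \<open>|g\<^sub>i|^2\<close>, is the Nevanlinna kernel.\<close>

lemma weyl_titchmarsh_mult_op:
  assumes z: "z \<in> resolvent_set (L2 \<mu>) (mult_op \<mu>)"
  shows "weyl_titchmarsh (L2 \<mu>) (mult_op \<mu>) (g_vec \<mu> \<i>) z = Mf z"
proof -
  note zz = resolvent_set_mult_op[OF z]
  have gi: "gf \<i> \<in> l2_fun \<mu>" by (rule gf_l2) simp
  define u where "u x = gf \<i> x * gf z x" for x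
  have u: "u \<in> l2_fun \<mu>"
    using zz(3) by (simp add: u_def[abs_def])
  define m where "m x = gf \<i> x + z * u x" for x
  have m: "m \<in> l2_fun \<mu>"
    unfolding m_def[abs_def] by (rule l2_fun_add[OF gi l2_fun_smult[OF u]])
  have mu: "AE x in \<mu>. m x = mx u x"
    using zz(1)
  proof eventually_elim
    case (elim x)
    have "complex_of_real x - \<i> \<noteq> 0"
      by (rule of_real_neq_nonreal) simp
    then show ?case
      using elim by (simp add: m_def u_def gf_def divide_simps)
  qed
  have "mx u \<in> borel_measurable borel"
    using l2_funD(1)[OF u] by measurable
  then have mxu: "mx u \<in> l2_fun \<mu>"
    using l2_fun_AE[OF m _ mu] by blast
  have clm: "cl (mx u) = cl m"
    using cl_eq_iff[OF m mxu] mu by simp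
  have "(\<lambda>x. mx u x - z * u x) \<in> l2_fun \<mu>"
    using mxu u by (intro l2_fun_diff l2_fun_smult)
  moreover have "AE x in \<mu>. gf \<i> x = mx u x - z * u x"
    using mu by eventually_elim (simp add: m_def flip: eq_diff_eq)
  ultimately have "g_vec \<mu> \<i> = cl (\<lambda>x. mx u x - z * u x)"
    unfolding g_vec_eq using cl_eq_iff[OF gi] by blast
  then have "(g_vec \<mu> \<i>, cl u) \<in> resolvent (L2 \<mu>) (mult_op \<mu>) z"
    unfolding resolvent_cl using u mxu by blast
  then have 1: "op_app (resolvent (L2 \<mu>) (mult_op \<mu>) z) (g_vec \<mu> \<i>) = cl u"
    using z by (intro L2.op_app_eq) (simp_all add: resolvent_set_def)
  have "(cl u, cl m) \<in> mult_op \<mu>"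
    using mult_opI[OF u mxu] unfolding clm .
  then have 2: "op_app (mult_op \<mu>) (cl u) = cl m"
    using mult_op_linear by (intro L2.op_app_eq) (simp_all add: linear_op_def)
  have k: "AE x in \<mu>. (z * m x + u x) * gf (-\<i>) x = kf z x"
    using zz(1)
  proof eventually_elim
    case (elim x)
    define y where "y = complex_of_real x"
    have n: "y - \<i> \<noteq> 0" "y + \<i> \<noteq> 0" "y - z \<noteq> 0"
      using of_real_neq_nonreal[of \<i> x] of_real_neq_nonreal[of "-\<i>" x] elim by (auto simp: y_def)
    have e: "1 + y\<^sup>2 = (y - \<i>) * (y + \<i>)"
      by (simp add: algebra_simps power2_eq_square)
    have "z * m x + u x = (1 + z * y) / ((y - \<i>) * (y - z))"
      unfolding m_def u_def gf_def y_def[symmetric] using n by (simp add: divide_simps)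
    moreover have "gf (-\<i>) x = 1 / (y + \<i>)"
      by (simp add: gf_def y_def)
    moreover have "kf z x = (1 + z * y) / ((y - z) * (1 + y\<^sup>2))"
    proof -
      have "1 + y\<^sup>2 \<noteq> 0"
        unfolding e using n by simp
      moreover have "1 * (1 + y\<^sup>2) - y * (y - z) = 1 + z * y"
        by (simp add: algebra_simps power2_eq_square)
      ultimately show ?thesis
        unfolding kf_def y_def[symmetric] using n(3) diff_frac_eq[of "y - z" "1 + y\<^sup>2" 1 y] by simp
    qed
    ultimately show ?case
      unfolding e by (simp add: mult.commute mult.left_commute)
  qed
  have mum: "m \<in> borel_measurable borel" "u \<in> borel_measurable borel" "kf z \<in> borel_measurable borel"
    using l2_funD(1)[OF m] l2_funD(1)[OF u] by (auto simp: kf_def[abs_def])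
  have s: "z \<odot>\<^bsub>L2 \<mu>\<^esub> cl m \<oplus>\<^bsub>L2 \<mu>\<^esub> cl u = cl (\<lambda>x. z * m x + u x)"
    using m u by (simp add: l2_fun_smult)
  have "cinner (L2 \<mu>) (z \<odot>\<^bsub>L2 \<mu>\<^esub> cl m \<oplus>\<^bsub>L2 \<mu>\<^esub> cl u) (g_vec \<mu> \<i>) = (\<integral>x. (z * m x + u x) * gf (-\<i>) x \<partial>\<mu>)"
    unfolding s g_vec_eq using cinner_cl[OF l2_fun_add[OF l2_fun_smult[OF m] u] gi] by (simp add: cnj_gf)
  also have "\<dots> = Mf z"
    unfolding Mf_def using k mum by (intro integral_cong_AE) auto
  finally show ?thesis
    unfolding weyl_titchmarsh_def Let_def 1 2 .
qed

end

context universal_dense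
begin

text \<open>Krein's formula. With \<open>u = (B - z)^-1 h\<close> and \<open>t = (h, g)\<close>
  taken at \<open>cnj z\<close>, any vector \<open>u - s g\<^sub>z\<close> is mapped to
  \<open>h\<close> by the adjoint minus \<open>z\<close>; the condition \<open>T_cond\<close>
  selects \<open>s = p t\<close>. As the resolvent of \<open>T\<close> at \<open>z\<close> is
  single-valued, membership of these vectors already gives equality.\<close>

lemma resolvent_model_T:
  assumes zT: "z \<in> resolvent_set X (model_T \<mu> Q a)" and zM: "z \<in> resolvent_set X M"
  defines "p \<equiv> inverse (weyl_titchmarsh X M (g \<i>) z + \<i> * ((model_k Q a + 1) / (model_k Q a - 1)))"
  shows "resolvent X (model_T \<mu> Q a) z =
    {(h, op_app (resolvent X M z) h \<ominus>\<^bsub>X\<^esub> (p * cinner X h (g (cnj z))) \<odot>\<^bsub>X\<^esub> g z) | h. h \<in> carrier X}"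
proof -
  note zz = resolvent_set_mult_op[OF zM]
  note T_eq = model_T_eq[OF R.single_Sa]
  have svT: "single_valued (resolvent X (model_T \<mu> Q a) z)"
    using zT by (simp add: resolvent_set_def)
  have svM: "single_valued (resolvent X M z)" and domM: "Domain (resolvent X M z) = carrier X"
    using zM by (simp_all add: resolvent_set_def)
  have gz: "g z \<in> carrier X"
    using zz(2) by (auto simp: g_vec_eq)
  define sa where "sa = complex_of_real (sqrt a)"
  have sa: "sa \<noteq> 0" "sa * sa = ca" "C0 = \<i> * sa" "ca \<noteq> 0"
    using a by (simp_all add: sa_def C0_def flip: of_real_mult)
  let ?d = "g z \<ominus>\<^bsub>X\<^esub> g \<i>" and ?d' = "z \<odot>\<^bsub>X\<^esub> g z \<ominus>\<^bsub>X\<^esub> \<i> \<odot>\<^bsub>X\<^esub> g \<i>"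
  note dM = mult_op_gf_diff(1)[OF zz(1,2)]
  have ed: "e ?d ?d' = Mf z - \<i>"
    unfolding e_def integral_dom[OF dM] by (rule integral_gf_diff[OF zz(1,2)])
  \<comment> \<open>\<open>T_cond\<close> evaluated, up to a nonzero factor, at
    \<open>g\<^sub>z = (g\<^sub>z - g\<^sub>i) + g\<^sub>i\<close>. It turns out that
    \<open>p = a / N\<close>.\<close>
  define N where "N = ca * Mf z + cQ - \<i>"
  have cond: "T_cond F K (t / C0) \<longleftrightarrow> t * (cQ - \<i> + \<i> * ca) + ca * e F K = 0" for t F K
  proof -
    have "sa * (t / C0 * (1 - ca + cQ * \<i>) + sa * e F K) = t * (cQ - \<i> + \<i> * ca) + ca * e F K"
      unfolding sa(2)[symmetric] sa(3) using sa(1) by (simp add: field_simps)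
    then show ?thesis
      unfolding T_cond_def sa_def[symmetric] using sa(1) by (metis mult_eq_0_iff)
  qed
  \<comment> \<open>If \<open>N\<close> were zero, \<open>g\<^sub>z\<close> would be in the kernel
    of \<open>T - z\<close> and hence zero, since \<open>z\<close> is a resolvent point; then
    \<open>g\<^sub>i\<close> would lie in the domain of multiplication and be an eigenvector at
    \<i>.\<close>
  have N0: "N \<noteq> 0"
  proof
    assume N: "N = 0"
    have "T_cond ?d ?d' (1 / C0)"
      unfolding cond ed using N by (simp add: N_def algebra_simps)
    then have "(?d \<oplus>\<^bsub>X\<^esub> (1 / C0) \<odot>\<^bsub>X\<^esub> \<gamma> \<i>, ?d' \<oplus>\<^bsub>X\<^esub> (\<i> * (1 / C0)) \<odot>\<^bsub>X\<^esub> \<gamma> \<i>) \<in> model_T \<mu> Q a"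
      unfolding T_eq using dM by blast
    moreover have "?d \<oplus>\<^bsub>X\<^esub> (1 / C0) \<odot>\<^bsub>X\<^esub> \<gamma> \<i> = g z" "?d' \<oplus>\<^bsub>X\<^esub> (\<i> * (1 / C0)) \<odot>\<^bsub>X\<^esub> \<gamma> \<i> = z \<odot>\<^bsub>X\<^esub> g z"
      by (rule L2.vec_eqI; use gz C0(1) in simp)+
    ultimately have "(z \<odot>\<^bsub>X\<^esub> g z \<ominus>\<^bsub>X\<^esub> z \<odot>\<^bsub>X\<^esub> g z, g z) \<in> resolvent X (model_T \<mu> Q a) z"
      using resolventI by metis
    moreover have "z \<odot>\<^bsub>X\<^esub> g z \<ominus>\<^bsub>X\<^esub> z \<odot>\<^bsub>X\<^esub> g z = \<zero>\<^bsub>X\<^esub>"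
      using gz by (simp add: L2.minus_eq_zero_iff)
    moreover have "(\<zero>\<^bsub>X\<^esub>, \<zero>\<^bsub>X\<^esub>) \<in> resolvent X (model_T \<mu> Q a) z"
    proof -
      have "T_cond \<zero>\<^bsub>X\<^esub> \<zero>\<^bsub>X\<^esub> 0"
        by (simp add: T_cond_def e_def)
      then have "(\<zero>\<^bsub>X\<^esub> \<oplus>\<^bsub>X\<^esub> 0 \<odot>\<^bsub>X\<^esub> \<gamma> \<i>, \<zero>\<^bsub>X\<^esub> \<oplus>\<^bsub>X\<^esub> (\<i> * 0) \<odot>\<^bsub>X\<^esub> \<gamma> \<i>) \<in> model_T \<mu> Q a"
        unfolding T_eq using L2.linear_op_zero[OF G.B_lin] by blast
      moreover have "\<zero>\<^bsub>X\<^esub> \<oplus>\<^bsub>X\<^esub> 0 \<odot>\<^bsub>X\<^esub> \<gamma> \<i> = \<zero>\<^bsub>X\<^esub>" "\<zero>\<^bsub>X\<^esub> \<oplus>\<^bsub>X\<^esub> (\<i> * 0) \<odot>\<^bsub>X\<^esub> \<gamma> \<i> = \<zero>\<^bsub>X\<^esub>" "\<zero>\<^bsub>X\<^esub> \<ominus>\<^bsub>X\<^esub> z \<odot>\<^bsub>X\<^esub> \<zero>\<^bsub>X\<^esub> = \<zero>\<^bsub>X\<^esub>"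
        by (rule L2.vec_eqI; simp)+
      ultimately show ?thesis
        using resolventI by metis
    qed
    ultimately have g0: "g z = \<zero>\<^bsub>X\<^esub>"
      using svT by (simp add: single_valued_def)
    have "?d = (-1) \<odot>\<^bsub>X\<^esub> g \<i>" "?d' = \<i> \<odot>\<^bsub>X\<^esub> ((-1) \<odot>\<^bsub>X\<^esub> g \<i>)"
      unfolding g0 by (rule L2.vec_eqI; simp)+
    then have "((-1) \<odot>\<^bsub>X\<^esub> g \<i>, \<i> \<odot>\<^bsub>X\<^esub> ((-1) \<odot>\<^bsub>X\<^esub> g \<i>)) \<in> M"
      using dM by simp
    then have "(-1) \<odot>\<^bsub>X\<^esub> g \<i> = \<zero>\<^bsub>X\<^esub>"
      by (intro L2.symmetric_eigen_zero[OF mult_op_linear mult_op_symmetric, where z="\<i>"]) simp_all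
    then have "cinner X ((-1) \<odot>\<^bsub>X\<^esub> g \<i>) (g \<i>) = 0"
      by simp
    then show False
      using g_unit by simp
  qed
  have p: "p * N = ca"
  proof -
    have "Mf z + (cQ - \<i>) / ca = N / ca"
      using sa(4) by (simp add: N_def add_divide_distrib diff_divide_distrib)
    then show ?thesis
      unfolding p_def weyl_titchmarsh_mult_op[OF zM] k_ratio using N0 by simp
  qed
  have mem: "(h, op_app (resolvent X M z) h \<ominus>\<^bsub>X\<^esub> (p * cinner X h (g (cnj z))) \<odot>\<^bsub>X\<^esub> g z)
    \<in> resolvent X (model_T \<mu> Q a) z" if h: "h \<in> carrier X" for h
  proof -
    obtain u where hu: "(h, u) \<in> resolvent X M z"
      using h domM by blast
    then have app: "op_app (resolvent X M z) h = u"
      by (rule L2.op_app_eq[OF svM])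
    obtain w where uw: "(u, w) \<in> M" "h = w \<ominus>\<^bsub>X\<^esub> z \<odot>\<^bsub>X\<^esub> u"
      using hu by (auto simp: resolvent_def)
    note c = G.B_in[OF uw(1)]
    define t where "t = cinner X h (g (cnj z))"
    have eu: "e u w = t"
      unfolding e_def integral_dom[OF uw(1)] t_def by (rule integral_resolvent[OF zz(1,2) hu])
    \<comment> \<open>Subtracting \<open>p t g\<^sub>z\<close> puts
      \<open>- p t (g\<^sub>z - g\<^sub>i)\<close> into the part in the domain of multiplication and
      leaves \<open>- p t g\<^sub>i\<close> as the defect part.\<close>
    define F where "F = u \<oplus>\<^bsub>X\<^esub> (- (p * t)) \<odot>\<^bsub>X\<^esub> ?d"
    define K where "K = w \<oplus>\<^bsub>X\<^esub> (- (p * t)) \<odot>\<^bsub>X\<^esub> ?d'"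
    have FK: "(F, K) \<in> M"
      unfolding F_def K_def by (rule L2.linear_op_add[OF G.B_lin uw(1) L2.linear_op_smult[OF G.B_lin dM]])
    have eF: "e F K = t - p * t * (Mf z - \<i>)"
      unfolding F_def K_def e_add[OF uw(1) L2.linear_op_smult[OF G.B_lin dM]] e_smult[OF dM] ed eu by simp
    have "- (p * t) * (cQ - \<i> + \<i> * ca) + ca * e F K = t * (ca - p * N)"
      unfolding eF N_def by (simp add: algebra_simps)
    then have "T_cond F K (- (p * t) / C0)"
      unfolding cond p by simp
    then have "(F \<oplus>\<^bsub>X\<^esub> (- (p * t) / C0) \<odot>\<^bsub>X\<^esub> \<gamma> \<i>, K \<oplus>\<^bsub>X\<^esub> (\<i> * (- (p * t) / C0)) \<odot>\<^bsub>X\<^esub> \<gamma> \<i>) \<in> model_T \<mu> Q a"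
      unfolding T_eq using FK by blast
    moreover have "F \<oplus>\<^bsub>X\<^esub> (- (p * t) / C0) \<odot>\<^bsub>X\<^esub> \<gamma> \<i> = u \<ominus>\<^bsub>X\<^esub> (p * t) \<odot>\<^bsub>X\<^esub> g z"
      "K \<oplus>\<^bsub>X\<^esub> (\<i> * (- (p * t) / C0)) \<odot>\<^bsub>X\<^esub> \<gamma> \<i> = w \<ominus>\<^bsub>X\<^esub> (p * t * z) \<odot>\<^bsub>X\<^esub> g z"
      unfolding F_def K_def by (rule L2.vec_eqI; use gz c C0(1) in \<open>simp add: algebra_simps\<close>)+
    ultimately have "((w \<ominus>\<^bsub>X\<^esub> (p * t * z) \<odot>\<^bsub>X\<^esub> g z) \<ominus>\<^bsub>X\<^esub> z \<odot>\<^bsub>X\<^esub> (u \<ominus>\<^bsub>X\<^esub> (p * t) \<odot>\<^bsub>X\<^esub> g z), u \<ominus>\<^bsub>X\<^esub> (p * t) \<odot>\<^bsub>X\<^esub> g z)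
      \<in> resolvent X (model_T \<mu> Q a) z"
      using resolventI by metis
    moreover have "(w \<ominus>\<^bsub>X\<^esub> (p * t * z) \<odot>\<^bsub>X\<^esub> g z) \<ominus>\<^bsub>X\<^esub> z \<odot>\<^bsub>X\<^esub> (u \<ominus>\<^bsub>X\<^esub> (p * t) \<odot>\<^bsub>X\<^esub> g z) = h"
      unfolding uw(2) by (rule L2.vec_eqI; use gz c in \<open>simp add: algebra_simps\<close>)
    ultimately show ?thesis
      unfolding app t_def by simp
  qed
  show ?thesis
  proof (intro equalityI subsetI)
    fix q assume q: "q \<in> resolvent X (model_T \<mu> Q a) z"
    obtain h f where hf: "q = (h, f)" by (cases q)
    have "h \<in> Domain (resolvent X (model_T \<mu> Q a) z)"
      using q hf by blast
    then have "h \<in> carrier X"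
      using zT by (simp add: resolvent_set_def del: Domain_iff)
    then show "q \<in> {(h, op_app (resolvent X M z) h \<ominus>\<^bsub>X\<^esub> (p * cinner X h (g (cnj z))) \<odot>\<^bsub>X\<^esub> g z) | h. h \<in> carrier X}"
      using single_valuedD[OF svT q[unfolded hf] mem] hf by blast
  next
    fix q assume "q \<in> {(h, op_app (resolvent X M z) h \<ominus>\<^bsub>X\<^esub> (p * cinner X h (g (cnj z))) \<odot>\<^bsub>X\<^esub> g z) | h. h \<in> carrier X}"
    then show "q \<in> resolvent X (model_T \<mu> Q a) z"
      using mem by blast
  qed
qed

end

section \<open>Equivalence with the universal model\<close>

text \<open>The assumption on the impedance function makes the Q-functions of the two gamma fields
  equal off the real axis, which is what \<open>gamma_field_pair\<close> requires.\<close>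

locale realization = L: prime_lsystem_data H S T A K + universal \<mu> Q a
  for H :: "'a hilbert" and S T A K and \<mu> :: "real measure" and Q a :: real +
  assumes V: "Im z \<noteq> 0 \<Longrightarrow> L.V z = complex_of_real Q + complex_of_real a * Mf z"
begin

sublocale pair: gamma_field_pair H L.B L.\<gamma> "\<lambda>z. cQ + ca * Mf z" X M \<gamma>
  by (intro gamma_field_pair.intro G.gamma_field_axioms gamma_field_cong[OF L.gamma_field_axioms V])

end

locale realization_map = realization H S T A K \<mu> Q a
  for H :: "'a hilbert" and S T A K and \<mu> :: "real measure" and Q a :: real +
  fixes U
  assumes U_unitary: "unitary_op H (L2 \<mu>) U"
    and U_\<gamma>: "Im z \<noteq> 0 \<Longrightarrow> U (L.\<gamma> z) = (\<i> * complex_of_real (sqrt a)) \<odot>\<^bsub>L2 \<mu>\<^esub> g_vec \<mu> z"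
begin

lemmas u = unitary_opD[OF U_unitary]

lemma U_\<gamma>_i: "U (L.\<gamma> \<i>) = \<gamma> \<i>"
  using U_\<gamma>[of \<i>] by (simp add: C0_def)

lemma M_eq: "M = map_prod U U ` L.B"
  using U_\<gamma> by (intro pair.intertwine_image U_unitary) (simp add: C0_def)

lemma U_B: "(f, k) \<in> L.B \<Longrightarrow> (U f, U k) \<in> M"
  unfolding M_eq by auto

lemma cinner_\<gamma>_i:
  assumes fk: "(f, k) \<in> L.B"
  shows "cinner H (L.\<gamma> \<i>) (k \<oplus>\<^bsub>H\<^esub> \<i> \<odot>\<^bsub>H\<^esub> f) = cinner X (\<gamma> \<i>) (U k \<oplus>\<^bsub>X\<^esub> \<i> \<odot>\<^bsub>X\<^esub> U f)"
    "cinner H (k \<oplus>\<^bsub>H\<^esub> \<i> \<odot>\<^bsub>H\<^esub> f) (L.\<gamma> \<i>) = cinner X (U k \<oplus>\<^bsub>X\<^esub> \<i> \<odot>\<^bsub>X\<^esub> U f) (\<gamma> \<i>)"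
proof -
  have c: "f \<in> carrier H" "k \<in> carrier H" "L.\<gamma> \<i> \<in> carrier H"
    using L.B_in[OF fk] by auto
  then have "U (k \<oplus>\<^bsub>H\<^esub> \<i> \<odot>\<^bsub>H\<^esub> f) = U k \<oplus>\<^bsub>X\<^esub> \<i> \<odot>\<^bsub>X\<^esub> U f" "k \<oplus>\<^bsub>H\<^esub> \<i> \<odot>\<^bsub>H\<^esub> f \<in> carrier H"
    by (simp_all add: u(2,3))
  then show "cinner H (L.\<gamma> \<i>) (k \<oplus>\<^bsub>H\<^esub> \<i> \<odot>\<^bsub>H\<^esub> f) = cinner X (\<gamma> \<i>) (U k \<oplus>\<^bsub>X\<^esub> \<i> \<odot>\<^bsub>X\<^esub> U f)"
    "cinner H (k \<oplus>\<^bsub>H\<^esub> \<i> \<odot>\<^bsub>H\<^esub> f) (L.\<gamma> \<i>) = cinner X (U k \<oplus>\<^bsub>X\<^esub> \<i> \<odot>\<^bsub>X\<^esub> U f) (\<gamma> \<i>)"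
    using c(3) u(4) unfolding U_\<gamma>_i[symmetric] by metis+
qed

text \<open>Both symmetric operators are cut out of the self-adjoint one by the same condition
  against \<open>\<gamma> \<i>\<close>, and \<open>U\<close> preserves this condition.\<close>

lemma Md_image: "Md = map_prod U U ` S"
proof -
  have "map_prod U U ` S = {(F, K) \<in> map_prod U U ` L.B. cinner X (K \<oplus>\<^bsub>X\<^esub> \<i> \<odot>\<^bsub>X\<^esub> F) (\<gamma> \<i>) = 0}"
  proof (intro equalityI subsetI)
    fix p assume "p \<in> map_prod U U ` S"
    then obtain f k where p: "p = (U f, U k)" and fk: "(f, k) \<in> S" by auto
    then have "(f, k) \<in> L.B" "cinner H (k \<oplus>\<^bsub>H\<^esub> \<i> \<odot>\<^bsub>H\<^esub> f) (L.\<gamma> \<i>) = 0"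
      using L.S_eq_restriction by blast+
    then show "p \<in> {(F, K) \<in> map_prod U U ` L.B. cinner X (K \<oplus>\<^bsub>X\<^esub> \<i> \<odot>\<^bsub>X\<^esub> F) (\<gamma> \<i>) = 0}"
      unfolding p using cinner_\<gamma>_i(2)[of f k] by force
  next
    fix p assume "p \<in> {(F, K) \<in> map_prod U U ` L.B. cinner X (K \<oplus>\<^bsub>X\<^esub> \<i> \<odot>\<^bsub>X\<^esub> F) (\<gamma> \<i>) = 0}"
    then obtain f k where p: "p = (U f, U k)" and fk: "(f, k) \<in> L.B"
      and 0: "cinner X (U k \<oplus>\<^bsub>X\<^esub> \<i> \<odot>\<^bsub>X\<^esub> U f) (\<gamma> \<i>) = 0" by auto
    have "(f, k) \<in> S"
      using fk 0[folded cinner_\<gamma>_i(2)[OF fk]] by (subst L.S_eq_restriction) blast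
    then show "p \<in> map_prod U U ` S"
      unfolding p by force
  qed
  then show ?thesis
    unfolding Md_eq M_eq[symmetric] by simp
qed

sublocale m: rigged_map H X U S Md
  by (intro rigged_map.intro unitary_map.intro unitary_map_axioms.intro rigged_map_axioms.intro
    L.hilb_axioms L2.hilb_axioms U_unitary L.rigged_axioms Md_image)

sublocale universal_dense \<mu> Q a
  by unfold_locales

lemma U_comb: "(f, k) \<in> L.B \<Longrightarrow> U (f \<oplus>\<^bsub>H\<^esub> c \<odot>\<^bsub>H\<^esub> L.\<gamma> \<i>) = U f \<oplus>\<^bsub>X\<^esub> c \<odot>\<^bsub>X\<^esub> \<gamma> \<i>"
  "(f, k) \<in> L.B \<Longrightarrow> U (k \<oplus>\<^bsub>H\<^esub> c \<odot>\<^bsub>H\<^esub> L.\<gamma> \<i>) = U k \<oplus>\<^bsub>X\<^esub> c \<odot>\<^bsub>X\<^esub> \<gamma> \<i>"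
  using L.B_in[of f k] by (simp_all add: u(2,3) U_\<gamma>_i[symmetric])

lemma D_E:
  assumes "f \<in> L.D"
  obtains f0 k c where "(f0, k) \<in> L.B" "f = f0 \<oplus>\<^bsub>H\<^esub> c \<odot>\<^bsub>H\<^esub> L.\<gamma> \<i>"
  using assms unfolding L.Sa_eq by auto

text \<open>The counterpart of \<open>chi_formula\<close> for the given system, expressed through
  images under \<open>U\<close>. That the two right sides coincide is what yields
  \<open>chi_U\<close>.\<close>

lemma L_chi_formula:
  assumes fk: "(f, k) \<in> L.B"
  shows "L.chi (f \<oplus>\<^bsub>H\<^esub> c \<odot>\<^bsub>H\<^esub> L.\<gamma> \<i>) = C0 * cnj (e (U f) (U k)) + (cQ - ca * \<i>) * cnj c"
proof -
  have in2: "U k \<oplus>\<^bsub>X\<^esub> \<i> \<odot>\<^bsub>X\<^esub> U f \<in> carrier X"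
    using L.B_in[OF fk] u(1) by simp
  have "cinner H (L.\<gamma> \<i>) (k \<oplus>\<^bsub>H\<^esub> \<i> \<odot>\<^bsub>H\<^esub> f) = C0 * cinner X (g \<i>) (U k \<oplus>\<^bsub>X\<^esub> \<i> \<odot>\<^bsub>X\<^esub> U f)"
    unfolding cinner_\<gamma>_i[OF fk] by (rule L2.cinner_smult_left[OF g_pm(1) in2])
  also have "cinner X (g \<i>) (U k \<oplus>\<^bsub>X\<^esub> \<i> \<odot>\<^bsub>X\<^esub> U f) = cnj (e (U f) (U k))"
    unfolding e_def by (rule L2.cinner_commute[OF in2 g_pm(1)])
  finally show ?thesis
    unfolding L.chi_formula[OF fk] using V[of \<i>] by (simp add: Mf_i mult.commute)
qed

lemma chi_U: "f \<in> L.D \<Longrightarrow> chi (U f) = L.chi f"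
  by (erule D_E) (simp only: U_comb chi_formula[OF U_B] L_chi_formula)

text \<open>In the decomposition \<open>f0 + c \<gamma> \<i>\<close> both operators are given by the
  same expression, and off H_+ both sides vanish by the normalization of functionals.\<close>

lemma model_B_push:
  assumes f: "f \<in> L.D"
  shows "model_B \<mu> Q a (U f) = m.push (A f)"
proof -
  obtain f0 k c where fk: "(f0, k) \<in> L.B" and f_eq: "f = f0 \<oplus>\<^bsub>H\<^esub> c \<odot>\<^bsub>H\<^esub> L.\<gamma> \<i>"
    using f by (rule D_E)
  have Uf: "U f = U f0 \<oplus>\<^bsub>X\<^esub> c \<odot>\<^bsub>X\<^esub> \<gamma> \<i>"
    unfolding f_eq by (rule U_comb[OF fk])
  show ?thesis
  proof (rule m.push_eqI)
    show "model_B \<mu> Q a (U f) Z = 0" if "Z \<notin> m.D\<^sub>2" for Z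
      unfolding Uf by (rule model_B_outside[OF U_B[OF fk] that])
  next
    fix h assume h: "h \<in> m.D\<^sub>1"
    have "k \<oplus>\<^bsub>H\<^esub> (\<i> * c) \<odot>\<^bsub>H\<^esub> L.\<gamma> \<i> \<in> carrier H" "h \<in> carrier H"
      using L.B_in[OF fk] L.D_in[OF h] by simp_all
    then show "model_B \<mu> Q a (U f) (U h) = A f h"
      using model_B_formula(1)[OF U_B[OF fk] m.UD[OF h], where d=c]
      unfolding Uf[symmetric] U_comb(2)[OF fk, symmetric] chi_U[OF h] chi_U[OF f]
      unfolding f_eq L.A_formula[OF fk h] by (simp add: u(4))
  qed
qed

lemma T_cond_iff:
  assumes fk: "(f, k) \<in> L.B"
  shows "c + \<i> * cnj (L.chi (f \<oplus>\<^bsub>H\<^esub> c \<odot>\<^bsub>H\<^esub> L.\<gamma> \<i>)) = 0 \<longleftrightarrow> T_cond (U f) (U k) c"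
proof -
  define sa where "sa = complex_of_real (sqrt a)"
  have "cnj C0 = - (\<i> * sa)"
    by (simp add: C0_def sa_def)
  then have "c + \<i> * cnj (L.chi (f \<oplus>\<^bsub>H\<^esub> c \<odot>\<^bsub>H\<^esub> L.\<gamma> \<i>)) = c * (1 - ca + cQ * \<i>) + sa * e (U f) (U k)"
    unfolding L_chi_formula[OF fk] by (simp add: algebra_simps)
  then show ?thesis
    by (simp add: T_cond_def sa_def)
qed

lemma model_T_image: "model_T \<mu> Q a = map_prod U U ` T"
  unfolding model_T_eq[OF m.R2.single_Sa]
proof (intro equalityI subsetI)
  fix p assume "p \<in> {(F \<oplus>\<^bsub>X\<^esub> d \<odot>\<^bsub>X\<^esub> \<gamma> \<i>, K \<oplus>\<^bsub>X\<^esub> (\<i> * d) \<odot>\<^bsub>X\<^esub> \<gamma> \<i>) | F K d. (F, K) \<in> M \<and> T_cond F K d}"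
  then obtain f k d where p: "p = (U f \<oplus>\<^bsub>X\<^esub> d \<odot>\<^bsub>X\<^esub> \<gamma> \<i>, U k \<oplus>\<^bsub>X\<^esub> (\<i> * d) \<odot>\<^bsub>X\<^esub> \<gamma> \<i>)"
    and fk: "(f, k) \<in> L.B" and d: "T_cond (U f) (U k) d"
    unfolding M_eq by auto
  have "(f \<oplus>\<^bsub>H\<^esub> d \<odot>\<^bsub>H\<^esub> L.\<gamma> \<i>, k \<oplus>\<^bsub>H\<^esub> (\<i> * d) \<odot>\<^bsub>H\<^esub> L.\<gamma> \<i>) \<in> T"
    unfolding L.T_eq using fk d[folded T_cond_iff[OF fk]] by blast
  then have "map_prod U U (f \<oplus>\<^bsub>H\<^esub> d \<odot>\<^bsub>H\<^esub> L.\<gamma> \<i>, k \<oplus>\<^bsub>H\<^esub> (\<i> * d) \<odot>\<^bsub>H\<^esub> L.\<gamma> \<i>) \<in> map_prod U U ` T"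
    by (rule imageI)
  then show "p \<in> map_prod U U ` T"
    unfolding p map_prod_simp U_comb[OF fk] .
next
  fix p assume "p \<in> map_prod U U ` T"
  then obtain q where q: "p = map_prod U U q" "q \<in> T" by (rule imageE)
  from q(2)[unfolded L.T_eq] obtain f k d where "q = (f \<oplus>\<^bsub>H\<^esub> d \<odot>\<^bsub>H\<^esub> L.\<gamma> \<i>, k \<oplus>\<^bsub>H\<^esub> (\<i> * d) \<odot>\<^bsub>H\<^esub> L.\<gamma> \<i>)"
    and fk: "(f, k) \<in> L.B" and d: "d + \<i> * cnj (L.chi (f \<oplus>\<^bsub>H\<^esub> d \<odot>\<^bsub>H\<^esub> L.\<gamma> \<i>)) = 0"
    by (elim CollectE exE conjE) (rule that)
  then have "p = (U f \<oplus>\<^bsub>X\<^esub> d \<odot>\<^bsub>X\<^esub> \<gamma> \<i>, U k \<oplus>\<^bsub>X\<^esub> (\<i> * d) \<odot>\<^bsub>X\<^esub> \<gamma> \<i>)"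
    unfolding q(1) by (simp only: map_prod_simp U_comb[OF fk])
  then show "p \<in> {(F \<oplus>\<^bsub>X\<^esub> d \<odot>\<^bsub>X\<^esub> \<gamma> \<i>, K \<oplus>\<^bsub>X\<^esub> (\<i> * d) \<odot>\<^bsub>X\<^esub> \<gamma> \<i>) | F K d. (F, K) \<in> M \<and> T_cond F K d}"
    using U_B[OF fk] d[unfolded T_cond_iff[OF fk]] by blast
qed

lemma channel_push: "c \<odot>\<^bsub>H_minus X Md\<^esub> chi = m.push (K c)"
proof -
  have 0: "chi Y = 0" if "Y \<notin> m.D\<^sub>2" for Y
    by (rule m.R2.P.antidualD(3)[OF chi_in]) (subst m.R2.P_simps(1), rule that)
  have K: "K c f = c * L.chi f" for f
    by (rule fun_cong[OF L.K_eq])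
  have "c \<odot>\<^bsub>H_minus X Md\<^esub> \<phi> = (\<lambda>Y. c * \<phi> Y)" for \<phi>
    by (simp add: H_minus_def antidual_def)
  moreover have "(\<lambda>Y. c * chi Y) = m.push (K c)"
    by (rule m.push_eqI) (simp_all only: 0 mult_zero_right simp_thms chi_U K)
  ultimately show ?thesis
    by (simp only:)
qed

lemma lsystem_map: "lsystem_map H X U S Md T A K (model_T \<mu> Q a) (model_B \<mu> Q a) (\<lambda>c. c \<odot>\<^bsub>H_minus X Md\<^esub> chi)"
  by (intro lsystem_map.intro lsystem_map_axioms.intro m.rigged_map_axioms L.lsystem_data_axioms
    model_T_image model_B_push channel_push)

end

theorem theorem25:
  fixes Q a :: real and \<mu> :: "real measure" and \<Theta> :: "'a lsystem"
  assumes "Q \<noteq> 0" and "a > 0"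
    and "sets \<mu> = sets borel" and "emeasure \<mu> UNIV = \<infinity>"
    and "(\<integral>x. 1 / (1 + x\<^sup>2) \<partial>\<mu>) = 1"
    and "minimal_L_system \<Theta>"
    and "\<forall>z. Im z \<noteq> 0 \<longrightarrow> impedance \<Theta> z =
      of_real Q + of_real a *
        (\<integral>x. 1 / (complex_of_real x - z) - complex_of_real x / (1 + (complex_of_real x)\<^sup>2) \<partial>\<mu>)"
  shows "bi_unitarily_equivalent \<Theta> (universal_model \<mu> Q a) \<and>
    (let H = L2 \<mu>; B = mult_op \<mu>; T = main_op (universal_model \<mu> Q a); k = model_k Q a;
         p = (\<lambda>z. inverse (weyl_titchmarsh H B (g_vec \<mu> \<i>) z + \<i> * ((k + 1) / (k - 1))))
     in \<forall>z \<in> resolvent_set H T \<inter> resolvent_set H B.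
          resolvent H T z =
            {(h, op_app (resolvent H B z) h \<ominus>\<^bsub>H\<^esub>
                 (p z * cinner H h (g_vec \<mu> (cnj z))) \<odot>\<^bsub>H\<^esub> g_vec \<mu> z) | h. h \<in> carrier H})"
proof -
  have L: "L_system \<Theta>" and prime: "prime_op (state_space \<Theta>) (symm_op \<Theta>)"
    using assms(6) by (simp_all add: minimal_L_system_def)
  interpret L: prime_lsystem_data "state_space \<Theta>" "symm_op \<Theta>" "main_op \<Theta>" "state_op \<Theta>" "channel_op \<Theta>"
    by (intro prime_lsystem_data.intro prime_lsystem_data_axioms.intro L_system_data[OF L] prime)
  interpret universal \<mu> Q a
    using assms(1-3,5) by unfold_locales
  have V: "L.V z = cQ + ca * Mf z" if "Im z \<noteq> 0" for z
  proof -
    \<comment> \<open>The defect vector was defined by the very equation that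
      \<open>impedance\<close> solves, so unfolding suffices.\<close>
    have "impedance \<Theta> z = L.V z"
      unfolding impedance_def Let_def L.V_def L.\<gamma>_def ..
    moreover have "impedance \<Theta> z = cQ + ca * Mf z"
      unfolding Mf_def kf_def using assms(7) that by blast
    ultimately show ?thesis by simp
  qed
  interpret realization "state_space \<Theta>" "symm_op \<Theta>" "main_op \<Theta>" "state_op \<Theta>" "channel_op \<Theta>" \<mu> Q a
    by unfold_locales (rule V)
  obtain U where U: "unitary_op (state_space \<Theta>) X U" "\<And>z. Im z \<noteq> 0 \<Longrightarrow> U (L.\<gamma> z) = \<gamma> z"
    using pair.unitary_exists by blast
  interpret realization_map "state_space \<Theta>" "symm_op \<Theta>" "main_op \<Theta>" "state_op \<Theta>" "channel_op \<Theta>" \<mu> Q a U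
    by unfold_locales (use U in \<open>simp_all add: C0_def\<close>)
  have T: "main_op (universal_model \<mu> Q a) = model_T \<mu> Q a"
    by (simp add: universal_model_def)
  have "bi_unitarily_equivalent \<Theta> (universal_model \<mu> Q a)"
    by (rule bi_unitarily_equivalent_map[OF assms(6)]) (use lsystem_map in \<open>simp add: universal_model_def\<close>)
  moreover have "\<forall>z \<in> resolvent_set X (model_T \<mu> Q a) \<inter> resolvent_set X M. resolvent X (model_T \<mu> Q a) z =
      {(h, op_app (resolvent X M z) h \<ominus>\<^bsub>X\<^esub>
        (inverse (weyl_titchmarsh X M (g \<i>) z + \<i> * ((model_k Q a + 1) / (model_k Q a - 1)))
          * cinner X h (g (cnj z))) \<odot>\<^bsub>X\<^esub> g z) | h. h \<in> carrier X}"
    by (intro ballI, erule IntE) (rule resolvent_model_T)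
  ultimately show ?thesis
    unfolding Let_def T by (rule conjI)
qed

end
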